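(* Let Assumption 1 (whose part on the constraint functions $\phi^i$, $i\in I$, is recalled in the context) hold. Then the set $$\{R\in\mathcal P_2(\Omega;\widehat\Omega):\ (m\otimes R)(A_i^R)=T\ \text{ for all } i\in I\}$$ is closed in $\mathcal P_2(\Omega;\widehat\Omega)$.
   Context: **Data.** Fix $n,l,k,d\in\mathbb N$, $T>0$, $p>2$, $I=\{1,\dots,d\}$, a closed convex set $U\subset\mathbb R^l$. $\mathcal P_q(E)$ is the set of Borel probability measures on a metric space $E$ with finite $q$-th moment, $\mathcal W_{q,E}$ the $q$-Wasserstein metric, $M_2(\mu)=\int_{\mathbb R^n}|x|^2\mu(dx)$. **Constraint functions.** $\phi^i:[0,T]\times\mathbb R^n\times\mathcal P_2(\mathbb R^n)\times\mathbb R^l\to\mathbb R$ ($i\in I$) are Borel measurable, upper semicontinuous in $(x,\mu,u)$, satisfy $|\phi^i(t,x,\mu,u)|\le M(1+|x|+\sqrt{M_2(\mu)}+|u|)$ for some $M>0$, and are upper semicontinuous in $\mu\in\mathcal P_2(\mathbb R^n)$ uniformly with respect to $(t,x,u)\in[0,T]\times\mathbb R^n\times\mathbb R^l$. (The other items of Assumption 1 concern coefficients that do not appear in this statement.) **Canonical space.** $D^n[0,T]$: càdlàg functions $[0,T]\to\mathbb R^n$ with the Skorokhod metric $d_D$. $\mathcal Q$: measures $q$ on $[0,T]\times U$ with first marginal Lebesgue measure and $\int|u|^pq(dt,du)<\infty$, with metric $d_{\mathcal Q}(q^1,q^2)=\mathcal W_{2,[0,T]\times U}(q^1/T,q^2/T)$;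 write $q(dt,du)=q_t(du)dt$. $A^k[0,T]$: functions $a:[0,T]\to\mathbb R^k$ with càdlàg non-decreasing components and $a^i_0\ge0$, identified with $k$-tuples of non-negative finite measures on $[0,T]$ via $\nu_i(\{0\})=a^i_0$, $\nu_i((s,t])=a^i_t-a^i_s$, with metric $\sum_i d_{\rm FM}(\nu^1_i,\nu^2_i)$, where $d_{\rm FM}(\mu,\nu)=\sup\{|\int h\,d\mu-\int h\,d\nu|:\|h\|_\infty+{\rm Lip}(h)\le1\}$ (Fortet–Mourier metric, inducing weak convergence). Set $\widehat\Omega=D^n[0,T]\times\mathcal Q$, $\Omega=\widehat\Omega\times A^k[0,T]$ with the sum metrics and Borel product $\sigma$-algebra $\mathcal F$. Coordinate processes: $X_t(\omega)=\psi_t$, $q_t(\omega)=q_t$, $\zeta_t(\omega)=\zeta_t$ for $\omega=(\psi,q,\zeta)$. $\mathcal P_2(\Omega;\widehat\Omega)$ is the set of probability measures $R$ on $(\Omega,\mathcal F)$ whose marginal $R|_{\widehat\Omega}$ lies in $\mathcal P_2(\widehat\Omega)$, with metric $d(R_1,R_2)=\mathcal W_{2,\widehat\Omega}(R_1|_{\widehat\Omega},R_2|_{\widehat\Omega})+d_{{\rm FM},\Omega}(R_1,R_2)$, $d_{{\rm FM},\Omega}$ being the Fortet–Mourier metric on probability measures on $\Omega$. **The sets $A_i^R$.** For $R\in\mathcal P_2(\Omega;\widehat\Omega)$ let $R^X(t)=R\circ X_t^{-1}$, let $m$ be Lebesgue measure on $[0,T]$, and $$A_i^R=\Big\{(t,\omega)\in[0,T]\times\Omega:\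 \int_U\phi^i(t,X_t(\omega),R^X(t),u)\,q_t(\omega,du)\ge0\Big\}.$$ *)

theory Defs
  imports "HOL-Probability.Probability"
begin

section \<open>Measures on metric spaces\<close>

text \<open>
  Metric spaces are given, as in the locale \<^locale>\<open>Metric_space\<close>, by a carrier and a distance.
  Suprema and infima in distances are taken in \<^typ>\<open>ennreal\<close> and then mapped back to the reals;
  they are finite on the carriers considered below.
\<close>

text \<open>
  Outside the locale \<^locale>\<open>Metric_space\<close> nothing is provable about
  \<^const>\<open>Metric_space.mtopology\<close> without the metric axioms. The following version of it is a
  topology for every function \<open>d\<close>; that the two agree on metric spaces is
  \<open>metric_topology_eq_mtopology\<close> below.
\<close>

definition metric_topology :: "'a set \<Rightarrow> ('a \<Rightarrow> 'a \<Rightarrow> real) \<Rightarrow> 'a topology" where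
  "metric_topology M d =
     topology (\<lambda>V. V \<subseteq> M \<and> (\<forall>x\<in>V. \<exists>r>0. \<forall>y\<in>M. d x y < r \<longrightarrow> y \<in> V))"

lemma openin_metric_topology:
  "openin (metric_topology M d) V \<longleftrightarrow>
     V \<subseteq> M \<and> (\<forall>x\<in>V. \<exists>r>0. \<forall>y\<in>M. d x y < r \<longrightarrow> y \<in> V)"
proof -
  define P where "P V \<longleftrightarrow> V \<subseteq> M \<and> (\<forall>x\<in>V. \<exists>r>0. \<forall>y\<in>M. d x y < r \<longrightarrow> y \<in> V)" for V
  have "istopology P"
    unfolding istopology_def
  proof (intro conjI allI impI)
    fix S V assume S: "P S" and V: "P V"
    show "P (S \<inter> V)"
      unfolding P_def
    proof (intro conjI ballI)
      show "S \<inter> V \<subseteq> M" using S by (auto simp: P_def)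
      fix x assume "x \<in> S \<inter> V"
      then obtain r r' where "r > 0" "\<forall>y\<in>M. d x y < r \<longrightarrow> y \<in> S"
        and "r' > 0" "\<forall>y\<in>M. d x y < r' \<longrightarrow> y \<in> V"
        using S V unfolding P_def by blast
      then show "\<exists>r>0. \<forall>y\<in>M. d x y < r \<longrightarrow> y \<in> S \<inter> V"
        by (intro exI[of _ "min r r'"]) auto
    qed
  next
    fix K assume K: "\<forall>S\<in>K. P S"
    show "P (\<Union>K)"
      using K unfolding P_def by (meson UnionE UnionI Sup_least)
  qed
  then show ?thesis
    by (simp add: metric_topology_def topology_inverse' P_def[abs_def])
qed

lemma metric_topology_eq_mtopology:
  assumes "Metric_space M d"
  shows "metric_topology M d = Metric_space.mtopology M d"
proof -
  interpret Metric_space M d by fact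
  show ?thesis
    unfolding topology_eq openin_metric_topology openin_mtopology
    by (simp add: subset_iff) blast
qed

definition borel_on :: "'a set \<Rightarrow> ('a \<Rightarrow> 'a \<Rightarrow> real) \<Rightarrow> 'a measure" where
  "borel_on M d = sigma M {V. openin (metric_topology M d) V}"

lemma borel_on_UNIV: "borel_on (UNIV :: 'a::metric_space set) dist = borel"
  by (simp add: borel_on_def borel_def metric_topology_eq_mtopology[OF Met_TC.Metric_space_axioms])

definition sum_dist ::
  "('a \<Rightarrow> 'a \<Rightarrow> real) \<Rightarrow> ('b \<Rightarrow> 'b \<Rightarrow> real) \<Rightarrow> 'a \<times> 'b \<Rightarrow> 'a \<times> 'b \<Rightarrow> real" where
  "sum_dist d1 d2 z w = d1 (fst z) (fst w) + d2 (snd z) (snd w)"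

definition usc_on :: "'a set \<Rightarrow> ('a \<Rightarrow> 'a \<Rightarrow> real) \<Rightarrow> ('a \<Rightarrow> real) \<Rightarrow> bool" where
  "usc_on M d f \<longleftrightarrow>
     (\<forall>x\<in>M. \<forall>\<epsilon>>0. \<exists>\<delta>>0. \<forall>y\<in>M. d x y < \<delta> \<longrightarrow> f y < f x + \<epsilon>)"

definition prob_measures :: "'a set \<Rightarrow> ('a \<Rightarrow> 'a \<Rightarrow> real) \<Rightarrow> 'a measure set" where
  "prob_measures M d = {\<mu>. prob_space \<mu> \<and> sets \<mu> = sets (borel_on M d)}"

definition prob_moment :: "real \<Rightarrow> 'a set \<Rightarrow> ('a \<Rightarrow> 'a \<Rightarrow> real) \<Rightarrow> 'a measure set" where
  "prob_moment r M d =
     {\<mu> \<in> prob_measures M d. \<exists>x0\<in>M. (\<integral>\<^sup>+x. ennreal (d x x0 powr r) \<partial>\<mu>) < \<infinity>}"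

definition couplings ::
  "'a set \<Rightarrow> ('a \<Rightarrow> 'a \<Rightarrow> real) \<Rightarrow> 'a measure \<Rightarrow> 'a measure \<Rightarrow> ('a \<times> 'a) measure set" where
  "couplings M d \<mu> \<nu> =
     {\<pi> \<in> prob_measures (M \<times> M) (sum_dist d d). distr \<pi> \<mu> fst = \<mu> \<and> distr \<pi> \<nu> snd = \<nu>}"

definition wasserstein ::
  "real \<Rightarrow> 'a set \<Rightarrow> ('a \<Rightarrow> 'a \<Rightarrow> real) \<Rightarrow> 'a measure \<Rightarrow> 'a measure \<Rightarrow> real" where
  "wasserstein r M d \<mu> \<nu> =
     enn2real (INF \<pi>\<in>couplings M d \<mu> \<nu>. \<integral>\<^sup>+z. ennreal (d (fst z) (snd z) powr r) \<partial>\<pi>) powr (1 / r)"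

text \<open>
  In the test class, \<open>a\<close> bounds the supremum norm and \<open>b\<close> the Lipschitz constant, so that
  \<open>a + b \<le> 1\<close> for some such bounds iff supremum norm plus best Lipschitz constant is at most 1.
\<close>

definition fm_test :: "'a set \<Rightarrow> ('a \<Rightarrow> 'a \<Rightarrow> real) \<Rightarrow> ('a \<Rightarrow> real) set" where
  "fm_test M d =
     {h. \<exists>a b. 0 \<le> a \<and> 0 \<le> b \<and> a + b \<le> 1 \<and> (\<forall>x\<in>M. \<bar>h x\<bar> \<le> a) \<and>
           (\<forall>x\<in>M. \<forall>y\<in>M. \<bar>h x - h y\<bar> \<le> b * d x y)}"

definition fortet_mourier ::
  "'a set \<Rightarrow> ('a \<Rightarrow> 'a \<Rightarrow> real) \<Rightarrow> 'a measure \<Rightarrow> 'a measure \<Rightarrow> real" where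
  "fortet_mourier M d \<mu> \<nu> =
     enn2real (SUP h\<in>fm_test M d. ennreal \<bar>(\<integral>x. h x \<partial>\<mu>) - (\<integral>x. h x \<partial>\<nu>)\<bar>)"

definition second_moment :: "'a::euclidean_space measure \<Rightarrow> real" where
  "second_moment \<mu> = (\<integral>x. (norm x)\<^sup>2 \<partial>\<mu>)"

abbreviation P2 :: "'a::euclidean_space measure set" where
  "P2 \<equiv> prob_moment 2 UNIV dist"

abbreviation W2 :: "'a::euclidean_space measure \<Rightarrow> 'a measure \<Rightarrow> real" where
  "W2 \<equiv> wasserstein 2 UNIV dist"


section \<open>The canonical space\<close>

definition leb :: "real \<Rightarrow> real measure" where
  "leb T = restrict_space lborel {0..T}"

subsection \<open>Skorokhod space\<close>

text \<open>
  Paths on \<open>[0,T]\<close> are functions on all reals that are \<^const>\<open>undefined\<close> outside \<open>[0,T]\<close>.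
\<close>

definition cadlag_on :: "real \<Rightarrow> (real \<Rightarrow> 'a::topological_space) \<Rightarrow> bool" where
  "cadlag_on T x \<longleftrightarrow>
     (\<forall>t\<in>{0..<T}. (x \<longlongrightarrow> x t) (at_right t)) \<and> (\<forall>t\<in>{0<..T}. \<exists>l. (x \<longlongrightarrow> l) (at_left t))"

definition skorokhod :: "real \<Rightarrow> (real \<Rightarrow> 'a::euclidean_space) set" where
  "skorokhod T = {x \<in> extensional {0..T}. cadlag_on T x}"

definition time_changes :: "real \<Rightarrow> (real \<Rightarrow> real) set" where
  "time_changes T =
     {\<tau>. strict_mono_on {0..T} \<tau> \<and> continuous_on {0..T} \<tau> \<and> \<tau> ` {0..T} = {0..T}}"

text \<open>
  Billingsley's incomplete Skorokhod metric. His complete variant induces the same topology and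
  the same distances to the zero path, hence the same measures with finite second moment.
\<close>

definition skorokhod_dist ::
  "real \<Rightarrow> (real \<Rightarrow> 'a::euclidean_space) \<Rightarrow> (real \<Rightarrow> 'a) \<Rightarrow> real" where
  "skorokhod_dist T x y =
     enn2real (INF \<tau>\<in>time_changes T.
       max (SUP t\<in>{0..T}. ennreal \<bar>\<tau> t - t\<bar>) (SUP t\<in>{0..T}. ennreal (dist (x t) (y (\<tau> t)))))"

subsection \<open>Relaxed controls\<close>

definition controls ::
  "real \<Rightarrow> 'b::euclidean_space set \<Rightarrow> real \<Rightarrow> (real \<times> 'b) measure set" where
  "controls T U p =
     {q. sets q = sets (restrict_space borel ({0..T} \<times> U)) \<and>
         distr q (leb T) fst = leb T \<and>
         (\<integral>\<^sup>+z. ennreal (norm (snd z) powr p) \<partial>q) < \<infinity>}"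

definition controls_dist ::
  "real \<Rightarrow> 'b::euclidean_space set \<Rightarrow> (real \<times> 'b) measure \<Rightarrow> (real \<times> 'b) measure \<Rightarrow> real" where
  "controls_dist T U q1 q2 =
     wasserstein 2 ({0..T} \<times> U) dist
       (scale_measure (ennreal (1 / T)) q1) (scale_measure (ennreal (1 / T)) q2)"

text \<open>
  A jointly measurable version of the disintegration \<open>q(dt,du) = q\<^sub>t(du) dt\<close>, with
  \<open>\<kappa> q t\<close> for \<open>q\<^sub>t\<close>. The kernels \<open>q\<^sub>t\<close> are unique only up to Lebesgue-null sets of times \<open>t\<close>.
\<close>

definition disintegration ::
  "real \<Rightarrow> 'b::euclidean_space set \<Rightarrow> real \<Rightarrow>
     ((real \<times> 'b) measure \<Rightarrow> real \<Rightarrow> 'b measure) \<Rightarrow> bool" where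
  "disintegration T U p \<kappa> \<longleftrightarrow>
     (\<lambda>(t, q). \<kappa> q t)
       \<in> leb T \<Otimes>\<^sub>M borel_on (controls T U p) (controls_dist T U)
           \<rightarrow>\<^sub>M prob_algebra (restrict_space borel U) \<and>
     (\<forall>q\<in>controls T U p. \<forall>B\<in>sets (restrict_space borel ({0..T} \<times> U)).
        emeasure q B = (\<integral>\<^sup>+t. emeasure (\<kappa> q t) {u. (t, u) \<in> B} \<partial>leb T))"

subsection \<open>Monotone paths\<close>

definition mono_paths :: "real \<Rightarrow> (real \<Rightarrow> real ^ 'k) set" where
  "mono_paths T =
     {a \<in> extensional {0..T}. cadlag_on T a \<and>
        (\<forall>i. mono_on {0..T} (\<lambda>t. a t $ i) \<and> 0 \<le> a 0 $ i)}"

text \<open>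
  The measure \<open>\<nu>\<^sub>i\<close> on \<open>[0,T]\<close> with \<open>\<nu>\<^sub>i({0}) = a\<^sup>i\<^sub>0\<close> and \<open>\<nu>\<^sub>i((s,t]) = a\<^sup>i\<^sub>t - a\<^sup>i\<^sub>s\<close>: the path is
  extended by \<open>0\<close> to the left and by its final value to the right of \<open>[0,T]\<close>, so that its
  initial value becomes the atom at \<open>0\<close>.
\<close>

definition path_measure :: "real \<Rightarrow> (real \<Rightarrow> real ^ 'k) \<Rightarrow> 'k \<Rightarrow> real measure" where
  "path_measure T a i =
     restrict_space (interval_measure (\<lambda>t. if t < 0 then 0 else a (min t T) $ i)) {0..T}"

lemma path_fun_right_cont:
  assumes "a \<in> mono_paths T" "T > 0"
  shows "continuous (at_right t) (\<lambda>t. if t < 0 then 0 else a (min t T) $ i)"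
proof -
  let ?F = "\<lambda>t. if t < 0 then 0 else a (min t T) $ i"
  consider "t < 0" | "0 \<le> t" "t < T" | "T \<le> t" by linarith
  then show ?thesis
  proof cases
    case 1
    have "eventually (\<lambda>s. ?F s = 0) (at_right t)"
      using 1 by (auto simp: eventually_at_right_field intro!: exI[of _ 0])
    then show ?thesis using 1 by (auto simp: continuous_within intro: tendsto_eventually)
  next
    case 2
    have "(a \<longlongrightarrow> a t) (at_right t)" using assms 2 by (auto simp: mono_paths_def cadlag_on_def)
    then have "((\<lambda>s. a s $ i) \<longlongrightarrow> a t $ i) (at_right t)" by (rule tendsto_vec_nth)
    moreover have "eventually (\<lambda>s. a s $ i = ?F s) (at_right t)"
      using 2 by (auto simp: eventually_at_right_field intro!: exI[of _ T])
    ultimately show ?thesis using 2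
      by (auto simp: continuous_within elim: Lim_transform_eventually)
  next
    case 3
    have "eventually (\<lambda>s. ?F s = ?F t) (at_right t)"
      using 3 assms by (auto simp: eventually_at_right_field min_def intro!: exI[of _ "t+1"])
    then show ?thesis by (auto simp: continuous_within intro: tendsto_eventually)
  qed
qed

lemma path_fun_mono:
  assumes "a \<in> mono_paths T" "T > 0" "s \<le> t"
  shows "(if s < 0 then 0 else a (min s T) $ i) \<le> (if t < 0 then 0 else a (min t T) $ i)"
proof -
  have m: "mono_on {0..T} (\<lambda>t. a t $ i)" and z: "0 \<le> a 0 $ i" using assms by (auto simp: mono_paths_def)
  have "0 \<le> a (min t T) $ i" if "t \<ge> 0" using mono_onD[OF m, of 0 "min t T"] z that assms by auto
  moreover have "a (min s T) $ i \<le> a (min t T) $ i" if "s \<ge> 0" using mono_onD[OF m, of "min s T" "min t T"] that assms by auto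
  ultimately show ?thesis using assms by auto
qed

lemma path_measure_Ioc:
  assumes "a \<in> mono_paths T" "T > 0" "0 \<le> s" "s \<le> t" "t \<le> T"
  shows "emeasure (path_measure T a i) {s<..t} = ennreal (a t $ i - a s $ i)"
  unfolding path_measure_def using assms
  by (subst emeasure_restrict_space) (auto simp: emeasure_interval_measure_Ioc[OF _ path_fun_mono path_fun_right_cont])

lemma path_measure_zero:
  assumes a: "a \<in> mono_paths T" and T: "T > 0"
  shows "emeasure (path_measure T a i) {0} = ennreal (a 0 $ i)"
proof -
  let ?F = "\<lambda>t. if t < 0 then 0 else a (min t T) $ i"
  let ?m = "interval_measure ?F"
  have I: "emeasure ?m {- 1 / real (Suc n) <.. 0} = ennreal (a 0 $ i)" for n
    using T by (subst emeasure_interval_measure_Ioc[OF _ path_fun_mono[OF a T] path_fun_right_cont[OF a T]]) (auto simp: field_simps)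
  have e: "(\<Inter>n. {- 1 / real (Suc n) <.. (0::real)}) = {0}"
  proof (rule set_eqI)
    fix x :: real
    { assume "x < 0"
      then obtain n where "inverse (real (Suc n)) < - x" using reals_Archimedean[of "-x"] by auto
      then have "\<exists>n. \<not> - 1 / real (Suc n) < x" by (intro exI[of _ n]) (simp add: inverse_eq_divide) }
    then show "x \<in> (\<Inter>n. {- 1 / real (Suc n) <.. (0::real)}) \<longleftrightarrow> x \<in> {0}" by (force simp: field_simps)
  qed
  have "(\<lambda>n. emeasure ?m {- 1 / real (Suc n) <.. 0}) \<longlonglongrightarrow> emeasure ?m (\<Inter>n. {- 1 / real (Suc n) <.. (0::real)})"
  proof (rule Lim_emeasure_decseq)
    show "decseq (\<lambda>n. {- 1 / real (Suc n) <.. (0::real)})"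
    proof (rule decseq_SucI)
      fix n
      have "- 1 / real (Suc n) \<le> - 1 / real (Suc (Suc n))" by (simp add: field_simps)
      then show "{- 1 / real (Suc (Suc n)) <.. 0} \<subseteq> {- 1 / real (Suc n) <.. (0::real)}"
        by (meson greaterThanAtMost_iff le_less_trans subsetI)
    qed
    show "emeasure ?m {- 1 / real (Suc n) <.. 0} \<noteq> \<infinity>" for n
      unfolding I by simp
  qed auto
  then have "emeasure ?m {0} = ennreal (a 0 $ i)" unfolding I e using LIMSEQ_unique tendsto_const by blast
  then show ?thesis unfolding path_measure_def using T by (subst emeasure_restrict_space) auto
qed

definition mono_paths_dist ::
  "real \<Rightarrow> (real \<Rightarrow> real ^ 'k) \<Rightarrow> (real \<Rightarrow> real ^ 'k) \<Rightarrow> real" where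
  "mono_paths_dist T a b =
     (\<Sum>i\<in>UNIV. fortet_mourier {0..T} dist (path_measure T a i) (path_measure T b i))"

subsection \<open>Product space and laws\<close>

type_synonym ('n, 'l) Omega_hat = "(real \<Rightarrow> real ^ 'n) \<times> (real \<times> (real ^ 'l)) measure"
type_synonym ('n, 'l, 'k) Omega = "('n, 'l) Omega_hat \<times> (real \<Rightarrow> real ^ 'k)"

definition Omega_hat ::
  "real \<Rightarrow> (real ^ 'l) set \<Rightarrow> real \<Rightarrow> ('n::finite, 'l::finite) Omega_hat set" where
  "Omega_hat T U p = skorokhod T \<times> controls T U p"

definition Omega_hat_dist ::
  "real \<Rightarrow> (real ^ 'l) set \<Rightarrow> ('n::finite, 'l::finite) Omega_hat \<Rightarrow> ('n, 'l) Omega_hat \<Rightarrow> real" where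
  "Omega_hat_dist T U = sum_dist (skorokhod_dist T) (controls_dist T U)"

definition Omega ::
  "real \<Rightarrow> (real ^ 'l) set \<Rightarrow> real \<Rightarrow> ('n::finite, 'l::finite, 'k::finite) Omega set" where
  "Omega T U p = Omega_hat T U p \<times> mono_paths T"

definition Omega_dist ::
  "real \<Rightarrow> (real ^ 'l) set \<Rightarrow>
     ('n::finite, 'l::finite, 'k::finite) Omega \<Rightarrow> ('n, 'l, 'k) Omega \<Rightarrow> real" where
  "Omega_dist T U = sum_dist (Omega_hat_dist T U) (mono_paths_dist T)"

definition coord_X :: "('n::finite, 'l::finite, 'k::finite) Omega \<Rightarrow> real \<Rightarrow> real ^ 'n" where
  "coord_X \<omega> = fst (fst \<omega>)"

definition coord_q :: "('n::finite, 'l::finite, 'k::finite) Omega \<Rightarrow> (real \<times> (real ^ 'l)) measure" where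
  "coord_q \<omega> = snd (fst \<omega>)"

definition marginal_hat ::
  "real \<Rightarrow> (real ^ 'l) set \<Rightarrow> real \<Rightarrow> ('n::finite, 'l::finite, 'k::finite) Omega measure \<Rightarrow>
     ('n, 'l) Omega_hat measure" where
  "marginal_hat T U p R = distr R (borel_on (Omega_hat T U p) (Omega_hat_dist T U)) fst"

definition laws ::
  "real \<Rightarrow> (real ^ 'l) set \<Rightarrow> real \<Rightarrow> ('n::finite, 'l::finite, 'k::finite) Omega measure set" where
  "laws T U p =
     {R \<in> prob_measures (Omega T U p) (Omega_dist T U).
        marginal_hat T U p R \<in> prob_moment 2 (Omega_hat T U p) (Omega_hat_dist T U)}"

definition laws_dist ::
  "real \<Rightarrow> (real ^ 'l) set \<Rightarrow> real \<Rightarrow> ('n::finite, 'l::finite, 'k::finite) Omega measure \<Rightarrow>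
     ('n, 'l, 'k) Omega measure \<Rightarrow> real" where
  "laws_dist T U p R1 R2 =
     wasserstein 2 (Omega_hat T U p) (Omega_hat_dist T U) (marginal_hat T U p R1) (marginal_hat T U p R2)
     + fortet_mourier (Omega T U p) (Omega_dist T U) R1 R2"

definition law_X ::
  "('n::finite, 'l::finite, 'k::finite) Omega measure \<Rightarrow> real \<Rightarrow> (real ^ 'n) measure" where
  "law_X R t = distr R borel (\<lambda>\<omega>. coord_X \<omega> t)"


section \<open>The constraint sets\<close>

definition constraint_set ::
  "real \<Rightarrow> (real ^ 'l) set \<Rightarrow> real \<Rightarrow>
   ((real \<times> (real ^ 'l)) measure \<Rightarrow> real \<Rightarrow> (real ^ 'l) measure) \<Rightarrow>
   (real \<Rightarrow> real ^ 'n \<Rightarrow> (real ^ 'n) measure \<Rightarrow> real ^ 'l \<Rightarrow> real) \<Rightarrow>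
   ('n::finite, 'l::finite, 'k::finite) Omega measure \<Rightarrow> (real \<times> ('n, 'l, 'k) Omega) set" where
  "constraint_set T U p \<kappa> f R =
     {(t, \<omega>). t \<in> {0..T} \<and> \<omega> \<in> Omega T U p \<and>
        0 \<le> (\<integral>u. f t (coord_X \<omega> t) (law_X R t) u \<partial>\<kappa> (coord_q \<omega>) t)}"

end

theory Submission
 imports Defs
begin

text \<open>
 Near a law, choose laws satisfying the constraint and couplings of the path-control marginals with
 vanishing cost. The paths then converge in mean square in time, so the time marginals converge for
 almost every time, and the controls converge stably: integrals of a continuous function of the control
 over any fixed measurable set of times and limit coordinates converge. A portmanteau argument gives the
 upper semicontinuity of the integrals of the truncated constraint over the set where the limit
 constraint is negative, and second moments control the truncation error, so that set is null.
\<close>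

text \<open>The obstacle is time. \<open>\<phi>\<close> is only Borel in \<open>t\<close>, so
  testing with continuous functions of time does not reach it, and the set where the limit
  constraint is negative is merely measurable. Couplings remove this: the limit coordinate is
  carried along unchanged, its law together with time is the same for every index, and any
  measurable set of it may serve as a test set. Topology is then asked only of state and control,
  where \<open>\<phi>\<close> is upper semicontinuous once its measure argument is frozen at the
  limit marginal; changing that argument costs a term that uniform upper semicontinuity makes small
  at almost every time. The second obstacle is measurability. Distances of paths and controls are
  infima and are never assumed measurable: their integrals are used as lower integrals, and
  \<open>hat_size\<close> and \<open>path_sq\<close> stand in wherever additivity is needed. Borel
  sets of products agree with product sets through countable networks, and time marginals are
  measurable because they are right-continuous in \<open>t\<close>.\<close>

type_synonym ('a, 'b) hat = "(real \<Rightarrow> 'a) \<times> (real \<times> 'b) measure"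

section \<open>Borel sigma-algebras of metric spaces\<close>

lemma openin_metric_topologyI:
 assumes "V \<subseteq> M" "!!x. x \<in> V ==> \<exists>r>0. \<forall>y\<in>M. d x y < r --> y \<in> V"
 shows "openin (metric_topology M d) V"
 using assms by (auto simp: openin_metric_topology)

lemma space_borel_on [simp]: "space (borel_on M d) = M"
 by (simp add: borel_on_def space_measure_of_conv)

lemma sets_borel_on: "sets (borel_on M d) = sigma_sets M {V. openin (metric_topology M d) V}"
 unfolding borel_on_def by (rule sets_measure_of) (auto simp: openin_metric_topology)

lemma openin_in_sets_borel_on: "openin (metric_topology M d) V ==> V \<in> sets (borel_on M d)"
 by (auto simp: sets_borel_on)

text \<open>Openness in \<open>metric_topology\<close> is the ball condition itself, so
  epsilon-delta continuity pulls open sets back to open sets for arbitrary distance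
  functions.\<close>

lemma measurable_borel_onI:
 assumes "!!x. x \<in> M ==> h x \<in> M'"
 and "!!x e. x \<in> M ==> e > 0 ==> \<exists>\<delta>>0. \<forall>y\<in>M. d x y < \<delta> --> d' (h x) (h y) < e"
 shows "h \<in> borel_on M d \<rightarrow>\<^sub>M borel_on M' d'"
proof (rule measurable_sigma_sets[OF sets_borel_on])
 show "{V. openin (metric_topology M' d') V} \<subseteq> Pow M'" by (auto simp: openin_metric_topology)
 show "h \<in> space (borel_on M d) \<rightarrow> M'" using assms by auto
 fix V assume "V \<in> {V. openin (metric_topology M' d') V}"
 hence V: "V \<subseteq> M'" "!!x. x \<in> V ==> \<exists>r>0. \<forall>y\<in>M'. d' x y < r --> y \<in> V"
 by (auto simp: openin_metric_topology)
 show "h -` V \<inter> space (borel_on M d) \<in> sets (borel_on M d)"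
 proof (intro openin_in_sets_borel_on openin_metric_topologyI)
 fix x assume x: "x \<in> h -` V \<inter> space (borel_on M d)"
 then obtain r where r: "r > 0" "\<forall>y\<in>M'. d' (h x) y < r --> y \<in> V" using V(2) by auto
 then obtain \<delta> where "\<delta> > 0" "\<forall>y\<in>M. d x y < \<delta> --> d' (h x) (h y) < r"
 using assms(2) x by (metis IntE space_borel_on)
 thus "\<exists>r>0. \<forall>y\<in>M. d x y < r --> y \<in> h -` V \<inter> space (borel_on M d)"
 using r assms(1) by (intro exI[of _ \<delta>]) auto
 qed auto
qed

lemma borel_measurable_usc_on:
 assumes "usc_on M d f"
 shows "f \<in> borel_measurable (borel_on M d)"
 unfolding borel_measurable_iff_less
proof
 fix a
 show "{w \<in> space (borel_on M d). f w < a} \<in> sets (borel_on M d)"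
 proof (intro openin_in_sets_borel_on openin_metric_topologyI)
 fix x assume "x \<in> {w \<in> space (borel_on M d). f w < a}"
 hence x: "x \<in> M" "0 < a - f x" by auto
 then obtain \<delta> where "\<delta> > 0" "\<forall>y\<in>M. d x y < \<delta> --> f y < f x + (a - f x)"
 using assms unfolding usc_on_def by blast
 thus "\<exists>r>0. \<forall>y\<in>M. d x y < r --> y \<in> {w \<in> space (borel_on M d). f w < a}"
 by (intro exI[of _ \<delta>]) auto
 qed auto
qed

lemma sets_borel_on_dist: "sets (borel_on S dist) = sets (restrict_space (borel :: 'a::metric_space measure) S)"
proof -
 have *: "openin (metric_topology S dist) V \<longleftrightarrow> (\<exists>W. open W & V = S \<inter> W)" for V :: "'a set"
 proof
 assume V: "openin (metric_topology S dist) V"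
 \<comment> \<open>Taking all balls whose trace lies in \<open>V\<close> spares a choice of
   radii.\<close>
 let ?W = "\<Union>{ball x r | x r. x \<in> V & S \<inter> ball x r \<subseteq> V}"
 have "open ?W" by (intro open_Union) auto
 moreover have "V = S \<inter> ?W"
 proof
 show "V \<subseteq> S \<inter> ?W"
 proof
 fix x assume x: "x \<in> V"
 then obtain r where "r > 0" "\<forall>y\<in>S. dist x y < r --> y \<in> V"
 using V by (auto simp: openin_metric_topology)
 hence "S \<inter> ball x r \<subseteq> V" "x \<in> ball x r" by auto
 hence "x \<in> ?W" using x by blast
 moreover have "x \<in> S" using V x unfolding openin_metric_topology by blast
 ultimately show "x \<in> S \<inter> ?W" by blast
 qed
 show "S \<inter> ?W \<subseteq> V" by blast
 qed
 ultimately show "\<exists>W. open W & V = S \<inter> W" by blast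
 next
 assume "\<exists>W. open W & V = S \<inter> W"
 then obtain W where W: "open W" "V = S \<inter> W" by blast
 show "openin (metric_topology S dist) V"
 proof (rule openin_metric_topologyI)
 fix x assume "x \<in> V"
 then obtain e where "e > 0" "ball x e \<subseteq> W" using W open_contains_ball by blast
 thus "\<exists>r>0. \<forall>y\<in>S. dist x y < r --> y \<in> V"
 using W by (intro exI[of _ e]) (auto simp: subset_iff)
 qed (use W in auto)
 qed
 have "sets (restrict_space borel S) = (\<inter>) S ` sigma_sets UNIV {W. open W}"
 unfolding sets_restrict_space by (simp add: borel_def)
 also have "\<dots> = {(%x. x) -` A \<inter> S | A. A \<in> sigma_sets UNIV {W. open W}}" by auto
 also have "\<dots> = sigma_sets S {(%x. x) -` A \<inter> S | A. A \<in> {W. open W}}"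
 by (rule sigma_sets_vimage_commute) auto
 also have "{(%x. x) -` A \<inter> S | A. A \<in> {W. open W}} = {V. openin (metric_topology S dist) V}"
 unfolding * by auto
 finally show ?thesis by (simp add: sets_borel_on)
qed

text \<open>
 A countable network of measurable sets replaces separability: no triangle inequality
 is needed to see that open sets of the product are countable unions of rectangles.
\<close>

definition countable_network :: "'a set => ('a => 'a => real) => bool" where
 "countable_network M d \<longleftrightarrow> (\<exists>\<N>. countable \<N> & \<N> \<subseteq> sets (borel_on M d) \<and>
 (\<forall>x\<in>M. \<forall>r>0. \<exists>N\<in>\<N>. x \<in> N & (\<forall>y\<in>N. d x y < r)))"

section \<open>Product spaces with sum distances\<close>

context
 fixes M1 :: "'a set" and d1 :: "'a => 'a => real" and M2 :: "'b set" and d2 :: "'b => 'b => real"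
 assumes nonneg: "!!x y. 0 <= d1 x y" "!!x y. 0 <= d2 x y"
begin

lemma measurable_fst_sum_dist: "fst \<in> borel_on (M1 \<times> M2) (sum_dist d1 d2) \<rightarrow>\<^sub>M borel_on M1 d1"
proof (rule measurable_borel_onI)
 fix x e assume "e > (0::real)"
 thus "\<exists>\<delta>>0. \<forall>y\<in>M1 \<times> M2. sum_dist d1 d2 x y < \<delta> --> d1 (fst x) (fst y) < e"
 by (intro exI[of _ e] conjI ballI impI) (auto simp: sum_dist_def intro: le_less_trans[OF add_increasing2[OF nonneg(2) order_refl]])
qed auto

lemma measurable_snd_sum_dist: "snd \<in> borel_on (M1 \<times> M2) (sum_dist d1 d2) \<rightarrow>\<^sub>M borel_on M2 d2"
proof (rule measurable_borel_onI)
 fix x e assume "e > (0::real)"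
 thus "\<exists>\<delta>>0. \<forall>y\<in>M1 \<times> M2. sum_dist d1 d2 x y < \<delta> --> d2 (snd x) (snd y) < e"
 by (intro exI[of _ e] conjI ballI impI) (auto simp: sum_dist_def intro: le_less_trans[OF add_increasing[OF nonneg(1) order_refl]])
qed auto

lemma sets_borel_on_sum_dist:
 assumes "countable_network M1 d1" "countable_network M2 d2"
 shows "sets (borel_on (M1 \<times> M2) (sum_dist d1 d2)) = sets (borel_on M1 d1 \<Otimes>\<^sub>M borel_on M2 d2)"
proof
 obtain N1 where N1: "countable N1" "N1 \<subseteq> sets (borel_on M1 d1)"
 "!!x r. x \<in> M1 ==> r > 0 ==> \<exists>N\<in>N1. x \<in> N & (\<forall>y\<in>N. d1 x y < r)"
 using assms(1) by (auto simp: countable_network_def)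
 obtain N2 where N2: "countable N2" "N2 \<subseteq> sets (borel_on M2 d2)"
 "!!x r. x \<in> M2 ==> r > 0 ==> \<exists>N\<in>N2. x \<in> N & (\<forall>y\<in>N. d2 x y < r)"
 using assms(2) by (auto simp: countable_network_def)
 have sub: "N \<in> N1 ==> N \<subseteq> M1" "N' \<in> N2 ==> N' \<subseteq> M2" for N N'
 using N1(2) N2(2) sets.sets_into_space[of N "borel_on M1 d1"] sets.sets_into_space[of N' "borel_on M2 d2"] by auto
 have "V \<in> sets (borel_on M1 d1 \<Otimes>\<^sub>M borel_on M2 d2)"
 if V: "openin (metric_topology (M1 \<times> M2) (sum_dist d1 d2)) V" for V
 proof -
 let ?C = "{p \<in> N1 \<times> N2. fst p \<times> snd p \<subseteq> V}"
 have "V = (\<Union>p\<in>?C. fst p \<times> snd p)"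
 proof
 show "V \<subseteq> (\<Union>p\<in>?C. fst p \<times> snd p)"
 proof
 fix z assume z: "z \<in> V"
 then obtain r where r: "r > 0" "\<forall>y\<in>M1 \<times> M2. sum_dist d1 d2 z y < r --> y \<in> V" and zM: "z \<in> M1 \<times> M2"
 using V unfolding openin_metric_topology by blast
 hence zr: "fst z \<in> M1" "snd z \<in> M2" "r / 2 > 0" by auto
 obtain A where A: "A \<in> N1" "fst z \<in> A" "\<forall>y\<in>A. d1 (fst z) y < r / 2"
 using N1(3)[OF zr(1,3)] by blast
 obtain B where B: "B \<in> N2" "snd z \<in> B" "\<forall>y\<in>B. d2 (snd z) y < r / 2"
 using N2(3)[OF zr(2,3)] by blast
 have "A \<times> B \<subseteq> V"
 proof
 fix y assume y: "y \<in> A \<times> B"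
 hence "d1 (fst z) (fst y) < r/2" "d2 (snd z) (snd y) < r/2" using A B by auto
 hence "sum_dist d1 d2 z y < r" by (simp add: sum_dist_def)
 moreover have "y \<in> M1 \<times> M2" using y sub(1)[OF A(1)] sub(2)[OF B(1)] by auto
 ultimately show "y \<in> V" using r by blast
 qed
 thus "z \<in> (\<Union>p\<in>?C. fst p \<times> snd p)" using A B
 by (intro UN_I[of "(A,B)"]) (auto simp: mem_Times_iff)
 qed
 qed auto
 moreover have "countable ?C" using N1(1) N2(1) by (auto intro: countable_subset[of _ "N1 \<times> N2"])
 hence "(\<Union>p\<in>?C. fst p \<times> snd p) \<in> sets (borel_on M1 d1 \<Otimes>\<^sub>M borel_on M2 d2)"
 using N1(2) N2(2) by (intro sets.countable_UN'' pair_measureI) auto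
 ultimately show ?thesis by simp
 qed
 thus "sets (borel_on (M1 \<times> M2) (sum_dist d1 d2)) \<subseteq> sets (borel_on M1 d1 \<Otimes>\<^sub>M borel_on M2 d2)"
 unfolding sets_borel_on[of "M1 \<times> M2"]
 by (intro sets.sigma_sets_subset'[where M="borel_on M1 d1 \<Otimes>\<^sub>M borel_on M2 d2", simplified space_pair_measure space_borel_on])
 (auto intro: sets.top[of "borel_on M1 d1 \<Otimes>\<^sub>M borel_on M2 d2", simplified space_pair_measure space_borel_on])
next
 \<comment> \<open>The reverse inclusion is measurability of the identity, read as the pair of the
   two continuous projections.\<close>
 have "(%z. (fst z, snd z)) \<in> borel_on (M1 \<times> M2) (sum_dist d1 d2) \<rightarrow>\<^sub>M (borel_on M1 d1 \<Otimes>\<^sub>M borel_on M2 d2)"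
 by (intro measurable_Pair measurable_fst_sum_dist measurable_snd_sum_dist)
 hence m: "(%z. z) \<in> borel_on (M1 \<times> M2) (sum_dist d1 d2) \<rightarrow>\<^sub>M (borel_on M1 d1 \<Otimes>\<^sub>M borel_on M2 d2)" by simp
 show "sets (borel_on M1 d1 \<Otimes>\<^sub>M borel_on M2 d2) \<subseteq> sets (borel_on (M1 \<times> M2) (sum_dist d1 d2))"
 proof
 fix A assume A: "A \<in> sets (borel_on M1 d1 \<Otimes>\<^sub>M borel_on M2 d2)"
 hence "A \<subseteq> M1 \<times> M2" using sets.sets_into_space by (fastforce simp: space_pair_measure)
 thus "A \<in> sets (borel_on (M1 \<times> M2) (sum_dist d1 d2))"
 using measurable_sets[OF m A] by (simp add: inf.absorb1)
 qed
qed

lemma countable_network_sum_dist: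
 assumes "countable_network M1 d1" "countable_network M2 d2"
 shows "countable_network (M1 \<times> M2) (sum_dist d1 d2)"
proof -
 obtain N1 where N1: "countable N1" "N1 \<subseteq> sets (borel_on M1 d1)"
 "!!x r. x \<in> M1 ==> r > 0 ==> \<exists>N\<in>N1. x \<in> N & (\<forall>y\<in>N. d1 x y < r)"
 using assms(1) by (auto simp: countable_network_def)
 obtain N2 where N2: "countable N2" "N2 \<subseteq> sets (borel_on M2 d2)"
 "!!x r. x \<in> M2 ==> r > 0 ==> \<exists>N\<in>N2. x \<in> N & (\<forall>y\<in>N. d2 x y < r)"
 using assms(2) by (auto simp: countable_network_def)
 let ?N = "(%(A, B). A \<times> B) ` (N1 \<times> N2)"
 have "\<exists>N\<in>?N. x \<in> N & (\<forall>y\<in>N. sum_dist d1 d2 x y < r)" if "x \<in> M1 \<times> M2" "r > 0" for x r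
 proof -
 have zr: "fst x \<in> M1" "snd x \<in> M2" "r / 2 > 0" using that by auto
 obtain A where A: "A \<in> N1" "fst x \<in> A" "\<forall>y\<in>A. d1 (fst x) y < r / 2"
 using N1(3)[OF zr(1,3)] by blast
 obtain B where B: "B \<in> N2" "snd x \<in> B" "\<forall>y\<in>B. d2 (snd x) y < r / 2"
 using N2(3)[OF zr(2,3)] by blast
 have "sum_dist d1 d2 x y < r" if "y \<in> A \<times> B" for y
 proof -
 have "d1 (fst x) (fst y) < r/2" "d2 (snd x) (snd y) < r/2" using A B that by auto
 thus ?thesis by (simp add: sum_dist_def)
 qed
 thus ?thesis using A B by (intro bexI[of _ "A \<times> B"]) (auto simp: mem_Times_iff)
 qed
 moreover have "?N \<subseteq> sets (borel_on (M1 \<times> M2) (sum_dist d1 d2))"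
 unfolding sets_borel_on_sum_dist[OF assms] using N1(2) N2(2) by auto
 ultimately show ?thesis unfolding countable_network_def
 using N1(1) N2(1) by (intro exI[of _ ?N]) auto
qed

end

lemma countable_network_dist:
 "countable_network (S :: 'a::{metric_space, second_countable_topology} set) dist"
proof -
 obtain B :: "'a set set" where B: "countable B" "topological_basis B"
 using ex_countable_basis by blast
 have "\<exists>N\<in>(\<inter>) S ` B. x \<in> N & (\<forall>y\<in>N. dist x y < r)" if "x \<in> S" "r > 0" for x and r :: real
 proof -
 have "open (ball x r)" "x \<in> ball x r" using that by auto
 then obtain W where "W \<in> B" "x \<in> W" "W \<subseteq> ball x r" using B(2) by (meson topological_basisE)
 thus ?thesis using that by (intro bexI[of _ "S \<inter> W"]) auto
 qed
 moreover have "(\<inter>) S ` B \<subseteq> sets (borel_on S dist)"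
 unfolding sets_borel_on_dist sets_restrict_space
 using topological_basis_open[OF B(2)] by (auto intro!: imageI)
 ultimately show ?thesis unfolding countable_network_def
 using B(1) by (intro exI[of _ "(\<inter>) S ` B"]) auto
qed

section \<open>Couplings and the 2-Wasserstein distance\<close>

lemma prob_measuresD:
 assumes "\<mu> \<in> prob_measures M d"
 shows "prob_space \<mu>" "sets \<mu> = sets (borel_on M d)" "space \<mu> = M"
 using assms sets_eq_imp_space_eq[of \<mu> "borel_on M d"] by (auto simp: prob_measures_def)

text \<open>A coupling must live on the Borel sets of the sum distance, while the product measure
  lives on the product sigma-algebra. The network makes the two agree, and so couplings
  exist.\<close>

lemma couplings_pair_measure:
 assumes "countable_network M d" "!!x y. 0 <= d x y"
 and \<mu>: "\<mu> \<in> prob_measures M d" and \<nu>: "\<nu> \<in> prob_measures M d"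
 shows "\<mu> \<Otimes>\<^sub>M \<nu> \<in> couplings M d \<mu> \<nu>"
proof -
 interpret \<mu>: prob_space \<mu> using prob_measuresD[OF \<mu>] by simp
 interpret \<nu>: prob_space \<nu> using prob_measuresD[OF \<nu>] by simp
 interpret P: pair_prob_space \<mu> \<nu> ..
 have "sets (\<mu> \<Otimes>\<^sub>M \<nu>) = sets (borel_on (M \<times> M) (sum_dist d d))"
 unfolding sets_borel_on_sum_dist[OF assms(2,2,1,1)]
 by (intro sets_pair_measure_cong prob_measuresD \<mu> \<nu>)
 moreover have "distr (\<mu> \<Otimes>\<^sub>M \<nu>) \<mu> fst = \<mu>" by (rule \<nu>.distr_pair_fst)
 moreover have "distr (\<mu> \<Otimes>\<^sub>M \<nu>) \<nu> snd = \<nu>"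
 proof (rule measure_eqI)
 fix A assume "A \<in> sets (distr (\<mu> \<Otimes>\<^sub>M \<nu>) \<nu> snd)"
 hence A: "A \<in> sets \<nu>" by simp
 hence "snd -` A \<inter> space (\<mu> \<Otimes>\<^sub>M \<nu>) = space \<mu> \<times> A"
 using sets.sets_into_space by (auto simp: space_pair_measure)
 thus "emeasure (distr (\<mu> \<Otimes>\<^sub>M \<nu>) \<nu> snd) A = emeasure \<nu> A"
 using A by (simp add: emeasure_distr \<nu>.emeasure_pair_measure_Times \<mu>.emeasure_space_1)
 qed simp
 ultimately show ?thesis by (simp add: couplings_def prob_measures_def P.prob_space_axioms)
qed

lemma wasserstein2_le:
 assumes "\<pi> \<in> couplings M d \<mu> \<nu>" "(\<integral>\<^sup>+z. ennreal (d (fst z) (snd z) powr 2) \<partial>\<pi>) <= ennreal c" "c \<ge> 0"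
 shows "wasserstein 2 M d \<mu> \<nu> <= sqrt c"
proof -
 let ?I = "INF \<pi>\<in>couplings M d \<mu> \<nu>. \<integral>\<^sup>+z. ennreal (d (fst z) (snd z) powr 2) \<partial>\<pi>"
 have "?I <= ennreal c" using assms(1,2) by (meson INF_lower order_trans)
 hence "enn2real ?I <= c" using assms(3) by (rule enn2real_leI[rotated])
 thus ?thesis unfolding wasserstein_def by (simp add: powr_half_sqrt powr_mono2)
qed

text \<open>\<open>enn2real\<close> maps an infinite infimum to 0, so smallness of the real-valued
  distance says nothing until some coupling of finite cost is exhibited.\<close>

lemma ex_coupling_cost_less:
 assumes "\<pi>0 \<in> couplings M d \<mu> \<nu>" "(\<integral>\<^sup>+z. ennreal (d (fst z) (snd z) powr 2) \<partial>\<pi>0) < \<infinity>"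
 and "wasserstein 2 M d \<mu> \<nu> < r"
 shows "\<exists>\<pi>\<in>couplings M d \<mu> \<nu>. (\<integral>\<^sup>+z. ennreal (d (fst z) (snd z) powr 2) \<partial>\<pi>) < ennreal (r\<^sup>2)"
proof -
 let ?I = "INF \<pi>\<in>couplings M d \<mu> \<nu>. \<integral>\<^sup>+z. ennreal (d (fst z) (snd z) powr 2) \<partial>\<pi>"
 have fin: "?I < \<infinity>" using assms(1,2) by (meson INF_lower le_less_trans)
 have "sqrt (enn2real ?I) < r" using assms(3) by (simp add: wasserstein_def powr_half_sqrt)
 hence "(sqrt (enn2real ?I))\<^sup>2 < r\<^sup>2" by (intro power_strict_mono) auto
 hence "enn2real ?I < r\<^sup>2" by simp
 hence "ennreal (enn2real ?I) < ennreal (r\<^sup>2)" by (intro ennreal_lessI) (rule le_less_trans[OF enn2real_nonneg], auto)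
 hence "?I < ennreal (r\<^sup>2)" using fin by simp
 thus ?thesis by (simp add: INF_less_iff)
qed

lemma wasserstein_nonneg: "0 <= wasserstein r M d \<mu> \<nu>"
 by (simp add: wasserstein_def)

lemma couplingsD:
 assumes "\<pi> \<in> couplings M d \<mu> \<nu>"
 shows "prob_space \<pi>" "sets \<pi> = sets (borel_on (M \<times> M) (sum_dist d d))" "space \<pi> = M \<times> M"
 "distr \<pi> \<mu> fst = \<mu>" "distr \<pi> \<nu> snd = \<nu>"
 using assms prob_measuresD[of \<pi> "M \<times> M"] by (auto simp: couplings_def)

section \<open>Skorokhod space\<close>

subsection \<open>Cadlag paths\<close>

text \<open>Interval induction: the property passes from two adjacent intervals to their union by
  adding the common endpoint, and it holds near each point by the one-sided limits. The half-open
  \<open>{s<..t}\<close> lets \<open>s\<close> itself be a point of \<open>S\<close>, which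
  right-continuity makes harmless, while a jump at \<open>t\<close> is excluded.\<close>

lemma cadlag_on_ex_partition:
 fixes x :: "real => 'a::metric_space"
 assumes x: "cadlag_on T x" and "0 <= T" "\<epsilon> > 0"
 shows "\<exists>S. finite S & (\<forall>s t. 0 <= s & s <= t & t <= T & {s<..t} \<inter> S = {} --> dist (x s) (x t) < \<epsilon>)"
proof -
 define P where "P a b \<longleftrightarrow> (\<exists>S. finite S & (\<forall>s t. a <= s & s <= t & t <= b & 0 <= s & t <= T & {s<..t} \<inter> S = {} \<longrightarrow>
 dist (x s) (x t) < \<epsilon>))" for a b
 have "P 0 T"
 using \<open>0 <= T\<close>
 proof (induction rule: Bolzano)
 case (trans a b c)
 then obtain S1 S2 where S: "finite S1" "finite S2"
 "\<forall>s t. a <= s & s <= t & t <= b & 0 <= s & t <= T & {s<..t} \<inter> S1 = {} --> dist (x s) (x t) < \<epsilon>"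
 "\<forall>s t. b <= s & s <= t & t <= c & 0 <= s & t <= T & {s<..t} \<inter> S2 = {} --> dist (x s) (x t) < \<epsilon>"
 unfolding P_def by blast
 show ?case unfolding P_def
 proof (intro exI[of _ "insert b (S1 \<union> S2)"] conjI allI impI)
 fix s t assume st: "a <= s & s <= t & t <= c & 0 <= s & t <= T & {s<..t} \<inter> insert b (S1 \<union> S2) = {}"
 hence "{s<..t} \<inter> S1 = {}" "{s<..t} \<inter> S2 = {}" "\<not> (s < b & b <= t)" by auto
 then consider "t <= b" "{s<..t} \<inter> S1 = {}" | "b <= s" "{s<..t} \<inter> S2 = {}" by force
 thus "dist (x s) (x t) < \<epsilon>" using S(3,4) st by cases auto
 qed (use S in auto)
 next
 case (local r)
 \<comment> \<open>Left of \<open>r\<close> two values are compared through the left limit; from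
   \<open>r\<close> on, the second bound compares them through \<open>x r\<close>. The single
   partition point \<open>r\<close> rules out intervals that cross it.\<close>
 have "\<exists>d>0. \<forall>s t. r - d < s & s <= t & t < r & 0 <= s --> dist (x s) (x t) < \<epsilon>"
 proof (cases "r = 0")
 case False
 hence "r \<in> {0<..T}" using local by auto
 then obtain l where "(x \<longlongrightarrow> l) (at_left r)" using x unfolding cadlag_on_def by blast
 hence "\<forall>\<^sub>F s in at_left r. dist (x s) l < \<epsilon> / 2" by (rule tendstoD) (use \<open>\<epsilon> > 0\<close> in simp)
 then obtain b where b: "b < r" "!!y. b < y ==> y < r ==> dist (x y) l < \<epsilon> / 2"
 unfolding eventually_at_left_field by auto
 show ?thesis
 proof (intro exI[of _ "r - b"] conjI allI impI)
 fix s t assume "r - (r - b) < s & s <= t & t < r & 0 <= s"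
 hence "dist (x s) l < \<epsilon> / 2" "dist (x t) l < \<epsilon> / 2" using b by auto
 thus "dist (x s) (x t) < \<epsilon>" by (rule dist_triangle_half_l)
 qed (use b in auto)
 qed (auto intro!: exI[of _ 1])
 then obtain d1 where d1: "d1 > 0" "!!s t. r - d1 < s ==> s <= t ==> t < r ==> 0 <= s ==> dist (x s) (x t) < \<epsilon>"
 by blast
 have "\<exists>d>0. \<forall>s t. r <= s & s <= t & t < r + d & t <= T --> dist (x s) (x t) < \<epsilon>"
 proof (cases "r = T")
 case False
 hence "(x \<longlongrightarrow> x r) (at_right r)" using x local by (auto simp: cadlag_on_def)
 hence "\<forall>\<^sub>F s in at_right r. dist (x s) (x r) < \<epsilon> / 2" by (rule tendstoD) (use \<open>\<epsilon> > 0\<close> in simp)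
 then obtain b where b: "b > r" "!!y. y > r ==> y < b ==> dist (x y) (x r) < \<epsilon> / 2"
 unfolding eventually_at_right_field by auto
 have b': "dist (x y) (x r) < \<epsilon> / 2" if "y \<ge> r" "y < b" for y
 using b(2)[of y] that \<open>\<epsilon> > 0\<close> by (cases "y = r") auto
 show ?thesis
 proof (intro exI[of _ "b - r"] conjI allI impI)
 fix s t assume "r <= s & s <= t & t < r + (b - r) & t <= T"
 hence "dist (x s) (x r) < \<epsilon> / 2" "dist (x t) (x r) < \<epsilon> / 2" using b' by auto
 thus "dist (x s) (x t) < \<epsilon>" by (rule dist_triangle_half_l)
 qed (use b in auto)
 next
 case True
 have "dist (x s) (x t) < \<epsilon>" if "r <= s" "s <= t" "t <= T" for s t
 using that True \<open>\<epsilon> > 0\<close> by (auto dest: order_antisym)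
 thus ?thesis by (intro exI[of _ 1]) auto
 qed
 then obtain d2 where d2: "d2 > 0" "!!s t. r <= s ==> s <= t ==> t < r + d2 ==> t <= T ==> dist (x s) (x t) < \<epsilon>"
 by blast
 show ?case
 proof (intro exI[of _ "min d1 d2"] conjI allI impI)
 fix a b assume ab: "a <= r & r <= b & b - a < min d1 d2"
 show "P a b" unfolding P_def
 proof (intro exI[of _ "{r}"] conjI allI impI)
 fix s t assume st: "a <= s & s <= t & t <= b & 0 <= s & t <= T & {s<..t} \<inter> {r} = {}"
 then consider "t < r" | "r <= s" by force
 thus "dist (x s) (x t) < \<epsilon>"
 by cases (use d1(2)[of s t] d2(2)[of s t] st ab in auto)
 qed auto
 qed (use d1 d2 in auto)
 qed
 thus ?thesis unfolding P_def by blast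
qed

text \<open>Every value is within 1 of the value at the last partition point \<open>s\<close> not
  after \<open>t\<close>, and there are finitely many such points.\<close>

lemma cadlag_on_bounded:
 fixes x :: "real => 'a::real_normed_vector"
 assumes x: "cadlag_on T x" and T: "0 <= T"
 shows "\<exists>K. \<forall>t\<in>{0..T}. norm (x t) <= K"
proof -
 obtain S where S: "finite S" "!!s t. 0 <= s ==> s <= t ==> t <= T ==> {s<..t} \<inter> S = {} ==> dist (x s) (x t) < 1"
 using cadlag_on_ex_partition[OF x T, of 1] by auto
 let ?S = "insert 0 (S \<inter> {0..T})"
 have "norm (x t) <= Max ((%s. norm (x s)) ` ?S) + 1" if t: "t \<in> {0..T}" for t
 proof -
 let ?A = "{s \<in> ?S. s <= t}"
 define s where "s = Max ?A"
 have fin: "finite ?A" "?A ~= {}" using S(1) t by auto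
 hence s: "s \<in> ?A" unfolding s_def by (rule Max_in)
 have "{s<..t} \<inter> S = {}"
 proof (rule ccontr)
 assume "{s<..t} \<inter> S ~= {}"
 then obtain r where "r \<in> S" "s < r" "r <= t" by auto
 moreover from this have "r \<in> ?A" using s t by auto
 ultimately show False using Max_ge[OF fin(1), of r] unfolding s_def[symmetric] by linarith
 qed
 hence "dist (x s) (x t) < 1" using S(2)[of s t] s t by auto
 moreover have "norm (x s) <= Max ((%s. norm (x s)) ` ?S)" using s S(1) by (intro Max_ge) auto
 moreover have "norm (x t) <= norm (x s) + dist (x s) (x t)"
 by (metis dist_norm norm_triangle_sub norm_minus_commute)
 ultimately show ?thesis by linarith
 qed
 thus ?thesis by blast
qed

text \<open>The partitions \<open>S n\<close> for the tolerances 1/(n+1) are finite, hence closed. A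
  time outside all of them has, for each \<open>n\<close>, a neighbourhood free of
  \<open>S n\<close>, so the oscillation there is below 1/(n+1).\<close>

lemma cadlag_on_countable_discont:
 fixes x :: "real => 'a::metric_space"
 assumes x: "cadlag_on T x" and T: "0 <= T"
 shows "\<exists>A. countable A & (\<forall>t\<in>{0..T} - A. continuous (at t within {0..T}) x)"
proof -
 have "\<exists>S. finite S & (\<forall>s t. 0 <= s & s <= t & t <= T & {s<..t} \<inter> S = {} --> dist (x s) (x t) < inverse (real (Suc n)))" for n
 by (rule cadlag_on_ex_partition[OF x T]) auto
 then obtain S where S: "!!n. finite (S n)"
 "!!n s t. 0 <= s ==> s <= t ==> t <= T ==> {s<..t} \<inter> S n = {} ==> dist (x s) (x t) < inverse (real (Suc n))"
 by metis
 show ?thesis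
 proof (intro exI[of _ "\<Union>n. S n"] conjI ballI)
 show "countable (\<Union>n. S n)" using S(1) by (auto intro: countable_finite)
 fix t assume t: "t \<in> {0..T} - (\<Union>n. S n)"
 show "continuous (at t within {0..T}) x"
 unfolding continuous_within_eps_delta
 proof (intro allI impI)
 fix e :: real assume "e > 0"
 then obtain n where n: "inverse (real (Suc n)) < e" using reals_Archimedean by blast
 have "open (- S n)" by (intro open_Compl finite_imp_closed S(1))
 moreover have "t \<in> - S n" using t by blast
 ultimately obtain d where d: "d > 0" "ball t d \<subseteq> - S n" by (rule openE)
 show "\<exists>d>0. \<forall>x'\<in>{0..T}. dist x' t < d --> dist (x x') (x t) < e"
 proof (intro exI[of _ d] conjI ballI impI)
 fix s assume s: "s \<in> {0..T}" "dist s t < d"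
 have *: "r \<notin> S n" if "\<bar>r - t\<bar> < d" for r using d that by (auto simp: dist_real_def subset_iff abs_minus_commute)
 hence "{min s t<..max s t} \<inter> S n = {}" using s by (auto simp: dist_real_def)
 hence "dist (x (min s t)) (x (max s t)) < inverse (real (Suc n))"
 using S(2)[of "min s t" "max s t" n] s t by auto
 hence "dist (x s) (x t) < inverse (real (Suc n))"
 by (cases "s <= t") (auto simp: min_def max_def dist_commute)
 thus "dist (x s) (x t) < e" using n by simp
 qed (rule d)
 qed
 qed
qed

subsection \<open>Time changes\<close>

lemma time_change_bounds:
 assumes "\<tau> \<in> time_changes T" "t \<in> {0..T}" shows "\<tau> t \<in> {0..T}"
 using assms by (auto simp: time_changes_def)

lemma time_change_end:
 assumes "\<tau> \<in> time_changes T" "0 <= T" shows "\<tau> T = T"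
proof -
 have "T \<in> \<tau> ` {0..T}" using assms by (simp add: time_changes_def)
 then obtain s where s: "s \<in> {0..T}" "\<tau> s = T" by auto
 have "\<not> s < T" using assms s time_change_bounds[of \<tau> T T] strict_mono_onD[of "{0..T}" \<tau> s T]
 by (auto simp: time_changes_def)
 thus ?thesis using s by auto
qed

lemma time_changes_id: "(%t. t) \<in> time_changes T"
 by (auto simp: time_changes_def strict_mono_on_def)

lemma time_changes_comp:
 assumes "\<sigma> \<in> time_changes T" "\<tau> \<in> time_changes T"
 shows "(%t. \<sigma> (\<tau> t)) \<in> time_changes T"
proof -
 have s: "strict_mono_on {0..T} \<sigma>" "continuous_on {0..T} \<sigma>" "\<sigma> ` {0..T} = {0..T}"
 and t: "strict_mono_on {0..T} \<tau>" "continuous_on {0..T} \<tau>" "\<tau> ` {0..T} = {0..T}"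
 using assms by (auto simp: time_changes_def)
 have "strict_mono_on {0..T} (%t. \<sigma> (\<tau> t))"
 using s(1) t(1) time_change_bounds[OF assms(2)] unfolding strict_mono_on_def by blast
 moreover have "continuous_on {0..T} (%t. \<sigma> (\<tau> t))"
 by (rule continuous_on_compose2[OF s(2) t(2)]) (simp add: t(3))
 moreover have "(%t. \<sigma> (\<tau> t)) ` {0..T} = {0..T}" using s(3) t(3) image_image[of \<sigma> \<tau> "{0..T}"] by simp
 ultimately show ?thesis by (simp add: time_changes_def)
qed

lemma time_changes_inverse:
 assumes "\<tau> \<in> time_changes T"
 shows "\<exists>\<sigma>\<in>time_changes T. \<forall>t\<in>{0..T}. \<tau> (\<sigma> t) = t"
proof -
 let ?\<sigma> = "inv_into {0..T} \<tau>"
 have t: "strict_mono_on {0..T} \<tau>" "continuous_on {0..T} \<tau>" "\<tau> ` {0..T} = {0..T}"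
 using assms by (auto simp: time_changes_def)
 hence inj: "inj_on \<tau> {0..T}" using strict_mono_on_imp_inj_on by blast
 have inv: "?\<sigma> t \<in> {0..T}" "\<tau> (?\<sigma> t) = t" if "t \<in> {0..T}" for t
 using that t(3) inv_into_into[of t \<tau> "{0..T}"] f_inv_into_f[of t \<tau> "{0..T}"] by auto
 have "strict_mono_on {0..T} ?\<sigma>"
 proof (rule strict_mono_onI)
 fix r s assume rs: "r \<in> {0..T}" "s \<in> {0..T}" "r < s"
 show "?\<sigma> r < ?\<sigma> s"
 proof (rule ccontr)
 assume "\<not> ?\<sigma> r < ?\<sigma> s"
 hence "\<tau> (?\<sigma> s) <= \<tau> (?\<sigma> r)"
 using strict_mono_onD[OF t(1) inv(1)[OF rs(2)] inv(1)[OF rs(1)]] by (cases "?\<sigma> s = ?\<sigma> r") auto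
 thus False using inv(2) rs by simp
 qed
 qed
 moreover have "continuous_on {0..T} ?\<sigma>"
 using continuous_on_inv[OF t(2), of ?\<sigma>] inj by (simp add: t(3))
 moreover have "?\<sigma> ` {0..T} = {0..T}"
 proof
 show "?\<sigma> ` {0..T} \<subseteq> {0..T}" using inv by blast
 show "{0..T} \<subseteq> ?\<sigma> ` {0..T}"
 proof
 fix t assume "t \<in> {0..T}"
 moreover from this have "?\<sigma> (\<tau> t) = t" using inj by simp
 moreover have "\<tau> t \<in> {0..T}" using t(3) calculation by blast
 ultimately show "t \<in> ?\<sigma> ` {0..T}" by (metis imageI)
 qed
 qed
 ultimately show ?thesis using inv by (intro bexI[of _ ?\<sigma>]) (auto simp: time_changes_def)
qed

subsection \<open>The Skorokhod distance\<close>

text \<open>The infimum over time changes of two suprema, replaced by pointwise bounds for a single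
  time change. The bounds are not strict, so that they pass to the suprema.\<close>

definition skorokhod_close ::
 "real => real => (real => 'a::euclidean_space) => (real => 'a) => bool" where
 "skorokhod_close T \<delta> x y \<longleftrightarrow>
 (\<exists>\<tau>\<in>time_changes T. \<forall>t\<in>{0..T}. \<bar>\<tau> t - t\<bar> <= \<delta> & dist (x t) (y (\<tau> t)) <= \<delta>)"

text \<open>Substitute the inverse time change.\<close>

lemma skorokhod_close_sym:
 assumes "skorokhod_close T \<delta> x y" shows "skorokhod_close T \<delta> y x"
proof -
 obtain \<tau> where \<tau>: "\<tau> \<in> time_changes T" "!!t. t \<in> {0..T} ==> \<bar>\<tau> t - t\<bar> <= \<delta> & dist (x t) (y (\<tau> t)) <= \<delta>"
 using assms by (auto simp: skorokhod_close_def)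
 obtain \<sigma> where \<sigma>: "\<sigma> \<in> time_changes T" "\<forall>t\<in>{0..T}. \<tau> (\<sigma> t) = t" using time_changes_inverse[OF \<tau>(1)] by auto
 have "\<bar>\<sigma> t - t\<bar> <= \<delta> & dist (y t) (x (\<sigma> t)) <= \<delta>" if "t \<in> {0..T}" for t
 using \<tau>(2)[of "\<sigma> t"] \<sigma>(2) time_change_bounds[OF \<sigma>(1) that] that by (auto simp: dist_commute abs_minus_commute)
 thus ?thesis using \<sigma>(1) unfolding skorokhod_close_def by blast
qed

lemma skorokhod_close_trans:
 assumes "skorokhod_close T \<delta> x y" "skorokhod_close T \<epsilon> y z" shows "skorokhod_close T (\<delta> + \<epsilon>) x z"
proof -
 obtain \<tau> where \<tau>: "\<tau> \<in> time_changes T" "!!t. t \<in> {0..T} ==> \<bar>\<tau> t - t\<bar> <= \<delta> & dist (x t) (y (\<tau> t)) <= \<delta>"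
 using assms by (auto simp: skorokhod_close_def)
 obtain \<sigma> where \<sigma>: "\<sigma> \<in> time_changes T" "!!t. t \<in> {0..T} ==> \<bar>\<sigma> t - t\<bar> <= \<epsilon> & dist (y t) (z (\<sigma> t)) <= \<epsilon>"
 using assms by (auto simp: skorokhod_close_def)
 have "\<bar>\<sigma> (\<tau> t) - t\<bar> <= \<delta> + \<epsilon> & dist (x t) (z (\<sigma> (\<tau> t))) <= \<delta> + \<epsilon>" if "t \<in> {0..T}" for t
 using \<tau>(2)[OF that] \<sigma>(2)[OF time_change_bounds[OF \<tau>(1) that]]
 dist_triangle[of "x t" "z (\<sigma> (\<tau> t))" "y (\<tau> t)"] by linarith
 thus ?thesis using time_changes_comp[OF \<sigma>(1) \<tau>(1)] unfolding skorokhod_close_def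
 by (intro bexI[of _ "%t. \<sigma> (\<tau> t)"]) auto
qed

lemma skorokhod_dist_nonneg: "0 <= skorokhod_dist T x y"
 by (simp add: skorokhod_dist_def)

lemma skorokhod_dist_leI:
 assumes "skorokhod_close T \<delta> x y" "0 <= T"
 shows "skorokhod_dist T x y <= \<delta>"
proof -
 obtain \<tau> where \<tau>: "\<tau> \<in> time_changes T" "!!t. t \<in> {0..T} ==> \<bar>\<tau> t - t\<bar> <= \<delta> & dist (x t) (y (\<tau> t)) <= \<delta>"
 using assms by (auto simp: skorokhod_close_def)
 have "0 <= \<delta>" using \<tau>(2)[of 0] assms(2) by auto
 show ?thesis unfolding skorokhod_dist_def
 by (rule enn2real_leI[OF \<open>0 <= \<delta>\<close>], rule INF_lower2[OF \<tau>(1)])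
 (auto intro!: SUP_least ennreal_leI simp: \<tau>(2))
qed

lemma skorokhod_bounded:
 assumes "x \<in> skorokhod T" "0 <= T" shows "\<exists>K. \<forall>t\<in>{0..T}. norm (x t) <= K"
 using assms cadlag_on_bounded by (auto simp: skorokhod_def)

text \<open>The identity time change and the boundedness of both paths make the infimum finite; for
  an infinite one \<open>enn2real\<close> would report 0.\<close>

lemma skorokhod_dist_lessD:
 assumes x: "x \<in> skorokhod T" and y: "y \<in> skorokhod T" and T: "0 <= T" and less: "skorokhod_dist T x y < r"
 shows "\<exists>\<delta>. 0 <= \<delta> & \<delta> < r & skorokhod_close T \<delta> x y"
proof -
 let ?m = "%\<tau>. max (SUP t\<in>{0..T}. ennreal \<bar>\<tau> t - t\<bar>) (SUP t\<in>{0..T}. ennreal (dist (x t) (y (\<tau> t))))"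
 obtain K L where K: "!!t. t\<in>{0..T} ==> norm (x t) <= K" and L: "!!t. t\<in>{0..T} ==> norm (y t) <= L"
 using skorokhod_bounded[OF x T] skorokhod_bounded[OF y T] by blast
 have "0 <= K" "0 <= L" using order_trans[OF norm_ge_zero K[of 0]] order_trans[OF norm_ge_zero L[of 0]] T by auto
 have "dist (x t) (y t) <= K + L" if "t \<in> {0..T}" for t
 using K[OF that] L[OF that] norm_triangle_ineq4[of "x t" "y t"] by (simp add: dist_norm)
 hence "?m (%t. t) <= ennreal (K + L)"
 using \<open>0 <= K\<close> \<open>0 <= L\<close> by (auto intro!: SUP_least ennreal_leI simp del: ennreal_plus)
 hence "(INF \<tau>\<in>time_changes T. ?m \<tau>) <= ennreal (K + L)" by (intro INF_lower2[where f="?m", OF time_changes_id])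
 hence fin: "(INF \<tau>\<in>time_changes T. ?m \<tau>) < \<infinity>" by (rule le_less_trans) simp
 have *: "v < ennreal r" if "v < \<infinity>" "enn2real v < r" for v
 proof -
 have "ennreal (enn2real v) < ennreal r"
 using that(2) enn2real_nonneg[of v] by (simp only: ennreal_less_iff)
 thus ?thesis using that(1) by simp
 qed
 have "(INF \<tau>\<in>time_changes T. ?m \<tau>) < ennreal r"
 by (rule *[OF fin]) (use less in \<open>simp only: skorokhod_dist_def\<close>)
 then obtain \<tau> where \<tau>: "\<tau> \<in> time_changes T" "?m \<tau> < ennreal r" unfolding INF_less_iff by blast
 have ex: "\<exists>\<delta>. 0 <= \<delta> & v = ennreal \<delta>" if "v < ennreal r" for v
 using that by (cases v) auto
 obtain \<delta> where \<delta>: "0 <= \<delta>" "?m \<tau> = ennreal \<delta>" using ex[OF \<tau>(2)] by blast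
 have "\<bar>\<tau> t - t\<bar> <= \<delta> & dist (x t) (y (\<tau> t)) <= \<delta>" if "t \<in> {0..T}" for t
 proof -
 have "ennreal \<bar>\<tau> t - t\<bar> <= ?m \<tau>"
 by (rule max.coboundedI1[OF SUP_upper[where f="%t. ennreal \<bar>\<tau> t - t\<bar>", OF that]])
 moreover have "ennreal (dist (x t) (y (\<tau> t))) <= ?m \<tau>"
 by (rule max.coboundedI2[OF SUP_upper[where f="%t. ennreal (dist (x t) (y (\<tau> t)))", OF that]])
 ultimately show ?thesis using \<delta>(1) unfolding \<delta>(2) by simp
 qed
 moreover have "\<delta> < r" using \<tau>(2) \<delta>(1) unfolding \<delta>(2) by (simp add: ennreal_less_iff)
 ultimately show ?thesis using \<tau>(1) \<delta>(1) unfolding skorokhod_close_def by blast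
qed

lemma skorokhod_dist_triangle:
 assumes "x \<in> skorokhod T" "y \<in> skorokhod T" "z \<in> skorokhod T" "0 <= T"
 shows "skorokhod_dist T x z <= skorokhod_dist T x y + skorokhod_dist T y z"
proof (rule field_le_epsilon)
 fix e :: real assume "e > 0"
 hence 1: "skorokhod_dist T x y < skorokhod_dist T x y + e/2" and 2: "skorokhod_dist T y z < skorokhod_dist T y z + e/2" by auto
 obtain \<delta> \<epsilon> where *: "\<delta> < skorokhod_dist T x y + e/2" "skorokhod_close T \<delta> x y" "\<epsilon> < skorokhod_dist T y z + e/2" "skorokhod_close T \<epsilon> y z"
 using skorokhod_dist_lessD[OF assms(1,2,4) 1] skorokhod_dist_lessD[OF assms(2,3,4) 2] by blast
 have "skorokhod_dist T x z <= \<delta> + \<epsilon>"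
 by (rule skorokhod_dist_leI[OF skorokhod_close_trans[OF *(2,4)] assms(4)])
 thus "skorokhod_dist T x z <= skorokhod_dist T x y + skorokhod_dist T y z + e" using * by linarith
qed

lemma skorokhod_dist_commute:
 assumes "x \<in> skorokhod T" "y \<in> skorokhod T" "0 <= T"
 shows "skorokhod_dist T x y = skorokhod_dist T y x"
proof -
 have "skorokhod_dist T y x <= skorokhod_dist T x y" if "x \<in> skorokhod T" "y \<in> skorokhod T" for x y :: "real => 'a"
 proof (rule field_le_epsilon)
 fix e :: real assume "e > 0"
 hence "skorokhod_dist T x y < skorokhod_dist T x y + e" by auto
 from skorokhod_dist_lessD[OF that assms(3) this]
 obtain \<delta> where *: "\<delta> < skorokhod_dist T x y + e" "skorokhod_close T \<delta> x y" by blast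
 have "skorokhod_dist T y x <= \<delta>"
 by (rule skorokhod_dist_leI[OF skorokhod_close_sym[OF *(2)] assms(3)])
 thus "skorokhod_dist T y x <= skorokhod_dist T x y + e" using * by linarith
 qed
 thus ?thesis using assms by (intro order_antisym) auto
qed

section \<open>Supremum norm and evaluation of paths\<close>

definition path_norm :: "real => (real => 'a::real_normed_vector) => real" where
 "path_norm T x = (SUP t\<in>{0..T}. norm (x t))"

lemma norm_le_path_norm:
 assumes "x \<in> skorokhod T" "t \<in> {0..T}" shows "norm (x t) <= path_norm T x"
 unfolding path_norm_def using assms skorokhod_bounded[of x T]
 by (intro cSUP_upper) (auto simp: bdd_above_def)

lemma path_norm_leI:
 assumes "0 <= T" "!!t. t \<in> {0..T} ==> norm (x t) <= K" shows "path_norm T x <= K"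
 unfolding path_norm_def using assms by (intro cSUP_least) auto

lemma path_norm_nonneg: "x \<in> skorokhod T ==> 0 <= T ==> 0 <= path_norm T x"
 using norm_le_path_norm[of x T 0] norm_ge_zero[of "x 0"] by (auto simp del: norm_ge_zero)

lemma skorokhod_dist_le_path_norm:
 assumes "x \<in> skorokhod T" "y \<in> skorokhod T" "0 <= T"
 shows "skorokhod_dist T x y <= path_norm T x + path_norm T y"
proof (rule skorokhod_dist_leI)
 show "skorokhod_close T (path_norm T x + path_norm T y) x y" unfolding skorokhod_close_def
 proof (intro bexI[of _ "%t. t"] ballI conjI time_changes_id)
 fix t assume t: "t \<in> {0..T}"
 show "\<bar>t - t\<bar> <= path_norm T x + path_norm T y" using path_norm_nonneg[OF assms(1,3)] path_norm_nonneg[OF assms(2,3)] by simp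
 show "dist (x t) (y t) <= path_norm T x + path_norm T y"
 using norm_le_path_norm[OF assms(1) t] norm_le_path_norm[OF assms(2) t] norm_triangle_ineq4[of "x t" "y t"]
 by (simp add: dist_norm)
 qed
qed (rule assms)

text \<open>A time change maps the interval to itself, so every value of \<open>y\<close> is within
  \<open>\<delta>\<close> of some value of \<open>x\<close>.\<close>

lemma path_norm_le:
 assumes "x \<in> skorokhod T" "y \<in> skorokhod T" "0 <= T"
 shows "path_norm T y <= path_norm T x + skorokhod_dist T x y"
proof (rule field_le_epsilon)
 fix e :: real assume "e > 0"
 hence "skorokhod_dist T x y < skorokhod_dist T x y + e" by auto
 then obtain \<delta> where *: "\<delta> < skorokhod_dist T x y + e" "skorokhod_close T \<delta> x y"
 using skorokhod_dist_lessD[OF assms] by blast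
 obtain \<tau> where \<tau>: "\<tau> \<in> time_changes T" "!!t. t \<in> {0..T} ==> \<bar>\<tau> t - t\<bar> <= \<delta> & dist (y t) (x (\<tau> t)) <= \<delta>"
 using skorokhod_close_sym[OF *(2)] by (auto simp: skorokhod_close_def)
 show "path_norm T y <= path_norm T x + skorokhod_dist T x y + e"
 proof (rule path_norm_leI[OF assms(3)])
 fix t assume t: "t \<in> {0..T}"
 have "norm (y t) <= norm (x (\<tau> t)) + dist (y t) (x (\<tau> t))"
 by (metis dist_norm norm_triangle_sub)
 thus "norm (y t) <= path_norm T x + skorokhod_dist T x y + e"
 using \<tau>(2)[OF t] norm_le_path_norm[OF assms(1) time_change_bounds[OF \<tau>(1) t]] * by linarith
 qed
qed

text \<open>A path near \<open>x\<close> takes at \<open>s\<close> almost the value of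
  \<open>x\<close> at some time near \<open>s\<close>.\<close>

lemma skorokhod_eval_cont:
 assumes x: "x \<in> skorokhod T" and s: "s \<in> {0..T}" and c: "continuous (at s within {0..T}) x" and "e > 0"
 shows "\<exists>\<delta>>0. \<forall>y\<in>skorokhod T. skorokhod_dist T x y < \<delta> --> dist (x s) (y s) < e"
proof -
 obtain \<eta> where \<eta>: "\<eta> > 0" "!!s'. s' \<in> {0..T} ==> dist s' s < \<eta> ==> dist (x s') (x s) < e / 2"
 using c \<open>e > 0\<close> unfolding continuous_within_eps_delta by (meson half_gt_zero)
 show ?thesis
 proof (intro exI[of _ "min \<eta> (e/2)"] conjI ballI impI)
 fix y :: "real => 'a" assume y: "y \<in> skorokhod T" "skorokhod_dist T x y < min \<eta> (e / 2)"
 then obtain \<delta> where \<delta>: "\<delta> < min \<eta> (e/2)" "skorokhod_close T \<delta> x y"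
 using skorokhod_dist_lessD[OF x y(1) _ y(2)] s by auto
 then obtain \<tau> where \<tau>: "\<tau> \<in> time_changes T" "!!t. t \<in> {0..T} ==> \<bar>\<tau> t - t\<bar> <= \<delta> & dist (y t) (x (\<tau> t)) <= \<delta>"
 using skorokhod_close_sym[OF \<delta>(2)] by (auto simp: skorokhod_close_def)
 have "dist (x (\<tau> s)) (x s) < e/2"
 using \<tau>(2)[OF s] \<delta>(1) by (intro \<eta>(2) time_change_bounds[OF \<tau>(1) s]) (auto simp: dist_real_def)
 thus "dist (x s) (y s) < e"
 using \<tau>(2)[OF s] \<delta>(1) dist_triangle[of "x s" "y s" "x (\<tau> s)"] by (simp add: dist_commute)
 qed (use \<eta> \<open>e > 0\<close> in auto)
qed

text \<open>Every time change fixes \<open>T\<close>, so evaluation there is Lipschitz, unlike at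
  interior times.\<close>

lemma skorokhod_eval_end:
 assumes x: "x \<in> skorokhod T" and y: "y \<in> skorokhod T" and T: "0 <= T"
 shows "dist (x T) (y T) <= skorokhod_dist T x y"
proof (rule field_le_epsilon)
 fix e :: real assume "e > 0"
 hence "skorokhod_dist T x y < skorokhod_dist T x y + e" by auto
 then obtain \<delta> where *: "\<delta> < skorokhod_dist T x y + e" "skorokhod_close T \<delta> x y"
 using skorokhod_dist_lessD[OF assms] by blast
 then obtain \<tau> where \<tau>: "\<tau> \<in> time_changes T" "!!t. t \<in> {0..T} ==> \<bar>\<tau> t - t\<bar> <= \<delta> & dist (x t) (y (\<tau> t)) <= \<delta>"
 by (auto simp: skorokhod_close_def)
 thus "dist (x T) (y T) <= skorokhod_dist T x y + e"
 using \<tau>(2)[of T] time_change_end[OF \<tau>(1) T] * T by auto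
qed

subsection \<open>Measurability of the evaluation maps\<close>

lemma space_leb [simp]: "space (leb T) = {0..T}"
 by (simp add: leb_def)

lemma sets_leb: "sets (leb T) = sets (restrict_space borel {0..T})"
 by (simp add: leb_def sets_restrict_space)

lemma measurable_leb_id: "(%t. t) \<in> borel_measurable (leb T)"
 unfolding leb_def by (intro measurable_restrict_space1) simp

lemma finite_measure_leb: "finite_measure (leb T)"
 by (rule finite_measureI, cases "0 <= T") (auto simp: leb_def emeasure_restrict_space)

lemma emeasure_leb: "0 <= T ==> emeasure (leb T) {0..T} = ennreal T"
 by (simp add: leb_def emeasure_restrict_space)

lemma measurable_skorokhod_ball:
 assumes "0 <= T" "x \<in> skorokhod T"
 shows "{y \<in> skorokhod T. skorokhod_dist T x y < r} \<in> sets (borel_on (skorokhod T) (skorokhod_dist T))"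
proof (intro openin_in_sets_borel_on openin_metric_topologyI)
 fix y assume "y \<in> {y \<in> skorokhod T. skorokhod_dist T x y < r}"
 hence y: "y \<in> skorokhod T" "skorokhod_dist T x y < r" by auto
 show "\<exists>s>0. \<forall>z\<in>skorokhod T. skorokhod_dist T y z < s --> z \<in> {y \<in> skorokhod T. skorokhod_dist T x y < r}"
 proof (intro exI[of _ "r - skorokhod_dist T x y"] conjI ballI impI)
 fix z assume z: "z \<in> skorokhod T" "skorokhod_dist T y z < r - skorokhod_dist T x y"
 have "skorokhod_dist T x z <= skorokhod_dist T x y + skorokhod_dist T y z"
 by (rule skorokhod_dist_triangle) (use assms y z in auto)
 thus "z \<in> {y \<in> skorokhod T. skorokhod_dist T x y < r}" using z by auto
 qed (use y in auto)
qed auto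

lemma measurable_path_norm:
 assumes "0 <= T"
 shows "path_norm T \<in> borel_measurable (borel_on (skorokhod T) (skorokhod_dist T))"
proof (rule borel_measurable_usc_on, unfold usc_on_def, intro ballI allI impI)
 fix x :: "real => 'a" and \<epsilon> :: real assume x: "x \<in> skorokhod T" and "\<epsilon> > 0"
 show "\<exists>\<delta>>0. \<forall>y\<in>skorokhod T. skorokhod_dist T x y < \<delta> --> path_norm T y < path_norm T x + \<epsilon>"
 proof (intro exI[of _ \<epsilon>] conjI ballI impI)
 fix y assume "y \<in> skorokhod T" "skorokhod_dist T x y < \<epsilon>"
 thus "path_norm T y < path_norm T x + \<epsilon>" using path_norm_le[OF x _ assms, of y] by linarith
 qed fact
qed

text \<open>Evaluation at \<open>t < T\<close> is not continuous. But having a coordinate below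
  \<open>q\<close> at some time of an open interval is an open condition on the path, since a time
  change moves that time only slightly. By right-continuity, \<open>x t \<bullet> i > c\<close>
  means that for some rational \<open>q > c\<close> and some \<open>n\<close> the coordinate stays
  at least \<open>q\<close> during the next 1/(n+1) time units, which is a countable union of
  complements of such open sets.\<close>

lemma measurable_skorokhod_eval:
 fixes t T :: real
 assumes t: "t \<in> {0..T}"
 shows "(%x :: real => 'a::euclidean_space. x t) \<in> borel_measurable (borel_on (skorokhod T) (skorokhod_dist T))"
proof (cases "t = T")
 case True
 have "(%x :: real => 'a. x T) \<in> borel_on (skorokhod T) (skorokhod_dist T) \<rightarrow>\<^sub>M borel_on UNIV dist"
 proof (rule measurable_borel_onI)
 fix x :: "real => 'a" and e :: real assume x: "x \<in> skorokhod T" "e > 0"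
 show "\<exists>\<delta>>0. \<forall>y\<in>skorokhod T. skorokhod_dist T x y < \<delta> --> dist (x T) (y T) < e"
 using skorokhod_eval_end[OF x(1)] t x(2) by (intro exI[of _ e]) (auto intro: le_less_trans)
 qed auto
 thus ?thesis using True by (simp add: borel_on_UNIV)
next
 case False
 hence tT: "0 <= t" "t < T" using t by auto
 let ?D = "borel_on (skorokhod T :: (real => 'a) set) (skorokhod_dist T)"
 have op: "{x \<in> skorokhod T. \<exists>s. a < s & s < b & s \<in> {0..T} & x s \<bullet> i < q} \<in> sets ?D"
 if i: "i \<in> Basis" for a b q and i :: 'a
 proof (intro openin_in_sets_borel_on openin_metric_topologyI)
 fix x assume "x \<in> {x \<in> skorokhod T. \<exists>s. a < s & s < b & s \<in> {0..T} & x s \<bullet> i < q}"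
 then obtain s where x: "x \<in> skorokhod T" and s: "a < s" "s < b" "s \<in> {0..T}" "x s \<bullet> i < q" by blast
 \<comment> \<open>The slack in the level and the two slacks in time: a time change within
   \<open>r\<close> keeps \<open>\<tau> s\<close> in the interval and the value below
   \<open>q\<close>.\<close>
 define r where "r = min (q - x s \<bullet> i) (min (s - a) (b - s))"
 have "r > 0" using s by (auto simp: r_def)
 show "\<exists>r>0. \<forall>y\<in>skorokhod T. skorokhod_dist T x y < r \<longrightarrow>
 y \<in> {x \<in> skorokhod T. \<exists>s. a < s & s < b & s \<in> {0..T} & x s \<bullet> i < q}"
 proof (intro exI[of _ r] conjI ballI impI \<open>r > 0\<close>)
 fix y :: "real => 'a" assume y: "y \<in> skorokhod T" "skorokhod_dist T x y < r"
 have "0 <= T" using tT by simp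
 from skorokhod_dist_lessD[OF x y(1) this y(2)]
 obtain \<delta> where \<delta>: "\<delta> < r" "skorokhod_close T \<delta> x y" by blast
 then obtain \<tau> where \<tau>: "\<tau> \<in> time_changes T" "!!t. t \<in> {0..T} ==> \<bar>\<tau> t - t\<bar> <= \<delta> & dist (x t) (y (\<tau> t)) <= \<delta>"
 by (auto simp: skorokhod_close_def)
 have 1: "\<bar>\<tau> s - s\<bar> < r" "dist (x s) (y (\<tau> s)) < r" using \<tau>(2)[OF s(3)] \<delta>(1) by linarith+
 have "y (\<tau> s) \<bullet> i <= x s \<bullet> i + dist (x s) (y (\<tau> s))"
 using Basis_le_norm[OF i, of "y (\<tau> s) - x s"] by (simp add: dist_norm inner_diff_left norm_minus_commute)
 hence "y (\<tau> s) \<bullet> i < q" "a < \<tau> s" "\<tau> s < b" using 1 unfolding r_def by linarith+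
 thus "y \<in> {x \<in> skorokhod T. \<exists>s. a < s & s < b & s \<in> {0..T} & x s \<bullet> i < q}"
 using y(1) time_change_bounds[OF \<tau>(1) s(3)] by blast
 qed
 qed auto
 have "(%x :: real => 'a. x t \<bullet> i) \<in> borel_measurable ?D" if i: "i \<in> Basis" for i :: 'a
 unfolding borel_measurable_iff_greater
 proof
 fix c
 let ?N = "%q n. {x \<in> skorokhod T :: (real => 'a) set. \<exists>s. t < s & s < t + inverse (real (Suc n)) & s \<in> {0..T} & x s \<bullet> i < q}"
 have "{x \<in> space ?D. c < x t \<bullet> i} = (\<Union>q\<in>{q\<in>\<rat>. c < q}. \<Union>n. skorokhod T - ?N q n)"
 proof (intro equalityI subsetI)
 fix x assume "x \<in> {x \<in> space ?D. c < x t \<bullet> i}"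
 hence x: "x \<in> skorokhod T" "c < x t \<bullet> i" by auto
 obtain q where q: "q \<in> \<rat>" "c < q" "q < x t \<bullet> i" using Rats_dense_in_real[OF x(2)] by blast
 have "(x \<longlongrightarrow> x t) (at_right t)" using x(1) tT by (auto simp: skorokhod_def cadlag_on_def)
 hence "((%s. x s \<bullet> i) \<longlongrightarrow> x t \<bullet> i) (at_right t)" by (intro tendsto_intros)
 hence "\<forall>\<^sub>F s in at_right t. q < x s \<bullet> i" by (rule order_tendstoD) (rule q)
 then obtain b where b: "b > t" "!!s. t < s ==> s < b ==> q < x s \<bullet> i"
 unfolding eventually_at_right_field by blast
 then obtain n where n: "inverse (real (Suc n)) < b - t" using reals_Archimedean[of "b - t"] by auto
 have "x \<in> skorokhod T - ?N q n"
 using x(1) b(2) n by (fastforce simp: not_less)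
 thus "x \<in> (\<Union>q\<in>{q\<in>\<rat>. c < q}. \<Union>n. skorokhod T - ?N q n)" using q by blast
 next
 fix x assume "x \<in> (\<Union>q\<in>{q\<in>\<rat>. c < q}. \<Union>n. skorokhod T - ?N q n)"
 then obtain q n where q: "c < q" and xN: "x \<in> skorokhod T - ?N q n" by blast
 hence x: "x \<in> skorokhod T" by blast
 have n: "q <= x s \<bullet> i" if "t < s" "s < t + inverse (real (Suc n))" "s \<in> {0..T}" for s
 using xN that by (metis (mono_tags, lifting) DiffE mem_Collect_eq not_less)
 have "(x \<longlongrightarrow> x t) (at_right t)" using x(1) tT by (auto simp: skorokhod_def cadlag_on_def)
 hence lim: "((%s. x s \<bullet> i) \<longlongrightarrow> x t \<bullet> i) (at_right t)" by (intro tendsto_intros)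
 have "\<forall>\<^sub>F s in at_right t. q <= x s \<bullet> i"
 unfolding eventually_at_right_field
 using n tT by (intro exI[of _ "min T (t + inverse (real (Suc n)))"]) auto
 hence "q <= x t \<bullet> i" by (rule tendsto_lowerbound[OF lim]) simp
 thus "x \<in> {x \<in> space ?D. c < x t \<bullet> i}" using x q by auto
 qed
 moreover have "countable {q\<in>\<rat>. c < q}" using countable_rat by (rule countable_subset[rotated]) auto
 hence "(\<Union>q\<in>{q\<in>\<rat>. c < q}. \<Union>n. skorokhod T - ?N q n) \<in> sets ?D"
 using sets.top[of ?D] op[OF i] by (intro sets.countable_UN' sets.countable_UN sets.Diff) auto
 ultimately show "{x \<in> space ?D. c < x t \<bullet> i} \<in> sets ?D" by simp
 qed
 thus ?thesis unfolding borel_measurable_euclidean_space[of "%x. x t"] by blast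
qed

text \<open>Times are rounded up to a grid, which leaves countably many evaluation maps per mesh;
  right-continuity gives the limit.\<close>

lemma measurable_skorokhod_eval_joint:
 assumes T: "0 <= T"
 shows "(%(t, x :: real => 'a::euclidean_space). x t)
 \<in> borel_measurable (leb T \<Otimes>\<^sub>M borel_on (skorokhod T) (skorokhod_dist T))"
proof (rule borel_measurable_LIMSEQ_metric)
 let ?D = "borel_on (skorokhod T :: (real => 'a) set) (skorokhod_dist T)"
 \<comment> \<open>The \<open>+ 1\<close> puts the grid point strictly to the right of
   \<open>t\<close>, as convergence along \<open>at_right t\<close> demands; clipping at
   \<open>T\<close> makes it exactly \<open>T\<close> when \<open>t = T\<close>.\<close>
 let ?h = "%n k. max 0 (min T ((of_int k + 1) / real (Suc n)))"
 let ?k = "%n t. \<lfloor>real (Suc n) * t\<rfloor>"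
 show "(%(t, x :: real => 'a). x (?h n (?k n t))) \<in> borel_measurable (leb T \<Otimes>\<^sub>M ?D)" for n
 proof -
 have "(%z. snd z (?h n k)) \<in> borel_measurable (leb T \<Otimes>\<^sub>M ?D)" for k :: int
 by (rule measurable_compose[OF measurable_snd measurable_skorokhod_eval]) (use T in auto)
 moreover have "(%z. ?k n (fst z)) \<in> leb T \<Otimes>\<^sub>M ?D \<rightarrow>\<^sub>M count_space UNIV"
 using measurable_compose[OF measurable_fst measurable_leb_id] by measurable
 ultimately have "(%z. snd z (?h n (?k n (fst z)))) \<in> borel_measurable (leb T \<Otimes>\<^sub>M ?D)"
 by (rule measurable_compose_countable)
 thus ?thesis by (simp add: case_prod_unfold)
 qed
 fix z assume "z \<in> space (leb T \<Otimes>\<^sub>M ?D)"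
 then obtain t x where z: "z = (t, x)" and t: "0 <= t" "t <= T" and x: "x \<in> skorokhod T"
 by (auto simp: space_pair_measure)
 have "(%n. x (?h n (?k n t))) \<longlonglongrightarrow> x t"
 proof (cases "t = T")
 case True
 have "?h n (?k n t) = T" for n
 proof -
 have "real (Suc n) * T <= of_int (?k n T) + 1" by linarith
 hence "T <= (of_int (?k n T) + 1) / real (Suc n)" by (simp add: field_simps)
 thus ?thesis using True T by simp
 qed
 thus ?thesis using True by simp
 next
 case False
 have lim: "(x \<longlongrightarrow> x t) (at_right t)" using x t False by (auto simp: skorokhod_def cadlag_on_def)
 have l1: "t < ?h n (?k n t)" for n
 proof -
 have "real (Suc n) * t < of_int (?k n t) + 1" by linarith
 hence "t < (of_int (?k n t) + 1) / real (Suc n)" by (simp add: field_simps)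
 thus ?thesis using t False by auto
 qed
 have l2: "?h n (?k n t) <= t + inverse (real (Suc n))" for n
 proof -
 have "of_int (?k n t) + 1 <= real (Suc n) * t + 1" by linarith
 hence "(of_int (?k n t) + 1) / real (Suc n) <= (real (Suc n) * t + 1) / real (Suc n)"
 by (rule divide_right_mono) simp
 also have "\<dots> = t + inverse (real (Suc n))" by (simp add: add_divide_distrib inverse_eq_divide del: of_nat_Suc)
 finally have "(of_int (?k n t) + 1) / real (Suc n) <= t + inverse (real (Suc n))" .
 thus ?thesis using t by auto
 qed
 have "(%n. t + inverse (real (Suc n))) \<longlonglongrightarrow> t + 0"
 by (intro tendsto_intros LIMSEQ_inverse_real_of_nat)
 hence lim0: "(%n. t + inverse (real (Suc n))) \<longlonglongrightarrow> t" by simp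
 have lim1: "(%n. ?h n (?k n t)) \<longlonglongrightarrow> t"
 by (rule real_tendsto_sandwich[OF _ _ tendsto_const lim0];
 intro always_eventually allI less_imp_le[OF l1] l2)
 have gt: "?h n (?k n t) \<in> {t<..} & ?h n (?k n t) ~= t" for n
 using l1[of n] less_imp_neq[OF l1[of n]] unfolding greaterThan_iff by argo
 have "filterlim (%n. ?h n (?k n t)) (at_right t) sequentially"
 unfolding filterlim_at by (rule conjI[OF always_eventually lim1], rule allI, rule gt)
 thus ?thesis by (rule filterlim_compose[OF lim])
 qed
 thus "(%n. (%(t, x). x (?h n (?k n t))) z) \<longlonglongrightarrow> (%(t, x). x t) z" by (simp add: z)
qed

subsection \<open>A countable network\<close>

lemma partition_mono:
 fixes t :: "nat => real"
 assumes gap: "!!i. i < m ==> t i + \<gamma> <= t (Suc i)" and "\<gamma> > 0" "i < j" "j <= m"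
 shows "t i + \<gamma> <= t j"
 using assms(3,4)
proof (induction j)
 case (Suc j)
 thus ?case using gap[of j] \<open>\<gamma> > 0\<close> by (cases "i = j") auto
qed simp

lemma partition_locate:
 fixes t :: "nat => real"
 assumes "t 0 <= a" "a < t m" shows "\<exists>i<m. t i <= a & a < t (Suc i)"
 using assms(2)
proof (induction m)
 case (Suc m)
 thus ?case by (cases "a < t m") (auto simp: not_less intro: less_SucI)
qed (use assms in simp)

text \<open>The time change is the identity plus tent functions of width \<open>\<gamma>\<close> around the points \<open>t i\<close>.\<close>

lemma ex_time_change:
 fixes t t' :: "nat => real"
 assumes T: "T > 0" and \<gamma>: "\<gamma> > 0" and ends: "t 0 = 0" "t m = T" "t' 0 = 0" "t' m = T"
 and gap: "!!i. i < m ==> t i + \<gamma> <= t (Suc i)"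
 and \<eta>: "!!i. i <= m ==> \<bar>t' i - t i\<bar> <= \<eta>" "real (Suc m) * \<eta> < \<gamma>"
 shows "\<exists>\<tau>\<in>time_changes T. (\<forall>i\<le>m. \<tau> (t i) = t' i) & (\<forall>a\<in>{0..T}. \<bar>\<tau> a - a\<bar> <= real (Suc m) * \<eta>)"
proof -
 define p where "p i a = max 0 (1 - \<bar>a - t i\<bar> / \<gamma>)" for i a
 define g where "g a = (\<Sum>i\<le>m. (t' i - t i) * p i a)" for a
 define \<tau> where "\<tau> a = a + g a" for a
 have p_lip: "\<bar>p i a - p i b\<bar> <= \<bar>a - b\<bar> / \<gamma>" for i a b
 proof -
 have "\<bar>p i a - p i b\<bar> <= \<bar>\<bar>a - t i\<bar> / \<gamma> - \<bar>b - t i\<bar> / \<gamma>\<bar>" unfolding p_def by linarith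
 also have "\<dots> = \<bar>\<bar>a - t i\<bar> - \<bar>b - t i\<bar>\<bar> / \<gamma>" using \<gamma> by (simp add: diff_divide_distrib[symmetric] abs_divide)
 also have "\<dots> <= \<bar>a - b\<bar> / \<gamma>" using \<gamma> by (intro divide_right_mono) auto
 finally show ?thesis .
 qed
 have p01: "\<bar>p i a\<bar> <= 1" for i a using \<gamma> by (auto simp: p_def)
 have "0 <= \<eta>" using \<eta>(1)[of 0] by auto
 have g_bound: "\<bar>g a\<bar> <= real (Suc m) * \<eta>" for a
 proof -
 have "\<bar>g a\<bar> <= (\<Sum>i\<le>m. \<bar>(t' i - t i) * p i a\<bar>)" unfolding g_def by (rule sum_abs)
 also have "\<dots> <= (\<Sum>i\<le>m. \<eta> * 1)" unfolding abs_mult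
 by (intro sum_mono mult_mono \<eta> p01 \<open>0 <= \<eta>\<close>) auto
 finally show ?thesis by simp
 qed
 \<comment> \<open>The Lipschitz constant \<open>real (Suc m) * \<eta> / \<gamma>\<close> is below 1
   by assumption, so the perturbation \<open>g\<close> cannot destroy the strict monotonicity of the
   identity.\<close>
 have g_lip: "\<bar>g a - g b\<bar> <= (real (Suc m) * \<eta> / \<gamma>) * \<bar>a - b\<bar>" for a b
 proof -
 have "\<bar>g a - g b\<bar> = \<bar>\<Sum>i\<le>m. (t' i - t i) * (p i a - p i b)\<bar>"
 unfolding g_def by (simp add: sum_subtractf[symmetric] right_diff_distrib)
 also have "\<dots> <= (\<Sum>i\<le>m. \<bar>(t' i - t i) * (p i a - p i b)\<bar>)" by (rule sum_abs)
 also have "\<dots> <= (\<Sum>i\<le>m. \<eta> * (\<bar>a - b\<bar> / \<gamma>))" unfolding abs_mult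
 by (intro sum_mono mult_mono \<eta> p_lip \<open>0 <= \<eta>\<close>) auto
 finally show ?thesis by simp
 qed
 have sm: "\<tau> a < \<tau> b" if "a < b" for a b
 proof -
 have "(real (Suc m) * \<eta> / \<gamma>) * \<bar>a - b\<bar> < 1 * \<bar>a - b\<bar>"
 using that \<eta>(2) \<gamma> by (intro mult_strict_right_mono) (auto simp: field_simps)
 hence "\<bar>g a - g b\<bar> < 1 * \<bar>a - b\<bar>" by (rule le_less_trans[OF g_lip])
 hence "\<bar>g a - g b\<bar> < b - a" using that by simp
 thus ?thesis unfolding \<tau>_def by linarith
 qed
 have at: "\<tau> (t j) = t' j" if j: "j <= m" for j
 proof -
 \<comment> \<open>The gaps are at least \<open>\<gamma>\<close>, so only the tent centred at
   \<open>t j\<close> is nonzero there.\<close>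
 have "p i (t j) = (if i = j then 1 else 0)" if "i <= m" for i
 proof (cases "i = j")
 case False
 have "\<gamma> <= \<bar>t j - t i\<bar>"
 using partition_mono[of m t \<gamma> i j, OF gap \<gamma>] partition_mono[of m t \<gamma> j i, OF gap \<gamma>] False that j
 by (cases i j rule: linorder_cases) auto
 hence "1 <= \<bar>t j - t i\<bar> / \<gamma>" using \<gamma> by simp
 thus ?thesis using False by (simp add: p_def)
 qed (simp add: p_def)
 hence "g (t j) = (\<Sum>i\<le>m. if i = j then t' i - t i else 0)" unfolding g_def by (intro sum.cong) auto
 thus ?thesis using j by (simp add: \<tau>_def sum.delta)
 qed
 have cont: "continuous_on A \<tau>" for A
 unfolding \<tau>_def g_def p_def using \<gamma> by (intro continuous_intros) auto
 have \<tau>0: "\<tau> 0 = 0" "\<tau> T = T" using at[of 0] at[of m] ends by auto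
 have "\<tau> ` {0..T} = {0..T}"
 proof (intro equalityI subsetI)
 fix b assume "b \<in> \<tau> ` {0..T}"
 then obtain a where a: "0 <= a" "a <= T" "b = \<tau> a" by auto
 have "\<tau> 0 <= \<tau> a" "\<tau> a <= \<tau> T" using sm[of 0 a] sm[of a T] a by (auto simp: le_less)
 thus "b \<in> {0..T}" using \<tau>0 a by auto
 next
 fix b assume "b \<in> {0..T}"
 then obtain a where "0 <= a" "a <= T" "\<tau> a = b" using IVT'[of \<tau> 0 b T] \<tau>0 T cont by auto
 thus "b \<in> \<tau> ` {0..T}" by auto
 qed
 hence "\<tau> \<in> time_changes T" using sm cont by (auto simp: time_changes_def strict_mono_on_def)
 thus ?thesis using at g_bound by (intro bexI[of _ \<tau>]) (auto simp: \<tau>_def)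
qed

text \<open>Finite data for a path: \<open>s\<close> approximates the partition times and
  \<open>v\<close> the values there. Two partitions fitting the same \<open>s\<close> differ by at
  most 1/(n+1) in each time, so the \<open>m + 1\<close> tents of \<open>ex_time_change\<close> move
  a time by at most (m+1)/(n+1); the prescribed gap (m+2)/(n+1) strictly exceeds this.\<close>

definition path_partition ::
 "real => real => nat => nat => real list => 'a::euclidean_space list => (real => 'a) => (nat => real) => bool" where
 "path_partition T \<epsilon> m n s v x t \<longleftrightarrow> (t 0 = 0 & t m = T \<and>
 (\<forall>i<m. t i + real (m + 2) / real (n + 1) <= t (Suc i)) \<and>
 (\<forall>i\<le>m. \<bar>t i - s ! i\<bar> <= 1 / (2 * real (n + 1))) \<and>
 (\<forall>i\<le>m. dist (x (t i)) (v ! i) <= \<epsilon>) \<and>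
 (\<forall>i<m. \<forall>a. t i <= a & a < t (Suc i) --> dist (x (t i)) (x a) <= \<epsilon>))"

definition path_class ::
 "real => real => nat => nat => real list => 'a::euclidean_space list => (real => 'a) => bool" where
 "path_class T \<epsilon> m n s v x \<longleftrightarrow> (\<exists>t. path_partition T \<epsilon> m n s v x t)"

text \<open>Once one time change matches the partition points, a value of \<open>x\<close> reaches
  the corresponding value of \<open>y\<close> in four steps of size \<open>\<epsilon>\<close>: to
  the partition point on its left, to \<open>v ! i\<close>, to the partition point of
  \<open>y\<close>, and on inside that cell.\<close>

lemma path_class_close:
 assumes T: "T > 0" and x: "path_class T \<epsilon> m n s v x" and y: "path_class T \<epsilon> m n s v y"
 and n: "real (m + 2) / real (n + 1) <= \<epsilon>"
 shows "skorokhod_close T (4 * \<epsilon>) x y"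
proof -
 obtain t where pt: "path_partition T \<epsilon> m n s v x t" using x unfolding path_class_def by blast
 have t: "t 0 = 0" "t m = T" "!!i. i < m ==> t i + real (m + 2) / real (n + 1) <= t (Suc i)"
 "!!i. i\<le>m ==> \<bar>t i - s ! i\<bar> <= 1 / (2 * real (n + 1))" "!!i. i\<le>m ==> dist (x (t i)) (v ! i) <= \<epsilon>"
 "!!i a. i<m ==> t i <= a ==> a < t (Suc i) ==> dist (x (t i)) (x a) <= \<epsilon>"
 using pt unfolding path_partition_def by blast+
 obtain t' where pt': "path_partition T \<epsilon> m n s v y t'" using y unfolding path_class_def by blast
 have t': "t' 0 = 0" "t' m = T"
 "!!i. i\<le>m ==> \<bar>t' i - s ! i\<bar> <= 1 / (2 * real (n + 1))" "!!i. i\<le>m ==> dist (y (t' i)) (v ! i) <= \<epsilon>"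
 "!!i a. i<m ==> t' i <= a ==> a < t' (Suc i) ==> dist (y (t' i)) (y a) <= \<epsilon>"
 using pt' unfolding path_partition_def by blast+
 have h: "\<bar>t' i - t i\<bar> <= 1 / real (n + 1)" if "i <= m" for i
 proof -
 have "1 / (2 * real (n + 1)) + 1 / (2 * real (n + 1)) = 1 / real (n + 1)" by (simp add: field_simps)
 moreover have "\<bar>y - x\<bar> <= b" if "a + a = b" "\<bar>x - s\<bar> <= a" "\<bar>y - s\<bar> <= a" for a b x y s :: real
 using that by linarith
 ultimately show ?thesis using t(4)[OF that] t'(3)[OF that] by blast
 qed
 have lt: "real (Suc m) * (1 / real (n + 1)) < real (m + 2) / real (n + 1)"
 by (simp add: divide_strict_right_mono)
 obtain \<tau> where \<tau>: "\<tau> \<in> time_changes T" "!!i. i <= m ==> \<tau> (t i) = t' i"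
 "!!a. a\<in>{0..T} ==> \<bar>\<tau> a - a\<bar> <= real (Suc m) * (1 / real (n + 1))"
 using ex_time_change[OF T _ t(1,2) t'(1,2) t(3) h lt] by auto
 have e0: "0 <= \<epsilon>" using n by (rule order_trans[rotated]) simp
 show ?thesis unfolding skorokhod_close_def
 proof (intro bexI[of _ \<tau>] ballI conjI)
 fix a assume a: "a \<in> {0..T}"
 show "\<bar>\<tau> a - a\<bar> <= 4 * \<epsilon>" using \<tau>(3)[OF a] lt n e0 by linarith
 show "dist (x a) (y (\<tau> a)) <= 4 * \<epsilon>"
 proof (cases "a = T")
 case True
 hence "\<tau> a = t' m" "a = t m" using \<tau>(2)[of m] t(2) t'(2) by auto
 thus ?thesis
 using t(5)[of m] t'(4)[of m] dist_triangle2[of "x (t m)" "y (t' m)" "v ! m"] e0 by simp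
 next
 case False
 then obtain i where i: "i < m" "t i <= a" "a < t (Suc i)"
 using partition_locate[of t a m] a t(1,2) by auto
 have sm: "strict_mono_on {0..T} \<tau>" using \<tau>(1) by (simp add: time_changes_def)
 have g: "0 < real (m + 2) / real (n + 1)" by simp
 note pm = partition_mono[where t=t and m=m and \<gamma>="real (m + 2) / real (n + 1)", OF t(3) g]
 have "t 0 <= t i" using pm[of 0 i] i(1) g by (cases "i = 0") (simp, linarith)
 moreover have "t (Suc i) <= t m" using pm[of "Suc i" m] i(1) g by (cases "Suc i = m") (simp, linarith)
 ultimately
 have ti: "t i \<in> {0..T}" "t (Suc i) \<in> {0..T}" using i a t(1,2) by auto
 have "t' i <= \<tau> a" using i \<tau>(2)[of i] strict_mono_onD[OF sm ti(1) a] by (cases "t i = a") auto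
 moreover have "\<tau> a < t' (Suc i)" using i \<tau>(2)[of "Suc i"] strict_mono_onD[OF sm a ti(2)] by auto
 ultimately have "dist (y (t' i)) (y (\<tau> a)) <= \<epsilon>" using t'(5) i by auto
 moreover have "dist (x (t i)) (x a) <= \<epsilon>" using t(6) i by auto
 moreover have "dist (x (t i)) (v ! i) <= \<epsilon>" "dist (y (t' i)) (v ! i) <= \<epsilon>" using t(5)[of i] t'(4)[of i] i by auto
 moreover have "dist (x a) (y (\<tau> a)) <= dist (x (t i)) (x a) + dist (x (t i)) (v ! i) + dist (y (t' i)) (v ! i) + dist (y (t' i)) (y (\<tau> a))"
 using dist_triangle3[of "x a" "y (\<tau> a)" "x (t i)"] dist_triangle3[of "x (t i)" "y (\<tau> a)" "y (t' i)"]
 dist_triangle2[of "x (t i)" "y (t' i)" "v ! i"] by (simp add: dist_commute)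
 ultimately show ?thesis by linarith
 qed
 qed (rule \<tau>)
qed

text \<open>The partition is the oscillation partition with both endpoints added. Only after it is
  fixed, and with it \<open>m\<close> and the least gap \<open>\<gamma>\<close>, is \<open>n\<close>
  chosen, so that (m+2)/(n+1) lies below both \<open>\<gamma>\<close> and
  \<open>\<epsilon>\<close>.\<close>

lemma ex_path_class:
 fixes x :: "real => 'a::euclidean_space"
 assumes T: "T > 0" and \<epsilon>: "\<epsilon> > 0" and x: "x \<in> skorokhod T"
 and Q: "!!X :: 'a set. open X ==> X ~= {} ==> \<exists>d\<in>Q. d \<in> X"
 shows "\<exists>m n s v. real (m + 2) / real (n + 1) <= \<epsilon> & set s \<subseteq> \<rat> & set v \<subseteq> Q & path_class T \<epsilon> m n s v x"
proof -
 have "cadlag_on T x" using x by (simp add: skorokhod_def)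
 then obtain S where S: "finite S" "!!s t. 0 <= s ==> s <= t ==> t <= T ==> {s<..t} \<inter> S = {} ==> dist (x s) (x t) < \<epsilon>"
 using cadlag_on_ex_partition[of T x \<epsilon>] T \<epsilon> by auto
 define A where "A = insert 0 (insert T (S \<inter> {0..T}))"
 define ts where "ts = sorted_list_of_set A"
 define t where "t i = ts ! i" for i
 define m where "m = length ts - 1"
 have A: "finite A" using S(1) by (simp add: A_def)
 have ts: "set ts = A" "sorted ts" "distinct ts" using A by (auto simp: ts_def)
 hence sw: "sorted_wrt (<) ts" by (simp add: strict_sorted_iff)
 have "card A \<ge> card {0, T}" by (intro card_mono A) (auto simp: A_def)
 hence "length ts \<ge> 2" using T distinct_card[OF ts(3)] ts(1) by simp
 hence m: "length ts = Suc m" "m > 0" by (auto simp: m_def)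
 have mono: "t i < t j" if "i < j" "j <= m" for i j
 using sorted_wrt_nth_less[OF sw, of i j] that m by (simp add: t_def)
 have mem: "t i \<in> A" if "i <= m" for i using ts(1) that m by (metis le_imp_less_Suc nth_mem t_def)
 have idx: "\<exists>i\<le>m. t i = a" if "a \<in> A" for a
 using that ts(1) m by (metis in_set_conv_nth less_Suc_eq_le t_def)
 have A0: "0 <= a & a <= T" if "a \<in> A" for a using that T by (auto simp: A_def)
 have t0: "t 0 = 0"
 proof -
 obtain i where i: "i <= m" "t i = 0" using idx[of 0] by (auto simp: A_def)
 thus ?thesis using mono[of 0 i] A0[OF mem[of 0]] by (cases "i = 0") auto
 qed
 have tm: "t m = T"
 proof -
 obtain i where i: "i <= m" "t i = T" using idx[of T] by (auto simp: A_def)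
 thus ?thesis using mono[of i m] A0[OF mem[of m]] by (cases "i = m") auto
 qed
 define \<gamma> where "\<gamma> = Min ((%i. t (Suc i) - t i) ` {..<m})"
 have "\<gamma> \<in> (%i. t (Suc i) - t i) ` {..<m}" unfolding \<gamma>_def using m by (intro Min_in) auto
 hence g0: "\<gamma> > 0" using mono by fastforce
 have g: "t i + \<gamma> <= t (Suc i)" if "i < m" for i
 proof -
 have "\<gamma> <= t (Suc i) - t i" unfolding \<gamma>_def using that by (intro Min_le) auto
 thus ?thesis by simp
 qed
 obtain n where n: "inverse (real (Suc n)) < min \<gamma> \<epsilon> / real (m + 2)"
 using reals_Archimedean[of "min \<gamma> \<epsilon> / real (m + 2)"] g0 \<epsilon> by auto
 hence n': "real (m + 2) / real (n + 1) < min \<gamma> \<epsilon>" by (simp add: field_simps)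
 have "\<exists>q\<in>\<rat>. \<bar>t i - q\<bar> <= 1 / (2 * real (n + 1))" for i
 proof -
 have "t i < t i + 1 / (2 * real (n + 1))" by simp
 then obtain q where "q \<in> \<rat>" "t i < q" "q < t i + 1 / (2 * real (n + 1))" using Rats_dense_in_real by blast
 thus ?thesis by (intro bexI[of _ q]) auto
 qed
 then obtain s where s: "!!i. s i \<in> \<rat>" "!!i. \<bar>t i - s i\<bar> <= 1 / (2 * real (n + 1))" by metis
 have "\<exists>q\<in>Q. dist (x (t i)) q <= \<epsilon>" for i
 proof -
 obtain d where "d \<in> Q" "d \<in> ball (x (t i)) \<epsilon>" using Q[of "ball (x (t i)) \<epsilon>"] \<epsilon> by auto
 thus ?thesis by (intro bexI[of _ d]) auto
 qed
 then obtain v where v: "!!i. v i \<in> Q" "!!i. dist (x (t i)) (v i) <= \<epsilon>" by metis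
 have osc: "dist (x (t i)) (x a) <= \<epsilon>" if "i < m" "t i <= a" "a < t (Suc i)" for i a
 proof -
 have "{t i<..a} \<inter> S = {}"
 proof (rule ccontr)
 assume "{t i<..a} \<inter> S ~= {}"
 then obtain b where b: "b \<in> S" "t i < b" "b <= a" by auto
 have "0 <= t i" "t (Suc i) <= T" using A0[OF mem] that by auto
 hence "b \<in> A" using b that by (auto simp: A_def)
 then obtain j where j: "j <= m" "t j = b" using idx by blast
 have "\<not> j <= i" using mono[of j i] b j that by (cases "j = i") auto
 hence "t (Suc i) <= t j" using mono[of "Suc i" j] j by (cases "j = Suc i") auto
 thus False using j b that by auto
 qed
 thus ?thesis using S(2)[of "t i" a] that A0[OF mem[of i]] A0[OF mem[of "Suc i"]] by auto
 qed
 have "path_class T \<epsilon> m n (map s [0..<Suc m]) (map v [0..<Suc m]) x"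
 unfolding path_class_def path_partition_def
 proof (intro exI[of _ t] conjI allI impI)
 fix i assume i: "i <= m"
 hence nth: "map s [0..<Suc m] ! i = s i" "map v [0..<Suc m] ! i = v i"
 by (auto simp del: upt_Suc)
 show "\<bar>t i - map s [0..<Suc m] ! i\<bar> <= 1 / (2 * real (n + 1))" unfolding nth by (rule s)
 show "dist (x (t i)) (map v [0..<Suc m] ! i) <= \<epsilon>" unfolding nth by (rule v)
 next
 fix i assume "i < m"
 thus "t i + real (m + 2) / real (n + 1) <= t (Suc i)" using g[of i] n' by linarith
 qed (use t0 tm osc in auto)
 moreover have "real (m + 2) / real (n + 1) <= \<epsilon>" using n' by linarith
 moreover have "set (map s [0..<Suc m]) \<subseteq> \<rat>" "set (map v [0..<Suc m]) \<subseteq> Q" using s v by auto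
 ultimately show ?thesis by blast
qed

text \<open>Separability of Skorokhod space. The path classes with rational data are countably many
  but not visibly Borel, so each nonempty class is replaced by a ball around one chosen member. A
  member of the class is within \<open>4 * \<epsilon>\<close> of it, hence inside the ball of radius
  \<open>5 * \<epsilon>\<close>, and at distance below \<open>9 * \<epsilon>\<close> from every
  point of that ball.\<close>

lemma countable_network_skorokhod:
 assumes T: "T > 0"
 shows "countable_network (skorokhod T :: (real => 'a::euclidean_space) set) (skorokhod_dist T)"
proof -
 obtain Q :: "'a set" where Q: "countable Q" "!!X. open X ==> X ~= {} ==> \<exists>d\<in>Q. d \<in> X"
 using countable_dense_setE by blast
 define c where "c \<epsilon> m n s v = (SOME x :: real => 'a. x \<in> skorokhod T & path_class T \<epsilon> m n s v x)" for \<epsilon> m n s v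
 define B where "B \<epsilon> m n s v = (if \<exists>x :: real => 'a. x \<in> skorokhod T & path_class T \<epsilon> m n s v x
 then {y \<in> skorokhod T. skorokhod_dist T (c \<epsilon> m n s v) y < 5 * \<epsilon>} else {})" for \<epsilon> m n s v
 have c: "c \<epsilon> m n s v \<in> skorokhod T" "path_class T \<epsilon> m n s v (c \<epsilon> m n s v)"
 if "x \<in> skorokhod T" "path_class T \<epsilon> m n s v x" for \<epsilon> m n s v and x :: "real => 'a"
 using someI[of "%x. x \<in> skorokhod T & path_class T \<epsilon> m n s v x" x] that unfolding c_def by auto
 let ?N = "(%(j, m, n, s, v). B (inverse (real (Suc j))) m n s v) ` (UNIV \<times> UNIV \<times> UNIV \<times> lists \<rat> \<times> lists Q)"
 have "countable ?N"
 by (intro countable_image countable_SIGMA countable_lists countableI_type Q(1) countable_rat)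
 moreover have "?N \<subseteq> sets (borel_on (skorokhod T) (skorokhod_dist T))"
 proof -
 have "B \<epsilon> m n s v \<in> sets (borel_on (skorokhod T) (skorokhod_dist T))" for \<epsilon> m n s v
 proof (cases "\<exists>x :: real => 'a. x \<in> skorokhod T & path_class T \<epsilon> m n s v x")
 case True
 hence "c \<epsilon> m n s v \<in> skorokhod T" using c(1) by blast
 thus ?thesis using measurable_skorokhod_ball[of T "c \<epsilon> m n s v"] T unfolding B_def if_P[OF True] by simp
 next
 case False
 show ?thesis unfolding B_def if_not_P[OF False] by simp
 qed
 thus ?thesis by (simp add: image_subset_iff)
 qed
 moreover have "\<exists>N\<in>?N. x \<in> N & (\<forall>y\<in>N. skorokhod_dist T x y < r)" if x: "x \<in> skorokhod T" and r: "r > 0" for x r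
 proof -
 obtain j where j: "inverse (real (Suc j)) < r / 9" using reals_Archimedean[of "r / 9"] r by auto
 define \<epsilon> where "\<epsilon> = inverse (real (Suc j))"
 have \<epsilon>: "\<epsilon> > 0" "9 * \<epsilon> < r" using j by (auto simp: \<epsilon>_def)
 obtain m n s v where p: "real (m + 2) / real (n + 1) <= \<epsilon>" "set s \<subseteq> \<rat>" "set v \<subseteq> Q" "path_class T \<epsilon> m n s v x"
 using ex_path_class[OF T \<epsilon>(1) x Q(2)] by blast
 let ?c = "c \<epsilon> m n s v"
 have cc: "?c \<in> skorokhod T" "path_class T \<epsilon> m n s v ?c" using c[OF x p(4)] by auto
 have d: "skorokhod_dist T ?c x <= 4 * \<epsilon>"
 using T by (intro skorokhod_dist_leI path_class_close[OF T cc(2) p(4) p(1)]) simp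
 have Beq: "B \<epsilon> m n s v = {y \<in> skorokhod T. skorokhod_dist T ?c y < 5 * \<epsilon>}"
 unfolding B_def using x p(4) by (intro if_P) blast
 have "B \<epsilon> m n s v \<in> ?N" using p(2,3) unfolding \<epsilon>_def
 by (intro image_eqI[of _ _ "(j, m, n, s, v)"]) (auto simp: in_lists_conv_set)
 moreover have "x \<in> B \<epsilon> m n s v" unfolding Beq using d x \<epsilon> by auto
 moreover have "skorokhod_dist T x y < r" if "y \<in> B \<epsilon> m n s v" for y
 proof -
 have y: "y \<in> skorokhod T" "skorokhod_dist T ?c y < 5 * \<epsilon>" using that unfolding Beq by auto
 have "skorokhod_dist T x y <= skorokhod_dist T x ?c + skorokhod_dist T ?c y"
 by (rule skorokhod_dist_triangle) (use x cc y T in auto)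
 also have "skorokhod_dist T x ?c = skorokhod_dist T ?c x"
 by (rule skorokhod_dist_commute) (use x cc T in auto)
 finally show ?thesis using d y \<epsilon> by linarith
 qed
 ultimately show ?thesis by (intro bexI[of _ "B \<epsilon> m n s v"] conjI ballI)
 qed
 ultimately show ?thesis unfolding countable_network_def by (intro exI[of _ ?N] conjI ballI allI impI)
qed

section \<open>Couplings along a finite partition\<close>

lemma measurable_coupling:
 assumes "\<pi> \<in> couplings M d \<mu> \<nu>" "!!x y. 0 <= d x y" "\<mu> \<in> prob_measures M d" "\<nu> \<in> prob_measures M d"
 shows "fst \<in> \<pi> \<rightarrow>\<^sub>M \<mu>" "snd \<in> \<pi> \<rightarrow>\<^sub>M \<nu>"
proof -
 have "fst \<in> borel_on (M \<times> M) (sum_dist d d) \<rightarrow>\<^sub>M borel_on M d" "snd \<in> borel_on (M \<times> M) (sum_dist d d) \<rightarrow>\<^sub>M borel_on M d"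
 by (rule measurable_fst_sum_dist measurable_snd_sum_dist; rule assms(2))+
 thus "fst \<in> \<pi> \<rightarrow>\<^sub>M \<mu>" "snd \<in> \<pi> \<rightarrow>\<^sub>M \<nu>"
 using measurable_cong_sets[OF couplingsD(2)[OF assms(1)] prob_measuresD(2)[OF assms(3)]]
 measurable_cong_sets[OF couplingsD(2)[OF assms(1)] prob_measuresD(2)[OF assms(4)]] by auto
qed

lemma nn_integral_coupling:
 assumes "\<pi> \<in> couplings M d \<mu> \<nu>" "!!x y. 0 <= d x y" "\<mu> \<in> prob_measures M d" "\<nu> \<in> prob_measures M d"
 shows "f \<in> borel_measurable \<mu> ==> (\<integral>\<^sup>+z. f (fst z) \<partial>\<pi>) = (\<integral>\<^sup>+x. f x \<partial>\<mu>)"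
 "f \<in> borel_measurable \<nu> ==> (\<integral>\<^sup>+z. f (snd z) \<partial>\<pi>) = (\<integral>\<^sup>+x. f x \<partial>\<nu>)"
proof -
 show "(\<integral>\<^sup>+z. f (fst z) \<partial>\<pi>) = (\<integral>\<^sup>+x. f x \<partial>\<mu>)" if "f \<in> borel_measurable \<mu>"
 using nn_integral_distr[OF measurable_coupling(1)[OF assms], of f] that couplingsD(4)[OF assms(1)] by simp
 show "(\<integral>\<^sup>+z. f (snd z) \<partial>\<pi>) = (\<integral>\<^sup>+x. f x \<partial>\<nu>)" if "f \<in> borel_measurable \<nu>"
 using nn_integral_distr[OF measurable_coupling(2)[OF assms], of f] that couplingsD(5)[OF assms(1)] by simp
qed

lemma nn_integral_finite_valued:
 assumes idx: "idx \<in> \<nu> \<rightarrow>\<^sub>M count_space UNIV" and J: "!!w. w \<in> space \<nu> ==> idx w <= (J::nat)"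
 shows "(\<integral>\<^sup>+w. c (idx w) \<partial>\<nu>) = (\<Sum>k\<le>J. c k * emeasure \<nu> {w \<in> space \<nu>. idx w = k})"
proof -
 have m: "{w \<in> space \<nu>. idx w = k} \<in> sets \<nu>" for k
 using measurable_sets[OF idx, of "{k}"] by (simp add: vimage_def Int_def conj_commute)
 have "(\<integral>\<^sup>+w. c (idx w) \<partial>\<nu>) = (\<integral>\<^sup>+w. (\<Sum>k\<le>J. c k * indicator {w \<in> space \<nu>. idx w = k} w) \<partial>\<nu>)"
 proof (rule nn_integral_cong)
 fix w assume w: "w \<in> space \<nu>"
 have "(\<Sum>k\<le>J. c k * indicator {w \<in> space \<nu>. idx w = k} w) = (\<Sum>k\<le>J. if idx w = k then c k else 0)"
 using w by (intro sum.cong) (auto simp: indicator_def)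
 thus "c (idx w) = (\<Sum>k\<le>J. c k * indicator {w \<in> space \<nu>. idx w = k} w)" using J[OF w] by simp
 qed
 also have "\<dots> = (\<Sum>k\<le>J. \<integral>\<^sup>+w. c k * indicator {w \<in> space \<nu>. idx w = k} w \<partial>\<nu>)"
 using m by (intro nn_integral_sum) simp
 also have "\<dots> = (\<Sum>k\<le>J. c k * emeasure \<nu> {w \<in> space \<nu>. idx w = k})"
 using m by (intro sum.cong nn_integral_cmult_indicator) auto
 finally show ?thesis .
qed

text \<open>
 The coupling of two probability vectors that keeps as much mass as possible on the diagonal.
\<close>

lemma ex_coupling_matrix:
 fixes a b :: "nat => real"
 assumes nn: "!!i. 0 <= a i" "!!i. 0 <= b i" and s: "(\<Sum>i\<le>J. a i) = 1" "(\<Sum>i\<le>J. b i) = 1"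
 shows "\<exists>\<theta>. (\<forall>i k. 0 <= \<theta> i k) & (\<forall>i\<le>J. (\<Sum>k\<le>J. \<theta> i k) = a i) & (\<forall>k\<le>J. (\<Sum>i\<le>J. \<theta> i k) = b k) \<and>
 (\<forall>i\<le>J. min (a i) (b i) <= \<theta> i i)"
proof -
 define m where "m i = min (a i) (b i)" for i
 define \<rho> where "\<rho> = (\<Sum>i\<le>J. a i - m i)"
 \<comment> \<open>The surplus masses left over by the diagonal are joined by their normalized
   product. If \<open>\<rho> = 0\<close> there is no surplus, and division by zero gives the right
   value 0.\<close>
 define \<theta> where "\<theta> i k = (if i = k then m i else 0) + (a i - m i) * (b k - m k) / \<rho>" for i k
 have m: "m i <= a i" "m i <= b i" "0 <= m i" for i using nn by (auto simp: m_def)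
 have \<rho>b: "\<rho> = (\<Sum>i\<le>J. b i - m i)" unfolding \<rho>_def by (simp add: sum_subtractf s)
 have \<rho>0: "0 <= \<rho>" unfolding \<rho>_def using m by (intro sum_nonneg) auto
 have za: "a i - m i = 0" if "\<rho> = 0" "i <= J" for i
 using that m sum_nonneg_eq_0_iff[of "{..J}" "%i. a i - m i"] unfolding \<rho>_def by auto
 have zb: "b i - m i = 0" if "\<rho> = 0" "i <= J" for i
 using that m sum_nonneg_eq_0_iff[of "{..J}" "%i. b i - m i"] unfolding \<rho>b by auto
 have "(\<Sum>k\<le>J. \<theta> i k) = a i" if i: "i <= J" for i
 proof -
 have "(\<Sum>k\<le>J. \<theta> i k) = m i + (a i - m i) * \<rho> / \<rho>"
 unfolding \<theta>_def sum.distrib \<rho>b using i by (simp add: sum_distrib_left sum_divide_distrib)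
 thus ?thesis using za[OF _ i] by (cases "\<rho> = 0") auto
 qed
 moreover have "(\<Sum>i\<le>J. \<theta> i k) = b k" if k: "k <= J" for k
 proof -
 have "(\<Sum>i\<le>J. \<theta> i k) = m k + \<rho> * (b k - m k) / \<rho>"
 unfolding \<theta>_def sum.distrib \<rho>_def using k by (simp add: sum_distrib_right sum_divide_distrib)
 thus ?thesis using zb[OF _ k] by (cases "\<rho> = 0") auto
 qed
 moreover have "0 <= \<theta> i k" for i k unfolding \<theta>_def using m \<rho>0 by (auto intro!: add_nonneg_nonneg divide_nonneg_nonneg mult_nonneg_nonneg)
 moreover have "min (a i) (b i) <= \<theta> i i" for i
 unfolding \<theta>_def using m \<rho>0 by (simp add: m_def[symmetric])
 ultimately show ?thesis by (intro exI[of _ \<theta>]) auto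
qed

text \<open>A coupling matrix \<open>\<theta>\<close> of the cell masses is lifted to the measures
  by a density with respect to the product measure that is constant on products of cells: given the
  pair of cells, the two points are independent. The mass leaving cell \<open>j\<close> is
  \<open>a j - \<theta> j j\<close>, at most \<open>a j - min (a j) (b j)\<close>.\<close>

lemma ex_coupling_partition:
 fixes \<mu> :: "'a measure" and \<nu> :: "'b measure"
 assumes "prob_space \<mu>" "prob_space \<nu>"
 and idx: "idx \<in> \<mu> \<rightarrow>\<^sub>M count_space UNIV" "idx' \<in> \<nu> \<rightarrow>\<^sub>M count_space UNIV"
 and J: "!!z. z \<in> space \<mu> ==> idx z <= (J::nat)" "!!z. z \<in> space \<nu> ==> idx' z <= J"
 defines "a \<equiv> (%j. measure \<mu> {z \<in> space \<mu>. idx z = j})" and "b \<equiv> (%j. measure \<nu> {z \<in> space \<nu>. idx' z = j})"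
 shows "\<exists>\<pi>. prob_space \<pi> & sets \<pi> = sets (\<mu> \<Otimes>\<^sub>M \<nu>) & distr \<pi> \<mu> fst = \<mu> & distr \<pi> \<nu> snd = \<nu> \<and>
 (\<forall>j\<le>J. emeasure \<pi> {z \<in> space \<pi>. idx (fst z) = j & idx' (snd z) ~= j} <= ennreal \<bar>a j - b j\<bar>) \<and>
 (\<forall>j\<le>J. emeasure \<pi> {z \<in> space \<pi>. idx' (snd z) = j & idx (fst z) ~= j} <= ennreal \<bar>a j - b j\<bar>)"
proof -
 interpret \<mu>: prob_space \<mu> by fact
 interpret \<nu>: prob_space \<nu> by fact
 interpret P: pair_prob_space \<mu> \<nu> ..
 have ea: "emeasure \<mu> {z \<in> space \<mu>. idx z = j} = ennreal (a j)" and eb: "emeasure \<nu> {z \<in> space \<nu>. idx' z = j} = ennreal (b j)" for j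
 unfolding a_def b_def by (rule \<mu>.emeasure_eq_measure \<nu>.emeasure_eq_measure)+
 have nn: "0 <= a j" "0 <= b j" for j by (auto simp: a_def b_def)
 have sa: "(\<Sum>j\<le>J. a j) = 1"
 proof -
 have "ennreal (\<Sum>j\<le>J. a j) = (\<Sum>j\<le>J. 1 * emeasure \<mu> {z \<in> space \<mu>. idx z = j})"
 unfolding ea using nn by (simp add: sum_ennreal)
 also have "\<dots> = (\<integral>\<^sup>+w. 1 \<partial>\<mu>)" by (rule nn_integral_finite_valued[OF idx(1) J(1), symmetric])
 finally show ?thesis by (simp add: \<mu>.emeasure_space_1)
 qed
 have sb: "(\<Sum>j\<le>J. b j) = 1"
 proof -
 have "ennreal (\<Sum>j\<le>J. b j) = (\<Sum>j\<le>J. 1 * emeasure \<nu> {z \<in> space \<nu>. idx' z = j})"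
 unfolding eb using nn by (simp add: sum_ennreal)
 also have "\<dots> = (\<integral>\<^sup>+w. 1 \<partial>\<nu>)" by (rule nn_integral_finite_valued[OF idx(2) J(2), symmetric])
 finally show ?thesis by (simp add: \<nu>.emeasure_space_1)
 qed
 obtain \<theta> where \<theta>: "!!i k. 0 <= \<theta> i k" "!!i. i\<le>J ==> (\<Sum>k\<le>J. \<theta> i k) = a i" "!!k. k\<le>J ==> (\<Sum>i\<le>J. \<theta> i k) = b k"
 "!!i. i\<le>J ==> min (a i) (b i) <= \<theta> i i"
 using ex_coupling_matrix[of a b J, OF nn sa sb] by blast
 have \<theta>a: "\<theta> i k = 0" if "a i = 0" "i <= J" "k <= J" for i k
 using \<theta>(2)[of i] that \<theta>(1) sum_nonneg_eq_0_iff[of "{..J}" "\<theta> i"] by auto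
 have \<theta>b: "\<theta> i k = 0" if "b k = 0" "i <= J" "k <= J" for i k
 using \<theta>(3)[of k] that \<theta>(1) sum_nonneg_eq_0_iff[of "{..J}" "%i. \<theta> i k"] by auto
 \<comment> \<open>Cells of mass zero get density 0 through division by zero. They are null for the
   marginals, which is why \<open>row\<close> and \<open>col\<close> need to give 1 only almost
   everywhere.\<close>
 define D where "D z = ennreal (\<theta> (idx (fst z)) (idx' (snd z)) / (a (idx (fst z)) * b (idx' (snd z))))" for z
 have Dm[measurable]: "D \<in> borel_measurable (\<mu> \<Otimes>\<^sub>M \<nu>)"
 proof -
 have 1: "(%z. (idx (fst z), idx' (snd z))) \<in> \<mu> \<Otimes>\<^sub>M \<nu> \<rightarrow>\<^sub>M count_space UNIV \<Otimes>\<^sub>M count_space UNIV"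
 using idx by measurable
 have "(%(i, k). ennreal (\<theta> i k / (a i * b k))) \<in> borel_measurable (count_space UNIV \<Otimes>\<^sub>M count_space UNIV)"
 by (simp add: pair_measure_countable)
 from measurable_compose[OF 1 this] show ?thesis by (simp add: D_def[abs_def])
 qed
 define \<pi> where "\<pi> = density (\<mu> \<Otimes>\<^sub>M \<nu>) D"
 have int: "(\<integral>\<^sup>+z. f z \<partial>\<pi>) = (\<integral>\<^sup>+z. D z * f z \<partial>(\<mu> \<Otimes>\<^sub>M \<nu>))" if "f \<in> borel_measurable (\<mu> \<Otimes>\<^sub>M \<nu>)" for f
 unfolding \<pi>_def by (rule nn_integral_density) (use that in auto)
 have row: "(\<integral>\<^sup>+w. D (z, w) \<partial>\<nu>) = (if a (idx z) = 0 then 0 else 1)" if z: "z \<in> space \<mu>" for z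
 proof -
 have "(\<integral>\<^sup>+w. D (z, w) \<partial>\<nu>) = (\<Sum>k\<le>J. ennreal (\<theta> (idx z) k / (a (idx z) * b k)) * ennreal (b k))"
 unfolding D_def fst_conv snd_conv eb[symmetric] by (rule nn_integral_finite_valued[OF idx(2) J(2)])
 also have "\<dots> = (\<Sum>k\<le>J. ennreal (\<theta> (idx z) k / a (idx z)))"
 using \<theta>b[OF _ J(1)[OF z]] nn \<theta>(1) by (intro sum.cong) (auto simp: ennreal_mult[symmetric])
 also have "\<dots> = ennreal (\<Sum>k\<le>J. \<theta> (idx z) k / a (idx z))" using nn \<theta>(1) by (intro sum_ennreal) auto
 also have "(\<Sum>k\<le>J. \<theta> (idx z) k / a (idx z)) = a (idx z) / a (idx z)"
 using \<theta>(2)[OF J(1)[OF z]] by (simp add: sum_divide_distrib[symmetric])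
 finally show ?thesis by auto
 qed
 have col: "(\<integral>\<^sup>+z. D (z, w) \<partial>\<mu>) = (if b (idx' w) = 0 then 0 else 1)" if w: "w \<in> space \<nu>" for w
 proof -
 have "(\<integral>\<^sup>+z. D (z, w) \<partial>\<mu>) = (\<Sum>k\<le>J. ennreal (\<theta> k (idx' w) / (a k * b (idx' w))) * ennreal (a k))"
 unfolding D_def fst_conv snd_conv ea[symmetric] by (rule nn_integral_finite_valued[OF idx(1) J(1)])
 also have "\<dots> = (\<Sum>k\<le>J. ennreal (\<theta> k (idx' w) / b (idx' w)))"
 using \<theta>a[OF _ _ J(2)[OF w]] nn \<theta>(1) by (intro sum.cong) (auto simp: ennreal_mult[symmetric])
 also have "\<dots> = ennreal (\<Sum>k\<le>J. \<theta> k (idx' w) / b (idx' w))" using nn \<theta>(1) by (intro sum_ennreal) auto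
 also have "(\<Sum>k\<le>J. \<theta> k (idx' w) / b (idx' w)) = b (idx' w) / b (idx' w)"
 using \<theta>(3)[OF J(2)[OF w]] by (simp add: sum_divide_distrib[symmetric])
 finally show ?thesis by auto
 qed
 have AEa: "AE z in \<mu>. a (idx z) ~= 0"
 proof -
 have "AE z in \<mu>. \<not> (idx z = j & a j = 0)" for j
 proof (cases "a j = 0")
 case True
 hence "{z \<in> space \<mu>. idx z = j} \<in> null_sets \<mu>"
 using ea[of j] measurable_sets[OF idx(1), of "{j}"] by (auto simp: null_sets_def vimage_def Int_def conj_commute)
 thus ?thesis by (rule AE_I') auto
 qed auto
 hence "AE z in \<mu>. \<forall>j. \<not> (idx z = j & a j = 0)" unfolding AE_all_countable by auto
 thus ?thesis by auto
 qed
 have AEb: "AE z in \<nu>. b (idx' z) ~= 0"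
 proof -
 have "AE z in \<nu>. \<not> (idx' z = j & b j = 0)" for j
 proof (cases "b j = 0")
 case True
 hence "{z \<in> space \<nu>. idx' z = j} \<in> null_sets \<nu>"
 using eb[of j] measurable_sets[OF idx(2), of "{j}"] by (auto simp: null_sets_def vimage_def Int_def conj_commute)
 thus ?thesis by (rule AE_I') auto
 qed auto
 hence "AE z in \<nu>. \<forall>j. \<not> (idx' z = j & b j = 0)" unfolding AE_all_countable by auto
 thus ?thesis by auto
 qed
 have int_fst: "(\<integral>\<^sup>+z. f (fst z) \<partial>\<pi>) = (\<integral>\<^sup>+z. f z \<partial>\<mu>)" if f: "f \<in> borel_measurable \<mu>" for f
 proof -
 have fm: "(%z. f (fst z)) \<in> borel_measurable (\<mu> \<Otimes>\<^sub>M \<nu>)" by (rule measurable_compose[OF measurable_fst f])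
 have "(\<integral>\<^sup>+z. f (fst z) \<partial>\<pi>) = (\<integral>\<^sup>+z. \<integral>\<^sup>+w. D (z, w) * f z \<partial>\<nu> \<partial>\<mu>)"
 unfolding int[OF fm] by (subst \<nu>.nn_integral_fst[symmetric]) (use fm in auto)
 also have "\<dots> = (\<integral>\<^sup>+z. f z \<partial>\<mu>)"
 proof (rule nn_integral_cong_AE)
 have "AE z in \<mu>. z \<in> space \<mu>" by (rule AE_space)
 with AEa show "AE z in \<mu>. (\<integral>\<^sup>+w. D (z, w) * f z \<partial>\<nu>) = f z"
 proof eventually_elim
 case (elim z)
 have "(\<integral>\<^sup>+w. D (z, w) * f z \<partial>\<nu>) = (\<integral>\<^sup>+w. D (z, w) \<partial>\<nu>) * f z"
 by (rule nn_integral_multc) (use elim in measurable)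
 thus ?case using row[OF elim(2)] elim(1) by simp
 qed
 qed
 finally show ?thesis .
 qed
 have int_snd: "(\<integral>\<^sup>+z. f (snd z) \<partial>\<pi>) = (\<integral>\<^sup>+z. f z \<partial>\<nu>)" if f: "f \<in> borel_measurable \<nu>" for f
 proof -
 have fm: "(%z. f (snd z)) \<in> borel_measurable (\<mu> \<Otimes>\<^sub>M \<nu>)" by (rule measurable_compose[OF measurable_snd f])
 have "(\<integral>\<^sup>+z. f (snd z) \<partial>\<pi>) = (\<integral>\<^sup>+w. \<integral>\<^sup>+z. D (z, w) * f w \<partial>\<mu> \<partial>\<nu>)"
 unfolding int[OF fm] by (subst P.nn_integral_snd[symmetric]) (use fm in \<open>auto simp: case_prod_unfold\<close>)
 also have "\<dots> = (\<integral>\<^sup>+z. f z \<partial>\<nu>)"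
 proof (rule nn_integral_cong_AE)
 have "AE z in \<nu>. z \<in> space \<nu>" by (rule AE_space)
 with AEb show "AE w in \<nu>. (\<integral>\<^sup>+z. D (z, w) * f w \<partial>\<mu>) = f w"
 proof eventually_elim
 case (elim w)
 have "(\<integral>\<^sup>+z. D (z, w) * f w \<partial>\<mu>) = (\<integral>\<^sup>+z. D (z, w) \<partial>\<mu>) * f w"
 by (rule nn_integral_multc) (use elim in measurable)
 thus ?case using col[OF elim(2)] elim(1) by simp
 qed
 qed
 finally show ?thesis .
 qed
 have sets: "sets \<pi> = sets (\<mu> \<Otimes>\<^sub>M \<nu>)" by (simp add: \<pi>_def)
 have meas: "fst \<in> \<pi> \<rightarrow>\<^sub>M \<mu>" "snd \<in> \<pi> \<rightarrow>\<^sub>M \<nu>" unfolding \<pi>_def by auto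
 have d1: "distr \<pi> \<mu> fst = \<mu>"
 proof (rule measure_eqI)
 fix A assume "A \<in> sets (distr \<pi> \<mu> fst)"
 hence A: "A \<in> sets \<mu>" by simp
 have "emeasure (distr \<pi> \<mu> fst) A = (\<integral>\<^sup>+z. indicator A z \<partial>distr \<pi> \<mu> fst)" using A by simp
 also have "\<dots> = (\<integral>\<^sup>+z. indicator A (fst z) \<partial>\<pi>)" using A by (intro nn_integral_distr meas) simp
 also have "\<dots> = emeasure \<mu> A" using A by (subst int_fst) auto
 finally show "emeasure (distr \<pi> \<mu> fst) A = emeasure \<mu> A" .
 qed simp
 have d2: "distr \<pi> \<nu> snd = \<nu>"
 proof (rule measure_eqI)
 fix A assume "A \<in> sets (distr \<pi> \<nu> snd)"
 hence A: "A \<in> sets \<nu>" by simp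
 have "emeasure (distr \<pi> \<nu> snd) A = (\<integral>\<^sup>+z. indicator A z \<partial>distr \<pi> \<nu> snd)" using A by simp
 also have "\<dots> = (\<integral>\<^sup>+z. indicator A (snd z) \<partial>\<pi>)" using A by (intro nn_integral_distr meas) simp
 also have "\<dots> = emeasure \<nu> A" using A by (subst int_snd) auto
 finally show "emeasure (distr \<pi> \<nu> snd) A = emeasure \<nu> A" .
 qed simp
 have prob: "prob_space \<pi>"
 proof (rule prob_spaceI)
 have "emeasure \<pi> (space \<pi>) = (\<integral>\<^sup>+z. 1 \<partial>\<pi>)" by simp
 also have "\<dots> = (\<integral>\<^sup>+z. 1 \<partial>\<mu>)" by (rule int_fst) simp
 finally show "emeasure \<pi> (space \<pi>) = 1" by (simp add: \<mu>.emeasure_space_1)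
 qed
 interpret \<pi>: prob_space \<pi> by (rule prob)
 have idxm: "(%z. idx (fst z)) \<in> \<pi> \<rightarrow>\<^sub>M count_space UNIV" "(%z. idx' (snd z)) \<in> \<pi> \<rightarrow>\<^sub>M count_space UNIV"
 by (rule measurable_compose[OF meas(1) idx(1)] measurable_compose[OF meas(2) idx(2)])+
 have sp: "space \<pi> = space \<mu> \<times> space \<nu>" by (simp add: \<pi>_def space_pair_measure)
 have [measurable]: "{z \<in> space \<pi>. idx (fst z) = j} \<in> sets \<pi>" "{z \<in> space \<pi>. idx' (snd z) = j} \<in> sets \<pi>" for j
 using measurable_sets[OF idxm(1), of "{j}"] measurable_sets[OF idxm(2), of "{j}"]
 by (auto simp: vimage_def Int_def conj_commute)
 have ma: "measure \<pi> {z \<in> space \<pi>. idx (fst z) = j} = a j" for j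
 proof -
 have "emeasure \<pi> {z \<in> space \<pi>. idx (fst z) = j} = emeasure (distr \<pi> \<mu> fst) {z \<in> space \<mu>. idx z = j}"
 using measurable_sets[OF idx(1), of "{j}"] by (subst emeasure_distr[OF meas(1)]) (auto simp: vimage_def Int_def conj_commute sp intro!: arg_cong[of _ _ "emeasure \<pi>"])
 thus ?thesis unfolding d1 by (simp add: measure_def a_def)
 qed
 have mb: "measure \<pi> {z \<in> space \<pi>. idx' (snd z) = j} = b j" for j
 proof -
 have "emeasure \<pi> {z \<in> space \<pi>. idx' (snd z) = j} = emeasure (distr \<pi> \<nu> snd) {z \<in> space \<nu>. idx' z = j}"
 using measurable_sets[OF idx(2), of "{j}"] by (subst emeasure_distr[OF meas(2)]) (auto simp: vimage_def Int_def conj_commute sp intro!: arg_cong[of _ _ "emeasure \<pi>"])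
 thus ?thesis unfolding d2 by (simp add: measure_def b_def)
 qed
 have diag: "min (a j) (b j) <= measure \<pi> ({z \<in> space \<pi>. idx (fst z) = j} \<inter> {z \<in> space \<pi>. idx' (snd z) = j})"
 if j: "j <= J" for j
 proof -
 let ?A = "{z \<in> space \<mu>. idx z = j}" and ?B = "{z \<in> space \<nu>. idx' z = j}"
 have AB: "?A \<in> sets \<mu>" "?B \<in> sets \<nu>"
 using measurable_sets[OF idx(1), of "{j}"] measurable_sets[OF idx(2), of "{j}"] by (auto simp: vimage_def Int_def conj_commute)
 have eq: "{z \<in> space \<pi>. idx (fst z) = j} \<inter> {z \<in> space \<pi>. idx' (snd z) = j} = ?A \<times> ?B" by (auto simp: sp)
 have "emeasure \<pi> (?A \<times> ?B) = (\<integral>\<^sup>+z. D z * indicator (?A \<times> ?B) z \<partial>(\<mu> \<Otimes>\<^sub>M \<nu>))"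
 unfolding \<pi>_def using AB by (intro emeasure_density) auto
 also have "\<dots> = (\<integral>\<^sup>+z. ennreal (\<theta> j j / (a j * b j)) * indicator (?A \<times> ?B) z \<partial>(\<mu> \<Otimes>\<^sub>M \<nu>))"
 by (intro nn_integral_cong) (auto simp: D_def indicator_def)
 also have "\<dots> = ennreal (\<theta> j j / (a j * b j)) * (ennreal (a j) * ennreal (b j))"
 using AB by (simp add: nn_integral_cmult_indicator \<nu>.emeasure_pair_measure_Times ea eb)
 also have "\<dots> = ennreal (\<theta> j j)"
 using \<theta>a[of j j] \<theta>b[of j j] j nn \<theta>(1) by (cases "a j = 0 \<or> b j = 0") (auto simp: ennreal_mult[symmetric])
 finally have "measure \<pi> (?A \<times> ?B) = \<theta> j j" using \<theta>(1) by (simp add: measure_def)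
 thus ?thesis unfolding eq using \<theta>(4)[OF j] by simp
 qed
 have "emeasure \<pi> {z \<in> space \<pi>. idx (fst z) = j & idx' (snd z) ~= j} <= ennreal \<bar>a j - b j\<bar>" if j: "j <= J" for j
 proof -
 have "measure \<pi> {z \<in> space \<pi>. idx (fst z) = j & idx' (snd z) ~= j} =
 measure \<pi> ({z \<in> space \<pi>. idx (fst z) = j} - {z \<in> space \<pi>. idx' (snd z) = j})"
 by (intro arg_cong[of _ _ "measure \<pi>"]) auto
 also have "\<dots> = a j - measure \<pi> ({z \<in> space \<pi>. idx (fst z) = j} \<inter> {z \<in> space \<pi>. idx' (snd z) = j})"
 by (subst \<pi>.finite_measure_Diff') (auto simp: ma)
 finally show ?thesis using diag[OF j] unfolding \<pi>.emeasure_eq_measure by (intro ennreal_leI) linarith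
 qed
 moreover have "emeasure \<pi> {z \<in> space \<pi>. idx' (snd z) = j & idx (fst z) ~= j} <= ennreal \<bar>a j - b j\<bar>" if j: "j <= J" for j
 proof -
 have "measure \<pi> {z \<in> space \<pi>. idx' (snd z) = j & idx (fst z) ~= j} =
 measure \<pi> ({z \<in> space \<pi>. idx' (snd z) = j} - {z \<in> space \<pi>. idx (fst z) = j})"
 by (intro arg_cong[of _ _ "measure \<pi>"]) auto
 also have "\<dots> = b j - measure \<pi> ({z \<in> space \<pi>. idx (fst z) = j} \<inter> {z \<in> space \<pi>. idx' (snd z) = j})"
 by (subst \<pi>.finite_measure_Diff') (auto simp: mb Int_commute)
 finally show ?thesis using diag[OF j] unfolding \<pi>.emeasure_eq_measure by (intro ennreal_leI) linarith
 qed
 ultimately show ?thesis using prob sets d1 d2 by (intro exI[of _ \<pi>]) blast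
qed

lemma dist_power2_le: "(dist z w)\<^sup>2 <= 2 * (norm z)\<^sup>2 + 2 * (norm w)\<^sup>2" for z w :: "'a::real_normed_vector"
proof -
 have "(dist z w)\<^sup>2 <= (norm z + norm w)\<^sup>2"
 unfolding dist_norm by (intro power_mono norm_triangle_ineq4) auto
 also have "\<dots> <= 2 * (norm z)\<^sup>2 + 2 * (norm w)\<^sup>2"
 using zero_le_power2[of "norm z - norm w"] by (simp add: power2_sum power2_diff)
 finally show ?thesis .
qed

lemma nn_integral_add4:
 assumes "f \<in> borel_measurable M" "g \<in> borel_measurable M" "u \<in> borel_measurable M" "v \<in> borel_measurable M"
 shows "(\<integral>\<^sup>+z. c + (2 * f z + 2 * g z) + u z + v z \<partial>M) =
 (\<integral>\<^sup>+z. c \<partial>M) + (2 * (\<integral>\<^sup>+z. f z \<partial>M) + 2 * (\<integral>\<^sup>+z. g z \<partial>M)) + (\<integral>\<^sup>+z. u z \<partial>M) + (\<integral>\<^sup>+z. v z \<partial>M)"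
 using assms by (simp add: nn_integral_add nn_integral_cmult)

lemma eq_refl_plus: "(a + s) + (b + t) <= e + (a + b) + s + (t :: ennreal)"
proof -
 have "(a + s) + (b + t) = 0 + (a + b) + s + t" by (simp add: ac_simps)
 also have "\<dots> <= e + (a + b) + s + t" by (intro add_mono) auto
 finally show ?thesis .
qed

text \<open>Cells below \<open>J\<close> are small and bounded, cell \<open>J\<close> is the tail.
  Under the coupling of the cells a pair in a common small cell costs at most
  \<open>\<delta>\<^sup>2\<close>. Otherwise the cost is at most twice the sum of the squared norms,
  and each squared norm is charged either to the tail or, through \<open>B\<close>, to the event
  \<open>F1\<close> or \<open>F2\<close> that its cell is mismatched. These events have mass at most
  \<open>\<eta>\<close> each; each of the two points contributes a factor 2, whence both factors
  4.\<close>

lemma wasserstein2_partition_le: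
 fixes \<mu> \<nu> :: "'a::euclidean_space measure"
 assumes \<mu>: "\<mu> \<in> prob_measures E dist" and \<nu>: "\<nu> \<in> prob_measures E dist"
 and idx: "idx \<in> restrict_space borel E \<rightarrow>\<^sub>M count_space UNIV" and J: "!!z. idx z <= (J::nat)"
 and diam: "!!z w. z \<in> E ==> w \<in> E ==> idx z = idx w ==> idx z < J ==> dist z w <= \<delta>"
 and B: "!!z. z \<in> E ==> idx z < J ==> norm z <= B"
 and \<eta>: "!!j. j < J ==> \<bar>measure \<mu> {z \<in> E. idx z = j} - measure \<nu> {z \<in> E. idx z = j}\<bar> <= \<eta>"
 and tail: "(\<integral>\<^sup>+z. ennreal ((norm z)\<^sup>2) * indicator {z. idx z = J} z \<partial>\<mu>) <= ennreal \<epsilon>"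
 "(\<integral>\<^sup>+z. ennreal ((norm z)\<^sup>2) * indicator {z. idx z = J} z \<partial>\<nu>) <= ennreal \<epsilon>"
 and nonneg: "0 <= \<epsilon>" "0 <= \<eta>" "0 <= B"
 shows "wasserstein 2 E dist \<mu> \<nu> <= sqrt (\<delta>\<^sup>2 + 4 * \<epsilon> + 4 * (real J * B\<^sup>2 * \<eta>))"
proof -
 note pm = prob_measuresD[OF \<mu>] prob_measuresD[OF \<nu>]
 have sets: "sets \<mu> = sets (restrict_space borel E)" "sets \<nu> = sets (restrict_space borel E)"
 using pm sets_borel_on_dist[of E] by auto
 have idxm: "idx \<in> \<mu> \<rightarrow>\<^sub>M count_space UNIV" "idx \<in> \<nu> \<rightarrow>\<^sub>M count_space UNIV"
 using idx unfolding measurable_cong_sets[OF sets(1) refl] measurable_cong_sets[OF sets(2) refl] by simp_all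
 have "norm \<in> borel_measurable (restrict_space borel E)" by (intro measurable_restrict_space1) simp
 hence normm: "norm \<in> borel_measurable \<mu>" "norm \<in> borel_measurable \<nu>"
 unfolding measurable_cong_sets[OF sets(1) refl] measurable_cong_sets[OF sets(2) refl] by simp_all
 obtain \<pi> where \<pi>: "prob_space \<pi>" "sets \<pi> = sets (\<mu> \<Otimes>\<^sub>M \<nu>)" "distr \<pi> \<mu> fst = \<mu>" "distr \<pi> \<nu> snd = \<nu>"
 and off: "!!j. j\<le>J ==> emeasure \<pi> {z \<in> space \<pi>. idx (fst z) = j & idx (snd z) ~= j} \<le>
 ennreal \<bar>measure \<mu> {z \<in> space \<mu>. idx z = j} - measure \<nu> {z \<in> space \<nu>. idx z = j}\<bar>"
 "!!j. j\<le>J ==> emeasure \<pi> {z \<in> space \<pi>. idx (snd z) = j & idx (fst z) ~= j} \<le>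
 ennreal \<bar>measure \<mu> {z \<in> space \<mu>. idx z = j} - measure \<nu> {z \<in> space \<nu>. idx z = j}\<bar>"
 using ex_coupling_partition[OF pm(1) pm(4) idxm, of J] J by blast
 have cp: "\<pi> \<in> couplings E dist \<mu> \<nu>"
 proof -
 have "sets (\<mu> \<Otimes>\<^sub>M \<nu>) = sets (borel_on (E \<times> E) (sum_dist dist dist))"
 by (subst sets_borel_on_sum_dist[OF _ _ countable_network_dist countable_network_dist])
 (auto intro!: sets_pair_measure_cong pm)
 thus ?thesis using \<pi> by (simp add: couplings_def prob_measures_def)
 qed
 note meas = measurable_coupling[OF cp zero_le_dist \<mu> \<nu>]
 have sp: "space \<pi> = E \<times> E" using couplingsD(3)[OF cp] .
 define F1 where "F1 j = {z \<in> space \<pi>. idx (fst z) = j & idx (snd z) ~= j}" for j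
 define F2 where "F2 j = {z \<in> space \<pi>. idx (snd z) = j & idx (fst z) ~= j}" for j
 have im: "(%z. idx (fst z)) \<in> \<pi> \<rightarrow>\<^sub>M count_space UNIV" "(%z. idx (snd z)) \<in> \<pi> \<rightarrow>\<^sub>M count_space UNIV"
 by (rule measurable_compose[OF meas(1) idxm(1)] measurable_compose[OF meas(2) idxm(2)])+
 have s1: "{z \<in> space \<pi>. idx (fst z) = j} \<in> sets \<pi>" "{z \<in> space \<pi>. idx (snd z) = j} \<in> sets \<pi>" for j
 using measurable_sets[OF im(1), of "{j}"] measurable_sets[OF im(2), of "{j}"]
 by (auto simp: vimage_def Int_def conj_commute)
 have F: "F1 j \<in> sets \<pi>" "F2 j \<in> sets \<pi>" for j
 proof -
 have "F1 j = {z \<in> space \<pi>. idx (fst z) = j} - {z \<in> space \<pi>. idx (snd z) = j}"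
 "F2 j = {z \<in> space \<pi>. idx (snd z) = j} - {z \<in> space \<pi>. idx (fst z) = j}" by (auto simp: F1_def F2_def)
 thus "F1 j \<in> sets \<pi>" "F2 j \<in> sets \<pi>" by (simp_all add: s1 sets.Diff del: Diff_iff)
 qed
 define h where "h z = ennreal ((norm z)\<^sup>2) * indicator {z. idx z = J} z" for z
 have hm: "h \<in> borel_measurable \<mu>" "h \<in> borel_measurable \<nu>"
 proof -
 have *: "(%z. indicator {z. idx z = J} z :: ennreal) = (%z. indicator {J} (idx z))" by (auto simp: indicator_def)
 have "(%z. indicator {z. idx z = J} z :: ennreal) \<in> borel_measurable \<mu>" "(%z. indicator {z. idx z = J} z :: ennreal) \<in> borel_measurable \<nu>"
 unfolding * by (rule measurable_compose[OF idxm(1)] measurable_compose[OF idxm(2)]; simp)+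
 thus "h \<in> borel_measurable \<mu>" "h \<in> borel_measurable \<nu>"
 unfolding h_def[abs_def] using normm by measurable
 qed
 let ?c = "ennreal (2 * B\<^sup>2)"
 let ?b = "%z. ennreal (\<delta>\<^sup>2) + (2 * h (fst z) + 2 * h (snd z)) + (\<Sum>j<J. ?c * indicator (F1 j) z) + (\<Sum>j<J. ?c * indicator (F2 j) z)"
 have pt: "ennreal (dist (fst z) (snd z) powr 2) <= ?b z" if z: "z \<in> space \<pi>" for z
 proof -
 define x y where "x = fst z" and "y = snd z"
 have "z \<in> E \<times> E" using z unfolding sp .
 hence xy: "x \<in> E" "y \<in> E" unfolding x_def y_def by (simp_all only: mem_Times_iff)
 have e: "dist x y powr 2 = (dist x y)\<^sup>2" by (simp add: powr_numeral)
 have s1: "?c * indicator (F1 (idx x)) z <= (\<Sum>j<J. ?c * indicator (F1 j) z)" if "idx x < J"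
 using that by (intro member_le_sum) auto
 have s2: "?c * indicator (F2 (idx y)) z <= (\<Sum>j<J. ?c * indicator (F2 j) z)" if "idx y < J"
 using that by (intro member_le_sum) auto
 have half1: "ennreal (2 * (norm x)\<^sup>2) <= 2 * h x + (\<Sum>j<J. ?c * indicator (F1 j) z)" if "idx x = J \<or> idx x ~= idx y"
 proof (cases "idx x = J")
 case True
 hence "2 * h x = ennreal (2 * (norm x)\<^sup>2)" by (simp add: h_def ennreal_mult)
 thus ?thesis by simp
 next
 case False
 hence lt: "idx x < J" using J[of x] by simp
 hence "z \<in> F1 (idx x)" using that z by (auto simp: F1_def x_def y_def)
 hence "?c <= (\<Sum>j<J. ?c * indicator (F1 j) z)" using s1[OF lt] by simp
 moreover have "ennreal (2 * (norm x)\<^sup>2) <= ?c" using B[OF xy(1) lt] by (intro ennreal_leI) (simp add: power_mono)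
 ultimately show ?thesis by (intro add_increasing[OF zero_le order_trans])
 qed
 have half2: "ennreal (2 * (norm y)\<^sup>2) <= 2 * h y + (\<Sum>j<J. ?c * indicator (F2 j) z)" if "idx y = J \<or> idx x ~= idx y"
 proof (cases "idx y = J")
 case True
 hence "2 * h y = ennreal (2 * (norm y)\<^sup>2)" by (simp add: h_def ennreal_mult)
 thus ?thesis by simp
 next
 case False
 hence lt: "idx y < J" using J[of y] by simp
 hence "z \<in> F2 (idx y)" using that z by (auto simp: F2_def x_def y_def)
 hence "?c <= (\<Sum>j<J. ?c * indicator (F2 j) z)" using s2[OF lt] by simp
 moreover have "ennreal (2 * (norm y)\<^sup>2) <= ?c" using B[OF xy(2) lt] by (intro ennreal_leI) (simp add: power_mono)
 ultimately show ?thesis by (intro add_increasing[OF zero_le order_trans])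
 qed
 show ?thesis
 proof (cases "idx x = idx y & idx x < J")
 case True
 hence "(dist x y)\<^sup>2 <= \<delta>\<^sup>2" using diam[OF xy] by (intro power_mono) auto
 hence "ennreal (dist x y powr 2) <= ennreal (\<delta>\<^sup>2)" unfolding e by (rule ennreal_leI)
 thus ?thesis unfolding x_def y_def by (simp add: add.assoc add_increasing2)
 next
 case False
 hence c: "idx x = J \<or> idx x ~= idx y" "idx y = J \<or> idx x ~= idx y" using J[of x] by auto
 have "ennreal (dist x y powr 2) <= ennreal (2 * (norm x)\<^sup>2 + 2 * (norm y)\<^sup>2)"
 unfolding e by (intro ennreal_leI dist_power2_le)
 also have "\<dots> = ennreal (2 * (norm x)\<^sup>2) + ennreal (2 * (norm y)\<^sup>2)" by simp
 also have "\<dots> <= (2 * h x + (\<Sum>j<J. ?c * indicator (F1 j) z)) + (2 * h y + (\<Sum>j<J. ?c * indicator (F2 j) z))"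
 by (intro add_mono half1 half2 c)
 also have "\<dots> <= ?b z" unfolding x_def[symmetric] y_def[symmetric] by (rule eq_refl_plus)
 finally show ?thesis unfolding x_def y_def .
 qed
 qed
 have hf: "(%z. h (fst z)) \<in> borel_measurable \<pi>" "(%z. h (snd z)) \<in> borel_measurable \<pi>"
 by (rule measurable_compose[OF meas(1) hm(1)] measurable_compose[OF meas(2) hm(2)])+
 have Fm: "(%z. \<Sum>j<J. ?c * indicator (F1 j) z) \<in> borel_measurable \<pi>" "(%z. \<Sum>j<J. ?c * indicator (F2 j) z) \<in> borel_measurable \<pi>"
 using F by (auto intro!: borel_measurable_sum)
 have Fi: "(\<integral>\<^sup>+z. (\<Sum>j<J. ?c * indicator (Fs j) z) \<partial>\<pi>) <= ennreal (2 * (real J * B\<^sup>2 * \<eta>))"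
 if "Fs = F1 \<or> Fs = F2" for Fs
 proof -
 have Fs: "Fs j \<in> sets \<pi>" for j using that F by auto
 have le: "emeasure \<pi> (Fs j) <= ennreal \<eta>" if "j < J" for j
 using off[of j] \<eta>[OF that] that \<open>Fs = F1 \<or> Fs = F2\<close> pm(3,6)
 by (auto simp: F1_def F2_def intro: order_trans ennreal_leI)
 have "(\<integral>\<^sup>+z. (\<Sum>j<J. ?c * indicator (Fs j) z) \<partial>\<pi>) = (\<Sum>j<J. ?c * emeasure \<pi> (Fs j))"
 using Fs by (subst nn_integral_sum) (auto simp: nn_integral_cmult_indicator)
 also have "\<dots> <= (\<Sum>j<J. ?c * ennreal \<eta>)" by (intro sum_mono mult_left_mono le) auto
 also have "\<dots> = ennreal (2 * (real J * B\<^sup>2 * \<eta>))"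
 using nonneg by (simp add: ennreal_mult[symmetric] ennreal_of_nat_eq_real_of_nat ac_simps)
 finally show ?thesis .
 qed
 have "(\<integral>\<^sup>+z. ennreal (dist (fst z) (snd z) powr 2) \<partial>\<pi>) <= (\<integral>\<^sup>+z. ?b z \<partial>\<pi>)"
 by (rule nn_integral_mono) (rule pt)
 also have "\<dots> = (\<integral>\<^sup>+z. ennreal (\<delta>\<^sup>2) \<partial>\<pi>) + (2 * (\<integral>\<^sup>+z. h (fst z) \<partial>\<pi>) + 2 * (\<integral>\<^sup>+z. h (snd z) \<partial>\<pi>)) +
 (\<integral>\<^sup>+z. (\<Sum>j<J. ?c * indicator (F1 j) z) \<partial>\<pi>) + (\<integral>\<^sup>+z. (\<Sum>j<J. ?c * indicator (F2 j) z) \<partial>\<pi>)"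
 by (rule nn_integral_add4[OF hf Fm])
 also have "\<dots> <= ennreal (\<delta>\<^sup>2) + (2 * ennreal \<epsilon> + 2 * ennreal \<epsilon>) + ennreal (2 * (real J * B\<^sup>2 * \<eta>)) + ennreal (2 * (real J * B\<^sup>2 * \<eta>))"
 proof (intro add_mono mult_left_mono Fi)
 show "(\<integral>\<^sup>+z. ennreal (\<delta>\<^sup>2) \<partial>\<pi>) <= ennreal (\<delta>\<^sup>2)" using \<pi>(1) by (simp add: prob_space.emeasure_space_1)
 show "(\<integral>\<^sup>+z. h (fst z) \<partial>\<pi>) <= ennreal \<epsilon>"
 unfolding nn_integral_coupling(1)[OF cp zero_le_dist \<mu> \<nu> hm(1)] using tail(1) unfolding h_def .
 show "(\<integral>\<^sup>+z. h (snd z) \<partial>\<pi>) <= ennreal \<epsilon>"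
 unfolding nn_integral_coupling(2)[OF cp zero_le_dist \<mu> \<nu> hm(2)] using tail(2) unfolding h_def .
 qed auto
 also have "\<dots> = ennreal (\<delta>\<^sup>2 + (2 * \<epsilon> + 2 * \<epsilon>) + 2 * (real J * B\<^sup>2 * \<eta>) + 2 * (real J * B\<^sup>2 * \<eta>))"
 proof -
 have e2: "2 * ennreal \<epsilon> = ennreal (2 * \<epsilon>)" using nonneg by (simp add: ennreal_mult)
 have K: "0 <= 2 * (real J * B\<^sup>2 * \<eta>)" using nonneg by simp
 show ?thesis unfolding e2 using nonneg K
 by (simp only: ennreal_plus[symmetric] add_nonneg_nonneg mult_nonneg_nonneg zero_le_power2 zero_le_numeral)
 qed
 also have "\<delta>\<^sup>2 + (2 * \<epsilon> + 2 * \<epsilon>) + 2 * (real J * B\<^sup>2 * \<eta>) + 2 * (real J * B\<^sup>2 * \<eta>) = \<delta>\<^sup>2 + 4 * \<epsilon> + 4 * (real J * B\<^sup>2 * \<eta>)" by simp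
 finally show ?thesis by (rule wasserstein2_le[OF cp]) (use nonneg in \<open>auto intro!: add_nonneg_nonneg mult_nonneg_nonneg\<close>)
qed

section \<open>Relaxed controls\<close>

text \<open>The distances under an integral are not known to be measurable; only \<open>f\<close> and \<open>g\<close> are.\<close>

lemma nn_integral_le_add_nonmeasurable:
 assumes f: "f \<in> borel_measurable M" and g: "g \<in> borel_measurable M" and "k > 0" and nn: "!!x. x \<in> space M ==> 0 <= g x"
 and le: "!!x. x \<in> space M ==> ennreal (f x) <= ennreal (g x) + ennreal k * c x"
 shows "(\<integral>\<^sup>+x. ennreal (f x) \<partial>M) <= (\<integral>\<^sup>+x. ennreal (g x) \<partial>M) + ennreal k * (\<integral>\<^sup>+x. c x \<partial>M)"
proof -
 \<comment> \<open>\<open>nn_integral\<close> is a supremum over simple functions below its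
   argument: always monotone, but additive for measurable functions only. So \<open>c\<close> is
   replaced by the measurable lower bound \<open>?h\<close>, which carries the whole excess of
   \<open>f\<close> over \<open>g\<close>.\<close>
 let ?h = "%x. max 0 ((f x - g x) / k)"
 have h: "ennreal (?h x) <= c x" if x: "x \<in> space M" for x
 proof (cases "c x")
 case (real c0)
 hence "ennreal (f x) <= ennreal (g x + k * c0)"
 using le[OF x] nn[OF x] \<open>k > 0\<close> by (simp add: ennreal_mult)
 moreover have "0 <= g x + k * c0" using real nn[OF x] \<open>k > 0\<close> by simp
 ultimately have "f x <= g x + k * c0" by (simp only: ennreal_le_iff)
 hence "?h x <= c0" using real \<open>k > 0\<close> by (simp add: field_simps)
 thus ?thesis unfolding real by (rule ennreal_leI)
 qed simp
 have "(\<integral>\<^sup>+x. ennreal (f x) \<partial>M) <= (\<integral>\<^sup>+x. ennreal (g x) + ennreal k * ennreal (?h x) \<partial>M)"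
 proof (rule nn_integral_mono)
 fix x assume x: "x \<in> space M"
 have "f x <= g x + k * ?h x" using \<open>k > 0\<close> by (simp add: max_def field_simps)
 hence "ennreal (f x) <= ennreal (g x + k * ?h x)" by (rule ennreal_leI)
 also have "\<dots> = ennreal (g x) + ennreal k * ennreal (?h x)"
 using nn[OF x] \<open>k > 0\<close> by (subst ennreal_mult[symmetric]) (auto intro!: ennreal_plus mult_nonneg_nonneg)
 finally show "ennreal (f x) <= ennreal (g x) + ennreal k * ennreal (?h x)" .
 qed
 also have "\<dots> = (\<integral>\<^sup>+x. ennreal (g x) \<partial>M) + ennreal k * (\<integral>\<^sup>+x. ennreal (?h x) \<partial>M)"
 using f g by (simp add: nn_integral_add nn_integral_cmult)
 also have "(\<integral>\<^sup>+x. ennreal (?h x) \<partial>M) <= (\<integral>\<^sup>+x. c x \<partial>M)" by (rule nn_integral_mono) (rule h)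
 finally show ?thesis by (simp add: add_left_mono mult_left_mono)
qed

text \<open>Jensen's inequality for the square, obtained from nonnegativity of the variance.\<close>

lemma (in prob_space) integral_power2_le:
 fixes X :: "'a => real"
 assumes X: "X \<in> borel_measurable M" and b: "!!x. x \<in> space M ==> \<bar>X x\<bar> <= K"
 shows "ennreal ((\<integral>x. X x \<partial>M)\<^sup>2) <= (\<integral>\<^sup>+x. ennreal ((X x)\<^sup>2) \<partial>M)"
proof -
 have i: "integrable M X" using b X by (intro integrable_const_bound[of _ K]) auto
 have "0 <= K \<or> space M = {}" using b by (metis abs_ge_zero equals0I order_trans)
 hence i2: "integrable M (%x. (X x)\<^sup>2)"
 using b X by (intro integrable_const_bound[of _ "K\<^sup>2"])
 (auto simp: power_abs intro!: AE_I2 power_mono abs_le_square_iff[THEN iffD1] order_trans[OF _ abs_ge_self])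
 have "0 <= variance X" by (rule variance_positive)
 hence "(\<integral>x. X x \<partial>M)\<^sup>2 <= (\<integral>x. (X x)\<^sup>2 \<partial>M)" by (simp add: variance_eq[OF i i2])
 hence "ennreal ((\<integral>x. X x \<partial>M)\<^sup>2) <= ennreal (\<integral>x. (X x)\<^sup>2 \<partial>M)" by (rule ennreal_leI)
 also have "\<dots> = (\<integral>\<^sup>+x. ennreal ((X x)\<^sup>2) \<partial>M)" by (rule nn_integral_eq_integral[symmetric, OF i2]) simp
 finally show ?thesis .
qed

definition normalized :: "real => 'a measure => 'a measure" where
 "normalized T q = scale_measure (ennreal (1 / T)) q"

text \<open>The norm is that of the pair of time and control: the second moment about the origin of
  the space in which the Wasserstein distance of controls is formed.\<close>

definition control_moment :: "real => 'a::real_normed_vector measure => real" where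
 "control_moment T q = enn2real (\<integral>\<^sup>+z. ennreal ((norm z)\<^sup>2) \<partial>normalized T q)"

lemma controls_dist_eq: "controls_dist T U q q' = wasserstein 2 ({0..T} \<times> U) dist (normalized T q) (normalized T q')"
 by (simp add: controls_dist_def normalized_def)

locale control_kernel =
 fixes T p :: real and U :: "'b::euclidean_space set"
 and \<kappa> :: "(real \<times> 'b) measure => real => 'b measure"
 assumes T: "T > 0" and p: "p > 2" and disint: "disintegration T U p \<kappa>"
begin

abbreviation "E \<equiv> {0..T} \<times> U"
abbreviation "BE \<equiv> restrict_space (borel :: (real \<times> 'b) measure) E"
abbreviation "BU \<equiv> restrict_space (borel :: 'b measure) U"
abbreviation "BC \<equiv> borel_on (controls T U p) (controls_dist T U)"

lemma controls_sets: "q \<in> controls T U p ==> sets q = sets BE"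
 by (simp add: controls_def)

lemma controls_space: "q \<in> controls T U p ==> space q = E"
 using sets_eq_imp_space_eq[OF controls_sets] by (simp add: space_restrict_space)

lemma controls_measurable: "q \<in> controls T U p ==> f \<in> BE \<rightarrow>\<^sub>M N ==> f \<in> q \<rightarrow>\<^sub>M N"
 using measurable_cong_sets[OF controls_sets refl] by auto

lemma controls_emeasure_space: assumes q: "q \<in> controls T U p" shows "emeasure q E = ennreal T"
proof -
 have "fst \<in> borel_measurable BE" by (intro measurable_restrict_space1 borel_measurable_continuous_onI continuous_intros)
 hence "fst \<in> BE \<rightarrow>\<^sub>M leb T"
 unfolding leb_def by (intro measurable_restrict_space2) (auto simp: space_restrict_space measurable_lborel1)
 hence m: "fst \<in> q \<rightarrow>\<^sub>M leb T" by (rule controls_measurable[OF q])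
 have "emeasure (distr q (leb T) fst) {0..T} = emeasure q (fst -` {0..T} \<inter> space q)"
 using sets.top[of "leb T"] by (intro emeasure_distr m) simp
 also have "fst -` {0..T} \<inter> space q = E" by (auto simp: controls_space[OF q])
 finally show ?thesis using q T emeasure_leb[of T] by (simp add: controls_def)
qed

lemma normalized_prob: assumes q: "q \<in> controls T U p" shows "normalized T q \<in> prob_measures E dist"
proof -
 have "ennreal (1 / T) * ennreal T = 1" using T by (simp add: ennreal_mult[symmetric])
 hence "prob_space (normalized T q)"
 by (intro prob_spaceI) (simp add: normalized_def space_scale_measure controls_space[OF q] controls_emeasure_space[OF q])
 thus ?thesis using controls_sets[OF q] by (simp add: prob_measures_def normalized_def sets_borel_on_dist)
qed

lemma normalized_sets: "q \<in> controls T U p ==> sets (normalized T q) = sets BE"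
 by (simp add: normalized_def controls_sets)

lemma normalized_measurable: "q \<in> controls T U p ==> f \<in> BE \<rightarrow>\<^sub>M N ==> f \<in> normalized T q \<rightarrow>\<^sub>M N"
 using measurable_cong_sets[OF normalized_sets refl] by auto

lemma normalized_space: "q \<in> controls T U p ==> space (normalized T q) = E"
 using sets_eq_imp_space_eq[OF normalized_sets] by (simp add: space_restrict_space)

lemma nn_integral_normalized:
 assumes q: "q \<in> controls T U p" and f: "f \<in> borel_measurable BE"
 shows "(\<integral>\<^sup>+z. f z \<partial>normalized T q) = ennreal (1 / T) * (\<integral>\<^sup>+z. f z \<partial>q)"
 unfolding normalized_def by (rule nn_integral_scale_measure[OF controls_measurable[OF q f]])

lemma integral_normalized:
 fixes f :: "real \<times> 'b => real"
 assumes q: "q \<in> controls T U p" and f: "f \<in> borel_measurable BE"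
 shows "(\<integral>z. f z \<partial>q) = T * (\<integral>z. f z \<partial>normalized T q)"
proof -
 have "normalized T q = density q (%_. ennreal (1 / T))"
 by (rule measure_eqI) (auto simp: normalized_def emeasure_density_const)
 hence "(\<integral>z. f z \<partial>normalized T q) = (\<integral>z. (1 / T) *\<^sub>R f z \<partial>q)"
 using T integral_density[OF controls_measurable[OF q f], of "%_. 1 / T"] by simp
 thus ?thesis using T by simp
qed

lemma measurable_norm_BE: "(%z. (norm z)\<^sup>2) \<in> borel_measurable BE" "(%z. norm z) \<in> borel_measurable BE"
 "(%z. norm (snd z)) \<in> borel_measurable BE"
 by (intro measurable_restrict_space1 borel_measurable_continuous_onI continuous_intros)+

text \<open>\<open>p > 2\<close> enters here: the squared norm of the control is at most 1 plus its
  \<open>p\<close>-th power, while time is bounded by \<open>T\<close>.\<close>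

lemma moment_finite: assumes q: "q \<in> controls T U p" shows "(\<integral>\<^sup>+z. ennreal ((norm z)\<^sup>2) \<partial>normalized T q) < \<infinity>"
proof -
 have le: "ennreal ((norm z)\<^sup>2) <= ennreal (T\<^sup>2 + 1) + ennreal (norm (snd z) powr p)" if z: "z \<in> E" for z
 proof -
 have "(norm z)\<^sup>2 = (fst z)\<^sup>2 + (norm (snd z))\<^sup>2" by (cases z) (simp add: norm_Pair)
 moreover have "(fst z)\<^sup>2 <= T\<^sup>2" using z by (auto intro!: power_mono)
 moreover have "(norm (snd z))\<^sup>2 <= 1 + norm (snd z) powr p"
 proof (cases "norm (snd z) <= 1")
 case True
 hence "(norm (snd z))\<^sup>2 <= 1" by (simp add: power_le_one)
 thus ?thesis by (rule order_trans) simp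
 next
 case False
 hence "norm (snd z) powr 2 <= norm (snd z) powr p" using p by (intro powr_mono) auto
 thus ?thesis using False by (simp add: powr_numeral)
 qed
 ultimately have "(norm z)\<^sup>2 <= (T\<^sup>2 + 1) + norm (snd z) powr p" by linarith
 hence "ennreal ((norm z)\<^sup>2) <= ennreal ((T\<^sup>2 + 1) + norm (snd z) powr p)" by (rule ennreal_leI)
 thus ?thesis by (subst (asm) ennreal_plus) auto
 qed
 have "(\<integral>\<^sup>+z. ennreal ((norm z)\<^sup>2) \<partial>q) <= (\<integral>\<^sup>+z. ennreal (T\<^sup>2 + 1) + ennreal (norm (snd z) powr p) \<partial>q)"
 using le by (intro nn_integral_mono) (simp add: controls_space[OF q])
 also have "\<dots> = ennreal (T\<^sup>2 + 1) * emeasure q E + (\<integral>\<^sup>+z. ennreal (norm (snd z) powr p) \<partial>q)"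
 using controls_measurable[OF q measurable_norm_BE(3)] by (subst nn_integral_add) (auto simp: controls_space[OF q])
 also have "\<dots> < \<infinity>" using q by (auto simp: controls_emeasure_space[OF q] controls_def ennreal_mult_less_top)
 finally show ?thesis unfolding nn_integral_normalized[OF q measurable_compose[OF measurable_norm_BE(1) measurable_ennreal]]
 by (simp add: ennreal_mult_less_top)
qed

lemma control_moment: "q \<in> controls T U p ==> (\<integral>\<^sup>+z. ennreal ((norm z)\<^sup>2) \<partial>normalized T q) = ennreal (control_moment T q)"
 using moment_finite by (simp add: control_moment_def)

lemma control_moment_nonneg: "0 <= control_moment T q"
 by (simp add: control_moment_def)

subsection \<open>The distance of controls\<close>

text \<open>The product coupling, whose cost the second moments bound. It is the finite-cost
  coupling that \<open>ex_coupling_cost_less\<close> asks for.\<close>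

lemma ex_controls_coupling:
 assumes q: "q \<in> controls T U p" and q': "q' \<in> controls T U p"
 shows "\<exists>\<pi>\<in>couplings E dist (normalized T q) (normalized T q').
 (\<integral>\<^sup>+z. ennreal (dist (fst z) (snd z) powr 2) \<partial>\<pi>) <= ennreal (2 * control_moment T q + 2 * control_moment T q')"
proof -
 let ?\<pi> = "normalized T q \<Otimes>\<^sub>M normalized T q'"
 note P = normalized_prob[OF q] normalized_prob[OF q']
 have cp: "?\<pi> \<in> couplings E dist (normalized T q) (normalized T q')"
 by (rule couplings_pair_measure[OF countable_network_dist zero_le_dist P])
 note nm = normalized_measurable[OF q measurable_norm_BE(1)] normalized_measurable[OF q' measurable_norm_BE(1)]
 have "(\<integral>\<^sup>+z. ennreal (dist (fst z) (snd z) powr 2) \<partial>?\<pi>) <= (\<integral>\<^sup>+z. ennreal 2 * ennreal ((norm (fst z))\<^sup>2) + ennreal 2 * ennreal ((norm (snd z))\<^sup>2) \<partial>?\<pi>)"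
 proof (rule nn_integral_mono)
 fix z
 have "ennreal (dist (fst z) (snd z) powr 2) <= ennreal (2 * (norm (fst z))\<^sup>2 + 2 * (norm (snd z))\<^sup>2)"
 using dist_power2_le[of "fst z" "snd z"] by (intro ennreal_leI) (simp add: powr_numeral)
 also have "\<dots> = ennreal 2 * ennreal ((norm (fst z))\<^sup>2) + ennreal 2 * ennreal ((norm (snd z))\<^sup>2)"
 by (simp only: ennreal_plus ennreal_mult zero_le_numeral zero_le_power2 mult_nonneg_nonneg)
 finally show "ennreal (dist (fst z) (snd z) powr 2) <= ennreal 2 * ennreal ((norm (fst z))\<^sup>2) + ennreal 2 * ennreal ((norm (snd z))\<^sup>2)" .
 qed
 also have "\<dots> = ennreal 2 * (\<integral>\<^sup>+z. ennreal ((norm (fst z))\<^sup>2) \<partial>?\<pi>) + ennreal 2 * (\<integral>\<^sup>+z. ennreal ((norm (snd z))\<^sup>2) \<partial>?\<pi>)"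
 proof -
 have m: "(%z. ennreal ((norm (fst z))\<^sup>2)) \<in> borel_measurable ?\<pi>" "(%z. ennreal ((norm (snd z))\<^sup>2)) \<in> borel_measurable ?\<pi>"
 by (rule measurable_compose[OF measurable_compose[OF measurable_fst nm(1)] measurable_ennreal]
 measurable_compose[OF measurable_compose[OF measurable_snd nm(2)] measurable_ennreal])+
 show ?thesis using m by (simp add: nn_integral_add nn_integral_cmult)
 qed
 also have "(\<integral>\<^sup>+z. ennreal ((norm (fst z))\<^sup>2) \<partial>?\<pi>) = ennreal (control_moment T q)"
 using nn_integral_coupling(1)[OF cp zero_le_dist P measurable_compose[OF nm(1) measurable_ennreal]] control_moment[OF q] by simp
 also have "(\<integral>\<^sup>+z. ennreal ((norm (snd z))\<^sup>2) \<partial>?\<pi>) = ennreal (control_moment T q')"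
 using nn_integral_coupling(2)[OF cp zero_le_dist P measurable_compose[OF nm(2) measurable_ennreal]] control_moment[OF q'] by simp
 also have "ennreal 2 * ennreal (control_moment T q) + ennreal 2 * ennreal (control_moment T q') =
 ennreal (2 * control_moment T q + 2 * control_moment T q')"
 by (simp only: ennreal_plus ennreal_mult zero_le_numeral control_moment_nonneg mult_nonneg_nonneg)
 finally show ?thesis using cp by blast
qed

lemma controls_dist_le:
 assumes q: "q \<in> controls T U p" and q': "q' \<in> controls T U p"
 shows "controls_dist T U q q' <= sqrt (2 * control_moment T q + 2 * control_moment T q')"
proof -
 obtain \<pi> where \<pi>: "\<pi>\<in>couplings E dist (normalized T q) (normalized T q')"
 "(\<integral>\<^sup>+z. ennreal (dist (fst z) (snd z) powr 2) \<partial>\<pi>) <= ennreal (2 * control_moment T q + 2 * control_moment T q')"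
 using ex_controls_coupling[OF q q'] by blast
 show ?thesis unfolding controls_dist_eq
 by (rule wasserstein2_le[OF \<pi>]) (simp add: control_moment_nonneg)
qed

lemma ex_controls_coupling_less:
 assumes q: "q \<in> controls T U p" and q': "q' \<in> controls T U p" and r: "controls_dist T U q q' < r"
 shows "\<exists>\<pi>\<in>couplings E dist (normalized T q) (normalized T q').
 (\<integral>\<^sup>+z. ennreal (dist (fst z) (snd z) powr 2) \<partial>\<pi>) < ennreal (r\<^sup>2)"
proof -
 obtain \<pi> where \<pi>: "\<pi>\<in>couplings E dist (normalized T q) (normalized T q')"
 "(\<integral>\<^sup>+z. ennreal (dist (fst z) (snd z) powr 2) \<partial>\<pi>) <= ennreal (2 * control_moment T q + 2 * control_moment T q')"
 using ex_controls_coupling[OF q q'] by blast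
 have "(\<integral>\<^sup>+z. ennreal (dist (fst z) (snd z) powr 2) \<partial>\<pi>) < \<infinity>" using \<pi>(2) by (rule le_less_trans) simp
 from ex_coupling_cost_less[OF \<pi>(1) this r[unfolded controls_dist_eq]] show ?thesis .
qed

lemma controls_dist_nonneg: "0 <= controls_dist T U q q'"
 by (simp add: controls_dist_eq wasserstein_nonneg)

lemma ennreal_le_plusD: "ennreal a <= ennreal b + ennreal c ==> 0 <= b ==> 0 <= c ==> a <= b + c"
 by (simp add: ennreal_plus[symmetric] ennreal_le_iff del: ennreal_plus)

text \<open>Couplings are only nearly optimal, so bounds are obtained for every \<open>r\<close>
  above the distance and carried to the distance itself by right-continuity.\<close>

lemma le_if_le_all_greater:
 fixes a d :: real assumes "!!r. r > d ==> a <= g r" "(g \<longlongrightarrow> g d) (at_right d)" shows "a <= g d"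
proof (rule tendsto_lowerbound[OF assms(2)])
 show "\<forall>\<^sub>F r in at_right d. a <= g r" using assms(1) by (auto simp: eventually_at_right_field intro: exI[of _ "d + 1"])
qed simp

text \<open>The bound \<open>(norm x)\<^sup>2 \<le> 2 * (norm y)\<^sup>2 + 2 * (dist x
  y)\<^sup>2\<close>, integrated against a nearly optimal coupling in both directions.\<close>

lemma control_moment_le:
 assumes q: "q \<in> controls T U p" and q': "q' \<in> controls T U p"
 shows "control_moment T q <= 2 * control_moment T q' + 2 * (controls_dist T U q q')\<^sup>2"
 "control_moment T q' <= 2 * control_moment T q + 2 * (controls_dist T U q q')\<^sup>2"
proof -
 note P = normalized_prob[OF q] normalized_prob[OF q']
 have *: "control_moment T q <= 2 * control_moment T q' + 2 * r\<^sup>2 & control_moment T q' <= 2 * control_moment T q + 2 * r\<^sup>2"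
 if r: "controls_dist T U q q' < r" for r
 proof -
 obtain \<pi> where cp: "\<pi>\<in>couplings E dist (normalized T q) (normalized T q')" and
 cost: "(\<integral>\<^sup>+z. ennreal (dist (fst z) (snd z) powr 2) \<partial>\<pi>) < ennreal (r\<^sup>2)"
 using ex_controls_coupling_less[OF q q' r] by blast
 note nm = normalized_measurable[OF q measurable_norm_BE(1)] normalized_measurable[OF q' measurable_norm_BE(1)]
 note mc = measurable_coupling[OF cp zero_le_dist P]
 have m: "(%z. (norm (fst z))\<^sup>2) \<in> borel_measurable \<pi>" "(%z. (norm (snd z))\<^sup>2) \<in> borel_measurable \<pi>"
 by (rule measurable_compose[OF mc(1) nm(1)] measurable_compose[OF mc(2) nm(2)])+
 have m2: "(%z. 2 * (norm (fst z))\<^sup>2) \<in> borel_measurable \<pi>" "(%z. 2 * (norm (snd z))\<^sup>2) \<in> borel_measurable \<pi>"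
 using m by auto
 have i: "(\<integral>\<^sup>+z. ennreal ((norm (fst z))\<^sup>2) \<partial>\<pi>) = ennreal (control_moment T q)"
 "(\<integral>\<^sup>+z. ennreal ((norm (snd z))\<^sup>2) \<partial>\<pi>) = ennreal (control_moment T q')"
 using nn_integral_coupling(1)[OF cp zero_le_dist P measurable_compose[OF nm(1) measurable_ennreal]] control_moment[OF q]
 nn_integral_coupling(2)[OF cp zero_le_dist P measurable_compose[OF nm(2) measurable_ennreal]] control_moment[OF q'] by simp_all
 have i2: "(\<integral>\<^sup>+z. ennreal (2 * (norm (fst z))\<^sup>2) \<partial>\<pi>) = ennreal (2 * control_moment T q)"
 "(\<integral>\<^sup>+z. ennreal (2 * (norm (snd z))\<^sup>2) \<partial>\<pi>) = ennreal (2 * control_moment T q')"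
 using m i by (simp_all add: ennreal_mult nn_integral_cmult control_moment_nonneg)
 have le: "ennreal ((norm x)\<^sup>2) <= ennreal (2 * (norm y)\<^sup>2) + ennreal 2 * ennreal (dist x y powr 2)"
 "ennreal ((norm y)\<^sup>2) <= ennreal (2 * (norm x)\<^sup>2) + ennreal 2 * ennreal (dist x y powr 2)" for x y :: "real \<times> 'b"
 proof -
 have "(norm x)\<^sup>2 <= 2 * (norm y)\<^sup>2 + 2 * (dist x y)\<^sup>2"
 using dist_power2_le[of "x - y" "- y"] by (simp add: dist_norm algebra_simps)
 hence "ennreal ((norm x)\<^sup>2) <= ennreal (2 * (norm y)\<^sup>2 + 2 * (dist x y)\<^sup>2)" by (rule ennreal_leI)
 also have "\<dots> = ennreal (2 * (norm y)\<^sup>2) + ennreal 2 * ennreal (dist x y powr 2)"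
 by (simp add: powr_numeral ennreal_mult)
 finally show "ennreal ((norm x)\<^sup>2) <= ennreal (2 * (norm y)\<^sup>2) + ennreal 2 * ennreal (dist x y powr 2)" .
 have "(norm y)\<^sup>2 <= 2 * (norm x)\<^sup>2 + 2 * (dist x y)\<^sup>2"
 using dist_power2_le[of "y - x" "- x"] by (simp add: dist_norm norm_minus_commute algebra_simps)
 hence "ennreal ((norm y)\<^sup>2) <= ennreal (2 * (norm x)\<^sup>2 + 2 * (dist x y)\<^sup>2)" by (rule ennreal_leI)
 also have "\<dots> = ennreal (2 * (norm x)\<^sup>2) + ennreal 2 * ennreal (dist x y powr 2)"
 by (simp add: powr_numeral ennreal_mult)
 finally show "ennreal ((norm y)\<^sup>2) <= ennreal (2 * (norm x)\<^sup>2) + ennreal 2 * ennreal (dist x y powr 2)" .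
 qed
 have c2: "ennreal 2 * (\<integral>\<^sup>+z. ennreal (dist (fst z) (snd z) powr 2) \<partial>\<pi>) <= ennreal (2 * r\<^sup>2)"
 using mult_left_mono[OF less_imp_le[OF cost], of "ennreal 2"] by (simp add: ennreal_mult)
 have "(\<integral>\<^sup>+z. ennreal ((norm (fst z))\<^sup>2) \<partial>\<pi>) <= (\<integral>\<^sup>+z. ennreal (2 * (norm (snd z))\<^sup>2) \<partial>\<pi>) + ennreal 2 * (\<integral>\<^sup>+z. ennreal (dist (fst z) (snd z) powr 2) \<partial>\<pi>)"
 by (rule nn_integral_le_add_nonmeasurable[OF m(1) m2(2) _ _ le(1)]) auto
 also have "\<dots> <= ennreal (2 * control_moment T q') + ennreal (2 * r\<^sup>2)" unfolding i2 by (rule add_left_mono[OF c2])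
 finally have 1: "control_moment T q <= 2 * control_moment T q' + 2 * r\<^sup>2"
 unfolding i by (rule ennreal_le_plusD) (simp_all add: control_moment_nonneg)
 have "(\<integral>\<^sup>+z. ennreal ((norm (snd z))\<^sup>2) \<partial>\<pi>) <= (\<integral>\<^sup>+z. ennreal (2 * (norm (fst z))\<^sup>2) \<partial>\<pi>) + ennreal 2 * (\<integral>\<^sup>+z. ennreal (dist (fst z) (snd z) powr 2) \<partial>\<pi>)"
 by (rule nn_integral_le_add_nonmeasurable[OF m(2) m2(1) _ _ le(2)]) auto
 also have "\<dots> <= ennreal (2 * control_moment T q) + ennreal (2 * r\<^sup>2)" unfolding i2 by (rule add_left_mono[OF c2])
 finally have 2: "control_moment T q' <= 2 * control_moment T q + 2 * r\<^sup>2"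
 unfolding i by (rule ennreal_le_plusD) (simp_all add: control_moment_nonneg)
 show ?thesis using 1 2 by simp
 qed
 show "control_moment T q <= 2 * control_moment T q' + 2 * (controls_dist T U q q')\<^sup>2"
 by (rule le_if_le_all_greater[where g="%r. 2 * control_moment T q' + 2 * r\<^sup>2"]) (use * in \<open>auto intro!: tendsto_intros\<close>)
 show "control_moment T q' <= 2 * control_moment T q + 2 * (controls_dist T U q q')\<^sup>2"
 by (rule le_if_le_all_greater[where g="%r. 2 * control_moment T q + 2 * r\<^sup>2"]) (use * in \<open>auto intro!: tendsto_intros\<close>)
qed

text \<open>The Kantorovich bound through a nearly optimal coupling; Jensen passes from the first to
  the second power of the distance, and the factor \<open>T\<close> undoes the
  normalization.\<close>

lemma controls_integral_lipschitz:
 fixes g :: "real \<times> 'b => real"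
 assumes q: "q \<in> controls T U p" and q': "q' \<in> controls T U p"
 and g: "g \<in> borel_measurable BE" and K: "!!z. z \<in> E ==> \<bar>g z\<bar> <= K"
 and L: "L > 0" "!!z w. z \<in> E ==> w \<in> E ==> \<bar>g z - g w\<bar> <= L * dist z w"
 shows "\<bar>(\<integral>z. g z \<partial>q) - (\<integral>z. g z \<partial>q')\<bar> <= T * L * controls_dist T U q q'"
proof -
 note P = normalized_prob[OF q] normalized_prob[OF q']
 interpret q: prob_space "normalized T q" using prob_measuresD(1)[OF P(1)] .
 interpret q': prob_space "normalized T q'" using prob_measuresD(1)[OF P(2)] .
 note gm = normalized_measurable[OF q g] normalized_measurable[OF q' g]
 have *: "\<bar>(\<integral>z. g z \<partial>normalized T q) - (\<integral>z. g z \<partial>normalized T q')\<bar> <= L * r" if r: "controls_dist T U q q' < r" for r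
 proof -
 obtain \<pi> where cp: "\<pi>\<in>couplings E dist (normalized T q) (normalized T q')" and
 cost: "(\<integral>\<^sup>+z. ennreal (dist (fst z) (snd z) powr 2) \<partial>\<pi>) < ennreal (r\<^sup>2)"
 using ex_controls_coupling_less[OF q q' r] by blast
 interpret \<pi>: prob_space \<pi> using couplingsD(1)[OF cp] .
 note mc = measurable_coupling[OF cp zero_le_dist P]
 have sp: "space \<pi> = E \<times> E" by (rule couplingsD(3)[OF cp])
 have m: "(%z. g (fst z)) \<in> borel_measurable \<pi>" "(%z. g (snd z)) \<in> borel_measurable \<pi>"
 by (rule measurable_compose[OF mc(1) gm(1)] measurable_compose[OF mc(2) gm(2)])+
 have bd: "\<bar>g (fst z)\<bar> <= K" "\<bar>g (snd z)\<bar> <= K" if "z \<in> space \<pi>" for z using that K by (auto simp: sp)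
 have int: "integrable \<pi> (%z. g (fst z))" "integrable \<pi> (%z. g (snd z))"
 using m bd by (auto intro!: \<pi>.integrable_const_bound[of _ K])
 have e1: "(\<integral>z. g (fst z) \<partial>\<pi>) = (\<integral>z. g z \<partial>normalized T q)"
 using integral_distr[OF mc(1) gm(1)] couplingsD(4)[OF cp] by simp
 have e2: "(\<integral>z. g (snd z) \<partial>\<pi>) = (\<integral>z. g z \<partial>normalized T q')"
 using integral_distr[OF mc(2) gm(2)] couplingsD(5)[OF cp] by simp
 \<comment> \<open>Dividing by \<open>L\<close> bounds the increment by the distance itself, so its
   square lies below the cost integrand.\<close>
 let ?X = "%z. (g (fst z) - g (snd z)) / L"
 have Xm: "?X \<in> borel_measurable \<pi>" using m by auto
 have "\<bar>?X z\<bar> <= 2 * K / L" if "z \<in> space \<pi>" for z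
 using bd[OF that] L(1) by (simp add: abs_divide divide_right_mono)
 from \<pi>.integral_power2_le[OF Xm this]
 have "ennreal ((\<integral>z. ?X z \<partial>\<pi>)\<^sup>2) <= (\<integral>\<^sup>+z. ennreal ((?X z)\<^sup>2) \<partial>\<pi>)" .
 also have "\<dots> <= (\<integral>\<^sup>+z. ennreal (dist (fst z) (snd z) powr 2) \<partial>\<pi>)"
 proof (rule nn_integral_mono)
 fix z assume "z \<in> space \<pi>"
 hence "\<bar>g (fst z) - g (snd z)\<bar> <= L * dist (fst z) (snd z)" using L(2) by (auto simp: sp)
 hence "\<bar>?X z\<bar> <= dist (fst z) (snd z)" using L(1) by (simp add: abs_divide field_simps)
 hence "\<bar>?X z\<bar>\<^sup>2 <= (dist (fst z) (snd z))\<^sup>2" by (intro power_mono) auto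
 thus "ennreal ((?X z)\<^sup>2) <= ennreal (dist (fst z) (snd z) powr 2)"
 unfolding power2_abs by (intro ennreal_leI) (simp add: powr_numeral)
 qed
 also note less_imp_le[OF cost]
 finally have "(\<integral>z. ?X z \<partial>\<pi>)\<^sup>2 <= r\<^sup>2" by (simp add: ennreal_le_iff)
 moreover have "0 <= r" using r controls_dist_nonneg[of q q'] by linarith
 ultimately have "\<bar>\<integral>z. ?X z \<partial>\<pi>\<bar> <= r" by (simp add: abs_le_square_iff[symmetric])
 moreover have "(\<integral>z. ?X z \<partial>\<pi>) = ((\<integral>z. g z \<partial>normalized T q) - (\<integral>z. g z \<partial>normalized T q')) / L"
 using int by (simp add: e1 e2)
 ultimately show ?thesis using L(1) by (simp add: abs_divide field_simps)
 qed
 have "\<bar>(\<integral>z. g z \<partial>normalized T q) - (\<integral>z. g z \<partial>normalized T q')\<bar> <= L * controls_dist T U q q'"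
 by (rule le_if_le_all_greater[where g="%r. L * r"]) (use * in \<open>auto intro!: tendsto_intros\<close>)
 hence "T * \<bar>(\<integral>z. g z \<partial>normalized T q) - (\<integral>z. g z \<partial>normalized T q')\<bar> <= T * (L * controls_dist T U q q')"
 using T by (intro mult_left_mono) auto
 thus ?thesis
 unfolding integral_normalized[OF q g] integral_normalized[OF q' g] right_diff_distrib[symmetric] abs_mult
 using T by (simp add: mult.assoc)
qed

end

context control_kernel
begin

subsection \<open>The disintegration kernel\<close>

lemma kernel_measurable: "(%z. \<kappa> (snd z) (fst z)) \<in> leb T \<Otimes>\<^sub>M BC \<rightarrow>\<^sub>M subprob_algebra BU"
 using disint measurable_prob_algebraD unfolding disintegration_def case_prod_unfold by blast

lemma kernel_space:
 assumes "q \<in> controls T U p" "t \<in> {0..T}"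
 shows "prob_space (\<kappa> q t)" "sets (\<kappa> q t) = sets BU" "space (\<kappa> q t) = U"
proof -
 have "(%z. \<kappa> (snd z) (fst z)) \<in> leb T \<Otimes>\<^sub>M BC \<rightarrow>\<^sub>M prob_algebra BU"
 using disint unfolding disintegration_def case_prod_unfold by blast
 from measurable_space[OF this, of "(t, q)"] have "\<kappa> q t \<in> space (prob_algebra BU)"
 using assms by (simp add: space_pair_measure)
 thus "prob_space (\<kappa> q t)" and s: "sets (\<kappa> q t) = sets BU" by (auto simp: space_prob_algebra)
 show "space (\<kappa> q t) = U" using sets_eq_imp_space_eq[OF s] by (simp add: space_restrict_space)
qed

lemma kernel_measurable_fun: "q \<in> controls T U p ==> t \<in> {0..T} ==> f \<in> BU \<rightarrow>\<^sub>M N ==> f \<in> \<kappa> q t \<rightarrow>\<^sub>M N"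
 using measurable_cong_sets[OF kernel_space(2) refl] by auto

lemma measurable_leb_BU_BE: "(%z. z) \<in> leb T \<Otimes>\<^sub>M BU \<rightarrow>\<^sub>M BE"
proof (rule measurable_restrict_space2)
 show "(%z. z) \<in> space (leb T \<Otimes>\<^sub>M BU) \<rightarrow> E" by (auto simp: space_pair_measure space_restrict_space)
 have 1: "(%z. fst z) \<in> borel_measurable (leb T \<Otimes>\<^sub>M BU)"
 by (rule measurable_compose[OF measurable_fst measurable_leb_id])
 have "(%u. u) \<in> borel_measurable BU" by (intro measurable_restrict_space1) simp
 hence 2: "(%z. snd z) \<in> borel_measurable (leb T \<Otimes>\<^sub>M BU)" by (rule measurable_compose[OF measurable_snd])
 show "(%z. z) \<in> borel_measurable (leb T \<Otimes>\<^sub>M BU)"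
 using measurable_Pair[OF 1 2] by (simp add: borel_prod)
qed

lemma measurable_section_BE: "t \<in> {0..T} ==> f \<in> BE \<rightarrow>\<^sub>M N ==> (%u. f (t, u)) \<in> BU \<rightarrow>\<^sub>M N"
proof -
 assume t: "t \<in> {0..T}" and f: "f \<in> BE \<rightarrow>\<^sub>M N"
 have 1: "(%u. (t, u)) \<in> BU \<rightarrow>\<^sub>M leb T \<Otimes>\<^sub>M BU" by (rule measurable_Pair1') (use t in simp)
 show ?thesis by (rule measurable_compose[OF measurable_compose[OF 1 measurable_leb_BU_BE] f])
qed

lemma kernel_nn_integral_measurable:
 fixes f :: "real \<times> 'b => ennreal"
 assumes f: "f \<in> borel_measurable BE"
 shows "(%z. \<integral>\<^sup>+u. f (fst z, u) \<partial>\<kappa> (snd z) (fst z)) \<in> borel_measurable (leb T \<Otimes>\<^sub>M BC)"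
proof (rule nn_integral_measurable_subprob_algebra2[OF _ kernel_measurable])
 have "(%z. (fst (fst z), snd z)) \<in> (leb T \<Otimes>\<^sub>M BC) \<Otimes>\<^sub>M BU \<rightarrow>\<^sub>M leb T \<Otimes>\<^sub>M BU" by measurable
 from measurable_compose[OF this measurable_compose[OF measurable_leb_BU_BE f]]
 show "(%(x, y). f (fst x, y)) \<in> borel_measurable ((leb T \<Otimes>\<^sub>M BC) \<Otimes>\<^sub>M BU)" by (simp add: case_prod_unfold)
qed

lemma kernel_nn_integral_measurable_time:
 fixes f :: "real \<times> 'b => ennreal"
 assumes f: "f \<in> borel_measurable BE" and q: "q \<in> controls T U p"
 shows "(%t. \<integral>\<^sup>+u. f (t, u) \<partial>\<kappa> q t) \<in> borel_measurable (leb T)"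
 using measurable_compose[OF measurable_Pair2'[of q BC "leb T"] kernel_nn_integral_measurable[OF f]] q by simp

lemma nn_integral_disintegration:
 fixes f :: "real \<times> 'b => ennreal"
 assumes q: "q \<in> controls T U p" and f: "f \<in> borel_measurable BE"
 shows "(\<integral>\<^sup>+z. f z \<partial>q) = (\<integral>\<^sup>+t. \<integral>\<^sup>+u. f (t, u) \<partial>\<kappa> q t \<partial>leb T)"
 using f
proof (induction f rule: borel_measurable_induct)
 case (cong f g)
 have "(\<integral>\<^sup>+z. f z \<partial>q) = (\<integral>\<^sup>+z. g z \<partial>q)"
 using cong by (intro nn_integral_cong) (simp add: controls_space[OF q] space_restrict_space)
 also have "\<dots> = (\<integral>\<^sup>+t. \<integral>\<^sup>+u. g (t, u) \<partial>\<kappa> q t \<partial>leb T)" by fact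
 also have "\<dots> = (\<integral>\<^sup>+t. \<integral>\<^sup>+u. f (t, u) \<partial>\<kappa> q t \<partial>leb T)"
 using cong(3) by (intro nn_integral_cong) (simp add: kernel_space[OF q] space_restrict_space)
 finally show ?case .
next
 case (set A)
 have "(\<integral>\<^sup>+z. indicator A z \<partial>q) = emeasure q A" using set controls_sets[OF q] by simp
 also have "\<dots> = (\<integral>\<^sup>+t. emeasure (\<kappa> q t) {u. (t, u) \<in> A} \<partial>leb T)"
 using disint q set unfolding disintegration_def by blast
 also have "\<dots> = (\<integral>\<^sup>+t. \<integral>\<^sup>+u. indicator A (t, u) \<partial>\<kappa> q t \<partial>leb T)"
 proof (rule nn_integral_cong)
 fix t assume "t \<in> space (leb T)"
 hence t: "t \<in> {0..T}" by simp
 have "A \<subseteq> E" using sets.sets_into_space[OF set] by (simp add: space_restrict_space)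
 hence sub: "{u. (t, u) \<in> A} = (%u. (t, u)) -` A \<inter> space BU" by (auto simp: space_restrict_space)
 have "(%u. (t, u)) \<in> BU \<rightarrow>\<^sub>M BE" using measurable_section_BE[OF t measurable_ident_sets[OF refl]] by simp
 hence "{u. (t, u) \<in> A} \<in> sets (\<kappa> q t)"
 unfolding sub kernel_space(2)[OF q t] by (rule measurable_sets[OF _ set])
 moreover have "indicator A (t, u) = (indicator {u. (t, u) \<in> A} u :: ennreal)" for u by (simp add: indicator_def)
 ultimately show "emeasure (\<kappa> q t) {u. (t, u) \<in> A} = (\<integral>\<^sup>+u. indicator A (t, u) \<partial>\<kappa> q t)" by simp
 qed
 finally show ?case .
next
 case (mult v c)
 have "(\<integral>\<^sup>+z. c * v z \<partial>q) = c * (\<integral>\<^sup>+z. v z \<partial>q)" by (rule nn_integral_cmult[OF controls_measurable[OF q mult(2)]])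
 also have "\<dots> = (\<integral>\<^sup>+t. c * (\<integral>\<^sup>+u. v (t, u) \<partial>\<kappa> q t) \<partial>leb T)"
 unfolding mult.IH by (rule nn_integral_cmult[symmetric, OF kernel_nn_integral_measurable_time[OF mult(2) q]])
 also have "\<dots> = (\<integral>\<^sup>+t. \<integral>\<^sup>+u. c * v (t, u) \<partial>\<kappa> q t \<partial>leb T)"
 by (intro nn_integral_cong nn_integral_cmult[symmetric] kernel_measurable_fun[OF q] measurable_section_BE mult(2)) auto
 finally show ?case .
next
 case (add v w)
 have "(\<integral>\<^sup>+z. w z + v z \<partial>q) = (\<integral>\<^sup>+z. w z \<partial>q) + (\<integral>\<^sup>+z. v z \<partial>q)"
 by (rule nn_integral_add[OF controls_measurable[OF q add.hyps(3)] controls_measurable[OF q add.hyps(1)]])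
 also have "\<dots> = (\<integral>\<^sup>+t. (\<integral>\<^sup>+u. w (t, u) \<partial>\<kappa> q t) + (\<integral>\<^sup>+u. v (t, u) \<partial>\<kappa> q t) \<partial>leb T)"
 unfolding add.IH
 by (rule nn_integral_add[symmetric, OF kernel_nn_integral_measurable_time[OF add.hyps(3) q] kernel_nn_integral_measurable_time[OF add.hyps(1) q]])
 also have "\<dots> = (\<integral>\<^sup>+t. \<integral>\<^sup>+u. w (t, u) + v (t, u) \<partial>\<kappa> q t \<partial>leb T)"
 by (intro nn_integral_cong nn_integral_add[symmetric] kernel_measurable_fun[OF q] measurable_section_BE add.hyps(1,3)) auto
 finally show ?case .
next
 case (seq V)
 have inc: "incseq (%i. V i (t, u))" for t u using \<open>incseq V\<close> by (simp add: incseq_def le_fun_def)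
 have "(\<integral>\<^sup>+z. (SUP i. V i) z \<partial>q) = (SUP i. \<integral>\<^sup>+z. V i z \<partial>q)"
 unfolding SUP_apply by (rule nn_integral_monotone_convergence_SUP[OF \<open>incseq V\<close> controls_measurable[OF q seq.hyps(1)]])
 also have "\<dots> = (SUP i. \<integral>\<^sup>+t. \<integral>\<^sup>+u. V i (t, u) \<partial>\<kappa> q t \<partial>leb T)" using seq.IH by simp
 also have "\<dots> = (\<integral>\<^sup>+t. (SUP i. \<integral>\<^sup>+u. V i (t, u) \<partial>\<kappa> q t) \<partial>leb T)"
 proof (rule nn_integral_monotone_convergence_SUP[symmetric])
 show "incseq (%i t. \<integral>\<^sup>+u. V i (t, u) \<partial>\<kappa> q t)"
 using inc by (auto simp: incseq_def le_fun_def intro!: nn_integral_mono)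
 qed (rule kernel_nn_integral_measurable_time[OF seq.hyps(1) q])
 also have "\<dots> = (\<integral>\<^sup>+t. \<integral>\<^sup>+u. (SUP i. V i) (t, u) \<partial>\<kappa> q t \<partial>leb T)"
 proof (rule nn_integral_cong)
 fix t assume "t \<in> space (leb T)"
 hence t: "t \<in> {0..T}" by simp
 show "(SUP i. \<integral>\<^sup>+u. V i (t, u) \<partial>\<kappa> q t) = (\<integral>\<^sup>+u. (SUP i. V i) (t, u) \<partial>\<kappa> q t)"
 unfolding SUP_apply
 by (rule nn_integral_monotone_convergence_SUP[symmetric])
 (use inc in \<open>auto simp: incseq_def le_fun_def intro!: kernel_measurable_fun[OF q t] measurable_section_BE[OF t] seq.hyps(1)\<close>)
 qed
 finally show ?case .
qed

text \<open>For a merely Borel \<open>f\<close> this map need not be continuous in the Wasserstein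
  distance. It is measurable because it equals a time integral of kernel integrals, and the kernels
  are jointly measurable in time and control.\<close>

lemma measurable_nn_integral_controls:
 fixes f :: "real \<times> 'b => ennreal"
 assumes f: "f \<in> borel_measurable BE"
 shows "(%q. \<integral>\<^sup>+z. f z \<partial>q) \<in> borel_measurable BC"
proof -
 interpret leb: finite_measure "leb T" by (rule finite_measure_leb)
 have "(%(q, t). \<integral>\<^sup>+u. f (t, u) \<partial>\<kappa> q t) \<in> borel_measurable (BC \<Otimes>\<^sub>M leb T)"
 using measurable_compose[OF measurable_pair_swap' kernel_nn_integral_measurable[OF f]] by (simp add: case_prod_unfold)
 from leb.borel_measurable_nn_integral[OF this]
 have "(%q. \<integral>\<^sup>+t. \<integral>\<^sup>+u. f (t, u) \<partial>\<kappa> q t \<partial>leb T) \<in> borel_measurable BC" .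
 thus ?thesis
 by (subst measurable_cong[OF nn_integral_disintegration[OF _ f]]) auto
qed

lemma measurable_nn_integral_normalized:
 fixes f :: "real \<times> 'b => ennreal"
 assumes f: "f \<in> borel_measurable BE"
 shows "(%q. \<integral>\<^sup>+z. f z \<partial>normalized T q) \<in> borel_measurable BC"
proof -
 have "(%q. ennreal (1 / T) * (\<integral>\<^sup>+z. f z \<partial>q)) \<in> borel_measurable BC"
 using measurable_nn_integral_controls[OF f] by simp
 thus ?thesis by (subst measurable_cong[OF nn_integral_normalized[OF _ f]]) auto
qed

lemma measurable_control_moment: "control_moment T \<in> borel_measurable BC"
 unfolding control_moment_def[abs_def]
 by (intro measurable_compose[OF measurable_nn_integral_normalized[OF measurable_compose[OF measurable_norm_BE(1) measurable_ennreal]]])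
 simp

subsection \<open>A countable network\<close>

lemma measurable_measure_normalized:
 assumes A: "A \<in> sets BE"
 shows "(%q. measure (normalized T q) A) \<in> borel_measurable BC"
proof -
 have i: "(indicator A :: _ => ennreal) \<in> borel_measurable BE" using A by simp
 have "(%q. enn2real (\<integral>\<^sup>+z. indicator A z \<partial>normalized T q)) \<in> borel_measurable BC"
 using measurable_nn_integral_normalized[OF i] by measurable
 moreover have "enn2real (\<integral>\<^sup>+z. indicator A z \<partial>normalized T q) = measure (normalized T q) A" if "q \<in> space BC" for q
 using that A normalized_sets[of q] by (simp add: measure_def)
 ultimately show ?thesis by (subst measurable_cong[symmetric]) auto
qed

text \<open>A member of the network prescribes, up to a tolerance, rational masses for finitely many
  small cells and a small second moment in the remaining tail cell.
  \<open>wasserstein2_partition_le\<close> bounds the distance of any two controls sharing these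
  data. The sets are Borel because cell masses and tail moments are measurable in the
  control.\<close>

lemma countable_network_controls: "countable_network (controls T U p) (controls_dist T U)"
proof -
 obtain Q :: "(real \<times> 'b) set" where Q: "countable Q" "!!X. open X ==> X ~= {} ==> \<exists>d\<in>Q. d \<in> X"
 using countable_dense_setE by blast
 have Qne: "Q ~= {}" using Q(2)[of UNIV] by auto
 define e where "e = from_nat_into Q"
 have ex: "\<exists>j. dist z (e j) < inverse (real (Suc n))" for z n
 proof -
 obtain d where "d \<in> Q" "d \<in> ball z (inverse (real (Suc n)))" using Q(2)[of "ball z (inverse (real (Suc n)))"] by auto
 thus ?thesis using from_nat_into_surj[OF Q(1)] unfolding e_def by (metis mem_ball)
 qed
 \<comment> \<open>Each point goes to the first dense point within 1/(n+1); indices from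
   \<open>J\<close> on are merged into the tail cell \<open>J\<close>.\<close>
 define i0 where "i0 n z = (LEAST j. dist z (e j) < inverse (real (Suc n)))" for n z
 define idx where "idx n J z = min (i0 n z) J" for n J z
 have i0: "dist z (e (i0 n z)) < inverse (real (Suc n))" for n z unfolding i0_def using ex by (rule LeastI_ex)
 have i0m: "i0 n \<in> borel \<rightarrow>\<^sub>M count_space UNIV" for n
 unfolding i0_def[abs_def] by measurable
 have idxm: "idx n J \<in> BE \<rightarrow>\<^sub>M count_space UNIV" for n J
 unfolding idx_def[abs_def] by (intro measurable_restrict_space1 measurable_compose[OF i0m]) simp
 have As: "{z \<in> E. idx n J z = j} \<in> sets BE" for n J j
 using measurable_sets[OF idxm[of n J], of "{j}"] by (simp add: space_restrict_space vimage_def Int_def conj_commute)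
 define h where "h n J z = ennreal ((norm z)\<^sup>2) * indicator {z. idx n J z = J} z" for n J z
 have hm: "h n J \<in> borel_measurable BE" for n J
 proof -
 have *: "h n J = (%z. ennreal ((norm z)\<^sup>2) * indicator {J} (idx n J z))" by (auto simp: h_def indicator_def)
 have 1: "(%z. ennreal ((norm z)\<^sup>2)) \<in> borel_measurable BE"
 by (rule measurable_compose[OF measurable_norm_BE(1) measurable_ennreal])
 have 2: "(%z. indicator {J} (idx n J z) :: ennreal) \<in> borel_measurable BE" by (rule measurable_compose[OF idxm]) simp
 show ?thesis unfolding * by (rule borel_measurable_times_ennreal[OF 1 2])
 qed
 define K where "K n J a N M = {q \<in> controls T U p. (\<forall>j<J. \<bar>measure (normalized T q) {z \<in> E. idx n J z = j} - a ! j\<bar> < inverse (real (Suc N))) \<and>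
 (\<integral>\<^sup>+z. h n J z \<partial>normalized T q) < ennreal (inverse (real (Suc M)))}" for n J a N M
 have Km: "K n J a N M \<in> sets BC" for n J a N M
 proof -
 have 1: "{q \<in> space BC. (\<integral>\<^sup>+z. h n J z \<partial>normalized T q) < ennreal (inverse (real (Suc M)))} \<in> sets BC"
 by (intro borel_measurable_less measurable_nn_integral_normalized hm measurable_const) simp
 have 2: "{q \<in> space BC. \<forall>j\<in>{..<J}. \<bar>measure (normalized T q) {z \<in> E. idx n J z = j} - a ! j\<bar> < inverse (real (Suc N))} \<in> sets BC"
 proof (rule sets.sets_Collect_finite_All)
 fix j
 have "(%q. \<bar>measure (normalized T q) {z \<in> E. idx n J z = j} - a ! j\<bar>) \<in> borel_measurable BC"
 using measurable_measure_normalized[OF As] by measurable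
 thus "{q \<in> space BC. \<bar>measure (normalized T q) {z \<in> E. idx n J z = j} - a ! j\<bar> < inverse (real (Suc N))} \<in> sets BC"
 by (rule borel_measurable_less) simp
 qed simp
 have "K n J a N M = {q \<in> space BC. \<forall>j\<in>{..<J}. \<bar>measure (normalized T q) {z \<in> E. idx n J z = j} - a ! j\<bar> < inverse (real (Suc N))} \<inter>
 {q \<in> space BC. (\<integral>\<^sup>+z. h n J z \<partial>normalized T q) < ennreal (inverse (real (Suc M)))}"
 by (auto simp: K_def)
 thus ?thesis using sets.Int[OF 2 1] by (simp only:)
 qed
 let ?N = "(%(n, J, a, N, M). K n J a N M) ` (UNIV \<times> UNIV \<times> lists \<rat> \<times> UNIV \<times> UNIV)"
 have "countable ?N"
 by (intro countable_image countable_SIGMA countable_lists countableI_type countable_rat)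
 moreover have "?N \<subseteq> sets BC" using Km by (simp add: image_subset_iff)
 moreover have "\<exists>N\<in>?N. q \<in> N & (\<forall>q'\<in>N. controls_dist T U q q' < r)" if q: "q \<in> controls T U p" and r: "r > 0" for q r
 proof -
 \<comment> \<open>The budget: mesh, tail and mass errors will contribute at most
   \<open>4 * s\<close>, \<open>4 * s\<close> and \<open>8 * s\<close> to the squared distance, in
   total less than \<open>r\<^sup>2\<close>. The cap at 1 allows the squared mesh to be estimated by
   \<open>s\<close>.\<close>
 define s where "s = min 1 (r\<^sup>2 / 20)"
 have s: "0 < s" "s <= 1" "20 * s <= r\<^sup>2" using r by (auto simp: s_def)
 obtain n where n: "inverse (real (Suc n)) < s" using reals_Archimedean[OF s(1)] by blast
 obtain M where M: "inverse (real (Suc M)) < s" using reals_Archimedean[OF s(1)] by blast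
 \<comment> \<open>For a fixed mesh every point leaves the tail once \<open>J\<close> exceeds its
   index, so the tail moment vanishes by dominated convergence.\<close>
 have "(%J. \<integral>\<^sup>+z. h n J z \<partial>normalized T q) \<longlonglongrightarrow> (\<integral>\<^sup>+z. 0 \<partial>normalized T q)"
 proof (rule nn_integral_dominated_convergence)
 show "h n J \<in> borel_measurable (normalized T q)" for J by (rule normalized_measurable[OF q hm])
 show "(%z. ennreal ((norm z)\<^sup>2)) \<in> borel_measurable (normalized T q)"
 by (rule normalized_measurable[OF q measurable_compose[OF measurable_norm_BE(1) measurable_ennreal]])
 show "(\<integral>\<^sup>+z. ennreal ((norm z)\<^sup>2) \<partial>normalized T q) < \<infinity>" by (rule moment_finite[OF q])
 show "AE z in normalized T q. h n J z <= ennreal ((norm z)\<^sup>2)" for J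
 by (rule AE_I2) (simp add: h_def indicator_def)
 show "AE z in normalized T q. (%J. h n J z) \<longlonglongrightarrow> 0"
 proof (rule AE_I2)
 fix z
 have "h n J z = 0" if "J > i0 n z" for J using that by (simp add: h_def idx_def indicator_def)
 hence "\<forall>\<^sub>F J in sequentially. h n J z = 0"
 unfolding eventually_sequentially by (intro exI[of _ "Suc (i0 n z)"]) auto
 thus "(%J. h n J z) \<longlonglongrightarrow> 0" by (rule tendsto_eventually)
 qed
 qed simp
 hence "(%J. \<integral>\<^sup>+z. h n J z \<partial>normalized T q) \<longlonglongrightarrow> 0" by simp
 hence "\<forall>\<^sub>F J in sequentially. (\<integral>\<^sup>+z. h n J z \<partial>normalized T q) < ennreal (inverse (real (Suc M)))"
 by (rule order_tendstoD) simp
 then obtain J where J: "(\<integral>\<^sup>+z. h n J z \<partial>normalized T q) < ennreal (inverse (real (Suc M)))"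
 unfolding eventually_sequentially by blast
 \<comment> \<open>A point of a cell below \<open>J\<close> is within 1 of its centre
   \<open>e j\<close>, and the sum bounds the norms of all these centres at once.\<close>
 define B where "B = (\<Sum>j<J. norm (e j)) + 1"
 have B0: "0 <= B" unfolding B_def by (intro add_nonneg_nonneg sum_nonneg) auto
 define c where "c = real J * B\<^sup>2"
 have c0: "0 <= c" by (simp add: c_def)
 \<comment> \<open>Chosen last, since \<open>c\<close> depends on \<open>J\<close> and
   \<open>B\<close>; it gives \<open>c * inverse (real (Suc N)) \<le> s\<close>.\<close>
 obtain N where N: "inverse (real (Suc N)) < s / (1 + c)" using reals_Archimedean[of "s / (1 + c)"] s c0 by auto
 define P where "P j x \<longleftrightarrow> x \<in> \<rat> & \<bar>measure (normalized T q) {z \<in> E. idx n J z = j} - x\<bar> < inverse (real (Suc N))" for j x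
 have exP: "\<exists>x. P j x" for j
 proof -
 let ?m = "measure (normalized T q) {z \<in> E. idx n J z = j}"
 have "?m < ?m + inverse (real (Suc N))" by simp
 then obtain x where "x \<in> \<rat>" "?m < x" "x < ?m + inverse (real (Suc N))" using Rats_dense_in_real by blast
 thus ?thesis unfolding P_def by (intro exI[of _ x]) auto
 qed
 define a where "a j = (SOME x. P j x)" for j
 have "P j (a j)" for j unfolding a_def by (rule someI_ex[OF exP])
 hence a: "a j \<in> \<rat>" "\<bar>measure (normalized T q) {z \<in> E. idx n J z = j} - a j\<bar> < inverse (real (Suc N))" for j
 unfolding P_def by simp_all
 let ?a = "map a [0..<J]"
 have qK: "q \<in> K n J ?a N M" using q J a(2) by (simp add: K_def)
 have "controls_dist T U q q' < r" if "q' \<in> K n J ?a N M" for q'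
 proof -
 have q': "q' \<in> controls T U p" "!!j. j < J ==> \<bar>measure (normalized T q') {z \<in> E. idx n J z = j} - a j\<bar> < inverse (real (Suc N))"
 "(\<integral>\<^sup>+z. h n J z \<partial>normalized T q') < ennreal (inverse (real (Suc M)))"
 using that by (auto simp: K_def)
 have "controls_dist T U q q' <= sqrt ((2 * inverse (real (Suc n)))\<^sup>2 + 4 * inverse (real (Suc M)) + 4 * (real J * B\<^sup>2 * (2 * inverse (real (Suc N)))))"
 unfolding controls_dist_eq
 proof (rule wasserstein2_partition_le[where idx="idx n J"])
 fix z w :: "real \<times> 'b" assume zw: "idx n J z = idx n J w" "idx n J z < J"
 hence "i0 n z = i0 n w" by (auto simp: idx_def)
 thus "dist z w <= 2 * inverse (real (Suc n))"
 using i0[of z n] i0[of w n] dist_triangle2[of z w "e (i0 n z)"] by simp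
 next
 fix z :: "real \<times> 'b" assume z: "idx n J z < J"
 hence "i0 n z < J" by (auto simp: idx_def)
 hence "norm (e (i0 n z)) <= (\<Sum>j<J. norm (e j))" by (intro member_le_sum) auto
 moreover have "dist z (e (i0 n z)) <= 1"
 using i0[of z n] by (rule less_imp_le[OF order_less_le_trans]) (simp add: inverse_le_1_iff)
 moreover have "norm z <= norm (e (i0 n z)) + dist z (e (i0 n z))" by (metis dist_norm norm_triangle_sub)
 ultimately show "norm z <= B" by (simp add: B_def)
 next
 fix j assume "j < J"
 thus "\<bar>measure (normalized T q) {z \<in> E. idx n J z = j} - measure (normalized T q') {z \<in> E. idx n J z = j}\<bar> <= 2 * inverse (real (Suc N))"
 using a(2)[of j] q'(2)[of j] by linarith
 next
 show "(\<integral>\<^sup>+z. ennreal ((norm z)\<^sup>2) * indicator {z. idx n J z = J} z \<partial>normalized T q) <= ennreal (inverse (real (Suc M)))"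
 using less_imp_le[OF J] unfolding h_def .
 show "(\<integral>\<^sup>+z. ennreal ((norm z)\<^sup>2) * indicator {z. idx n J z = J} z \<partial>normalized T q') <= ennreal (inverse (real (Suc M)))"
 using less_imp_le[OF q'(3)] unfolding h_def .
 show "idx n J z <= J" for z by (simp add: idx_def)
 qed (use idxm B0 normalized_prob[OF q] normalized_prob[OF q'(1)] in auto)
 also have "\<dots> < sqrt (r\<^sup>2)"
 proof (rule real_sqrt_less_mono)
 define x where "x = inverse (real (Suc n))"
 define y where "y = inverse (real (Suc N))"
 have "0 < x" "x < s" using n by (auto simp: x_def)
 hence "x * x <= s * 1" using s by (intro mult_mono) auto
 hence 1: "(2 * x)\<^sup>2 <= 4 * s" by (simp add: power2_eq_square)
 have "y * (1 + c) < s" using N c0 by (simp add: y_def pos_less_divide_eq)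
 moreover have "0 < y" by (simp add: y_def)
 ultimately have "c * y <= s" by (simp add: distrib_left mult.commute)
 hence 2: "4 * (c * (2 * y)) <= 8 * s" by simp
 show "(2 * inverse (real (Suc n)))\<^sup>2 + 4 * inverse (real (Suc M)) + 4 * (real J * B\<^sup>2 * (2 * inverse (real (Suc N)))) < r\<^sup>2"
 unfolding x_def[symmetric] y_def[symmetric] c_def[symmetric] using 1 2 M s by linarith
 qed
 finally show ?thesis using r by simp
 qed
 moreover have "K n J ?a N M \<in> ?N" using a(1)
 by (intro image_eqI[of _ _ "(n, J, ?a, N, M)"]) (auto simp: in_lists_conv_set)
 ultimately show ?thesis using qK by (intro bexI[of _ "K n J ?a N M"] conjI ballI)
 qed
 ultimately show ?thesis unfolding countable_network_def by (intro exI[of _ ?N] conjI ballI allI impI)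
qed

end

section \<open>The space of paths and controls\<close>

context control_kernel
begin

abbreviation "BS \<equiv> borel_on (skorokhod T :: (real => 'a::euclidean_space) set) (skorokhod_dist T)"
abbreviation "OH \<equiv> (skorokhod T :: (real => 'a::euclidean_space) set) \<times> controls T U p"
abbreviation "dH \<equiv> sum_dist (skorokhod_dist T :: (real => 'a::euclidean_space) => _) (controls_dist T U)"
abbreviation "BH \<equiv> borel_on (OH :: (('a::euclidean_space, 'b) hat) set) dH"

lemma dH_nonneg: "0 <= dH z w"
 by (simp add: sum_dist_def skorokhod_dist_nonneg controls_dist_nonneg)

lemma fst_dist_le: "skorokhod_dist T (fst z) (fst w) <= dH z w"
 by (simp add: sum_dist_def controls_dist_nonneg)

lemma snd_dist_le: "controls_dist T U (snd z) (snd w) <= dH z w"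
 by (simp add: sum_dist_def skorokhod_dist_nonneg)

lemma countable_network_OH: "countable_network OH dH"
 by (rule countable_network_sum_dist[OF skorokhod_dist_nonneg controls_dist_nonneg
 countable_network_skorokhod[OF T] countable_network_controls])

lemma measurable_fst_BH: "fst \<in> BH \<rightarrow>\<^sub>M BS"
 by (rule measurable_fst_sum_dist[OF skorokhod_dist_nonneg controls_dist_nonneg])

lemma measurable_snd_BH: "snd \<in> BH \<rightarrow>\<^sub>M BC"
 by (rule measurable_snd_sum_dist[OF skorokhod_dist_nonneg controls_dist_nonneg])

lemma measurable_eval_BH:
 "(%z. fst (snd z) (fst z)) \<in> borel_measurable (leb T \<Otimes>\<^sub>M (BH :: ((real => 'a::euclidean_space) \<times> _) measure))"
proof -
 have "(%z. (fst z, fst (snd z))) \<in> leb T \<Otimes>\<^sub>M (BH :: ((real => 'a) \<times> _) measure) \<rightarrow>\<^sub>M leb T \<Otimes>\<^sub>M BS"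
 by (intro measurable_Pair measurable_fst measurable_compose[OF measurable_snd measurable_fst_BH])
 from measurable_compose[OF this measurable_skorokhod_eval_joint] show ?thesis using T by simp
qed

lemma measurable_eval_BH_time:
 "t \<in> {0..T} ==> (%z. fst z t) \<in> borel_measurable (BH :: ((real => 'a::euclidean_space) \<times> _) measure)"
 by (rule measurable_compose[OF measurable_fst_BH measurable_skorokhod_eval])

lemma measurable_kernel_BH: "(%z. \<kappa> (snd (snd z)) (fst z)) \<in> leb T \<Otimes>\<^sub>M BH \<rightarrow>\<^sub>M subprob_algebra BU"
proof -
 have "(%z. (fst z, snd (snd z))) \<in> leb T \<Otimes>\<^sub>M BH \<rightarrow>\<^sub>M leb T \<Otimes>\<^sub>M BC"
 by (intro measurable_Pair measurable_fst measurable_compose[OF measurable_snd measurable_snd_BH])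
 from measurable_compose[OF this kernel_measurable] show ?thesis by simp
qed

text \<open>A measurable substitute for the squared distance to a base point. By
  \<open>hat_size_le\<close> and \<open>dH_power2_le\<close> it is comparable with
  \<open>dH\<close>, so second moments can be expressed by it instead of by
  \<open>dH\<close>.\<close>

definition hat_size :: "('a::euclidean_space, 'b) hat => real" where
 "hat_size z = (path_norm T (fst z))\<^sup>2 + control_moment T (snd z)"

lemma measurable_path_norm_BH: "(%z. path_norm T (fst z)) \<in> borel_measurable BH"
 using measurable_compose[OF measurable_fst_BH measurable_path_norm] T by simp

lemma measurable_moment_BH: "(%z. control_moment T (snd z)) \<in> borel_measurable BH"
 by (rule measurable_compose[OF measurable_snd_BH measurable_control_moment])

lemma measurable_hat_size: "hat_size \<in> borel_measurable BH"
 unfolding hat_size_def[abs_def]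
 by (intro borel_measurable_add borel_measurable_power measurable_path_norm_BH measurable_moment_BH)

lemma hat_size_nonneg: "0 <= hat_size z"
 by (simp add: hat_size_def control_moment_nonneg)

lemma power2_le_of_le_add: "0 <= a ==> a <= b + c ==> a\<^sup>2 <= 2 * b\<^sup>2 + 2 * (c::real)\<^sup>2"
proof -
 assume "0 <= a" "a <= b + c"
 hence "a\<^sup>2 <= (b + c)\<^sup>2" by (intro power_mono)
 also have "\<dots> <= 2 * b\<^sup>2 + 2 * c\<^sup>2" using zero_le_power2[of "b - c"] by (simp add: power2_sum power2_diff)
 finally show ?thesis .
qed

lemma hat_size_le:
 assumes z: "z \<in> OH" and w: "w \<in> OH"
 shows "hat_size w <= 2 * hat_size z + 4 * (dH z w)\<^sup>2" "hat_size z <= 2 * hat_size w + 4 * (dH z w)\<^sup>2"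
proof -
 have s: "fst z \<in> skorokhod T" "fst w \<in> skorokhod T" "snd z \<in> controls T U p" "snd w \<in> controls T U p"
 using z w by auto
 have T0: "0 <= T" using T by simp
 have d1: "(skorokhod_dist T (fst z) (fst w))\<^sup>2 <= (dH z w)\<^sup>2" by (intro power_mono fst_dist_le skorokhod_dist_nonneg)
 have d2: "(controls_dist T U (snd z) (snd w))\<^sup>2 <= (dH z w)\<^sup>2" by (intro power_mono snd_dist_le controls_dist_nonneg)
 have combine: "a + c <= 2 * (b + e) + 4 * d" if "a <= 2 * b + 2 * s" "c <= 2 * e + 2 * r" "s <= d" "r <= d"
 for a b c d e r s :: real using that by argo
 note pn = path_norm_le[OF s(1,2) T0] path_norm_le[OF s(2,1) T0]
 note m = control_moment_le[OF s(3,4)]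
 show "hat_size w <= 2 * hat_size z + 4 * (dH z w)\<^sup>2"
 unfolding hat_size_def
 by (rule combine[OF power2_le_of_le_add[OF path_norm_nonneg[OF s(2) T0] pn(1)] m(2) d1 d2])
 show "hat_size z <= 2 * hat_size w + 4 * (dH z w)\<^sup>2"
 unfolding hat_size_def
 by (rule combine[OF power2_le_of_le_add[OF path_norm_nonneg[OF s(1) T0] pn(2)[unfolded skorokhod_dist_commute[OF s(2,1) T0]]] m(1) d1 d2])
qed

lemma dH_power2_le:
 assumes z: "z \<in> OH" and w: "w \<in> OH"
 shows "(dH z w)\<^sup>2 <= 4 * hat_size z + 4 * hat_size w"
proof -
 have s: "fst z \<in> skorokhod T" "fst w \<in> skorokhod T" "snd z \<in> controls T U p" "snd w \<in> controls T U p"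
 using z w by auto
 have T0: "0 <= T" using T by simp
 let ?a = "skorokhod_dist T (fst z) (fst w)" and ?b = "controls_dist T U (snd z) (snd w)"
 have "?a\<^sup>2 <= 2 * (path_norm T (fst z))\<^sup>2 + 2 * (path_norm T (fst w))\<^sup>2"
 by (rule power2_le_of_le_add[OF skorokhod_dist_nonneg skorokhod_dist_le_path_norm[OF s(1,2) T0]])
 note 1 = this
 have "?b\<^sup>2 <= (sqrt (2 * control_moment T (snd z) + 2 * control_moment T (snd w)))\<^sup>2"
 by (intro power_mono controls_dist_le[OF s(3,4)] controls_dist_nonneg)
 hence 2: "?b\<^sup>2 <= 2 * control_moment T (snd z) + 2 * control_moment T (snd w)"
 by (simp add: control_moment_nonneg)
 have 3: "(dH z w)\<^sup>2 <= 2 * ?a\<^sup>2 + 2 * ?b\<^sup>2"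
 using power2_le_of_le_add[of "dH z w" ?a ?b] dH_nonneg by (simp add: sum_dist_def skorokhod_dist_nonneg controls_dist_nonneg)
 have combine: "d <= 4 * (x + u) + 4 * (y + v)" if "a <= 2 * x + 2 * y" "b <= 2 * u + 2 * v" "d <= 2 * a + 2 * b"
 for a b d x y u v :: real using that by argo
 show ?thesis unfolding hat_size_def by (rule combine[OF 1 2 3])
qed

subsection \<open>Couplings of laws\<close>

lemma prob_moment_prob: "\<mu> \<in> prob_moment r M d ==> \<mu> \<in> prob_measures M d"
 by (simp add: prob_moment_def)

lemma hat_meas: "\<mu> \<in> prob_measures OH dH ==> f \<in> BH \<rightarrow>\<^sub>M N ==> f \<in> \<mu> \<rightarrow>\<^sub>M N"
proof -
 assume \<mu>: "\<mu> \<in> prob_measures OH dH" and f: "f \<in> BH \<rightarrow>\<^sub>M N"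
 show ?thesis unfolding measurable_cong_sets[OF prob_measuresD(2)[OF \<mu>] refl] by (rule f)
qed

lemma hat_size_integrable:
 assumes \<mu>: "\<mu> \<in> prob_moment 2 OH dH"
 shows "(\<integral>\<^sup>+z. ennreal (hat_size z) \<partial>\<mu>) < \<infinity>"
proof -
 have P: "\<mu> \<in> prob_measures OH dH" by (rule prob_moment_prob[OF \<mu>])
 interpret prob_space \<mu> by (rule prob_measuresD(1)[OF P])
 obtain x0 where x0: "x0 \<in> OH" "(\<integral>\<^sup>+x. ennreal (dH x x0 powr 2) \<partial>\<mu>) < \<infinity>"
 using \<mu> unfolding prob_moment_def by blast
 have "(\<integral>\<^sup>+z. ennreal (hat_size z) \<partial>\<mu>) <= (\<integral>\<^sup>+z. ennreal (2 * hat_size x0) \<partial>\<mu>) + ennreal 4 * (\<integral>\<^sup>+x. ennreal (dH x x0 powr 2) \<partial>\<mu>)"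
 proof (rule nn_integral_le_add_nonmeasurable)
 fix x assume "x \<in> space \<mu>"
 hence x: "x \<in> OH" using prob_measuresD(3)[OF P] by simp
 have "ennreal (hat_size x) <= ennreal (2 * hat_size x0 + 4 * (dH x x0)\<^sup>2)"
 by (rule ennreal_leI[OF hat_size_le(2)[OF x x0(1)]])
 also have "\<dots> = ennreal (2 * hat_size x0) + ennreal 4 * ennreal (dH x x0 powr 2)"
 using hat_size_nonneg[of x0] dH_nonneg[of x x0] by (simp add: powr_numeral ennreal_mult)
 finally show "ennreal (hat_size x) <= ennreal (2 * hat_size x0) + ennreal 4 * ennreal (dH x x0 powr 2)" .
 qed (use hat_meas[OF P measurable_hat_size] hat_size_nonneg[of x0] in auto)
 also have "\<dots> < \<infinity>" using x0(2) by (simp add: ennreal_mult_less_top emeasure_space_1)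
 finally show ?thesis .
qed

text \<open>Makes second moments uniform over all laws whose coupling cost to \<open>\<mu>\<close>
  is bounded.\<close>

lemma hat_size_coupling_le:
 assumes cp: "\<pi> \<in> couplings OH dH \<mu> \<nu>" and \<mu>: "\<mu> \<in> prob_measures OH dH" and \<nu>: "\<nu> \<in> prob_measures OH dH"
 and cost: "(\<integral>\<^sup>+z. ennreal (dH (fst z) (snd z) powr 2) \<partial>\<pi>) <= ennreal c"
 shows "(\<integral>\<^sup>+z. ennreal (hat_size z) \<partial>\<nu>) <= 2 * (\<integral>\<^sup>+z. ennreal (hat_size z) \<partial>\<mu>) + ennreal 4 * ennreal c"
proof -
 note mc = measurable_coupling[OF cp dH_nonneg \<mu> \<nu>]
 note sm = hat_meas[OF \<mu> measurable_hat_size] hat_meas[OF \<nu> measurable_hat_size]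
 have m: "(%z. hat_size (fst z)) \<in> borel_measurable \<pi>" "(%z. hat_size (snd z)) \<in> borel_measurable \<pi>"
 by (rule measurable_compose[OF mc(1) sm(1)] measurable_compose[OF mc(2) sm(2)])+
 have m2: "(%z. 2 * hat_size (fst z)) \<in> borel_measurable \<pi>" using m by auto
 have sp: "space \<pi> = OH \<times> OH" by (rule couplingsD(3)[OF cp])
 have "(\<integral>\<^sup>+z. ennreal (hat_size z) \<partial>\<nu>) = (\<integral>\<^sup>+z. ennreal (hat_size (snd z)) \<partial>\<pi>)"
 by (rule nn_integral_coupling(2)[OF cp dH_nonneg \<mu> \<nu> measurable_compose[OF sm(2) measurable_ennreal], symmetric])
 also have "\<dots> <= (\<integral>\<^sup>+z. ennreal (2 * hat_size (fst z)) \<partial>\<pi>) + ennreal 4 * (\<integral>\<^sup>+z. ennreal (dH (fst z) (snd z) powr 2) \<partial>\<pi>)"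
 proof (rule nn_integral_le_add_nonmeasurable[OF m(2) m2])
 fix x assume "x \<in> space \<pi>"
 hence x: "fst x \<in> OH" "snd x \<in> OH" unfolding sp by (simp_all only: mem_Times_iff)
 show "0 <= 2 * hat_size (fst x)" by (simp add: hat_size_nonneg)
 have "ennreal (hat_size (snd x)) <= ennreal (2 * hat_size (fst x) + 4 * (dH (fst x) (snd x))\<^sup>2)"
 by (rule ennreal_leI[OF hat_size_le(1)[OF x]])
 also have "\<dots> = ennreal (2 * hat_size (fst x)) + ennreal 4 * ennreal (dH (fst x) (snd x) powr 2)"
 using hat_size_nonneg[of "fst x"] dH_nonneg[of "fst x" "snd x"] by (simp add: powr_numeral ennreal_mult)
 finally show "ennreal (hat_size (snd x)) <= ennreal (2 * hat_size (fst x)) + ennreal 4 * ennreal (dH (fst x) (snd x) powr 2)" .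
 qed simp
 also have "(\<integral>\<^sup>+z. ennreal (2 * hat_size (fst z)) \<partial>\<pi>) = 2 * (\<integral>\<^sup>+z. ennreal (hat_size (fst z)) \<partial>\<pi>)"
 using m(1) by (simp add: ennreal_mult nn_integral_cmult hat_size_nonneg)
 also have "(\<integral>\<^sup>+z. ennreal (hat_size (fst z)) \<partial>\<pi>) = (\<integral>\<^sup>+z. ennreal (hat_size z) \<partial>\<mu>)"
 by (rule nn_integral_coupling(1)[OF cp dH_nonneg \<mu> \<nu> measurable_compose[OF sm(1) measurable_ennreal]])
 also have "2 * (\<integral>\<^sup>+z. ennreal (hat_size z) \<partial>\<mu>) + ennreal 4 * (\<integral>\<^sup>+z. ennreal (dH (fst z) (snd z) powr 2) \<partial>\<pi>) \<le>
 2 * (\<integral>\<^sup>+z. ennreal (hat_size z) \<partial>\<mu>) + ennreal 4 * ennreal c"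
 by (intro add_left_mono mult_left_mono cost) simp
 finally show ?thesis .
qed

text \<open>As for controls, the product coupling supplies the finite cost;
  \<open>dH_power2_le\<close> bounds it by the \<open>hat_size\<close> moments of the two
  laws.\<close>

lemma ex_hat_coupling:
 assumes \<mu>: "\<mu> \<in> prob_moment 2 OH dH" and \<nu>: "\<nu> \<in> prob_moment 2 OH dH"
 and r: "wasserstein 2 OH dH \<mu> \<nu> < r"
 shows "\<exists>\<pi>\<in>couplings OH dH \<mu> \<nu>. (\<integral>\<^sup>+z. ennreal (dH (fst z) (snd z) powr 2) \<partial>\<pi>) < ennreal (r\<^sup>2)"
proof (rule ex_coupling_cost_less[OF _ _ r])
 note P = prob_moment_prob[OF \<mu>] prob_moment_prob[OF \<nu>]
 show cp: "\<mu> \<Otimes>\<^sub>M \<nu> \<in> couplings OH dH \<mu> \<nu>"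
 by (rule couplings_pair_measure[OF countable_network_OH dH_nonneg P])
 note mc = measurable_coupling[OF cp dH_nonneg P]
 note sm = measurable_compose[OF hat_meas[OF P(1) measurable_hat_size] measurable_ennreal]
 measurable_compose[OF hat_meas[OF P(2) measurable_hat_size] measurable_ennreal]
 have m: "(%z. ennreal (hat_size (fst z))) \<in> borel_measurable (\<mu> \<Otimes>\<^sub>M \<nu>)" "(%z. ennreal (hat_size (snd z))) \<in> borel_measurable (\<mu> \<Otimes>\<^sub>M \<nu>)"
 by (rule measurable_compose[OF mc(1) sm(1)] measurable_compose[OF mc(2) sm(2)])+
 have "(\<integral>\<^sup>+z. ennreal (dH (fst z) (snd z) powr 2) \<partial>(\<mu> \<Otimes>\<^sub>M \<nu>)) \<le>
 (\<integral>\<^sup>+z. 4 * ennreal (hat_size (fst z)) + 4 * ennreal (hat_size (snd z)) \<partial>(\<mu> \<Otimes>\<^sub>M \<nu>))"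
 proof (rule nn_integral_mono)
 fix x assume "x \<in> space (\<mu> \<Otimes>\<^sub>M \<nu>)"
 hence x: "fst x \<in> OH" "snd x \<in> OH" unfolding couplingsD(3)[OF cp] by (simp_all only: mem_Times_iff)
 have "ennreal (dH (fst x) (snd x) powr 2) <= ennreal (4 * hat_size (fst x) + 4 * hat_size (snd x))"
 using dH_power2_le[OF x] dH_nonneg[of "fst x" "snd x"] by (intro ennreal_leI) (simp add: powr_numeral)
 also have "\<dots> = 4 * ennreal (hat_size (fst x)) + 4 * ennreal (hat_size (snd x))"
 by (simp add: ennreal_mult hat_size_nonneg)
 finally show "ennreal (dH (fst x) (snd x) powr 2) <= 4 * ennreal (hat_size (fst x)) + 4 * ennreal (hat_size (snd x))" .
 qed
 also have "\<dots> = 4 * (\<integral>\<^sup>+z. ennreal (hat_size (fst z)) \<partial>(\<mu> \<Otimes>\<^sub>M \<nu>)) + 4 * (\<integral>\<^sup>+z. ennreal (hat_size (snd z)) \<partial>(\<mu> \<Otimes>\<^sub>M \<nu>))"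
 using m by (simp add: nn_integral_add nn_integral_cmult)
 also have "\<dots> = 4 * (\<integral>\<^sup>+z. ennreal (hat_size z) \<partial>\<mu>) + 4 * (\<integral>\<^sup>+z. ennreal (hat_size z) \<partial>\<nu>)"
 by (simp only: nn_integral_coupling(1)[OF cp dH_nonneg P sm(1)] nn_integral_coupling(2)[OF cp dH_nonneg P sm(2)])
 also have "\<dots> < \<infinity>" using hat_size_integrable[OF \<mu>] hat_size_integrable[OF \<nu>] by (simp add: ennreal_mult_less_top)
 finally show "(\<integral>\<^sup>+z. ennreal (dH (fst z) (snd z) powr 2) \<partial>(\<mu> \<Otimes>\<^sub>M \<nu>)) < \<infinity>" .
qed

end

subsection \<open>The squared distance of paths in the mean\<close>

definition path_sq :: "real => (real => 'a::euclidean_space) => (real => 'a) => ennreal" where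
 "path_sq T x y = (\<integral>\<^sup>+t. ennreal ((dist (x t) (y t))\<^sup>2) \<partial>leb T)"

text \<open>The modulus of continuity at \<open>x\<close> of the mean-square distance with respect
  to the Skorokhod distance. It depends on \<open>x\<close> alone, so it can be integrated against
  the limit law whatever the coupled path is.\<close>

definition path_mod :: "real => real => (real => 'a::euclidean_space) => ennreal" where
 "path_mod T \<delta> x = (SUP y\<in>{y \<in> skorokhod T. skorokhod_dist T x y < \<delta>}. path_sq T x y)"

lemma skorokhod_measurable:
 fixes x :: "real => 'a::euclidean_space"
 assumes "x \<in> skorokhod T" "0 <= T"
 shows "x \<in> borel_measurable (leb T)"
 using measurable_compose[OF measurable_Pair2'[of x "borel_on (skorokhod T) (skorokhod_dist T)" "leb T"]
 measurable_skorokhod_eval_joint[OF assms(2)]] assms(1) by simp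

lemma path_sq_measurable_arg:
 fixes x y :: "real => 'a::euclidean_space"
 assumes "x \<in> skorokhod T" "y \<in> skorokhod T" "0 <= T"
 shows "(%t. ennreal ((dist (x t) (y t))\<^sup>2)) \<in> borel_measurable (leb T)"
 using skorokhod_measurable[OF assms(1,3)] skorokhod_measurable[OF assms(2,3)] by measurable

lemma AE_leb_not_countable: "countable A ==> AE t in leb T. t \<notin> A"
proof -
 assume A: "countable A"
 have "AE t in lborel. t \<notin> A"
 by (rule AE_not_in) (simp add: countable_imp_null_set_lborel[OF A])
 thus ?thesis unfolding leb_def by (subst AE_restrict_space_iff) (auto simp: sets_lborel)
qed

text \<open>Skorokhod convergence forces convergence at the continuity times of the limit, and only
  countably many times are missing.\<close>

lemma path_sq_tendsto_AE:
 fixes x :: "real => 'a::euclidean_space"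
 assumes x: "x \<in> skorokhod T" and T: "0 <= T" and y: "!!n. y n \<in> skorokhod T"
 and lim: "(%n. skorokhod_dist T x (y n)) \<longlonglongrightarrow> 0"
 shows "AE t in leb T. (%n. y n t) \<longlonglongrightarrow> x t"
proof -
 have "cadlag_on T x" using x by (simp add: skorokhod_def)
 then obtain A where A: "countable A" "\<forall>t\<in>{0..T} - A. continuous (at t within {0..T}) x"
 using cadlag_on_countable_discont T by blast
 have "AE t in leb T. t \<in> {0..T}" using AE_space[of "leb T"] by simp
 with AE_leb_not_countable[OF A(1)] show ?thesis
 proof eventually_elim
 case (elim t)
 hence c: "continuous (at t within {0..T}) x" using A(2) by blast
 show ?case
 proof (rule tendstoI)
 fix e :: real assume "e > 0"
 from skorokhod_eval_cont[OF x elim(2) c this] obtain \<delta> where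
 \<delta>: "\<delta> > 0" "\<forall>y\<in>skorokhod T. skorokhod_dist T x y < \<delta> --> dist (x t) (y t) < e" by blast
 have "\<forall>\<^sub>F n in sequentially. skorokhod_dist T x (y n) < \<delta>" using lim \<delta>(1) by (rule order_tendstoD)
 thus "\<forall>\<^sub>F n in sequentially. dist (y n t) (x t) < e"
 by (rule eventually_mono) (subst dist_commute, use \<delta>(2) y in blast)
 qed
 qed
qed

lemma path_sq_le:
 assumes x: "x \<in> skorokhod T" and y: "y \<in> skorokhod T" and T: "0 <= T"
 shows "path_sq T x y <= ennreal (T * (path_norm T x + path_norm T y)\<^sup>2)"
proof -
 have "path_sq T x y <= (\<integral>\<^sup>+t. ennreal ((path_norm T x + path_norm T y)\<^sup>2) \<partial>leb T)" unfolding path_sq_def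
 proof (intro nn_integral_mono ennreal_leI power_mono)
 fix t assume "t \<in> space (leb T)"
 hence t: "t \<in> {0..T}" by simp
 show "dist (x t) (y t) <= path_norm T x + path_norm T y"
 using norm_le_path_norm[OF x t] norm_le_path_norm[OF y t] norm_triangle_ineq4[of "x t" "y t"] by (simp add: dist_norm)
 qed simp
 also have "\<dots> = ennreal (T * (path_norm T x + path_norm T y)\<^sup>2)"
 using T by (simp add: emeasure_leb ennreal_mult mult.commute)
 finally show ?thesis .
qed

text \<open>Dominated convergence in time: distance at most 1 bounds the norm of \<open>y n\<close>
  by that of \<open>x\<close> plus 1.\<close>

lemma path_sq_tendsto:
 fixes x :: "real => 'a::euclidean_space"
 assumes x: "x \<in> skorokhod T" and T: "0 <= T" and y: "!!n. y n \<in> skorokhod T"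
 and lim: "(%n. skorokhod_dist T x (y n)) \<longlonglongrightarrow> 0" and b: "!!n. skorokhod_dist T x (y n) <= 1"
 shows "(%n. path_sq T x (y n)) \<longlonglongrightarrow> 0"
proof -
 have "(%n. path_sq T x (y n)) \<longlonglongrightarrow> (\<integral>\<^sup>+t. 0 \<partial>leb T)"
 unfolding path_sq_def
 proof (rule nn_integral_dominated_convergence)
 show "(%t. ennreal ((dist (x t) (y n t))\<^sup>2)) \<in> borel_measurable (leb T)" for n
 by (rule path_sq_measurable_arg[OF x y T])
 let ?C = "(path_norm T x + (path_norm T x + 1))\<^sup>2"
 show "(\<integral>\<^sup>+t. ennreal ?C \<partial>leb T) < \<infinity>" using T by (simp add: emeasure_leb ennreal_mult_less_top)
 show "AE t in leb T. ennreal ((dist (x t) (y n t))\<^sup>2) <= ennreal ?C" for n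
 proof (intro AE_I2 ennreal_leI power_mono)
 fix t assume "t \<in> space (leb T)"
 hence t: "t \<in> {0..T}" by simp
 show "dist (x t) (y n t) <= path_norm T x + (path_norm T x + 1)"
 using norm_le_path_norm[OF x t] norm_le_path_norm[OF y[of n] t] norm_triangle_ineq4[of "x t" "y n t"]
 path_norm_le[OF x y[of n] T] b[of n] by (simp add: dist_norm)
 qed simp
 show "AE t in leb T. (%n. ennreal ((dist (x t) (y n t))\<^sup>2)) \<longlonglongrightarrow> 0"
 using path_sq_tendsto_AE[OF x T y lim]
 proof eventually_elim
 case (elim t)
 have "(%n. (dist (x t) (y n t))\<^sup>2) \<longlonglongrightarrow> (dist (x t) (x t))\<^sup>2" by (intro tendsto_intros elim)
 thus ?case using tendsto_ennrealI by fastforce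
 qed
 qed simp_all
 thus ?thesis by simp
qed

text \<open>If the supremum over shrinking balls did not become small, one violating path per radius
  would converge to \<open>x\<close> in the Skorokhod distance and contradict
  \<open>path_sq_tendsto\<close>.\<close>

lemma path_mod_tendsto:
 fixes x :: "real => 'a::euclidean_space"
 assumes x: "x \<in> skorokhod T" and T: "0 <= T"
 shows "(%n. path_mod T (inverse (real (Suc n))) x) \<longlonglongrightarrow> 0"
proof (rule order_tendstoI)
 fix e0 :: ennreal assume "0 < e0"
 then obtain e where e: "0 < e" "e < e0" using dense by blast
 have "\<exists>N. \<forall>y\<in>skorokhod T. skorokhod_dist T x y < inverse (real (Suc N)) --> path_sq T x y < e"
 proof (rule ccontr)
 assume "\<not> ?thesis"
 hence "\<forall>N. \<exists>y. y \<in> skorokhod T & skorokhod_dist T x y < inverse (real (Suc N)) & e <= path_sq T x y"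
 by (auto simp: not_less)
 from choice[OF this] obtain y where y: "!!n. y n \<in> skorokhod T" "!!n. skorokhod_dist T x (y n) < inverse (real (Suc n))"
 "!!n. e <= path_sq T x (y n)" by blast
 have "(%n. skorokhod_dist T x (y n)) \<longlonglongrightarrow> 0"
 by (rule real_tendsto_sandwich[OF _ _ tendsto_const LIMSEQ_inverse_real_of_nat];
 intro always_eventually allI skorokhod_dist_nonneg less_imp_le[OF y(2)])
 moreover have "skorokhod_dist T x (y n) <= 1" for n
 using y(2)[of n] by (rule less_imp_le[OF order_less_le_trans]) (simp add: inverse_le_1_iff)
 ultimately have "(%n. path_sq T x (y n)) \<longlonglongrightarrow> 0" by (intro path_sq_tendsto x T y)
 hence "\<forall>\<^sub>F n in sequentially. path_sq T x (y n) < e" using e(1) by (rule order_tendstoD)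
 then obtain n where "path_sq T x (y n) < e" unfolding eventually_sequentially by blast
 thus False using y(3)[of n] by simp
 qed
 then obtain N where N: "!!y. y\<in>skorokhod T ==> skorokhod_dist T x y < inverse (real (Suc N)) ==> path_sq T x y < e" by blast
 show "\<forall>\<^sub>F n in sequentially. path_mod T (inverse (real (Suc n))) x < e0"
 unfolding eventually_sequentially
 proof (intro exI[of _ N] allI impI)
 fix n assume "N <= n"
 hence le: "inverse (real (Suc n)) <= inverse (real (Suc N))" by simp
 have "path_mod T (inverse (real (Suc n))) x <= e" unfolding path_mod_def
 proof (rule SUP_least)
 fix y assume "y \<in> {y \<in> skorokhod T. skorokhod_dist T x y < inverse (real (Suc n))}"
 hence "y \<in> skorokhod T" "skorokhod_dist T x y < inverse (real (Suc N))"
 using order_less_le_trans[OF _ le] by blast+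
 thus "path_sq T x y <= e" using N by (simp add: less_imp_le)
 qed
 thus "path_mod T (inverse (real (Suc n))) x < e0" using e(2) by (rule le_less_trans)
 qed
qed simp

lemma path_mod_le:
 assumes x: "x \<in> skorokhod T" and T: "0 <= T" and \<delta>: "\<delta> <= 1"
 shows "path_mod T \<delta> x <= ennreal (T * (2 * path_norm T x + 1)\<^sup>2)"
 unfolding path_mod_def
proof (rule SUP_least)
 fix y assume "y \<in> {y \<in> skorokhod T. skorokhod_dist T x y < \<delta>}"
 hence y: "y \<in> skorokhod T" "skorokhod_dist T x y < \<delta>" by auto
 have "path_sq T x y <= ennreal (T * (path_norm T x + path_norm T y)\<^sup>2)" by (rule path_sq_le[OF x y(1) T])
 also have "\<dots> <= ennreal (T * (2 * path_norm T x + 1)\<^sup>2)"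
 using path_norm_le[OF x y(1) T] y(2) \<delta> T path_norm_nonneg[OF x T] path_norm_nonneg[OF y(1) T]
 by (intro ennreal_leI mult_left_mono power_mono) linarith+
 finally show "path_sq T x y <= ennreal (T * (2 * path_norm T x + 1)\<^sup>2)" .
qed

text \<open>Fatou's lemma: \<open>path_sq\<close> is lower semicontinuous in its first path.\<close>

lemma path_sq_lower:
 fixes x y :: "real => 'a::euclidean_space"
 assumes x: "x \<in> skorokhod T" and T: "0 <= T" and y: "y \<in> skorokhod T" and c: "c < path_sq T x y"
 shows "\<exists>r>0. \<forall>x'\<in>skorokhod T. skorokhod_dist T x x' < r --> c < path_sq T x' y"
proof (rule ccontr)
 assume neg: "\<not> ?thesis"
 have "\<exists>x'. x' \<in> skorokhod T & skorokhod_dist T x x' < inverse (real (Suc n)) & path_sq T x' y <= c" for n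
 proof -
 have "0 < inverse (real (Suc n))" by simp
 hence "\<not> (\<forall>x'\<in>skorokhod T. skorokhod_dist T x x' < inverse (real (Suc n)) --> c < path_sq T x' y)"
 using neg by blast
 thus ?thesis unfolding Ball_def not_all not_imp not_less by blast
 qed
 hence "\<forall>n. \<exists>x'. x' \<in> skorokhod T & skorokhod_dist T x x' < inverse (real (Suc n)) & path_sq T x' y <= c" by blast
 from choice[OF this] obtain xn where xn: "!!n. xn n \<in> skorokhod T" "!!n. skorokhod_dist T x (xn n) < inverse (real (Suc n))"
 "!!n. path_sq T (xn n) y <= c" by blast
 have lim: "(%n. skorokhod_dist T x (xn n)) \<longlonglongrightarrow> 0"
 by (rule real_tendsto_sandwich[OF _ _ tendsto_const LIMSEQ_inverse_real_of_nat];
 intro always_eventually allI skorokhod_dist_nonneg less_imp_le[OF xn(2)])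
 have "path_sq T x y = (\<integral>\<^sup>+t. liminf (%n. ennreal ((dist (xn n t) (y t))\<^sup>2)) \<partial>leb T)"
 unfolding path_sq_def
 proof (rule nn_integral_cong_AE)
 show "AE t in leb T. ennreal ((dist (x t) (y t))\<^sup>2) = liminf (%n. ennreal ((dist (xn n t) (y t))\<^sup>2))"
 using path_sq_tendsto_AE[OF x T xn(1) lim]
 proof eventually_elim
 case (elim t)
 have "(%n. ennreal ((dist (xn n t) (y t))\<^sup>2)) \<longlonglongrightarrow> ennreal ((dist (x t) (y t))\<^sup>2)"
 by (intro tendsto_intros elim)
 thus ?case using lim_imp_Liminf[OF sequentially_bot] by metis
 qed
 qed
 also have "\<dots> <= liminf (%n. path_sq T (xn n) y)" unfolding path_sq_def
 by (rule nn_integral_liminf[OF path_sq_measurable_arg[OF xn(1) y T]])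
 also have "\<dots> <= liminf (%n::nat. c)" by (intro Liminf_mono always_eventually allI xn(3))
 also have "\<dots> = c" by (simp add: Liminf_const)
 finally show False using c by simp
qed

text \<open>The supremum runs over uncountably many paths, yet its strict superlevel sets are open:
  a witness \<open>y\<close> for \<open>x\<close> is still a witness for \<open>x'\<close> as long
  as \<open>x'\<close> moves by less than the slack \<open>\<delta> - skorokhod_dist T x y\<close>
  and \<open>path_sq\<close> stays above the level by lower semicontinuity.\<close>

lemma measurable_path_mod:
 assumes T: "0 <= T"
 shows "path_mod T \<delta> \<in> borel_measurable (borel_on (skorokhod T :: (real => 'a::euclidean_space) set) (skorokhod_dist T))"
proof (rule borel_measurableI_greater)
 fix c
 show "{x \<in> space (borel_on (skorokhod T :: (real => 'a) set) (skorokhod_dist T)). c < path_mod T \<delta> x} \<in> sets (borel_on (skorokhod T) (skorokhod_dist T))"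
 proof (intro openin_in_sets_borel_on openin_metric_topologyI)
 fix x assume "x \<in> {x \<in> space (borel_on (skorokhod T :: (real => 'a) set) (skorokhod_dist T)). c < path_mod T \<delta> x}"
 hence x: "x \<in> skorokhod T" and "c < path_mod T \<delta> x" by auto
 then obtain y where y: "y \<in> skorokhod T" "skorokhod_dist T x y < \<delta>" "c < path_sq T x y"
 unfolding path_mod_def less_SUP_iff by blast
 obtain r where r: "r > 0" "\<forall>x'\<in>skorokhod T. skorokhod_dist T x x' < r --> c < path_sq T x' y"
 using path_sq_lower[OF x T y(1) y(3)] by blast
 show "\<exists>r>0. \<forall>x'\<in>skorokhod T. skorokhod_dist T x x' < r --> x' \<in> {x \<in> space (borel_on (skorokhod T) (skorokhod_dist T)). c < path_mod T \<delta> x}"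
 proof (intro exI[of _ "min r (\<delta> - skorokhod_dist T x y)"] conjI ballI impI)
 fix x' :: "real => 'a" assume x': "x' \<in> skorokhod T" "skorokhod_dist T x x' < min r (\<delta> - skorokhod_dist T x y)"
 have "skorokhod_dist T x' y <= skorokhod_dist T x' x + skorokhod_dist T x y"
 by (rule skorokhod_dist_triangle[OF x'(1) x y(1) T])
 also have "skorokhod_dist T x' x = skorokhod_dist T x x'" by (rule skorokhod_dist_commute[OF x'(1) x T])
 finally have "skorokhod_dist T x' y < \<delta>" using x'(2) by simp
 moreover have "c < path_sq T x' y" using r(2) x' by simp
 ultimately have "c < path_mod T \<delta> x'" unfolding path_mod_def less_SUP_iff using y(1) by blast
 thus "x' \<in> {x \<in> space (borel_on (skorokhod T) (skorokhod_dist T)). c < path_mod T \<delta> x}" using x'(1) by simp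
 qed (use r y in auto)
 qed auto
qed

section \<open>Coupled paths in mean square\<close>

context control_kernel
begin

lemma measurable_path_sq: "(%z. path_sq T (fst z) (snd z)) \<in> borel_measurable (BS \<Otimes>\<^sub>M (BS :: (real => 'a::euclidean_space) measure))"
proof -
 interpret leb: finite_measure "leb T" by (rule finite_measure_leb)
 let ?P = "(BS :: (real => 'a) measure) \<Otimes>\<^sub>M (BS :: (real => 'a) measure)"
 note ev = measurable_skorokhod_eval_joint[OF less_imp_le[OF T]]
 have 1: "(%z. (snd z, fst (fst z))) \<in> ?P \<Otimes>\<^sub>M leb T \<rightarrow>\<^sub>M leb T \<Otimes>\<^sub>M (BS :: (real => 'a) measure)" by measurable
 have 2: "(%z. (snd z, snd (fst z))) \<in> ?P \<Otimes>\<^sub>M leb T \<rightarrow>\<^sub>M leb T \<Otimes>\<^sub>M (BS :: (real => 'a) measure)" by measurable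
 have "(%z. fst (fst z) (snd z)) \<in> borel_measurable (?P \<Otimes>\<^sub>M leb T)" "(%z. snd (fst z) (snd z)) \<in> borel_measurable (?P \<Otimes>\<^sub>M leb T)"
 using measurable_compose[OF 1 ev] measurable_compose[OF 2 ev] by simp_all
 hence "(%z. ennreal ((dist (fst (fst z) (snd z)) (snd (fst z) (snd z)))\<^sup>2)) \<in> borel_measurable (?P \<Otimes>\<^sub>M leb T)"
 by measurable
 hence "(%(z, t). ennreal ((dist (fst z t) (snd z t))\<^sup>2)) \<in> borel_measurable (?P \<Otimes>\<^sub>M leb T)"
 by (simp add: case_prod_unfold)
 from leb.borel_measurable_nn_integral[OF this] show ?thesis by (simp add: path_sq_def[abs_def])
qed

text \<open>Pointwise, \<open>path_sq\<close> is at most \<open>g + C * dH\<^sup>2\<close>, where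
  \<open>C\<close> is fixed after \<open>g\<close> has been made small in mean; the admissible cost
  is then \<open>e / (2 * C)\<close>. The function \<open>g\<close> depends on the limit point only:
  the modulus \<open>\<omega> n\<close> serves pairs of paths closer than \<open>\<delta>\<close>,
  and \<open>b K\<close> serves limit paths of norm above \<open>K\<close>. All other pairs are at
  distance at least \<open>\<delta>\<close>, so the coupling cost pays for them.\<close>

lemma path_sq_coupling:
 fixes \<mu> :: "(('a::euclidean_space, 'b) hat) measure"
 assumes \<mu>: "\<mu> \<in> prob_moment 2 OH dH" and e: "e > 0"
 shows "\<exists>c>0. \<forall>\<nu>\<in>prob_measures OH dH. \<forall>\<pi>\<in>couplings OH dH \<mu> \<nu>.
 (\<integral>\<^sup>+z. ennreal (dH (fst z) (snd z) powr 2) \<partial>\<pi>) <= ennreal c \<longrightarrow>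
 (\<integral>\<^sup>+z. path_sq T (fst (fst z)) (fst (snd z)) \<partial>\<pi>) <= ennreal e"
proof -
 note P = prob_moment_prob[OF \<mu>]
 have sp: "space \<mu> = OH" by (rule prob_measuresD(3)[OF P])
 have T0: "0 <= T" using T by simp
 interpret prob_space \<mu> by (rule prob_measuresD(1)[OF P])
 define N where "N z = path_norm T (fst z)" for z :: "('a, 'b) hat"
 have Nm[measurable]: "N \<in> borel_measurable \<mu>" unfolding N_def[abs_def] by (rule hat_meas[OF P measurable_path_norm_BH])
 have Nsize: "(N z)\<^sup>2 <= hat_size z" for z by (simp add: N_def hat_size_def control_moment_nonneg)
 have hs[measurable]: "hat_size \<in> borel_measurable \<mu>" by (rule hat_meas[OF P measurable_hat_size])
 define \<omega> where "\<omega> n z = path_mod T (inverse (real (Suc n))) (fst z)" for n and z :: "('a, 'b) hat"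
 have \<omega>m: "\<omega> n \<in> borel_measurable \<mu>" for n unfolding \<omega>_def[abs_def]
 by (rule hat_meas[OF P measurable_compose[OF measurable_fst_BH measurable_path_mod[OF T0]]])
 have \<omega>le: "\<omega> n z <= ennreal (T * (2 * N z + 1)\<^sup>2)" if "z \<in> OH" for n z
 unfolding \<omega>_def N_def using that by (intro path_mod_le T0) (auto simp: inverse_le_1_iff)
 have "(%n. \<integral>\<^sup>+z. \<omega> n z \<partial>\<mu>) \<longlonglongrightarrow> (\<integral>\<^sup>+z. 0 \<partial>\<mu>)"
 proof (rule nn_integral_dominated_convergence[OF \<omega>m])
 show "(%z. ennreal (8 * T) * ennreal (hat_size z) + ennreal (2 * T)) \<in> borel_measurable \<mu>" by measurable
 show "AE z in \<mu>. \<omega> n z <= ennreal (8 * T) * ennreal (hat_size z) + ennreal (2 * T)" for n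
 proof (rule AE_I2)
 fix z assume "z \<in> space \<mu>"
 hence z: "z \<in> OH" by (simp add: sp)
 have "(2 * N z + 1)\<^sup>2 <= 2 * (2 * N z)\<^sup>2 + 2 * 1\<^sup>2"
 proof (rule power2_le_of_le_add)
 have "0 <= N z" unfolding N_def using z by (intro path_norm_nonneg T0) auto
 thus "0 <= 2 * N z + 1" by simp
 qed simp
 also have "\<dots> <= 8 * hat_size z + 2" using Nsize[of z] by (simp add: power_mult_distrib)
 finally have "T * (2 * N z + 1)\<^sup>2 <= T * (8 * hat_size z + 2)" using T0 by (rule mult_left_mono)
 hence "ennreal (T * (2 * N z + 1)\<^sup>2) <= ennreal (T * (8 * hat_size z + 2))" by (rule ennreal_leI)
 also have "\<dots> = ennreal (8 * T * hat_size z + 2 * T)" by (simp add: algebra_simps)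
 also have "\<dots> = ennreal (8 * T) * ennreal (hat_size z) + ennreal (2 * T)"
 using T0 hat_size_nonneg[of z] by (simp add: ennreal_mult)
 finally show "\<omega> n z <= ennreal (8 * T) * ennreal (hat_size z) + ennreal (2 * T)" using \<omega>le[OF z, of n] by (rule order_trans[rotated])
 qed
 show "(\<integral>\<^sup>+z. ennreal (8 * T) * ennreal (hat_size z) + ennreal (2 * T) \<partial>\<mu>) < \<infinity>"
 using hat_size_integrable[OF \<mu>] by (simp add: nn_integral_add nn_integral_cmult ennreal_mult_less_top emeasure_space_1)
 show "AE z in \<mu>. (%n. \<omega> n z) \<longlonglongrightarrow> 0"
 unfolding \<omega>_def by (intro AE_I2 path_mod_tendsto T0) (auto simp: sp)
 qed simp
 hence "(%n. \<integral>\<^sup>+z. \<omega> n z \<partial>\<mu>) \<longlonglongrightarrow> 0" by simp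
 hence "\<forall>\<^sub>F n in sequentially. (\<integral>\<^sup>+z. \<omega> n z \<partial>\<mu>) < ennreal (e / 4)" by (rule order_tendstoD) (use e in simp)
 then obtain n where n: "(\<integral>\<^sup>+z. \<omega> n z \<partial>\<mu>) < ennreal (e / 4)" unfolding eventually_sequentially by blast
 define b where "b K z = 8 * T * (N z)\<^sup>2 * indicator {real K<..} (N z)" for K z
 have bm[measurable]: "b K \<in> borel_measurable \<mu>" for K unfolding b_def[abs_def] by measurable
 have "(%K. \<integral>\<^sup>+z. ennreal (b K z) \<partial>\<mu>) \<longlonglongrightarrow> (\<integral>\<^sup>+z. 0 \<partial>\<mu>)"
 proof (rule nn_integral_dominated_convergence)
 show "(%z. ennreal (8 * T) * ennreal (hat_size z)) \<in> borel_measurable \<mu>" by measurable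
 show "AE z in \<mu>. ennreal (b K z) <= ennreal (8 * T) * ennreal (hat_size z)" for K
 proof (rule AE_I2)
 fix z
 have "b K z <= 8 * T * hat_size z" unfolding b_def indicator_def using T0 Nsize[of z] hat_size_nonneg[of z] by (auto intro!: mult_left_mono)
 hence "ennreal (b K z) <= ennreal (8 * T * hat_size z)" by (rule ennreal_leI)
 thus "ennreal (b K z) <= ennreal (8 * T) * ennreal (hat_size z)" using T0 hat_size_nonneg[of z] by (simp add: ennreal_mult)
 qed
 show "(\<integral>\<^sup>+z. ennreal (8 * T) * ennreal (hat_size z) \<partial>\<mu>) < \<infinity>"
 using hat_size_integrable[OF \<mu>] by (simp add: nn_integral_cmult ennreal_mult_less_top)
 show "AE z in \<mu>. (%K. ennreal (b K z)) \<longlonglongrightarrow> 0"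
 proof (rule AE_I2)
 fix z
 obtain K0 where K0: "N z <= real K0" using real_arch_simple by blast
 have "b K z = 0" if "K0 <= K" for K using that K0 by (simp add: b_def)
 hence "\<forall>\<^sub>F K in sequentially. ennreal (b K z) = 0" unfolding eventually_sequentially by (intro exI[of _ K0]) simp
 thus "(%K. ennreal (b K z)) \<longlonglongrightarrow> 0" by (rule tendsto_eventually)
 qed
 qed simp_all
 hence "(%K. \<integral>\<^sup>+z. ennreal (b K z) \<partial>\<mu>) \<longlonglongrightarrow> 0" by simp
 hence "\<forall>\<^sub>F K in sequentially. (\<integral>\<^sup>+z. ennreal (b K z) \<partial>\<mu>) < ennreal (e / 4)" by (rule order_tendstoD) (use e in simp)
 then obtain K where K: "(\<integral>\<^sup>+z. ennreal (b K z) \<partial>\<mu>) < ennreal (e / 4)" unfolding eventually_sequentially by blast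
 define \<delta> where "\<delta> = inverse (real (Suc n))"
 have \<delta>: "\<delta> > 0" by (simp add: \<delta>_def)
 \<comment> \<open>For paths at distance \<open>d \<ge> \<delta>\<close>, \<open>T * (2 * N z +
   d)\<^sup>2 \<le> 8 * T * (N z)\<^sup>2 + 2 * T * d\<^sup>2\<close>; if moreover
   \<open>N z \<le> K\<close>, the first summand is at most
   \<open>8 * T * K\<^sup>2 * d\<^sup>2 / \<delta>\<^sup>2\<close>. The two coefficients of
   \<open>d\<^sup>2\<close> add up to \<open>C\<close>.\<close>
 define C where "C = 8 * T * (real K)\<^sup>2 / \<delta>\<^sup>2 + 2 * T"
 have C: "C > 0" unfolding C_def using T by (intro add_nonneg_pos divide_nonneg_nonneg) auto
 define g where "g z = enn2real (\<omega> n z) + b K z" for z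
 have gm[measurable]: "g \<in> borel_measurable \<mu>" unfolding g_def[abs_def] using \<omega>m[of n] by measurable
 have b0: "0 <= b K z" for z using T0 by (simp add: b_def)
 have g0: "0 <= g z" for z using b0 by (simp add: g_def)
 have gi: "(\<integral>\<^sup>+z. ennreal (g z) \<partial>\<mu>) <= ennreal (e / 2)"
 proof -
 have "(\<integral>\<^sup>+z. ennreal (g z) \<partial>\<mu>) <= (\<integral>\<^sup>+z. \<omega> n z + ennreal (b K z) \<partial>\<mu>)"
 unfolding g_def using b0 by (intro nn_integral_mono) (simp add: ennreal_enn2real_if)
 also have "\<dots> = (\<integral>\<^sup>+z. \<omega> n z \<partial>\<mu>) + (\<integral>\<^sup>+z. ennreal (b K z) \<partial>\<mu>)" by (intro nn_integral_add \<omega>m) simp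
 also have "\<dots> <= ennreal (e / 4) + ennreal (e / 4)" using n K by (intro add_mono less_imp_le)
 also have "\<dots> = ennreal (e / 2)" using e by (simp add: ennreal_plus[symmetric] del: ennreal_plus)
 finally show ?thesis .
 qed
 have pt: "path_sq T (fst z) (fst w) <= ennreal (g z) + ennreal C * ennreal (dH z w powr 2)" if z: "z \<in> OH" and w: "w \<in> OH" for z w
 proof -
 let ?d = "skorokhod_dist T (fst z) (fst w)"
 have s: "fst z \<in> skorokhod T" "fst w \<in> skorokhod T" using z w by auto
 have d: "?d\<^sup>2 <= (dH z w)\<^sup>2" by (intro power_mono fst_dist_le skorokhod_dist_nonneg)
 show ?thesis
 proof (cases "?d < \<delta>")
 case True
 have "path_sq T (fst z) (fst w) <= \<omega> n z" unfolding \<omega>_def path_mod_def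
 using True s(2) by (intro SUP_upper) (simp add: \<delta>_def)
 also have "\<dots> = ennreal (enn2real (\<omega> n z))"
 using le_less_trans[OF \<omega>le[OF z, of n] ennreal_less_top] by simp
 also have "\<dots> <= ennreal (g z)" unfolding g_def using b0[of z] by (intro ennreal_leI) simp
 finally show ?thesis by (rule add_increasing2[OF zero_le])
 next
 case False
 have pn: "path_norm T (fst w) <= N z + ?d" unfolding N_def by (rule path_norm_le[OF s less_imp_le[OF T]])
 have n0: "0 <= N z" "0 <= path_norm T (fst w)" unfolding N_def by (rule path_norm_nonneg[OF _ T0]; rule s)+
 have "(N z + path_norm T (fst w))\<^sup>2 <= 2 * (2 * N z)\<^sup>2 + 2 * ?d\<^sup>2"
 using pn n0 by (intro power2_le_of_le_add) auto
 from mult_left_mono[OF this T0]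
 have "T * (N z + path_norm T (fst w))\<^sup>2 <= T * (2 * (2 * N z)\<^sup>2 + 2 * ?d\<^sup>2)" .
 also have "\<dots> = 8 * T * (N z)\<^sup>2 + 2 * T * ?d\<^sup>2" by (simp add: power_mult_distrib algebra_simps)
 finally have 1: "T * (N z + path_norm T (fst w))\<^sup>2 <= 8 * T * (N z)\<^sup>2 + 2 * T * ?d\<^sup>2" .
 have 2: "8 * T * (N z)\<^sup>2 <= b K z + 8 * T * (real K)\<^sup>2 / \<delta>\<^sup>2 * ?d\<^sup>2"
 proof (cases "real K < N z")
 case True
 hence "8 * T * (N z)\<^sup>2 = b K z" by (simp add: b_def)
 moreover have "0 <= 8 * T * (real K)\<^sup>2 / \<delta>\<^sup>2 * ?d\<^sup>2" using T0 by simp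
 ultimately show ?thesis by linarith
 next
 case F: False
 have one: "1 <= ?d\<^sup>2 / \<delta>\<^sup>2" using False \<delta> by (simp add: power_mono)
 have le: "8 * T * (N z)\<^sup>2 <= 8 * T * (real K)\<^sup>2" using F n0 T0 by (intro mult_left_mono power_mono) auto
 have z8: "0 <= 8 * T * (real K)\<^sup>2" using T0 by simp
 have "8 * T * (N z)\<^sup>2 * 1 <= 8 * T * (real K)\<^sup>2 * (?d\<^sup>2 / \<delta>\<^sup>2)"
 by (rule mult_mono[OF le one z8 zero_le_one])
 thus ?thesis using b0[of z] by simp
 qed
 have "path_sq T (fst z) (fst w) <= ennreal (T * (N z + path_norm T (fst w))\<^sup>2)"
 unfolding N_def by (rule path_sq_le[OF s T0])
 also have "\<dots> <= ennreal (g z + C * (dH z w)\<^sup>2)"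
 proof (rule ennreal_leI)
 have "C * ?d\<^sup>2 <= C * (dH z w)\<^sup>2" using d C by (intro mult_left_mono) auto
 moreover have "C * ?d\<^sup>2 = 8 * T * (real K)\<^sup>2 / \<delta>\<^sup>2 * ?d\<^sup>2 + 2 * T * ?d\<^sup>2" by (simp add: C_def distrib_right)
 moreover have "b K z <= g z" by (simp add: g_def)
 ultimately show "T * (N z + path_norm T (fst w))\<^sup>2 <= g z + C * (dH z w)\<^sup>2" using 1 2 by argo
 qed
 also have "\<dots> = ennreal (g z) + ennreal C * ennreal (dH z w powr 2)"
 using g0[of z] C dH_nonneg[of z w] by (simp add: powr_numeral ennreal_mult)
 finally show ?thesis .
 qed
 qed
 show ?thesis
 proof (intro exI[of _ "e / (2 * C)"] conjI ballI impI)
 show "0 < e / (2 * C)" using e C by simp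
 fix \<nu> \<pi> assume \<nu>: "\<nu> \<in> prob_measures OH dH" and cp: "\<pi> \<in> couplings OH dH \<mu> \<nu>"
 and cost: "(\<integral>\<^sup>+z. ennreal (dH (fst z) (snd z) powr 2) \<partial>\<pi>) <= ennreal (e / (2 * C))"
 note mc = measurable_coupling[OF cp dH_nonneg P \<nu>]
 have sp\<pi>: "space \<pi> = OH \<times> OH" by (rule couplingsD(3)[OF cp])
 have fin: "path_sq T (fst z) (fst w) < \<infinity>" if z: "z \<in> OH" and w: "w \<in> OH"
 for z w :: "('a, 'b) hat"
 using pt[OF z w] by (rule le_less_trans) (simp add: ennreal_mult_less_top)
 have m1: "(%z. (fst (fst z), fst (snd z))) \<in> \<pi> \<rightarrow>\<^sub>M (BS :: (real => 'a) measure) \<Otimes>\<^sub>M (BS :: (real => 'a) measure)"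
 by (intro measurable_Pair measurable_compose[OF mc(1) hat_meas[OF P measurable_fst_BH]]
 measurable_compose[OF mc(2) hat_meas[OF \<nu> measurable_fst_BH]])
 have m2: "(%z. path_sq T (fst (fst z)) (fst (snd z))) \<in> borel_measurable \<pi>"
 using measurable_compose[OF m1 measurable_path_sq] by simp
 have "(\<integral>\<^sup>+z. path_sq T (fst (fst z)) (fst (snd z)) \<partial>\<pi>) = (\<integral>\<^sup>+z. ennreal (enn2real (path_sq T (fst (fst z)) (fst (snd z)))) \<partial>\<pi>)"
 proof (rule nn_integral_cong)
 fix z assume "z \<in> space \<pi>"
 hence "fst z \<in> OH" "snd z \<in> OH" unfolding sp\<pi> by (simp_all only: mem_Times_iff)
 from fin[OF this] show "path_sq T (fst (fst z)) (fst (snd z)) = ennreal (enn2real (path_sq T (fst (fst z)) (fst (snd z))))" by simp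
 qed
 also have "\<dots> <= (\<integral>\<^sup>+z. ennreal (g (fst z)) \<partial>\<pi>) + ennreal C * (\<integral>\<^sup>+z. ennreal (dH (fst z) (snd z) powr 2) \<partial>\<pi>)"
 proof (rule nn_integral_le_add_nonmeasurable[OF _ measurable_compose[OF mc(1) gm] C g0])
 show "(%z. enn2real (path_sq T (fst (fst z)) (fst (snd z)))) \<in> borel_measurable \<pi>" using m2 by measurable
 fix z assume "z \<in> space \<pi>"
 hence z: "fst z \<in> OH" "snd z \<in> OH" unfolding sp\<pi> by (simp_all only: mem_Times_iff)
 thus "ennreal (enn2real (path_sq T (fst (fst z)) (fst (snd z)))) <= ennreal (g (fst z)) + ennreal C * ennreal (dH (fst z) (snd z) powr 2)"
 using pt[OF z] fin[OF z] by simp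
 qed
 also have "(\<integral>\<^sup>+z. ennreal (g (fst z)) \<partial>\<pi>) = (\<integral>\<^sup>+z. ennreal (g z) \<partial>\<mu>)"
 by (rule nn_integral_coupling(1)[OF cp dH_nonneg P \<nu> measurable_compose[OF gm measurable_ennreal]])
 also have "(\<integral>\<^sup>+z. ennreal (g z) \<partial>\<mu>) + ennreal C * (\<integral>\<^sup>+z. ennreal (dH (fst z) (snd z) powr 2) \<partial>\<pi>) <= ennreal (e / 2) + ennreal C * ennreal (e / (2 * C))"
 by (intro add_mono gi mult_left_mono cost) simp
 also have "\<dots> = ennreal e" using e C by (simp add: ennreal_mult[symmetric] ennreal_plus[symmetric] del: ennreal_plus)
 finally show "(\<integral>\<^sup>+z. path_sq T (fst (fst z)) (fst (snd z)) \<partial>\<pi>) <= ennreal e" .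
 qed
qed

end

section \<open>Time marginals\<close>

lemma sets_borel_on_UNIV_prod:
 "sets (borel_on (UNIV \<times> UNIV) (sum_dist dist dist)) = sets (borel :: ('a::euclidean_space \<times> 'a) measure)"
 by (subst sets_borel_on_sum_dist[OF zero_le_dist zero_le_dist countable_network_dist countable_network_dist])
 (simp only: borel_on_UNIV borel_prod)

text \<open>The joint law of \<open>X\<close> and \<open>Y\<close> is a coupling of their
  laws.\<close>

lemma W2_distr_le:
 fixes X Y :: "'c => 'a::euclidean_space"
 assumes "prob_space M" and X: "X \<in> borel_measurable M" and Y: "Y \<in> borel_measurable M"
 and c: "(\<integral>\<^sup>+z. ennreal ((dist (X z) (Y z))\<^sup>2) \<partial>M) <= ennreal c" "0 <= c"
 shows "W2 (distr M borel X) (distr M borel Y) <= sqrt c"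
proof (rule wasserstein2_le[OF _ _ c(2)])
 interpret prob_space M by fact
 let ?\<pi> = "distr M borel (%z. (X z, Y z))"
 have XY: "(%z. (X z, Y z)) \<in> M \<rightarrow>\<^sub>M borel" using measurable_Pair[OF X Y] by (simp add: borel_prod)
 have fs: "fst \<in> borel_measurable (borel :: ('a \<times> 'a) measure)" "snd \<in> borel_measurable (borel :: ('a \<times> 'a) measure)"
 by (intro borel_measurable_continuous_onI continuous_intros)+
 have "distr ?\<pi> (distr M borel X) fst = distr ?\<pi> borel fst" by (rule distr_cong) auto
 also have "\<dots> = distr M borel X" by (subst distr_distr[OF fs(1) XY]) (simp add: o_def)
 finally have 1: "distr ?\<pi> (distr M borel X) fst = distr M borel X" .
 have "distr ?\<pi> (distr M borel Y) snd = distr ?\<pi> borel snd" by (rule distr_cong) auto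
 also have "\<dots> = distr M borel Y" by (subst distr_distr[OF fs(2) XY]) (simp add: o_def)
 finally have 2: "distr ?\<pi> (distr M borel Y) snd = distr M borel Y" .
 have "prob_space ?\<pi>" by (rule prob_space_distr[OF XY])
 thus "?\<pi> \<in> couplings UNIV dist (distr M borel X) (distr M borel Y)"
 using 1 2 by (simp add: couplings_def prob_measures_def sets_borel_on_UNIV_prod[simplified])
 have dm: "(%z :: 'a \<times> 'a. ennreal (dist (fst z) (snd z) powr 2)) \<in> borel_measurable borel"
 using fs by measurable
 have "(\<integral>\<^sup>+z. ennreal (dist (fst z) (snd z) powr 2) \<partial>?\<pi>) = (\<integral>\<^sup>+z. ennreal (dist (X z) (Y z) powr 2) \<partial>M)"
 by (subst nn_integral_distr[OF XY]) (use dm in simp_all)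
 thus "(\<integral>\<^sup>+z. ennreal (dist (fst z) (snd z) powr 2) \<partial>?\<pi>) <= ennreal c" using c(1) by (simp add: powr_numeral)
qed

lemma W2_self:
 fixes \<mu> :: "'a::euclidean_space measure"
 assumes "prob_space \<mu>" "sets \<mu> = sets borel" shows "W2 \<mu> \<mu> = 0"
proof -
 have X: "(%x. x) \<in> borel_measurable \<mu>" using measurable_ident_sets[OF assms(2)] by simp
 have "W2 (distr \<mu> borel (%x. x)) (distr \<mu> borel (%x. x)) <= sqrt 0" by (rule W2_distr_le[OF assms(1) X X]) auto
 moreover have "distr \<mu> borel (%x. x) = \<mu>" by (rule distr_id2) (simp add: assms(2))
 ultimately show ?thesis using wasserstein_nonneg[of 2 UNIV dist \<mu> \<mu>] by simp
qed

text \<open>Such a set differs from its interior by countably many left endpoints.\<close>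

lemma right_open_borel:
 fixes G :: "real set"
 assumes G: "!!t. t \<in> G ==> t < T ==> \<exists>\<delta>>0. \<forall>s. t <= s & s < t + \<delta> & s <= T --> s \<in> G"
 shows "G \<inter> {..T} \<in> sets borel"
proof -
 define N where "N = {t \<in> G. t < T} - interior G"
 have ex: "\<exists>d>0. {t<..<t + d} \<subseteq> interior G" if t: "t \<in> N" for t
 proof -
 have t': "t \<in> G" "t < T" using t by (auto simp: N_def)
 then obtain \<delta> where \<delta>: "\<delta> > 0" "!!s. t <= s ==> s < t + \<delta> ==> s <= T ==> s \<in> G" using G[OF t'] by blast
 have "{t<..<t + min \<delta> (T - t)} \<subseteq> interior G"
 by (rule interior_maximal) (use \<delta> in auto)
 thus ?thesis using \<delta>(1) t'(2) by (intro exI[of _ "min \<delta> (T - t)"]) auto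
 qed
 \<comment> \<open>Each left endpoint is followed by an interval inside the interior. No other left
   endpoint lies in that interval, so the rationals picked as right ends are distinct and count the
   endpoints.\<close>
 have "\<exists>q. q \<in> \<rat> & t < q & {t<..q} \<subseteq> interior G" if tN: "t \<in> N" for t
 proof -
 obtain d where d: "d > 0" "{t<..<t + d} \<subseteq> interior G" using ex[OF tN] by blast
 have "t < t + d" using d(1) by simp
 then obtain q where q: "q \<in> \<rat>" "t < q" "q < t + d" using Rats_dense_in_real by blast
 have "{t<..q} \<subseteq> interior G" using d(2) q by auto
 thus ?thesis using q by blast
 qed
 hence "\<forall>t\<in>N. \<exists>q. q \<in> \<rat> & t < q & {t<..q} \<subseteq> interior G" by blast
 from bchoice[OF this] obtain q where q: "!!t. t \<in> N ==> q t \<in> \<rat>" "!!t. t \<in> N ==> t < q t"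
 "!!t. t \<in> N ==> {t<..q t} \<subseteq> interior G" by blast
 have less: "q t < t'" if "t \<in> N" "t' \<in> N" "t < t'" for t t'
 proof (rule ccontr)
 assume "\<not> q t < t'"
 hence "t' \<in> interior G" using q(3)[OF that(1)] that(3) by auto
 thus False using that(2) by (simp add: N_def)
 qed
 have "inj_on q N"
 proof (rule inj_onI)
 fix t t' assume t: "t \<in> N" "t' \<in> N" "q t = q t'"
 show "t = t'"
 using less[OF t(1,2)] less[OF t(2,1)] q(2)[OF t(1)] q(2)[OF t(2)] t(3) by (cases t t' rule: linorder_cases) auto
 qed
 moreover have "countable (q ` N)" using q(1) by (intro countable_subset[OF _ countable_rat]) auto
 ultimately have N: "countable N" using countable_image_inj_on by blast
 have cG: "countable (G \<inter> {T})" by (rule countable_finite) simp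
 have "G \<inter> {..T} = (interior G \<inter> {..T}) \<union> (N \<union> (G \<inter> {T}))" using interior_subset[of G] by (auto simp: N_def)
 moreover have "(interior G \<inter> {..T}) \<union> (N \<union> (G \<inter> {T})) \<in> sets borel"
 proof -
 have "interior G \<inter> {..T} \<in> sets borel" 
 by (rule sets.Int[OF borel_open[OF open_interior]]) simp
 moreover have "N \<in> sets borel" "G \<inter> {T} \<in> sets borel"
 using null_setsD2[OF countable_imp_null_set_lborel[OF N]] null_setsD2[OF countable_imp_null_set_lborel[OF cG]] by simp_all
 ultimately show ?thesis by (intro sets.Un)
 qed
 ultimately show ?thesis by simp
qed

definition hat_law :: "((real => 'a::euclidean_space) \<times> 'c) measure => real => 'a measure" where
 "hat_law \<nu> t = distr \<nu> borel (%z. fst z t)"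

context control_kernel
begin

lemma eval_measurable:
 fixes \<nu> :: "(('a::euclidean_space, 'b) hat) measure"
 assumes "\<nu> \<in> prob_measures OH dH" "t \<in> {0..T}" shows "(%z. fst z t) \<in> borel_measurable \<nu>"
 by (rule hat_meas[OF assms(1) measurable_eval_BH_time[OF assms(2)]])

lemma eval_le_hat_size: "z \<in> OH ==> t \<in> {0..T} ==> (norm (fst z t))\<^sup>2 <= hat_size z"
proof -
 assume z: "z \<in> OH" and t: "t \<in> {0..T}"
 have "norm (fst z t) <= path_norm T (fst z)" by (rule norm_le_path_norm[OF _ t]) (use z in auto)
 hence "(norm (fst z t))\<^sup>2 <= (path_norm T (fst z))\<^sup>2" by (intro power_mono) auto
 thus ?thesis using control_moment_nonneg[of "snd z"] unfolding hat_size_def by linarith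
qed

lemma hat_law_moment:
 fixes \<nu> :: "(('a::euclidean_space, 'b) hat) measure"
 assumes \<nu>: "\<nu> \<in> prob_moment 2 OH dH" and t: "t \<in> {0..T}"
 shows "prob_space (hat_law \<nu> t)" "sets (hat_law \<nu> t) = sets borel"
 "(\<integral>\<^sup>+x. ennreal ((norm x)\<^sup>2) \<partial>hat_law \<nu> t) <= (\<integral>\<^sup>+z. ennreal (hat_size z) \<partial>\<nu>)"
 "hat_law \<nu> t \<in> P2"
proof -
 note P = prob_moment_prob[OF \<nu>]
 note m = eval_measurable[OF P t]
 interpret prob_space \<nu> by (rule prob_measuresD(1)[OF P])
 show 1: "prob_space (hat_law \<nu> t)" unfolding hat_law_def by (rule prob_space_distr[OF m])
 show 2: "sets (hat_law \<nu> t) = sets borel" by (simp add: hat_law_def)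
 have "(\<integral>\<^sup>+x. ennreal ((norm x)\<^sup>2) \<partial>hat_law \<nu> t) = (\<integral>\<^sup>+z. ennreal ((norm (fst z t))\<^sup>2) \<partial>\<nu>)"
 unfolding hat_law_def by (rule nn_integral_distr[OF m]) measurable
 also have "\<dots> <= (\<integral>\<^sup>+z. ennreal (hat_size z) \<partial>\<nu>)"
 by (intro nn_integral_mono ennreal_leI eval_le_hat_size t) (simp add: prob_measuresD(3)[OF P])
 finally show 3: "(\<integral>\<^sup>+x. ennreal ((norm x)\<^sup>2) \<partial>hat_law \<nu> t) <= (\<integral>\<^sup>+z. ennreal (hat_size z) \<partial>\<nu>)" .
 have "(\<integral>\<^sup>+x. ennreal (dist x 0 powr 2) \<partial>hat_law \<nu> t) < \<infinity>"
 using le_less_trans[OF 3 hat_size_integrable[OF \<nu>]] by (simp add: powr_numeral)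
 hence "\<exists>x0\<in>UNIV. (\<integral>\<^sup>+x. ennreal (dist x x0 powr 2) \<partial>hat_law \<nu> t) < \<infinity>" by blast
 thus "hat_law \<nu> t \<in> P2" using 1 2 unfolding prob_moment_def prob_measures_def borel_on_UNIV by blast
qed

lemma second_moment_hat_law:
 fixes \<nu> :: "(('a::euclidean_space, 'b) hat) measure"
 assumes \<nu>: "\<nu> \<in> prob_moment 2 OH dH" and t: "t \<in> {0..T}" and c: "(\<integral>\<^sup>+z. ennreal (hat_size z) \<partial>\<nu>) <= ennreal c" "0 <= c"
 shows "second_moment (hat_law \<nu> t) <= c"
proof -
 have m: "(%x. (norm x)\<^sup>2) \<in> borel_measurable (hat_law \<nu> t)"
 unfolding measurable_cong_sets[OF hat_law_moment(2)[OF \<nu> t] refl] by measurable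
 have "second_moment (hat_law \<nu> t) = enn2real (\<integral>\<^sup>+x. ennreal ((norm x)\<^sup>2) \<partial>hat_law \<nu> t)"
 unfolding second_moment_def by (rule integral_eq_nn_integral[OF m]) simp
 also have "\<dots> <= c" by (rule enn2real_leI[OF c(2) order_trans[OF hat_law_moment(3)[OF \<nu> t] c(1)]])
 finally show ?thesis .
qed

text \<open>Paths are right-continuous with squared increments dominated by
  \<open>4 * hat_size\<close>, so the mean squared increment vanishes along every sequence of times
  decreasing to \<open>t\<close>, and \<open>W2_distr_le\<close> applies.\<close>

lemma hat_law_right_cont:
 fixes \<nu> :: "(('a::euclidean_space, 'b) hat) measure"
 assumes \<nu>: "\<nu> \<in> prob_moment 2 OH dH" and t: "0 <= t" "t < T" and e: "e > 0"
 shows "\<exists>\<delta>>0. \<forall>s. t <= s & s < t + \<delta> & s <= T --> W2 (hat_law \<nu> t) (hat_law \<nu> s) < e"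
proof (rule ccontr)
 assume neg: "\<not> ?thesis"
 note P = prob_moment_prob[OF \<nu>]
 interpret prob_space \<nu> by (rule prob_measuresD(1)[OF P])
 have sp: "space \<nu> = OH" by (rule prob_measuresD(3)[OF P])
 have "\<exists>s. t <= s & s < t + inverse (real (Suc n)) & s <= T & e <= W2 (hat_law \<nu> t) (hat_law \<nu> s)" for n
 proof -
 have "0 < inverse (real (Suc n))" by simp
 hence "\<not> (\<forall>s. t <= s & s < t + inverse (real (Suc n)) & s <= T --> W2 (hat_law \<nu> t) (hat_law \<nu> s) < e)"
 using neg by blast
 thus ?thesis unfolding not_all not_imp not_less by blast
 qed
 hence "\<forall>n. \<exists>s. t <= s & s < t + inverse (real (Suc n)) & s <= T & e <= W2 (hat_law \<nu> t) (hat_law \<nu> s)" by blast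
 from choice[OF this] obtain s where s: "!!n. t <= s n" "!!n. s n < t + inverse (real (Suc n))" "!!n. s n <= T"
 "!!n. e <= W2 (hat_law \<nu> t) (hat_law \<nu> (s n))" by blast
 have tT: "t \<in> {0..T}" "s n \<in> {0..T}" for n using t s(1,3)[of n] by auto
 have sn: "t < s n" for n
 proof (rule ccontr)
 assume "\<not> t < s n"
 hence "s n = t" using s(1)[of n] by simp
 thus False using s(4)[of n] W2_self[OF hat_law_moment(1,2)[OF \<nu> tT(1)]] e by simp
 qed
 have "(%n. t + inverse (real (Suc n))) \<longlonglongrightarrow> t + 0" by (intro tendsto_intros LIMSEQ_inverse_real_of_nat)
 hence lim0: "(%n. t + inverse (real (Suc n))) \<longlonglongrightarrow> t" by simp
 have "s \<longlonglongrightarrow> t"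
 by (rule real_tendsto_sandwich[OF _ _ tendsto_const lim0]; intro always_eventually allI s(1) less_imp_le[OF s(2)])
 hence sr: "filterlim s (at_right t) sequentially"
 unfolding filterlim_at using sn by (simp add: less_imp_neq[symmetric])
 have "(%n. \<integral>\<^sup>+z. ennreal ((dist (fst z t) (fst z (s n)))\<^sup>2) \<partial>\<nu>) \<longlonglongrightarrow> (\<integral>\<^sup>+z. 0 \<partial>\<nu>)"
 proof (rule nn_integral_dominated_convergence)
 show "(%z. ennreal ((dist (fst z t) (fst z (s n)))\<^sup>2)) \<in> borel_measurable \<nu>" for n
 using eval_measurable[OF P tT(1)] eval_measurable[OF P tT(2)[of n]] by measurable
 have hs: "(%z. ennreal (hat_size z)) \<in> borel_measurable \<nu>"
 by (rule measurable_compose[OF hat_meas[OF P measurable_hat_size] measurable_ennreal])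
 show "(%z. 4 * ennreal (hat_size z)) \<in> borel_measurable \<nu>" using hs by measurable
 show "(\<integral>\<^sup>+z. 4 * ennreal (hat_size z) \<partial>\<nu>) < \<infinity>"
 using hat_size_integrable[OF \<nu>] hs by (simp add: nn_integral_cmult ennreal_mult_less_top)
 show "AE z in \<nu>. ennreal ((dist (fst z t) (fst z (s n)))\<^sup>2) <= 4 * ennreal (hat_size z)" for n
 proof (rule AE_I2)
 fix z assume "z \<in> space \<nu>"
 hence z: "z \<in> OH" by (simp add: sp)
 have "(dist (fst z t) (fst z (s n)))\<^sup>2 <= 4 * hat_size z"
 using dist_power2_le[of "fst z t" "fst z (s n)"] eval_le_hat_size[OF z tT(1)] eval_le_hat_size[OF z tT(2)[of n]] by linarith
 hence "ennreal ((dist (fst z t) (fst z (s n)))\<^sup>2) <= ennreal (4 * hat_size z)" by (rule ennreal_leI)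
 thus "ennreal ((dist (fst z t) (fst z (s n)))\<^sup>2) <= 4 * ennreal (hat_size z)"
 by (simp add: ennreal_mult hat_size_nonneg)
 qed
 show "AE z in \<nu>. (%n. ennreal ((dist (fst z t) (fst z (s n)))\<^sup>2)) \<longlonglongrightarrow> 0"
 proof (rule AE_I2)
 fix z assume "z \<in> space \<nu>"
 hence "fst z \<in> skorokhod T" by (auto simp: sp)
 hence "(fst z \<longlongrightarrow> fst z t) (at_right t)" using t by (auto simp: skorokhod_def cadlag_on_def)
 from filterlim_compose[OF this sr] have "(%n. fst z (s n)) \<longlonglongrightarrow> fst z t" .
 hence "(%n. ennreal ((dist (fst z t) (fst z (s n)))\<^sup>2)) \<longlonglongrightarrow> ennreal ((dist (fst z t) (fst z t))\<^sup>2)"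
 by (intro tendsto_intros)
 thus "(%n. ennreal ((dist (fst z t) (fst z (s n)))\<^sup>2)) \<longlonglongrightarrow> 0" by simp
 qed
 qed simp
 hence "(%n. \<integral>\<^sup>+z. ennreal ((dist (fst z t) (fst z (s n)))\<^sup>2) \<partial>\<nu>) \<longlonglongrightarrow> 0" by simp
 hence "\<forall>\<^sub>F n in sequentially. (\<integral>\<^sup>+z. ennreal ((dist (fst z t) (fst z (s n)))\<^sup>2) \<partial>\<nu>) < ennreal ((e / 2)\<^sup>2)"
 by (rule order_tendstoD) (use e in simp)
 then obtain n where n: "(\<integral>\<^sup>+z. ennreal ((dist (fst z t) (fst z (s n)))\<^sup>2) \<partial>\<nu>) < ennreal ((e / 2)\<^sup>2)"
 unfolding eventually_sequentially by blast
 have "W2 (hat_law \<nu> t) (hat_law \<nu> (s n)) <= sqrt ((e / 2)\<^sup>2)" unfolding hat_law_def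
 by (rule W2_distr_le[OF prob_space_axioms eval_measurable[OF P tT(1)] eval_measurable[OF P tT(2)] less_imp_le[OF n]]) simp
 thus False using s(4)[of n] e by simp
qed

text \<open>By right-continuity the preimage of a \<open>W2\<close>-open set contains, with each
  time before \<open>T\<close>, a short interval to its right, and such sets are Borel. This allows
  the marginal to be inserted into \<open>\<phi>\<close>, which is measurable for the Borel sets of
  \<open>W2\<close>.\<close>

lemma measurable_hat_law:
 fixes \<nu> :: "(('a::euclidean_space, 'b) hat) measure"
 assumes \<nu>: "\<nu> \<in> prob_moment 2 OH dH"
 shows "hat_law \<nu> \<in> leb T \<rightarrow>\<^sub>M borel_on P2 W2"
proof (rule measurable_sigma_sets[OF sets_borel_on])
 show "{V. openin (metric_topology P2 W2) V} \<subseteq> Pow P2" by (auto simp: openin_metric_topology)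
 show "hat_law \<nu> \<in> space (leb T) \<rightarrow> P2" using hat_law_moment(4)[OF \<nu>] by auto
 fix V :: "'a measure set" assume "V \<in> {V. openin (metric_topology P2 W2) V}"
 hence V: "!!x. x \<in> V ==> \<exists>r>0. \<forall>y\<in>P2. W2 x y < r --> y \<in> V" by (auto simp: openin_metric_topology)
 let ?G = "hat_law \<nu> -` V \<inter> {0..T}"
 have "?G \<inter> {..T} \<in> sets borel"
 proof (rule right_open_borel)
 fix t assume t: "t \<in> ?G" "t < T"
 then obtain r where r: "r > 0" "\<forall>y\<in>P2. W2 (hat_law \<nu> t) y < r --> y \<in> V" using V by blast
 have "0 <= t" using t by simp
 from hat_law_right_cont[OF \<nu> this t(2) r(1)]
 obtain \<delta> where \<delta>: "\<delta> > 0" "\<forall>s. t <= s & s < t + \<delta> & s <= T --> W2 (hat_law \<nu> t) (hat_law \<nu> s) < r" by blast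
 have "s \<in> ?G" if "t <= s & s < t + \<delta> & s <= T" for s
 proof -
 have s: "s \<in> {0..T}" using that \<open>0 <= t\<close> by simp
 thus ?thesis using r(2) \<delta>(2) that hat_law_moment(4)[OF \<nu> s] by blast
 qed
 thus "\<exists>\<delta>>0. \<forall>s. t <= s & s < t + \<delta> & s <= T --> s \<in> ?G" using \<delta>(1) by blast
 qed
 moreover have "?G \<inter> {..T} = {0..T} \<inter> (?G \<inter> {..T})" "?G \<inter> {..T} = ?G" by auto
 ultimately have "?G \<in> sets (leb T)" unfolding sets_leb sets_restrict_space by (metis imageI)
 thus "hat_law \<nu> -` V \<inter> space (leb T) \<in> sets (leb T)" by simp
qed

end

text \<open>One law \<open>\<mu>\<close> coupled with each \<open>\<nu> k\<close>. The rate
  \<open>(1 / 2) ^ k\<close> is summable, so time marginals will converge almost everywhere along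
  the whole sequence and not merely along a subsequence.\<close>

locale coupled_sequence = control_kernel T p U \<kappa>
 for T p :: real and U :: "'b::euclidean_space set" and \<kappa> +
 fixes \<mu> :: "(('a::euclidean_space, 'b) hat) measure"
 and \<nu> :: "nat => (('a, 'b) hat) measure"
 and \<pi> :: "nat => ((('a, 'b) hat) \<times> (('a, 'b) hat)) measure"
 and c :: "nat => real"
 assumes \<mu>: "\<mu> \<in> prob_moment 2 OH dH" and \<nu>: "!!k. \<nu> k \<in> prob_moment 2 OH dH"
 and \<pi>: "!!k. \<pi> k \<in> couplings OH dH \<mu> (\<nu> k)"
 and cost: "!!k. (\<integral>\<^sup>+z. ennreal (dH (fst z) (snd z) powr 2) \<partial>\<pi> k) <= ennreal (c k)"
 and c: "!!k. 0 <= c k" "c \<longlonglongrightarrow> 0"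
 and sq: "!!k. (\<integral>\<^sup>+z. path_sq T (fst (fst z)) (fst (snd z)) \<partial>\<pi> k) <= ennreal ((1 / 2) ^ k)"
begin

lemmas \<mu>P = prob_moment_prob[OF \<mu>]
lemmas \<nu>P = prob_moment_prob[OF \<nu>]
lemmas \<pi>_meas = measurable_coupling[OF \<pi> dH_nonneg \<mu>P \<nu>P]

lemma \<pi>_prob: "prob_space (\<pi> k)" by (rule couplingsD(1)[OF \<pi>])
lemma \<pi>_space: "space (\<pi> k) = OH \<times> OH" by (rule couplingsD(3)[OF \<pi>])

lemma eval_joint_fst: "(%x. fst (fst (snd x)) (fst x)) \<in> borel_measurable (leb T \<Otimes>\<^sub>M \<pi> k)"
proof -
 have 1: "(%x. (fst x, fst (snd x))) \<in> leb T \<Otimes>\<^sub>M \<pi> k \<rightarrow>\<^sub>M leb T \<Otimes>\<^sub>M \<mu>"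
 by (intro measurable_Pair measurable_fst measurable_compose[OF measurable_snd \<pi>_meas(1)])
 have "leb T \<Otimes>\<^sub>M \<mu> \<rightarrow>\<^sub>M borel = leb T \<Otimes>\<^sub>M BH \<rightarrow>\<^sub>M (borel :: 'a measure)"
 by (intro measurable_cong_sets sets_pair_measure_cong refl prob_measuresD(2)[OF \<mu>P])
 hence 2: "(%z. fst (snd z) (fst z)) \<in> borel_measurable (leb T \<Otimes>\<^sub>M \<mu>)" using measurable_eval_BH by simp
 show ?thesis using measurable_compose[OF 1 2] by simp
qed

lemma eval_joint_snd: "(%x. fst (snd (snd x)) (fst x)) \<in> borel_measurable (leb T \<Otimes>\<^sub>M \<pi> k)"
proof -
 have 1: "(%x. (fst x, snd (snd x))) \<in> leb T \<Otimes>\<^sub>M \<pi> k \<rightarrow>\<^sub>M leb T \<Otimes>\<^sub>M \<nu> k"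
 by (intro measurable_Pair measurable_fst measurable_compose[OF measurable_snd \<pi>_meas(2)])
 have "leb T \<Otimes>\<^sub>M \<nu> k \<rightarrow>\<^sub>M borel = leb T \<Otimes>\<^sub>M BH \<rightarrow>\<^sub>M (borel :: 'a measure)"
 by (intro measurable_cong_sets sets_pair_measure_cong refl prob_measuresD(2)[OF \<nu>P])
 hence 2: "(%z. fst (snd z) (fst z)) \<in> borel_measurable (leb T \<Otimes>\<^sub>M \<nu> k)" using measurable_eval_BH by simp
 show ?thesis using measurable_compose[OF 1 2] by simp
qed

lemma nn_integral_path_sq:
 "(\<integral>\<^sup>+x. ennreal ((dist (fst (fst (snd x)) (fst x)) (fst (snd (snd x)) (fst x)))\<^sup>2) \<partial>(leb T \<Otimes>\<^sub>M \<pi> k)) <= ennreal ((1 / 2) ^ k)"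
proof -
 interpret \<pi>: prob_space "\<pi> k" by (rule \<pi>_prob)
 interpret leb: finite_measure "leb T" by (rule finite_measure_leb)
 interpret P: pair_sigma_finite "leb T" "\<pi> k" ..
 let ?f = "%x. ennreal ((dist (fst (fst (snd x)) (fst x)) (fst (snd (snd x)) (fst x)))\<^sup>2)"
 have m: "?f \<in> borel_measurable (leb T \<Otimes>\<^sub>M \<pi> k)" using eval_joint_fst eval_joint_snd by measurable
 hence m': "(%(t, z). ?f (t, z)) \<in> borel_measurable (leb T \<Otimes>\<^sub>M \<pi> k)" by (simp add: case_prod_unfold)
 have "(\<integral>\<^sup>+x. ?f x \<partial>(leb T \<Otimes>\<^sub>M \<pi> k)) = (\<integral>\<^sup>+z. \<integral>\<^sup>+t. ?f (t, z) \<partial>leb T \<partial>\<pi> k)"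
 using P.nn_integral_snd[OF m'] by (simp add: case_prod_unfold)
 also have "\<dots> = (\<integral>\<^sup>+z. path_sq T (fst (fst z)) (fst (snd z)) \<partial>\<pi> k)" by (simp add: path_sq_def)
 finally show ?thesis using sq[of k] by simp
qed

text \<open>The time integrals of the mean squared distances are summable, so at almost every time
  the series of mean squared distances is finite and its terms tend to 0; they dominate the squared
  \<open>W2\<close> distances.\<close>

lemma hat_law_tendsto: "AE t in leb T. (%k. W2 (hat_law \<mu> t) (hat_law (\<nu> k) t)) \<longlonglongrightarrow> 0"
proof -
 let ?f = "%x. ennreal ((dist (fst (fst (snd x)) (fst x)) (fst (snd (snd x)) (fst x)))\<^sup>2)"
 define a where "a k t = (\<integral>\<^sup>+z. ?f (t, z) \<partial>\<pi> k)" for k t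
 have fm: "?f \<in> borel_measurable (leb T \<Otimes>\<^sub>M \<pi> k)" for k using eval_joint_fst eval_joint_snd by measurable
 have am: "a k \<in> borel_measurable (leb T)" for k
 proof -
 interpret \<pi>: prob_space "\<pi> k" by (rule \<pi>_prob)
 have "(%(t, z). ?f (t, z)) \<in> borel_measurable (leb T \<Otimes>\<^sub>M \<pi> k)" using fm by (simp add: case_prod_unfold)
 from \<pi>.borel_measurable_nn_integral[OF this] show ?thesis by (simp add: a_def[abs_def])
 qed
 have ai: "(\<integral>\<^sup>+t. a k t \<partial>leb T) <= ennreal ((1 / 2) ^ k)" for k
 proof -
 interpret \<pi>: prob_space "\<pi> k" by (rule \<pi>_prob)
 show ?thesis using \<pi>.nn_integral_fst[OF fm] nn_integral_path_sq[of k] by (simp add: a_def)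
 qed
 have "(\<integral>\<^sup>+t. (\<Sum>k. a k t) \<partial>leb T) = (\<Sum>k. \<integral>\<^sup>+t. a k t \<partial>leb T)" by (rule nn_integral_suminf[OF am])
 also have "\<dots> <= (\<Sum>k. ennreal ((1 / 2) ^ k))" by (intro suminf_le ai) auto
 also have "\<dots> = ennreal (\<Sum>k. (1 / 2) ^ k)" by (intro suminf_ennreal2) (auto intro!: summable_geometric)
 also have "\<dots> < \<infinity>" by simp
 finally have "(\<integral>\<^sup>+t. (\<Sum>k. a k t) \<partial>leb T) ~= \<infinity>" by simp
 moreover have "(%t. \<Sum>k. a k t) \<in> borel_measurable (leb T)" using am by measurable
 ultimately have "AE t in leb T. (\<Sum>k. a k t) ~= \<infinity>" by (intro nn_integral_noteq_infinite)
 moreover have "AE t in leb T. t \<in> {0..T}" using AE_space[of "leb T"] by simp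
 ultimately show ?thesis
 proof eventually_elim
 case (elim t)
 define b where "b k = enn2real (a k t)" for k
 have le: "a k t <= (\<Sum>k. a k t)" for k using sum_le_suminf[OF summableI, of "{k}" "%k. a k t"] by simp
 have "(\<Sum>k. a k t) < \<infinity>" using elim(1) by (simp add: top.not_eq_extremum)
 hence fin: "a k t < \<infinity>" for k by (rule le_less_trans[OF le])
 hence ab: "a k t = ennreal (b k)" for k by (simp add: b_def)
 have "summable b"
 using elim(1) unfolding ab by (intro summable_suminf_not_top) (auto simp: b_def)
 hence "b \<longlonglongrightarrow> 0" by (rule summable_LIMSEQ_zero)
 hence "(%k. sqrt (b k)) \<longlonglongrightarrow> sqrt 0" by (rule tendsto_real_sqrt)
 hence lim: "(%k. sqrt (b k)) \<longlonglongrightarrow> 0" by simp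
 have "W2 (hat_law \<mu> t) (hat_law (\<nu> k) t) <= sqrt (b k)" for k
 proof -
 have X: "(%z. fst (fst z) t) \<in> borel_measurable (\<pi> k)" "(%z. fst (snd z) t) \<in> borel_measurable (\<pi> k)"
 by (rule measurable_compose[OF \<pi>_meas(1) eval_measurable[OF \<mu>P elim(2)]] measurable_compose[OF \<pi>_meas(2) eval_measurable[OF \<nu>P elim(2)]])+
 have "(\<integral>\<^sup>+z. ennreal ((dist (fst (fst z) t) (fst (snd z) t))\<^sup>2) \<partial>\<pi> k) <= ennreal (b k)"
 unfolding ab[symmetric] a_def by simp
 from W2_distr_le[OF \<pi>_prob X this]
 have "W2 (distr (\<pi> k) borel (%z. fst (fst z) t)) (distr (\<pi> k) borel (%z. fst (snd z) t)) <= sqrt (b k)"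
 by (simp add: b_def)
 moreover have "distr (\<pi> k) borel (%z. fst (fst z) t) = hat_law \<mu> t"
 using distr_distr[OF eval_measurable[OF \<mu>P elim(2)] \<pi>_meas(1)[of k]] couplingsD(4)[OF \<pi>[of k]]
 by (simp add: hat_law_def o_def)
 moreover have "distr (\<pi> k) borel (%z. fst (snd z) t) = hat_law (\<nu> k) t"
 using distr_distr[OF eval_measurable[OF \<nu>P elim(2)] \<pi>_meas(2)[of k]] couplingsD(5)[OF \<pi>[of k]]
 by (simp add: hat_law_def o_def)
 ultimately show ?thesis by simp
 qed
 thus ?case
 by (intro real_tendsto_sandwich[OF _ _ tendsto_const lim] always_eventually allI wasserstein_nonneg)
 qed
qed

text \<open>The convergent costs \<open>c\<close> are bounded, so
  \<open>hat_size_coupling_le\<close> yields one \<open>K\<close> for all laws.\<close>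

lemma hat_size_bound: "\<exists>K>0. (\<integral>\<^sup>+z. ennreal (hat_size z) \<partial>\<mu>) <= ennreal K & (\<forall>k. (\<integral>\<^sup>+z. ennreal (hat_size z) \<partial>\<nu> k) <= ennreal K)"
proof -
 obtain m where m: "0 <= m" "(\<integral>\<^sup>+z. ennreal (hat_size z) \<partial>\<mu>) = ennreal m"
 using hat_size_integrable[OF \<mu>] by (cases "\<integral>\<^sup>+z. ennreal (hat_size z) \<partial>\<mu>") auto
 have "Bseq c" by (rule convergent_imp_Bseq[OF convergentI[OF c(2)]])
 then obtain B where B: "B > 0" "!!k. norm (c k) <= B" by (auto simp: Bseq_def)
 let ?K = "2 * m + 4 * B"
 have "(\<integral>\<^sup>+z. ennreal (hat_size z) \<partial>\<nu> k) <= ennreal ?K" for k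
 proof -
 have "(\<integral>\<^sup>+z. ennreal (hat_size z) \<partial>\<nu> k) <= 2 * (\<integral>\<^sup>+z. ennreal (hat_size z) \<partial>\<mu>) + ennreal 4 * ennreal (c k)"
 by (rule hat_size_coupling_le[OF \<pi> \<mu>P \<nu>P cost])
 also have "\<dots> = ennreal (2 * m + 4 * c k)" unfolding m using m(1) c(1)[of k] by (simp add: ennreal_mult)
 also have "\<dots> <= ennreal ?K" using B(2)[of k] by (intro ennreal_leI) auto
 finally show ?thesis .
 qed
 moreover have "(\<integral>\<^sup>+z. ennreal (hat_size z) \<partial>\<mu>) <= ennreal ?K" unfolding m using m(1) B(1) by (intro ennreal_leI) auto
 ultimately show ?thesis using m(1) B(1) by (intro exI[of _ ?K]) auto
qed

end

section \<open>Stable convergence of the controls\<close>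

text \<open>The range keeps the class stable under products and all integrals finite; Lipschitz
  continuity, with an unspecified constant, is what a Wasserstein cost can control.\<close>

definition unit_lipschitz :: "('c::metric_space => real) => bool" where
 "unit_lipschitz f \<longleftrightarrow> (\<forall>x. 0 <= f x & f x <= 1) & (\<exists>L>0. \<forall>x y. \<bar>f x - f y\<bar> <= L * dist x y)"

lemma unit_lipschitzD: "unit_lipschitz f ==> 0 <= f x" "unit_lipschitz f ==> f x <= 1"
 by (auto simp: unit_lipschitz_def)

lemma unit_lipschitz_borel:
 assumes "unit_lipschitz f" shows "f \<in> borel_measurable borel"
proof -
 obtain L where L: "L > 0" "!!x y. \<bar>f x - f y\<bar> <= L * dist x y" using assms by (auto simp: unit_lipschitz_def)
 have "continuous_on UNIV f"
 proof (rule continuous_onI)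
 fix x :: 'a and e :: real assume "e > 0"
 have "dist (f y) (f x) <= e" if "dist y x < e / L" for y
 using L(2)[of y x] that L(1) by (simp add: dist_real_def field_simps)
 thus "\<exists>d>0. \<forall>y\<in>UNIV. dist y x < d --> dist (f y) (f x) <= e"
 using \<open>e > 0\<close> L(1) by (intro exI[of _ "e / L"]) auto
 qed
 thus ?thesis by (rule borel_measurable_continuous_onI)
qed

section \<open>Kernel means of test functions\<close>

context control_kernel
begin

definition kmean :: "('b => real) => real => (real \<times> 'b) measure => real" where
 "kmean g t q = enn2real (\<integral>\<^sup>+u. ennreal (g u) \<partial>\<kappa> q t)"

lemma measurable_BU: "g \<in> borel \<rightarrow>\<^sub>M N ==> g \<in> BU \<rightarrow>\<^sub>M N"
 by (rule measurable_restrict_space1)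

lemma kmean_bounds:
 assumes g: "!!u. 0 <= g u" "!!u. g u <= 1" and q: "q \<in> controls T U p" "t \<in> {0..T}"
 shows "(\<integral>\<^sup>+u. ennreal (g u) \<partial>\<kappa> q t) = ennreal (kmean g t q)" "0 <= kmean g t q" "kmean g t q <= 1"
proof -
 interpret prob_space "\<kappa> q t" by (rule kernel_space[OF q])
 have "(\<integral>\<^sup>+u. ennreal (g u) \<partial>\<kappa> q t) <= (\<integral>\<^sup>+u. 1 \<partial>\<kappa> q t)" using g by (intro nn_integral_mono) simp
 also have "\<dots> = 1" by (simp add: emeasure_space_1)
 finally have le: "(\<integral>\<^sup>+u. ennreal (g u) \<partial>\<kappa> q t) <= 1" .
 thus "(\<integral>\<^sup>+u. ennreal (g u) \<partial>\<kappa> q t) = ennreal (kmean g t q)"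
 unfolding kmean_def by (simp add: le_less_trans)
 show "0 <= kmean g t q" by (simp add: kmean_def)
 show "kmean g t q <= 1" unfolding kmean_def by (rule enn2real_leI) (use le in simp_all)
qed

lemma measurable_kmean:
 assumes g: "g \<in> borel_measurable borel"
 shows "(%y. kmean g (fst y) (snd (snd y))) \<in> borel_measurable (leb T \<Otimes>\<^sub>M BH)"
proof -
 have "(%(x, u). ennreal (g u)) \<in> borel_measurable ((leb T \<Otimes>\<^sub>M BH) \<Otimes>\<^sub>M BU)"
 using measurable_compose[OF measurable_snd measurable_compose[OF measurable_BU[OF g] measurable_ennreal]]
 by (simp add: case_prod_unfold)
 from nn_integral_measurable_subprob_algebra2[OF this measurable_kernel_BH]
 show ?thesis unfolding kmean_def by measurable
qed

text \<open>Kernels at single times are invisible to \<open>controls_dist\<close>; averaged against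
  a weight in time they become integrals against \<open>q\<close>, which it controls.\<close>

lemma integral_kmean:
 assumes q: "q \<in> controls T U p" and g: "unit_lipschitz g" and c: "unit_lipschitz c"
 shows "(\<integral>z. c (fst z) * g (snd z) \<partial>q) = (\<integral>t. c t * kmean g t q \<partial>leb T)"
 and "(%t. kmean g t q) \<in> borel_measurable (leb T)"
 and "(%z. c (fst z) * g (snd z)) \<in> borel_measurable BE"
proof -
 note g01 = unit_lipschitzD[OF g] and c01 = unit_lipschitzD[OF c]
 have cm: "(%z. c (fst z)) \<in> borel_measurable BE"
 by (intro measurable_restrict_space1 measurable_compose[OF _ unit_lipschitz_borel[OF c]] borel_measurable_continuous_onI continuous_intros)
 have gm: "(%z. g (snd z)) \<in> borel_measurable BE"
 by (intro measurable_restrict_space1 measurable_compose[OF _ unit_lipschitz_borel[OF g]] borel_measurable_continuous_onI continuous_intros)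
 show m: "(%z. c (fst z) * g (snd z)) \<in> borel_measurable BE" using cm gm by (rule borel_measurable_times)
 have gu: "(%u. ennreal (g u)) \<in> borel_measurable BU"
 by (rule measurable_compose[OF measurable_BU[OF unit_lipschitz_borel[OF g]] measurable_ennreal])
 have "(%t. \<integral>\<^sup>+u. ennreal (g (snd (t, u))) \<partial>\<kappa> q t) \<in> borel_measurable (leb T)"
 by (rule kernel_nn_integral_measurable_time[OF measurable_compose[OF gm measurable_ennreal] q])
 hence "(%t. \<integral>\<^sup>+u. ennreal (g u) \<partial>\<kappa> q t) \<in> borel_measurable (leb T)" by simp
 from measurable_compose[OF this borel_measurable_enn2real[OF measurable_ident_sets[OF refl]]]
 show km: "(%t. kmean g t q) \<in> borel_measurable (leb T)" unfolding kmean_def .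
 have "(\<integral>z. c (fst z) * g (snd z) \<partial>q) = enn2real (\<integral>\<^sup>+z. ennreal (c (fst z) * g (snd z)) \<partial>q)"
 by (rule integral_eq_nn_integral[OF controls_measurable[OF q m]]) (simp add: c01 g01)
 also have "(\<integral>\<^sup>+z. ennreal (c (fst z) * g (snd z)) \<partial>q) = (\<integral>\<^sup>+t. \<integral>\<^sup>+u. ennreal (c (fst (t, u)) * g (snd (t, u))) \<partial>\<kappa> q t \<partial>leb T)"
 by (rule nn_integral_disintegration[OF q measurable_compose[OF m measurable_ennreal]])
 also have "\<dots> = (\<integral>\<^sup>+t. ennreal (c t * kmean g t q) \<partial>leb T)"
 proof (rule nn_integral_cong)
 fix t assume "t \<in> space (leb T)"
 hence t: "t \<in> {0..T}" by simp
 have "(\<integral>\<^sup>+u. ennreal (c (fst (t, u)) * g (snd (t, u))) \<partial>\<kappa> q t) = (\<integral>\<^sup>+u. ennreal (c t) * ennreal (g u) \<partial>\<kappa> q t)"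
 by (simp add: ennreal_mult c01 g01)
 also have "\<dots> = ennreal (c t) * (\<integral>\<^sup>+u. ennreal (g u) \<partial>\<kappa> q t)"
 by (rule nn_integral_cmult[OF kernel_measurable_fun[OF q t gu]])
 also have "\<dots> = ennreal (c t * kmean g t q)"
 by (simp add: kmean_bounds[OF g01 q t] ennreal_mult c01)
 finally show "(\<integral>\<^sup>+u. ennreal (c (fst (t, u)) * g (snd (t, u))) \<partial>\<kappa> q t) = ennreal (c t * kmean g t q)" .
 qed
 also have "enn2real (\<integral>\<^sup>+t. ennreal (c t * kmean g t q) \<partial>leb T) = (\<integral>t. c t * kmean g t q \<partial>leb T)"
 proof (rule integral_eq_nn_integral[symmetric])
 have "c \<in> borel_measurable (leb T)" using measurable_compose[OF measurable_leb_id unit_lipschitz_borel[OF c]] .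
 thus "(%t. c t * kmean g t q) \<in> borel_measurable (leb T)" using km by (rule borel_measurable_times)
 show "AE t in leb T. 0 <= c t * kmean g t q" by (rule AE_I2) (simp add: c01 kmean_def)
 qed
 finally show "(\<integral>z. c (fst z) * g (snd z) \<partial>q) = (\<integral>t. c t * kmean g t q \<partial>leb T)" .
qed

text \<open>The product of the two factors is Lipschitz in the pair of time and control, because
  both are bounded by 1; \<open>controls_integral_lipschitz\<close> does the rest.\<close>

lemma kmean_integral_lipschitz:
 assumes g: "unit_lipschitz g" and c: "unit_lipschitz c"
 shows "\<exists>L>0. \<forall>q\<in>controls T U p. \<forall>q'\<in>controls T U p.
 \<bar>(\<integral>t. c t * kmean g t q \<partial>leb T) - (\<integral>t. c t * kmean g t q' \<partial>leb T)\<bar> <= L * controls_dist T U q q'"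
proof -
 note g01 = unit_lipschitzD[OF g] and c01 = unit_lipschitzD[OF c]
 obtain L1 where L1: "L1 > 0" "!!x y. \<bar>g x - g y\<bar> <= L1 * dist x y" using g by (auto simp: unit_lipschitz_def)
 obtain L2 where L2: "L2 > 0" "!!x y. \<bar>c x - c y\<bar> <= L2 * dist x y" using c by (auto simp: unit_lipschitz_def)
 have lip: "\<bar>c (fst z) * g (snd z) - c (fst w) * g (snd w)\<bar> <= (L1 + L2) * dist z w" for z w :: "real \<times> 'b"
 proof -
 have "c (fst z) * g (snd z) - c (fst w) * g (snd w) = c (fst z) * (g (snd z) - g (snd w)) + (c (fst z) - c (fst w)) * g (snd w)"
 by (simp add: algebra_simps)
 also have "\<bar>\<dots>\<bar> <= \<bar>c (fst z)\<bar> * \<bar>g (snd z) - g (snd w)\<bar> + \<bar>c (fst z) - c (fst w)\<bar> * \<bar>g (snd w)\<bar>"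
 unfolding abs_mult[symmetric] by (rule abs_triangle_ineq)
 also have "\<dots> <= 1 * (L1 * dist z w) + (L2 * dist z w) * 1"
 proof (intro add_mono mult_mono)
 show "\<bar>g (snd z) - g (snd w)\<bar> <= L1 * dist z w"
 using L1(2)[of "snd z" "snd w"] mult_left_mono[OF dist_snd_le[of z w], of L1] L1(1) by linarith
 show "\<bar>c (fst z) - c (fst w)\<bar> <= L2 * dist z w"
 using L2(2)[of "fst z" "fst w"] mult_left_mono[OF dist_fst_le[of z w], of L2] L2(1) by linarith
 qed (use g01 c01 L1(1) L2(1) in auto)
 finally show ?thesis by (simp add: distrib_right)
 qed
 have b: "\<bar>c (fst z) * g (snd z)\<bar> <= 1" for z :: "real \<times> 'b"
 using g01 c01 by (simp add: abs_mult mult_le_one)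
 show ?thesis
 proof (intro exI[of _ "T * (L1 + L2)"] conjI ballI)
 show "0 < T * (L1 + L2)" using T L1(1) L2(1) by simp
 fix q q' assume q: "q \<in> controls T U p" "q' \<in> controls T U p"
 show "\<bar>(\<integral>t. c t * kmean g t q \<partial>leb T) - (\<integral>t. c t * kmean g t q' \<partial>leb T)\<bar> <= T * (L1 + L2) * controls_dist T U q q'"
 unfolding integral_kmean(1)[OF q(1) g c, symmetric] integral_kmean(1)[OF q(2) g c, symmetric]
 by (rule controls_integral_lipschitz[OF q integral_kmean(3)[OF q(1) g c]]) (use b lip L1(1) L2(1) in auto)
 qed
qed

end

section \<open>Pairing increments of kernel means with weights in time and the limit
  coordinate\<close>

context coupled_sequence
begin

abbreviation "M0 \<equiv> leb T \<Otimes>\<^sub>M \<mu>"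
abbreviation "Mk k \<equiv> leb T \<Otimes>\<^sub>M \<pi> k"

lemma M0_finite: "finite_measure M0"
proof -
 interpret leb: finite_measure "leb T" by (rule finite_measure_leb)
 interpret prob_space \<mu> by (rule prob_measuresD(1)[OF \<mu>P])
 show ?thesis by (rule finite_measure_pair_measure) unfold_locales
qed

lemma Mk_finite: "finite_measure (Mk k)"
proof -
 interpret leb: finite_measure "leb T" by (rule finite_measure_leb)
 interpret prob_space "\<pi> k" by (rule \<pi>_prob)
 show ?thesis by (rule finite_measure_pair_measure) unfold_locales
qed

lemma M0_measurable: "f \<in> leb T \<Otimes>\<^sub>M BH \<rightarrow>\<^sub>M N ==> f \<in> M0 \<rightarrow>\<^sub>M N"
proof -
 assume f: "f \<in> leb T \<Otimes>\<^sub>M BH \<rightarrow>\<^sub>M N"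
 have "M0 \<rightarrow>\<^sub>M N = leb T \<Otimes>\<^sub>M BH \<rightarrow>\<^sub>M N"
 by (intro measurable_cong_sets sets_pair_measure_cong refl prob_measuresD(2)[OF \<mu>P])
 thus ?thesis using f by simp
qed

text \<open>\<open>pz\<close> keeps time and the limit point of the coupled pair, \<open>pw\<close>
  keeps time and the approximating point.\<close>

definition pz where "pz x = (fst x, fst (snd x))"
definition pw where "pw x = (fst x, snd (snd x))"

lemma measurable_pz: "pz \<in> Mk k \<rightarrow>\<^sub>M M0"
 unfolding pz_def[abs_def] by (intro measurable_Pair measurable_fst measurable_compose[OF measurable_snd \<pi>_meas(1)])

lemma measurable_pw_nu: "pw \<in> Mk k \<rightarrow>\<^sub>M leb T \<Otimes>\<^sub>M \<nu> k"
 unfolding pw_def[abs_def] by (intro measurable_Pair measurable_fst measurable_compose[OF measurable_snd \<pi>_meas(2)])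

lemma measurable_pw: "pw \<in> Mk k \<rightarrow>\<^sub>M leb T \<Otimes>\<^sub>M BH"
proof -
 have "Mk k \<rightarrow>\<^sub>M leb T \<Otimes>\<^sub>M \<nu> k = Mk k \<rightarrow>\<^sub>M leb T \<Otimes>\<^sub>M BH"
 by (intro measurable_cong_sets sets_pair_measure_cong refl prob_measuresD(2)[OF \<nu>P])
 thus ?thesis using measurable_pw_nu[of k] by simp
qed

lemma measurable_pz_BH: "pz \<in> Mk k \<rightarrow>\<^sub>M leb T \<Otimes>\<^sub>M BH"
proof -
 have "Mk k \<rightarrow>\<^sub>M M0 = Mk k \<rightarrow>\<^sub>M leb T \<Otimes>\<^sub>M BH"
 by (intro measurable_cong_sets sets_pair_measure_cong refl prob_measuresD(2)[OF \<mu>P])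
 thus ?thesis using measurable_pz[of k] by simp
qed

lemma distr_pz: "distr (Mk k) M0 pz = M0"
proof -
 interpret prob_space \<mu> by (rule prob_measuresD(1)[OF \<mu>P])
 have id: "distr (leb T) (leb T) (%t. t) = leb T" by (rule distr_id2) simp
 have "distr (leb T) (leb T) (%t. t) \<Otimes>\<^sub>M distr (\<pi> k) \<mu> fst = distr (Mk k) M0 (%(t, z). (t, fst z))"
 by (rule pair_measure_distr[OF measurable_ident \<pi>_meas(1), unfolded id_def])
 (unfold couplingsD(4)[OF \<pi>], rule sigma_finite_measure_axioms)
 thus ?thesis unfolding id couplingsD(4)[OF \<pi>] by (simp add: pz_def[abs_def] case_prod_unfold)
qed

lemma distr_pw: "distr (Mk k) (leb T \<Otimes>\<^sub>M \<nu> k) pw = leb T \<Otimes>\<^sub>M \<nu> k"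
proof -
 interpret prob_space "\<nu> k" by (rule prob_measuresD(1)[OF \<nu>P])
 have id: "distr (leb T) (leb T) (%t. t) = leb T" by (rule distr_id2) simp
 have "distr (leb T) (leb T) (%t. t) \<Otimes>\<^sub>M distr (\<pi> k) (\<nu> k) snd = distr (Mk k) (leb T \<Otimes>\<^sub>M \<nu> k) (%(t, z). (t, snd z))"
 by (rule pair_measure_distr[OF measurable_ident \<pi>_meas(2), unfolded id_def])
 (unfold couplingsD(5)[OF \<pi>], rule sigma_finite_measure_axioms)
 thus ?thesis unfolding id couplingsD(5)[OF \<pi>] by (simp add: pw_def[abs_def] case_prod_unfold)
qed

lemma Mk_spaceD: "x \<in> space (Mk k) ==> fst x \<in> {0..T} & fst (snd x) \<in> OH & snd (snd x) \<in> OH"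
 by (auto simp: space_pair_measure \<pi>_space)

definition \<gamma> :: "('b => real) => real \<times> (('a, 'b) hat) => real" where
 "\<gamma> g y = kmean g (fst y) (snd (snd y))"

lemma \<gamma>_measurable: "unit_lipschitz g ==> \<gamma> g \<in> borel_measurable (leb T \<Otimes>\<^sub>M BH)"
 unfolding \<gamma>_def[abs_def] by (rule measurable_kmean[OF unit_lipschitz_borel])

lemma \<gamma>_bounds: "unit_lipschitz g ==> x \<in> space (Mk k) ==> 0 <= \<gamma> g (pz x) & \<gamma> g (pz x) <= 1 & 0 <= \<gamma> g (pw x) & \<gamma> g (pw x) <= 1"
proof -
 assume g: "unit_lipschitz g" and x: "x \<in> space (Mk k)"
 have 1: "snd (fst (snd x)) \<in> controls T U p" "snd (snd (snd x)) \<in> controls T U p" "fst x \<in> {0..T}"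
 using Mk_spaceD[OF x] by auto
 show ?thesis using kmean_bounds[OF unit_lipschitzD[OF g] 1(1,3)] kmean_bounds[OF unit_lipschitzD[OF g] 1(2,3)]
 by (simp add: \<gamma>_def pz_def pw_def)
qed

text \<open>The weight \<open>\<rho>\<close> looks only at time and the limit point, while the
  increment compares the two controls. That it tends to 0 for every integrable \<open>\<rho>\<close>
  is the stable convergence of the controls.\<close>

definition pairing where "pairing g k \<rho> = (\<integral>x. \<rho> (pz x) * (\<gamma> g (pw x) - \<gamma> g (pz x)) \<partial>Mk k)"

lemma pairing_integrable:
 fixes \<rho> :: "real \<times> _ => real"
 assumes g: "unit_lipschitz g" and \<rho>: "integrable M0 \<rho>"
 shows "integrable (Mk k) (%x. \<rho> (pz x))" "integrable (Mk k) (%x. \<rho> (pz x) * (\<gamma> g (pw x) - \<gamma> g (pz x)))"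
 "(\<integral>x. \<rho> (pz x) \<partial>Mk k) = (\<integral>y. \<rho> y \<partial>M0)"
proof -
 show 1: "integrable (Mk k) (%x. \<rho> (pz x))"
 using \<rho> integrable_distr[OF measurable_pz, of k \<rho>] by (simp add: distr_pz)
 show "integrable (Mk k) (%x. \<rho> (pz x) * (\<gamma> g (pw x) - \<gamma> g (pz x)))"
 proof (rule Bochner_Integration.integrable_bound[OF 1])
 show "(%x. \<rho> (pz x) * (\<gamma> g (pw x) - \<gamma> g (pz x))) \<in> borel_measurable (Mk k)"
 using borel_measurable_integrable[OF 1] measurable_compose[OF measurable_pw \<gamma>_measurable[OF g]]
 measurable_compose[OF measurable_pz_BH \<gamma>_measurable[OF g]] by (intro borel_measurable_times borel_measurable_diff)
 show "AE x in Mk k. norm (\<rho> (pz x) * (\<gamma> g (pw x) - \<gamma> g (pz x))) <= norm (\<rho> (pz x))"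
 proof (rule AE_I2)
 fix x assume "x \<in> space (Mk k)"
 from \<gamma>_bounds[OF g this] have "\<bar>\<gamma> g (pw x) - \<gamma> g (pz x)\<bar> <= 1" by linarith
 thus "norm (\<rho> (pz x) * (\<gamma> g (pw x) - \<gamma> g (pz x))) <= norm (\<rho> (pz x))"
 unfolding real_norm_def abs_mult by (rule mult_left_le) simp
 qed
 qed
 show "(\<integral>x. \<rho> (pz x) \<partial>Mk k) = (\<integral>y. \<rho> y \<partial>M0)"
 using integral_distr[OF measurable_pz borel_measurable_integrable[OF \<rho>], of k] by (simp add: distr_pz)
qed

text \<open>Kernel means lie between 0 and 1, so the pairing is bounded by the L1 norm of the weight
  uniformly in \<open>k\<close>; this makes the class of weights with vanishing pairing
  closed.\<close>

lemma pairing_le: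
 assumes g: "unit_lipschitz g" and \<rho>: "integrable M0 \<rho>"
 shows "\<bar>pairing g k \<rho>\<bar> <= (\<integral>y. \<bar>\<rho> y\<bar> \<partial>M0)"
proof -
 have "\<bar>pairing g k \<rho>\<bar> <= (\<integral>x. \<bar>\<rho> (pz x) * (\<gamma> g (pw x) - \<gamma> g (pz x))\<bar> \<partial>Mk k)"
 unfolding pairing_def by (rule integral_abs_bound)
 also have "\<dots> <= (\<integral>x. \<bar>\<rho> (pz x)\<bar> \<partial>Mk k)"
 proof (rule integral_mono)
 show "integrable (Mk k) (%x. \<bar>\<rho> (pz x) * (\<gamma> g (pw x) - \<gamma> g (pz x))\<bar>)" "integrable (Mk k) (%x. \<bar>\<rho> (pz x)\<bar>)"
 using pairing_integrable[OF g \<rho>] by (auto intro: integrable_abs)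
 fix x assume "x \<in> space (Mk k)"
 from \<gamma>_bounds[OF g this] have "\<bar>\<gamma> g (pw x) - \<gamma> g (pz x)\<bar> <= 1" by linarith
 thus "\<bar>\<rho> (pz x) * (\<gamma> g (pw x) - \<gamma> g (pz x))\<bar> <= \<bar>\<rho> (pz x)\<bar>" unfolding abs_mult by (rule mult_left_le) simp
 qed
 also have "\<dots> = (\<integral>y. \<bar>\<rho> y\<bar> \<partial>M0)" by (rule pairing_integrable(3)[OF g integrable_abs[OF \<rho>]])
 finally show ?thesis .
qed

lemma pairing_add:
 assumes g: "unit_lipschitz g" and "integrable M0 \<rho>" "integrable M0 \<sigma>"
 shows "pairing g k (%y. \<rho> y + \<sigma> y) = pairing g k \<rho> + pairing g k \<sigma>"
 "pairing g k (%y. \<rho> y - \<sigma> y) = pairing g k \<rho> - pairing g k \<sigma>"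
proof -
 note i = pairing_integrable(2)[OF g assms(2), of k] pairing_integrable(2)[OF g assms(3), of k]
 show "pairing g k (%y. \<rho> y + \<sigma> y) = pairing g k \<rho> + pairing g k \<sigma>"
 unfolding pairing_def distrib_right by (rule Bochner_Integration.integral_add[OF i])
 have "pairing g k (%y. \<rho> y - \<sigma> y) = (\<integral>x. \<rho> (pz x) * (\<gamma> g (pw x) - \<gamma> g (pz x)) - \<sigma> (pz x) * (\<gamma> g (pw x) - \<gamma> g (pz x)) \<partial>Mk k)"
 unfolding pairing_def by (rule Bochner_Integration.integral_cong[OF refl]) (rule left_diff_distrib)
 also have "\<dots> = pairing g k \<rho> - pairing g k \<sigma>"
 unfolding pairing_def by (rule Bochner_Integration.integral_diff[OF i])
 finally show "pairing g k (%y. \<rho> y - \<sigma> y) = pairing g k \<rho> - pairing g k \<sigma>" .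
qed

lemma pairing_cong: "(!!y. y \<in> space M0 ==> \<rho> y = \<sigma> y) ==> pairing g k \<rho> = pairing g k \<sigma>"
 unfolding pairing_def using measurable_space[OF measurable_pz] by (intro Bochner_Integration.integral_cong) auto

text \<open>Dominated approximation is convergence in L1 of the weights, and
  \<open>pairing_le\<close> holds uniformly in \<open>k\<close>.\<close>

lemma pairing_closed:
 fixes \<rho> :: "real \<times> _ => real" and s :: "nat => real \<times> _ => real"
 assumes g: "unit_lipschitz g" and sm: "!!i. s i \<in> borel_measurable M0" and \<rho>m: "\<rho> \<in> borel_measurable M0" and w: "integrable M0 w"
 and b: "!!i y. y \<in> space M0 ==> \<bar>s i y\<bar> <= w y" and lim: "!!y. y \<in> space M0 ==> (%i. s i y) \<longlonglongrightarrow> \<rho> y"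
 and s0: "!!i. (%k. pairing g k (s i)) \<longlonglongrightarrow> 0"
 shows "(%k. pairing g k \<rho>) \<longlonglongrightarrow> 0"
proof -
 have \<rho>b: "\<bar>\<rho> y\<bar> <= w y" if "y \<in> space M0" for y
 by (rule tendsto_upperbound[OF tendsto_rabs[OF lim[OF that]]]) (auto intro!: always_eventually b that)
 have int: "integrable M0 (s i)" "integrable M0 \<rho>" for i
 proof -
 have le: "a <= \<bar>v\<bar>" if "a <= v" for a v :: real using that by simp
 show "integrable M0 (s i)"
 by (rule Bochner_Integration.integrable_bound[OF w sm AE_I2]) (simp only: real_norm_def le b)
 show "integrable M0 \<rho>"
 by (rule Bochner_Integration.integrable_bound[OF w \<rho>m AE_I2]) (simp only: real_norm_def le \<rho>b)
 qed
 have w2: "integrable M0 (%y. 2 * w y)" using w by simp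
 have "(%i. \<integral>y. \<bar>\<rho> y - s i y\<bar> \<partial>M0) \<longlonglongrightarrow> (\<integral>y. 0 \<partial>M0)"
 proof (rule integral_dominated_convergence[OF _ _ w2])
 show "(%y. \<bar>\<rho> y - s i y\<bar>) \<in> borel_measurable M0" for i using sm \<rho>m by measurable
 show "AE y in M0. (%i. \<bar>\<rho> y - s i y\<bar>) \<longlonglongrightarrow> 0"
 proof (rule AE_I2)
 fix y assume y: "y \<in> space M0"
 have "(%i. \<bar>\<rho> y - s i y\<bar>) \<longlonglongrightarrow> \<bar>\<rho> y - \<rho> y\<bar>" by (intro tendsto_intros lim y)
 thus "(%i. \<bar>\<rho> y - s i y\<bar>) \<longlonglongrightarrow> 0" by simp
 qed
 show "AE y in M0. norm \<bar>\<rho> y - s i y\<bar> <= 2 * w y" for i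
 proof (rule AE_I2)
 fix y assume "y \<in> space M0"
 thus "norm \<bar>\<rho> y - s i y\<bar> <= 2 * w y" using b[of y i] \<rho>b[of y] by simp
 qed
 qed simp
 hence L1: "(%i. \<integral>y. \<bar>\<rho> y - s i y\<bar> \<partial>M0) \<longlonglongrightarrow> 0" by simp
 show ?thesis
 proof (rule tendstoI)
 fix e :: real assume e: "e > 0"
 have "\<forall>\<^sub>F i in sequentially. (\<integral>y. \<bar>\<rho> y - s i y\<bar> \<partial>M0) < e / 2" by (rule order_tendstoD(2)[OF L1]) (use e in simp)
 then obtain i where i: "(\<integral>y. \<bar>\<rho> y - s i y\<bar> \<partial>M0) < e / 2" unfolding eventually_sequentially by blast
 have "\<forall>\<^sub>F k in sequentially. dist (pairing g k (s i)) 0 < e / 2" by (rule tendstoD[OF s0]) (use e in simp)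
 thus "\<forall>\<^sub>F k in sequentially. dist (pairing g k \<rho>) 0 < e"
 proof eventually_elim
 case (elim k)
 have "pairing g k \<rho> - pairing g k (s i) = pairing g k (%y. \<rho> y - s i y)"
 by (rule pairing_add(2)[OF g int(2) int(1), symmetric])
 moreover have "\<bar>pairing g k (%y. \<rho> y - s i y)\<bar> <= (\<integral>y. \<bar>\<rho> y - s i y\<bar> \<partial>M0)"
 by (rule pairing_le[OF g Bochner_Integration.integrable_diff[OF int(2) int(1)]])
 ultimately show ?case using elim i by simp
 qed
 qed
qed

text \<open>With a Lipschitz weight in time, integrating time first leaves a difference of two
  integrals that is Lipschitz in \<open>controls_dist\<close>; the indicator of \<open>A\<close> is
  a factor that does not depend on time. Jensen then bounds the pairing by
  \<open>L * sqrt (c k)\<close>.\<close>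

lemma pairing_lipschitz:
 assumes g: "unit_lipschitz g" and h: "unit_lipschitz h" and A: "A \<in> sets \<mu>"
 shows "(%k. pairing g k (%y. h (fst y) * indicator A (snd y))) \<longlonglongrightarrow> 0"
proof -
 obtain L where L: "L > 0" "!!q q'. q \<in> controls T U p ==> q' \<in> controls T U p ==>
 \<bar>(\<integral>t. h t * kmean g t q \<partial>leb T) - (\<integral>t. h t * kmean g t q' \<partial>leb T)\<bar> <= L * controls_dist T U q q'"
 using kmean_integral_lipschitz[OF g h] by blast
 interpret leb: finite_measure "leb T" by (rule finite_measure_leb)
 have hm: "h \<in> borel_measurable (leb T)" using measurable_compose[OF measurable_leb_id unit_lipschitz_borel[OF h]] .
 have hA: "(%y. h (fst y) * indicator A (snd y)) \<in> borel_measurable M0"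
 using measurable_compose[OF measurable_fst hm] measurable_compose[OF measurable_snd, of "indicator A :: _ => real" \<mu>] A
 by (intro borel_measurable_times) auto
 interpret M0: finite_measure M0 by (rule M0_finite)
 have hAi: "integrable M0 (%y. h (fst y) * indicator A (snd y) :: real)"
 using hA unit_lipschitzD[OF h] by (intro M0.integrable_const_bound[of _ 1]) (auto simp: indicator_def intro!: AE_I2)
 have main: "\<bar>pairing g k (%y. h (fst y) * indicator A (snd y))\<bar> <= L * sqrt (c k)" for k
 proof -
 interpret \<pi>: prob_space "\<pi> k" by (rule \<pi>_prob)
 interpret P: pair_sigma_finite "leb T" "\<pi> k" ..
 let ?F = "%x. h (fst (pz x)) * indicator A (snd (pz x)) * (\<gamma> g (pw x) - \<gamma> g (pz x))"
 define I where "I q = (\<integral>t. h t * kmean g t q \<partial>leb T)" for q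
 define X where "X z = (\<integral>t. ?F (t, z) \<partial>leb T)" for z
 have Fi: "integrable (Mk k) ?F" using pairing_integrable(2)[OF g hAi] by simp
 have eq: "pairing g k (%y. h (fst y) * indicator A (snd y)) = (\<integral>z. X z \<partial>\<pi> k)"
 unfolding pairing_def X_def using P.integral_snd[of "%t z. ?F (t, z)"] Fi by (simp add: case_prod_unfold)
 have Xm: "X \<in> borel_measurable (\<pi> k)"
 proof -
 have "?F \<in> borel_measurable (Mk k)" using Fi by (rule borel_measurable_integrable)
 hence "(%(z, t). ?F (t, z)) \<in> borel_measurable (\<pi> k \<Otimes>\<^sub>M leb T)"
 using measurable_compose[OF measurable_pair_swap'[of "\<pi> k" "leb T"], of ?F] by (simp add: case_prod_unfold)
 from leb.borel_measurable_lebesgue_integral[OF this] show ?thesis by (simp add: X_def[abs_def])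
 qed
 have Xeq: "X z = indicator A (fst z) * (I (snd (snd z)) - I (snd (fst z)))" if z: "z \<in> space (\<pi> k)" for z
 proof -
 have q: "snd (snd z) \<in> controls T U p" "snd (fst z) \<in> controls T U p" using z unfolding \<pi>_space by auto
 have i: "integrable (leb T) (%t. h t * kmean g t q)" if q: "q \<in> controls T U p" for q
 proof (rule leb.integrable_const_bound[of _ 1])
 show "(%t. h t * kmean g t q) \<in> borel_measurable (leb T)" using hm integral_kmean(2)[OF q g h] by (rule borel_measurable_times)
 show "AE t in leb T. norm (h t * kmean g t q) <= 1"
 proof (rule AE_I2)
 fix t assume "t \<in> space (leb T)"
 hence t: "t \<in> {0..T}" by simp
 show "norm (h t * kmean g t q) <= 1"
 using kmean_bounds(2,3)[OF unit_lipschitzD[OF g] q t] unit_lipschitzD[OF h, of t] by (simp add: abs_mult mult_le_one)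
 qed
 qed
 have "X z = (\<integral>t. indicator A (fst z) * (h t * kmean g t (snd (snd z)) - h t * kmean g t (snd (fst z))) \<partial>leb T)"
 unfolding X_def by (intro Bochner_Integration.integral_cong) (auto simp: pz_def pw_def \<gamma>_def algebra_simps)
 also have "\<dots> = indicator A (fst z) * (I (snd (snd z)) - I (snd (fst z)))"
 unfolding I_def using i[OF q(1)] i[OF q(2)] by simp
 finally show ?thesis .
 qed
 have Xle: "\<bar>X z\<bar> <= L * controls_dist T U (snd (fst z)) (snd (snd z))" if z: "z \<in> space (\<pi> k)" for z
 proof -
 have q: "snd (snd z) \<in> controls T U p" "snd (fst z) \<in> controls T U p" using z unfolding \<pi>_space by auto
 have "\<bar>X z\<bar> <= \<bar>I (snd (fst z)) - I (snd (snd z))\<bar>"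
 unfolding Xeq[OF z] by (auto simp: indicator_def)
 also have "\<dots> <= L * controls_dist T U (snd (fst z)) (snd (snd z))" unfolding I_def by (rule L(2)[OF q(2,1)])
 finally show ?thesis .
 qed
 \<comment> \<open>A crude bound, wanted only because \<open>integral_power2_le\<close> asks for a
   bounded integrand.\<close>
 have Xb: "\<bar>X z / L\<bar> <= T / L" if z: "z \<in> space (\<pi> k)" for z
 proof -
 have "\<bar>X z\<bar> <= (\<integral>t. \<bar>?F (t, z)\<bar> \<partial>leb T)" unfolding X_def by (rule integral_abs_bound)
 also have "\<dots> <= (\<integral>t. 1 \<partial>leb T)"
 proof (rule integral_mono')
 show "integrable (leb T) (%t. 1 :: real)" by (rule leb.integrable_const)
 fix t assume "t \<in> space (leb T)"
 hence x: "(t, z) \<in> space (Mk k)" using z by (simp add: space_pair_measure)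
 have "\<bar>\<gamma> g (pw (t, z)) - \<gamma> g (pz (t, z))\<bar> <= 1" using \<gamma>_bounds[OF g x] by linarith
 thus "\<bar>?F (t, z)\<bar> <= 1" using unit_lipschitzD[OF h, of t] by (auto simp: abs_mult indicator_def pz_def mult_le_one)
 qed simp
 also have "\<dots> = T" using T by (simp add: measure_def emeasure_leb)
 finally show ?thesis using L(1) by (simp add: abs_divide divide_right_mono)
 qed
 have "ennreal ((\<integral>z. X z / L \<partial>\<pi> k)\<^sup>2) <= (\<integral>\<^sup>+z. ennreal ((X z / L)\<^sup>2) \<partial>\<pi> k)"
 by (rule \<pi>.integral_power2_le[OF _ Xb]) (use Xm in measurable)
 also have "\<dots> <= (\<integral>\<^sup>+z. ennreal (dH (fst z) (snd z) powr 2) \<partial>\<pi> k)"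
 proof (rule nn_integral_mono)
 fix z assume z: "z \<in> space (\<pi> k)"
 have "\<bar>X z / L\<bar> <= controls_dist T U (snd (fst z)) (snd (snd z))"
 using Xle[OF z] L(1) by (simp add: abs_divide field_simps)
 also have "\<dots> <= dH (fst z) (snd z)" by (rule snd_dist_le)
 finally have "\<bar>X z / L\<bar>\<^sup>2 <= (dH (fst z) (snd z))\<^sup>2" by (rule power_mono) simp
 thus "ennreal ((X z / L)\<^sup>2) <= ennreal (dH (fst z) (snd z) powr 2)"
 unfolding power2_abs using dH_nonneg[of "fst z" "snd z"] by (intro ennreal_leI) (simp add: powr_numeral)
 qed
 also have "\<dots> <= ennreal (c k)" by (rule cost)
 finally have "(\<integral>z. X z / L \<partial>\<pi> k)\<^sup>2 <= c k" using c(1)[of k] by (simp add: ennreal_le_iff)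
 hence "sqrt ((\<integral>z. X z / L \<partial>\<pi> k)\<^sup>2) <= sqrt (c k)" by (rule real_sqrt_le_mono)
 hence "\<bar>\<integral>z. X z / L \<partial>\<pi> k\<bar> <= sqrt (c k)" unfolding real_sqrt_abs .
 thus ?thesis unfolding eq using L(1) by (simp add: abs_divide field_simps)
 qed
 have "(%k. L * sqrt (c k)) \<longlonglongrightarrow> L * sqrt 0" by (intro tendsto_intros c(2))
 hence "(%k. L * sqrt (c k)) \<longlonglongrightarrow> 0" by simp
 thus ?thesis by (rule Lim_null_comparison[rotated]) (use main in simp)
qed

text \<open>The sets with vanishing pairing form a Dynkin system: complements and finite disjoint
  unions by linearity, countable ones by \<open>pairing_closed\<close>. The map
  \<open>\<phi>\<close> and the factor \<open>a\<close> allow two uses: for sets of times with the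
  indicator of \<open>A\<close> held fixed, and then for sets generated by rectangles.\<close>

lemma pairing_dynkin:
 fixes \<phi> :: "real \<times> _ => 'x" and a :: "real \<times> _ => real"
 assumes g: "unit_lipschitz g" and a: "!!y. 0 <= a y" "!!y. a y <= 1"
 and \<phi>: "!!y. y \<in> space M0 ==> \<phi> y \<in> \<Omega>"
 and m: "!!X. X \<in> sigma_sets \<Omega> G ==> (%y. indicator X (\<phi> y) * a y) \<in> borel_measurable M0"
 and G: "Int_stable G" "G \<subseteq> Pow \<Omega>"
 and base: "!!X. X \<in> G ==> (%k. pairing g k (%y. indicator X (\<phi> y) * a y)) \<longlonglongrightarrow> 0"
 and top: "(%k. pairing g k a) \<longlonglongrightarrow> 0"
 and X: "X \<in> sigma_sets \<Omega> G"
 shows "(%k. pairing g k (%y. indicator X (\<phi> y) * a y)) \<longlonglongrightarrow> 0"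
 using G X
proof (induction rule: sigma_sets_induct_disjoint)
 case (basic X) thus ?case by (rule base)
next
 case empty show ?case by (simp add: pairing_def)
next
 interpret M0: finite_measure M0 by (rule M0_finite)
 interpret S: sigma_algebra \<Omega> "sigma_sets \<Omega> G" by (rule sigma_algebra_sigma_sets[OF G(2)])
 have b: "\<bar>indicator X (\<phi> y) * a y\<bar> <= 1" for X and y using a[of y] by (auto simp: indicator_def)
 have one: "integrable M0 (%_. 1 :: real)" by (rule M0.integrable_const)
 have int: "integrable M0 (%y. indicator X (\<phi> y) * a y)" if "X \<in> sigma_sets \<Omega> G" for X
 by (rule Bochner_Integration.integrable_bound[OF one m[OF that]]) (use b in auto)
 {
 case (compl X)
 have "pairing g k (%y. indicator (\<Omega> - X) (\<phi> y) * a y) = pairing g k a - pairing g k (%y. indicator X (\<phi> y) * a y)" for k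
 proof -
 have "pairing g k a = pairing g k (%y. indicator \<Omega> (\<phi> y) * a y)" by (rule pairing_cong) (simp add: \<phi>)
 hence "pairing g k a - pairing g k (%y. indicator X (\<phi> y) * a y) =
 pairing g k (%y. indicator \<Omega> (\<phi> y) * a y - indicator X (\<phi> y) * a y)"
 using pairing_add(2)[OF g int[OF S.top] int[OF compl(1)], of k] by simp
 also have "\<dots> = pairing g k (%y. indicator (\<Omega> - X) (\<phi> y) * a y)"
 by (rule pairing_cong) (use \<phi> in \<open>auto simp: indicator_def\<close>)
 finally show ?thesis by simp
 qed
 moreover have "(%k. pairing g k a - pairing g k (%y. indicator X (\<phi> y) * a y)) \<longlonglongrightarrow> 0 - 0"
 by (intro tendsto_diff top compl(2))
 ultimately show ?case by simp
 next
 case (union X)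
 have Xs: "X i \<in> sigma_sets \<Omega> G" for i using union(2) by auto
 have fin: "(%k. pairing g k (%y. indicator (\<Union>i<n. X i) (\<phi> y) * a y)) \<longlonglongrightarrow> 0" for n
 proof (induction n)
 case 0 show ?case by (simp add: pairing_def)
 next
 case (Suc n)
 have Un: "(\<Union>i<n. X i) \<in> sigma_sets \<Omega> G" using Xs by (intro S.finite_UN) auto
 have "X i \<inter> X n = {}" if "i < n" for i using union(1) that by (simp add: disjoint_family_on_def)
 hence disj: "(\<Union>i<n. X i) \<inter> X n = {}" by blast
 have "pairing g k (%y. indicator (\<Union>i<Suc n. X i) (\<phi> y) * a y) =
 pairing g k (%y. indicator (\<Union>i<n. X i) (\<phi> y) * a y) + pairing g k (%y. indicator (X n) (\<phi> y) * a y)" for k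
 unfolding pairing_add(1)[OF g int[OF Un] int[OF Xs], symmetric]
 by (rule pairing_cong) (use disj in \<open>auto simp: indicator_def lessThan_Suc\<close>)
 moreover have "(%k. pairing g k (%y. indicator (\<Union>i<n. X i) (\<phi> y) * a y) + pairing g k (%y. indicator (X n) (\<phi> y) * a y)) \<longlonglongrightarrow> 0 + 0"
 by (intro tendsto_add Suc.IH union(3))
 ultimately show ?case by simp
 qed
 show ?case
 proof (rule pairing_closed[OF g m m one b _ fin])
 show "(\<Union>i<n. X i) \<in> sigma_sets \<Omega> G" for n using Xs by (intro S.finite_UN) auto
 show "(\<Union>i. X i) \<in> sigma_sets \<Omega> G" using Xs by (intro S.countable_UN) auto
 show "(%n. indicator (\<Union>i<n. X i) (\<phi> y) * a y) \<longlonglongrightarrow> indicator (\<Union>i. X i) (\<phi> y) * a y" for y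
 by (intro tendsto_mult LIMSEQ_indicator_UN tendsto_const)
 qed
 }
qed

text \<open>Half-lines of times generate the Borel sets, and their indicators are bounded limits of
  Lipschitz weights.\<close>

lemma pairing_rectangle:
 assumes g: "unit_lipschitz g" and A: "A \<in> sets \<mu>" and C: "C \<in> sets borel"
 shows "(%k. pairing g k (%y. indicator C (fst y) * indicator A (snd y))) \<longlonglongrightarrow> 0"
proof -
 interpret M0: finite_measure M0 by (rule M0_finite)
 have one: "integrable M0 (%_. 1 :: real)" by (rule M0.integrable_const)
 have Am: "(%y. indicator A (snd y) :: real) \<in> borel_measurable M0"
 using A by (intro measurable_compose[OF measurable_snd]) simp
 have m: "(%y. indicator C (fst y) * indicator A (snd y) :: real) \<in> borel_measurable M0" if "C \<in> sets borel" for C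
 proof -
 have "(%y. indicator C (fst y) :: real) \<in> borel_measurable M0"
 using that by (intro measurable_compose[OF measurable_fst] measurable_compose[OF measurable_leb_id]) simp
 thus ?thesis using Am by (rule borel_measurable_times)
 qed
 have u: "unit_lipschitz (%_::real. 1)" unfolding unit_lipschitz_def by (intro conjI exI[of _ 1]) auto
 have Cs: "C \<in> sigma_sets UNIV (range atMost)" using C by (simp add: borel_eq_atMost)
 have basic: "(%k. pairing g k (%y. indicator X (fst y) * indicator A (snd y))) \<longlonglongrightarrow> 0" if XR: "X \<in> range atMost" for X
 proof -
 obtain s where X: "X = {..s}" using XR by auto
 \<comment> \<open>Ramps from 1 down to 0 on the interval from \<open>s\<close> to
   \<open>s + 1/(i+1)\<close>, decreasing to the indicator of the half-line.\<close>
 define h where "h i t = max 0 (min 1 (1 - real (Suc i) * (t - s)))" for i and t :: real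
 have hL: "unit_lipschitz (h i)" for i
 unfolding unit_lipschitz_def
 proof (intro conjI allI exI[of _ "real (Suc i)"])
 fix x y :: real
 have "\<bar>h i x - h i y\<bar> <= \<bar>real (Suc i) * (x - s) - real (Suc i) * (y - s)\<bar>" unfolding h_def by linarith
 also have "\<dots> = real (Suc i) * dist x y"
 unfolding right_diff_distrib[symmetric] abs_mult by (simp add: dist_real_def)
 finally show "\<bar>h i x - h i y\<bar> <= real (Suc i) * dist x y" .
 qed (auto simp: h_def)
 show ?thesis unfolding X
 proof (rule pairing_closed[OF g _ m one _ _ pairing_lipschitz[OF g hL A]])
 have "h i \<in> borel_measurable (leb T)" for i using measurable_compose[OF measurable_leb_id unit_lipschitz_borel[OF hL]] .
 thus "(%y. h i (fst y) * indicator A (snd y)) \<in> borel_measurable M0" for i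
 by (intro borel_measurable_times Am measurable_compose[OF measurable_fst])
 show "\<bar>h i (fst y) * indicator A (snd y)\<bar> <= 1" for i y
 using unit_lipschitzD[OF hL, of i "fst y"] by (auto simp: indicator_def)
 fix y :: "real \<times> (('a, 'b) hat)"
 have "(%i. h i (fst y)) \<longlonglongrightarrow> indicator {..s} (fst y)"
 proof (cases "fst y <= s")
 case True
 have "h i (fst y) = 1" for i
 proof -
 have "real (Suc i) * (fst y - s) <= 0" using True by (intro mult_nonneg_nonpos) auto
 thus ?thesis by (simp add: h_def)
 qed
 thus ?thesis using True by simp
 next
 case False
 then obtain N where N: "inverse (real (Suc N)) < fst y - s" using reals_Archimedean[of "fst y - s"] by auto
 have "h i (fst y) = 0" if "N <= i" for i
 proof -
 have "1 < real (Suc N) * (fst y - s)" using N by (simp add: field_simps)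
 also have "\<dots> <= real (Suc i) * (fst y - s)" using that False by (intro mult_right_mono) auto
 finally show ?thesis by (simp add: h_def)
 qed
 hence "\<forall>\<^sub>F i in sequentially. h i (fst y) = 0" unfolding eventually_sequentially by blast
 thus ?thesis using False by (simp add: tendsto_eventually)
 qed
 thus "(%i. h i (fst y) * indicator A (snd y)) \<longlonglongrightarrow> indicator {..s} (fst y) * indicator A (snd y)"
 by (intro tendsto_intros)
 qed simp
 qed
 have meas: "(%y. indicator X (fst y) * indicator A (snd y) :: real) \<in> borel_measurable M0" if "X \<in> sigma_sets UNIV (range atMost)" for X
 by (rule m) (use that in \<open>simp add: borel_eq_atMost\<close>)
 have top: "(%k. pairing g k (%y. indicator A (snd y))) \<longlonglongrightarrow> 0" using pairing_lipschitz[OF g u A] by simp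
 have Is: "Int_stable (range (atMost :: real => real set))" by (auto simp: Int_stable_def)
 show ?thesis
 by (rule pairing_dynkin[where \<phi>=fst and a="%y. indicator A (snd y)", OF g _ _ UNIV_I meas Is _ basic top Cs])
 (simp_all add: indicator_def)
qed

lemma pairing_sets:
 assumes g: "unit_lipschitz g" and B: "B \<in> sets M0"
 shows "(%k. pairing g k (indicator B)) \<longlonglongrightarrow> 0"
proof -
 let ?G = "{a \<times> b | a b. a \<in> sets (leb T) & b \<in> sets \<mu>}" and ?\<Omega> = "space (leb T) \<times> space \<mu>"
 have rect: "(%k. pairing g k (%y. indicator X y * 1)) \<longlonglongrightarrow> 0" if X: "X \<in> ?G" for X
 proof -
 obtain a b where ab: "a \<in> sets (leb T)" "b \<in> sets \<mu>" "X = a \<times> b" using X by blast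
 hence "a \<in> sets borel" unfolding sets_leb sets_restrict_space by auto
 from pairing_rectangle[OF g ab(2) this] show ?thesis unfolding ab(3)
 by (simp add: indicator_times)
 qed
 have top: "(%k. pairing g k (%_. 1)) \<longlonglongrightarrow> 0"
 proof -
 have "pairing g k (%_. 1) = pairing g k (%y. indicator ?\<Omega> y * 1)" for k
 by (rule pairing_cong) (simp add: space_pair_measure)
 moreover have "?\<Omega> \<in> ?G" using sets.top[of "leb T"] sets.top[of \<mu>] by blast
 ultimately show ?thesis using rect[of ?\<Omega>] by simp
 qed
 have "(%k. pairing g k (%y. indicator B y * 1)) \<longlonglongrightarrow> 0"
 proof (rule pairing_dynkin[OF g, where \<Omega>="?\<Omega>" and G="?G"])
 show "Int_stable ?G" by (rule Int_stable_pair_measure_generator)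
 show "?G \<subseteq> Pow ?\<Omega>" by (rule pair_measure_closed)
 show "B \<in> sigma_sets ?\<Omega> ?G" using B unfolding sets_pair_measure .
 show "(%y. indicator X y * 1 :: real) \<in> borel_measurable M0" if "X \<in> sigma_sets ?\<Omega> ?G" for X
 using that unfolding sets_pair_measure[symmetric] by simp
 qed (use rect top in \<open>auto simp: space_pair_measure\<close>)
 thus ?thesis by simp
qed

lemma pairing_tendsto:
 assumes g: "unit_lipschitz g" and \<rho>: "integrable M0 \<rho>"
 shows "(%k. pairing g k \<rho>) \<longlonglongrightarrow> 0"
 using \<rho>
proof (induction rule: integrable_induct)
 case (base A c)
 have "pairing g k (%x. indicator A x *\<^sub>R c) = pairing g k (indicator A) * c" for k
 unfolding pairing_def by (subst integral_mult_left_zero[symmetric]) (simp add: ac_simps)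
 moreover have "(%k. pairing g k (indicator A) * c) \<longlonglongrightarrow> 0 * c" by (intro tendsto_intros pairing_sets[OF g base(1)])
 ultimately show ?case by simp
next
 case (add \<rho> \<sigma>)
 have "(%k. pairing g k \<rho> + pairing g k \<sigma>) \<longlonglongrightarrow> 0 + 0" by (intro tendsto_add add.IH)
 thus ?case unfolding pairing_add(1)[OF g add.hyps(1,2)] by simp
next
 case (lim \<rho> s)
 have w: "integrable M0 (%y. 2 * \<bar>\<rho> y\<bar>)" using lim.hyps(4) by simp
 show ?case
 by (rule pairing_closed[OF g borel_measurable_integrable[OF lim.hyps(1)] borel_measurable_integrable[OF lim.hyps(4)] w _ lim.hyps(2) lim.IH])
 (use lim.hyps(3) in simp)
qed

end

section \<open>A portmanteau theorem for stable convergence\<close>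

lemma unit_lipschitz_one: "unit_lipschitz (%_. 1)"
 unfolding unit_lipschitz_def by (intro conjI exI[of _ 1]) auto

lemma unit_lipschitz_mult:
 assumes f: "unit_lipschitz f" and g: "unit_lipschitz g" shows "unit_lipschitz (%x. f x * g x)"
proof -
 obtain L1 where L1: "L1 > 0" "!!x y. \<bar>f x - f y\<bar> <= L1 * dist x y" using f by (auto simp: unit_lipschitz_def)
 obtain L2 where L2: "L2 > 0" "!!x y. \<bar>g x - g y\<bar> <= L2 * dist x y" using g by (auto simp: unit_lipschitz_def)
 note f01 = unit_lipschitzD[OF f] and g01 = unit_lipschitzD[OF g]
 have "\<bar>f x * g x - f y * g y\<bar> <= (L1 + L2) * dist x y" for x y
 proof -
 have "f x * g x - f y * g y = (f x - f y) * g x + f y * (g x - g y)" by (simp add: algebra_simps)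
 also have "\<bar>\<dots>\<bar> <= \<bar>f x - f y\<bar> * \<bar>g x\<bar> + \<bar>f y\<bar> * \<bar>g x - g y\<bar>"
 unfolding abs_mult[symmetric] by (rule abs_triangle_ineq)
 also have "\<dots> <= (L1 * dist x y) * 1 + 1 * (L2 * dist x y)"
 by (intro add_mono mult_mono L1(2) L2(2)) (use f01 g01 L1(1) L2(1) in auto)
 finally show ?thesis by (simp add: distrib_right)
 qed
 thus ?thesis using f01 g01 L1(1) L2(1) unfolding unit_lipschitz_def
 by (intro conjI allI exI[of _ "L1 + L2"]) (auto intro: mult_le_one)
qed

lemma unit_lipschitz_prod:
 assumes "finite X" "!!j. j \<in> X ==> unit_lipschitz (f j)" shows "unit_lipschitz (%x. \<Prod>j\<in>X. f j x)"
 using assms by (induction X rule: finite_induct) (simp_all add: unit_lipschitz_one unit_lipschitz_mult)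

text \<open>Lipschitz functions increasing with \<open>n\<close> to the indicator of the open
  ball.\<close>

definition ball_bump :: "'a::metric_space => real => nat => 'a => real" where
 "ball_bump c r n x = max 0 (min 1 (real n * (r - dist x c)))"

lemma unit_lipschitz_ball_bump: "unit_lipschitz (ball_bump c r n)"
 unfolding unit_lipschitz_def
proof (intro conjI allI exI[of _ "real n + 1"])
 fix x y :: 'a
 have "\<bar>ball_bump c r n x - ball_bump c r n y\<bar> <= \<bar>real n * (r - dist x c) - real n * (r - dist y c)\<bar>"
 unfolding ball_bump_def by linarith
 also have "\<dots> = real n * \<bar>dist y c - dist x c\<bar>" unfolding right_diff_distrib[symmetric] abs_mult by simp
 also have "\<dots> <= real n * dist x y"
 using dist_triangle[of x c y] dist_triangle[of y c x] by (intro mult_left_mono) (auto simp: dist_commute)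
 also have "\<dots> <= (real n + 1) * dist x y" by (simp add: mult_right_mono)
 finally show "\<bar>ball_bump c r n x - ball_bump c r n y\<bar> <= (real n + 1) * dist x y" .
qed (auto simp: ball_bump_def)

lemma ball_bump_outside: "x \<notin> ball c r ==> ball_bump c r n x = 0"
proof -
 assume "x \<notin> ball c r"
 hence "real n * (r - dist x c) <= 0" by (intro mult_nonneg_nonpos) (auto simp: dist_commute)
 thus ?thesis by (simp add: ball_bump_def)
qed

lemma ball_bump_inside: "x \<in> ball c r ==> \<exists>n0. \<forall>n\<ge>n0. ball_bump c r n x = 1"
proof -
 assume "x \<in> ball c r"
 hence p: "r - dist x c > 0" by (simp add: dist_commute)
 then obtain n0 where n0: "1 / (r - dist x c) <= real n0" using real_arch_simple by blast
 have "ball_bump c r n x = 1" if "n \<ge> n0" for n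
 proof -
 have "1 / (r - dist x c) <= real n" using n0 that by simp
 hence "1 <= real n * (r - dist x c)" using p by (simp add: divide_le_eq)
 thus ?thesis by (simp add: ball_bump_def)
 qed
 thus ?thesis by blast
qed

text \<open>The base \<open>S\<close> carries no topology: convergence is tested there with
  arbitrary measurable sets, and with one Lipschitz function on each of the two Euclidean
  factors.\<close>

locale stable_limit =
 fixes S :: "'s measure" and P :: "nat => ('s \<times> ('x::euclidean_space \<times> 'y::euclidean_space)) measure" and P0
 assumes P_sets: "!!k. sets (P k) = sets (S \<Otimes>\<^sub>M (borel \<Otimes>\<^sub>M borel))" and P0_sets: "sets P0 = sets (S \<Otimes>\<^sub>M (borel \<Otimes>\<^sub>M borel))"
 and P_finite: "!!k. finite_measure (P k)" and P0_finite: "finite_measure P0"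
 and P_lim: "!!C f g. C \<in> sets S ==> unit_lipschitz f ==> unit_lipschitz g ==>
 (%k. \<integral>s. indicator C (fst s) * f (fst (snd s)) * g (snd (snd s)) \<partial>P k) \<longlonglongrightarrow>
 (\<integral>s. indicator C (fst s) * f (fst (snd s)) * g (snd (snd s)) \<partial>P0)"
begin

abbreviation "N \<equiv> S \<Otimes>\<^sub>M ((borel :: 'x measure) \<Otimes>\<^sub>M (borel :: 'y measure))"

lemma P_meas: "f \<in> N \<rightarrow>\<^sub>M K ==> f \<in> P k \<rightarrow>\<^sub>M K" "f \<in> N \<rightarrow>\<^sub>M K ==> f \<in> P0 \<rightarrow>\<^sub>M K"
 by (simp_all add: measurable_cong_sets[OF P_sets refl] measurable_cong_sets[OF P0_sets refl])

lemma product_measurable: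
 assumes "C \<in> sets S" "unit_lipschitz f" "unit_lipschitz g"
 shows "(%s. indicator C (fst s) * f (fst (snd s)) * g (snd (snd s)) :: real) \<in> borel_measurable N"
proof -
 have "(%s. indicator C (fst s) :: real) \<in> borel_measurable N" using assms(1) by (intro measurable_compose[OF measurable_fst]) simp
 moreover have "(%s. f (fst (snd s))) \<in> borel_measurable N"
 by (rule measurable_compose[OF measurable_compose[OF measurable_snd measurable_fst] unit_lipschitz_borel[OF assms(2)]])
 moreover have "(%s. g (snd (snd s))) \<in> borel_measurable N"
 by (rule measurable_compose[OF measurable_compose[OF measurable_snd measurable_snd] unit_lipschitz_borel[OF assms(3)]])
 ultimately show ?thesis by (intro borel_measurable_times)
qed

text \<open>The lower half of the portmanteau theorem, for countable unions of boxes over measurable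
  base sets. The functions \<open>h n\<close> approximate the indicator of \<open>G\<close> from
  below; expanded by inclusion-exclusion they are finite combinations of products of the kind tested
  in \<open>P_lim\<close>.\<close>

lemma open_liminf:
 fixes c :: "nat => 'x" and d :: "nat => 'y" and r :: "nat => real"
 assumes B: "B \<in> sets S" and E: "!!j. E j \<in> sets S" and e: "e > 0"
 defines "G \<equiv> {s \<in> space N. fst s \<in> B & (\<exists>j. fst s \<in> E j & fst (snd s) \<in> ball (c j) (r j) & snd (snd s) \<in> ball (d j) (r j))}"
 shows "G \<in> sets N" "\<forall>\<^sub>F k in sequentially. measure P0 G - e <= measure (P k) G"
proof -
 have Gj: "{s \<in> space N. fst s \<in> B & fst s \<in> E j & fst (snd s) \<in> ball (c j) (r j) & snd (snd s) \<in> ball (d j) (r j)} \<in> sets N" for j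
 proof -
 have "{s \<in> space N. fst s \<in> B & fst s \<in> E j & fst (snd s) \<in> ball (c j) (r j) & snd (snd s) \<in> ball (d j) (r j)} =
 (B \<inter> E j) \<times> (ball (c j) (r j) \<times> ball (d j) (r j))"
 using sets.sets_into_space[OF B] by (auto simp: space_pair_measure)
 moreover have "\<dots> \<in> sets N" using B E by (intro pair_measureI sets.Int) auto
 ultimately show ?thesis by simp
 qed
 have "G = (\<Union>j. {s \<in> space N. fst s \<in> B & fst s \<in> E j & fst (snd s) \<in> ball (c j) (r j) & snd (snd s) \<in> ball (d j) (r j)})"
 by (auto simp: G_def)
 moreover have "\<dots> \<in> sets N" using Gj by blast
 ultimately show G: "G \<in> sets N" by simp
 interpret P0: finite_measure P0 by (rule P0_finite)
 define a where "a n j s = indicator (E j) (fst s) * ball_bump (c j) (r j) n (fst (snd s)) * ball_bump (d j) (r j) n (snd (snd s))" for n j and s :: "'s \<times> 'x \<times> 'y"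
 \<comment> \<open>\<open>n\<close> both cuts the union off after \<open>n\<close> boxes and
   sharpens the bumps. A maximum of the \<open>a n j\<close> would approximate the union as well,
   but does not expand into products.\<close>
 define h where "h n s = indicator B (fst s) * (1 - (\<Prod>j<n. 1 - a n j s))" for n s
 have a01: "0 <= a n j s" "a n j s <= 1" for n j s
 using unit_lipschitzD[OF unit_lipschitz_ball_bump[of "c j" "r j" n], of "fst (snd s)"]
 unit_lipschitzD[OF unit_lipschitz_ball_bump[of "d j" "r j" n], of "snd (snd s)"]
 by (auto simp: a_def indicator_def intro: mult_le_one)
 have pr01: "0 <= (\<Prod>j<n. 1 - a n j s)" "(\<Prod>j<n. 1 - a n j s) <= 1" for n s
 by (intro prod_nonneg prod_le_1; simp add: a01)+
 define I where "I X n s = indicator (B \<inter> (\<Inter>j\<in>X. E j)) (fst s) * (\<Prod>j\<in>X. ball_bump (c j) (r j) n (fst (snd s))) * (\<Prod>j\<in>X. ball_bump (d j) (r j) n (snd (snd s)))"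
 for X n and s :: "'s \<times> 'x \<times> 'y"
 have CX: "B \<inter> (\<Inter>j\<in>X. E j) \<in> sets S" if "finite X" for X
 using that B E by (cases "X = {}") (auto intro!: sets.Int sets.finite_INT)
 have uX: "unit_lipschitz (%x. \<Prod>j\<in>X. ball_bump (c j) (r j) n x)" "unit_lipschitz (%x. \<Prod>j\<in>X. ball_bump (d j) (r j) n x)" if "finite X" for X n
 using that by (auto intro!: unit_lipschitz_prod unit_lipschitz_ball_bump)
 have Im: "I X n \<in> borel_measurable N" if "finite X" for X n
 unfolding I_def[abs_def] by (rule product_measurable[OF CX[OF that] uX[OF that]])
 have I01: "\<bar>I X n s\<bar> <= 1" if "finite X" for X n s
 unfolding I_def using unit_lipschitzD[OF uX(1)[OF that]] unit_lipschitzD[OF uX(2)[OF that]]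
 by (auto simp: abs_mult indicator_def intro!: mult_le_one)
 have hI: "h n s = indicator B (fst s) - (\<Sum>X\<in>Pow {..<n}. (- 1) ^ card X * I X n s)" for n s
 proof -
 have "(\<Prod>j<n. 1 - a n j s) = (\<Prod>j<n. - a n j s + 1)" by (intro prod.cong) auto
 also have "\<dots> = (\<Sum>X\<in>Pow {..<n}. (\<Prod>j\<in>X. - a n j s) * (\<Prod>j\<in>{..<n} - X. 1))" by (rule prod_add) simp
 also have "\<dots> = (\<Sum>X\<in>Pow {..<n}. (- 1) ^ card X * (\<Prod>j\<in>X. a n j s))"
 by (intro sum.cong) (auto simp: prod_uminus)
 finally have "indicator B (fst s) * (\<Prod>j<n. 1 - a n j s) = (\<Sum>X\<in>Pow {..<n}. indicator B (fst s) * ((- 1) ^ card X * (\<Prod>j\<in>X. a n j s)))"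
 by (simp add: sum_distrib_left)
 also have "\<dots> = (\<Sum>X\<in>Pow {..<n}. (- 1) ^ card X * I X n s)"
 proof (intro sum.cong refl)
 fix X assume "X \<in> Pow {..<n}"
 hence f: "finite X" by (auto intro: finite_subset)
 have "indicator (B \<inter> (\<Inter>j\<in>X. E j)) (fst s) = (indicator B (fst s) * (\<Prod>j\<in>X. indicator (E j) (fst s)) :: real)"
 using f by (induction X rule: finite_induct) (auto simp: indicator_def)
 thus "indicator B (fst s) * ((- 1) ^ card X * (\<Prod>j\<in>X. a n j s)) = (- 1) ^ card X * I X n s"
 unfolding I_def a_def prod.distrib by (simp add: ac_simps)
 qed
 finally show ?thesis by (simp add: h_def right_diff_distrib)
 qed
 have Bm: "(%s. indicator B (fst s) :: real) \<in> borel_measurable N" using B by (intro measurable_compose[OF measurable_fst]) simp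
 have hm: "h n \<in> borel_measurable N" for n
 proof -
 have "(%s. indicator B (fst s) - (\<Sum>X\<in>Pow {..<n}. (- 1) ^ card X * I X n s)) \<in> borel_measurable N"
 by (intro borel_measurable_diff borel_measurable_sum borel_measurable_times borel_measurable_const Bm Im)
 (auto intro: finite_subset)
 thus ?thesis by (simp add: hI[abs_def])
 qed
 have h0: "0 <= h n s" "h n s <= 1" for n s
 using pr01[of n s] by (auto simp: h_def indicator_def)
 have hG: "h n s <= indicator G s" if s: "s \<in> space N" for n s
 proof (cases "s \<in> G")
 case True thus ?thesis using h0 by simp
 next
 case False
 have "a n j s = 0 \<or> fst s \<notin> B" for j
 using False s ball_bump_outside[of "fst (snd s)" "c j" "r j" n] ball_bump_outside[of "snd (snd s)" "d j" "r j" n]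
 by (auto simp: a_def G_def indicator_def)
 hence "h n s = 0" by (auto simp: h_def indicator_def)
 thus ?thesis by simp
 qed
 have hlim: "(%n. h n s) \<longlonglongrightarrow> indicator G s" if s: "s \<in> space N" for s
 proof (cases "s \<in> G")
 case False
 hence "h n s = 0" for n using hG[OF s, of n] h0[of n s] by simp
 thus ?thesis using False by simp
 next
 case True
 then obtain j where j: "fst s \<in> B" "fst s \<in> E j" "fst (snd s) \<in> ball (c j) (r j)" "snd (snd s) \<in> ball (d j) (r j)"
 by (auto simp: G_def)
 obtain n1 where n1: "\<forall>n\<ge>n1. ball_bump (c j) (r j) n (fst (snd s)) = 1" using ball_bump_inside[OF j(3)] by blast
 obtain n2 where n2: "\<forall>n\<ge>n2. ball_bump (d j) (r j) n (snd (snd s)) = 1" using ball_bump_inside[OF j(4)] by blast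
 have "h n s = 1" if n: "n \<ge> max (Suc j) (max n1 n2)" for n
 proof -
 have "a n j s = 1" using n n1 n2 j(2) by (simp add: a_def)
 hence "(\<Prod>j<n. 1 - a n j s) = 0" using n by (intro prod_zero) auto
 thus ?thesis using j(1) by (simp add: h_def)
 qed
 hence "\<forall>\<^sub>F n in sequentially. h n s = 1" unfolding eventually_sequentially by blast
 thus ?thesis using True by (simp add: tendsto_eventually)
 qed
 have hlimP: "(%k. \<integral>s. h n s \<partial>P k) \<longlonglongrightarrow> (\<integral>s. h n s \<partial>P0)" for n
 proof -
 have int: "(\<integral>s. h n s \<partial>R) = (\<integral>s. indicator B (fst s) * 1 * 1 \<partial>R) - (\<Sum>X\<in>Pow {..<n}. (- 1) ^ card X * (\<integral>s. I X n s \<partial>R))"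
 if R: "finite_measure R" "sets R = sets N" for R
 proof -
 interpret R: finite_measure R by fact
 have Rm: "f \<in> borel_measurable N ==> f \<in> borel_measurable R" for f :: "_ => real"
 using measurable_cong_sets[OF R(2) refl] by auto
 have iB: "integrable R (%s. indicator B (fst s) :: real)"
 by (rule R.integrable_const_bound[of _ 1 , OF _ Rm[OF Bm]]) simp
 have iI: "integrable R (I X n)" if "X \<in> Pow {..<n}" for X
 proof -
 have f: "finite X" using that by (auto intro: finite_subset)
 show ?thesis by (rule R.integrable_const_bound[of _ 1, OF _ Rm[OF Im[OF f]]]) (simp add: I01[OF f])
 qed
 have "(\<integral>s. h n s \<partial>R) = (\<integral>s. indicator B (fst s) \<partial>R) - (\<integral>s. (\<Sum>X\<in>Pow {..<n}. (- 1) ^ card X * I X n s) \<partial>R)"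
 unfolding hI using iI by (intro Bochner_Integration.integral_diff iB Bochner_Integration.integrable_sum integrable_mult_right) auto
 also have "(\<integral>s. (\<Sum>X\<in>Pow {..<n}. (- 1) ^ card X * I X n s) \<partial>R) = (\<Sum>X\<in>Pow {..<n}. (- 1) ^ card X * (\<integral>s. I X n s \<partial>R))"
 using iI by (subst Bochner_Integration.integral_sum) auto
 finally show ?thesis by simp
 qed
 have "(%k. \<integral>s. I X n s \<partial>P k) \<longlonglongrightarrow> (\<integral>s. I X n s \<partial>P0)" if "X \<in> Pow {..<n}" for X
 proof -
 have f: "finite X" using that by (auto intro: finite_subset)
 show ?thesis unfolding I_def by (rule P_lim[OF CX[OF f] uX[OF f]])
 qed
 thus ?thesis
 unfolding int[OF P_finite P_sets] int[OF P0_finite P0_sets]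
 by (intro tendsto_diff tendsto_sum tendsto_mult tendsto_const P_lim[OF B unit_lipschitz_one unit_lipschitz_one])
 qed
 have GP: "G \<in> sets P0" "G \<in> sets (P k)" for k using G P0_sets P_sets by auto
 have spN: "space P0 = space N" "space (P k) = space N" for k using sets_eq_imp_space_eq P0_sets P_sets by blast+
 have "(%n. \<integral>s. h n s \<partial>P0) \<longlonglongrightarrow> (\<integral>s. indicator G s \<partial>P0)"
 proof (rule integral_dominated_convergence)
 show "integrable P0 (%_. 1 :: real)" by (rule P0.integrable_const)
 show "h n \<in> borel_measurable P0" for n by (rule P_meas(2)[OF hm])
 show "AE s in P0. (%n. h n s) \<longlonglongrightarrow> indicator G s" by (rule AE_I2) (simp add: hlim spN)
 show "AE s in P0. norm (h n s) <= 1" for n using h0 by (intro AE_I2) simp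
 qed (use GP in simp)
 hence "(%n. \<integral>s. h n s \<partial>P0) \<longlonglongrightarrow> measure P0 G" using GP(1) by simp
 hence "\<forall>\<^sub>F n in sequentially. measure P0 G - e / 2 < (\<integral>s. h n s \<partial>P0)" by (rule order_tendstoD) (use e in simp)
 then obtain n where n: "measure P0 G - e / 2 < (\<integral>s. h n s \<partial>P0)" unfolding eventually_sequentially by blast
 have "\<forall>\<^sub>F k in sequentially. (\<integral>s. h n s \<partial>P0) - e / 2 < (\<integral>s. h n s \<partial>P k)" by (rule order_tendstoD[OF hlimP]) (use e in simp)
 thus "\<forall>\<^sub>F k in sequentially. measure P0 G - e <= measure (P k) G"
 proof eventually_elim
 case (elim k)
 interpret Pk: finite_measure "P k" by (rule P_finite)
 have "(\<integral>s. h n s \<partial>P k) <= (\<integral>s. indicator G s \<partial>P k)"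
 proof (rule integral_mono)
 show "integrable (P k) (h n)" using h0 by (intro Pk.integrable_const_bound[of _ 1] P_meas(1)[OF hm]) auto
 show "integrable (P k) (indicator G :: _ => real)" using GP by (intro integrable_real_indicator) (auto simp: Pk.emeasure_finite less_top[symmetric])
 qed (simp add: hG spN)
 also have "\<dots> = measure (P k) G" using GP(2) by simp
 finally show ?case using elim n by linarith
 qed
qed

end

text \<open>
 The upper semicontinuous functions below are merely measurable in time. Projections of measurable
 sets are avoided by testing the sections of the complement only against the countably many kernels \<open>H\<close>:
 a time is kept for a box if no kernel charges the part of the box inside the closed set.
\<close>

locale stable_limit_kernel = stable_limit S P P0
 for S :: "'s measure" and P :: "nat => ('s \<times> ('x::euclidean_space \<times> 'y::euclidean_space)) measure" and P0 +
 fixes L :: "'t measure" and \<tau> :: "'s => 't"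
 and H :: "nat => ('t \<times> ('x \<times> 'y)) set => 't => ennreal" and H0 :: "('t \<times> ('x \<times> 'y)) set => 't => ennreal"
 assumes \<tau>: "\<tau> \<in> S \<rightarrow>\<^sub>M L"
 and H_meas: "!!k D. D \<in> sets (L \<Otimes>\<^sub>M (borel \<Otimes>\<^sub>M borel)) ==> H k D \<in> borel_measurable L"
 "!!D. D \<in> sets (L \<Otimes>\<^sub>M (borel \<Otimes>\<^sub>M borel)) ==> H0 D \<in> borel_measurable L"
 and H_empty: "!!k D t. (!!v. (t, v) \<notin> D) ==> H k D t = 0" "!!D t. (!!v. (t, v) \<notin> D) ==> H0 D t = 0"
 and P_H: "!!k D E. D \<in> sets (L \<Otimes>\<^sub>M (borel \<Otimes>\<^sub>M borel)) ==> E \<in> sets L ==>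
 emeasure (P k) {s \<in> space N. \<tau> (fst s) \<in> E & (\<tau> (fst s), snd s) \<in> D} = (\<integral>\<^sup>+t. H k D t * indicator E t \<partial>L)"
 "!!D E. D \<in> sets (L \<Otimes>\<^sub>M (borel \<Otimes>\<^sub>M borel)) ==> E \<in> sets L ==>
 emeasure P0 {s \<in> space N. \<tau> (fst s) \<in> E & (\<tau> (fst s), snd s) \<in> D} = (\<integral>\<^sup>+t. H0 D t * indicator E t \<partial>L)"
 and P_base: "!!k B. B \<in> sets S ==> measure (P k) {s \<in> space N. fst s \<in> B} = measure P0 {s \<in> space N. fst s \<in> B}"
begin

abbreviation "NL \<equiv> L \<Otimes>\<^sub>M ((borel :: 'x measure) \<Otimes>\<^sub>M (borel :: 'y measure))"

lemma time_measurable: "(%s. (\<tau> (fst s), snd s)) \<in> N \<rightarrow>\<^sub>M NL"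
 by (intro measurable_Pair measurable_compose[OF measurable_fst \<tau>] measurable_snd)

lemma base_sets: "B \<in> sets S ==> {s \<in> space N. fst s \<in> B} \<in> sets N"
 using measurable_sets[of fst N S B] by (simp add: vimage_def Int_def conj_commute)

lemma time_sets: "F \<in> sets NL ==> {s \<in> space N. (\<tau> (fst s), snd s) \<in> F} \<in> sets N"
 using measurable_sets[OF time_measurable, of F] by (simp add: vimage_def Int_def conj_commute)

text \<open>Over \<open>B\<close>, the complement \<open>G\<close> of \<open>F\<close> is covered by
  \<open>G'\<close>, the union of the boxes over the times in \<open>E j\<close>: a point missed by
  a closed section has a box free of that section, and all kernels vanish there. Conversely
  \<open>G'\<close> exceeds \<open>G\<close> only inside the sets \<open>Z j\<close>, which are null
  for all the measures. So the bound of \<open>open_liminf\<close> for \<open>G'\<close> transfers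
  to \<open>G\<close>, and equal base masses turn it into an upper bound for
  \<open>F\<close>.\<close>

lemma closed_limsup:
 assumes B: "B \<in> sets S" and F: "F \<in> sets NL" and cl: "!!t. t \<in> space L ==> closed {v. (t, v) \<in> F}" and e: "e > 0"
 shows "\<forall>\<^sub>F k in sequentially. measure (P k) {s \<in> space N. fst s \<in> B & (\<tau> (fst s), snd s) \<in> F} \<le>
 measure P0 {s \<in> space N. fst s \<in> B & (\<tau> (fst s), snd s) \<in> F} + e"
proof -
 obtain Qx :: "'x set" where Qx: "countable Qx" "!!X. open X ==> X ~= {} ==> \<exists>d\<in>Qx. d \<in> X" using countable_dense_setE by blast
 obtain Qy :: "'y set" where Qy: "countable Qy" "!!X. open X ==> X ~= {} ==> \<exists>d\<in>Qy. d \<in> X" using countable_dense_setE by blast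
 let ?I = "Qx \<times> Qy \<times> range (%n. inverse (real (Suc n)))"
 have cI: "countable ?I" using Qx(1) Qy(1) by (intro countable_SIGMA) auto
 define c where "c j = fst (from_nat_into ?I j)" for j
 define d where "d j = fst (snd (from_nat_into ?I j))" for j
 define r where "r j = snd (snd (from_nat_into ?I j))" for j
 define D where "D j = F \<inter> (space L \<times> (ball (c j) (r j) \<times> ball (d j) (r j)))" for j
 have D: "D j \<in> sets NL" for j unfolding D_def by (intro sets.Int F pair_measureI) auto
 define E where "E j = {t \<in> space L. (\<forall>k. H k (D j) t = 0) & H0 (D j) t = 0}" for j
 have E: "E j \<in> sets L" for j
 proof -
 have "{t \<in> space L. H k (D j) t = 0} \<in> sets L" "{t \<in> space L. H0 (D j) t = 0} \<in> sets L" for k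
 using H_meas(1)[OF D, of k j] H_meas(2)[OF D, of j] by (auto intro: borel_measurable_eq)
 hence "{t \<in> space L. \<forall>k. H k (D j) t = 0} \<in> sets L" "{t \<in> space L. H0 (D j) t = 0} \<in> sets L"
 by (auto intro: sets.sets_Collect_countable_All)
 hence "{t \<in> space L. \<forall>k. H k (D j) t = 0} \<inter> {t \<in> space L. H0 (D j) t = 0} \<in> sets L" by (rule sets.Int)
 moreover have "E j = {t \<in> space L. \<forall>k. H k (D j) t = 0} \<inter> {t \<in> space L. H0 (D j) t = 0}" by (auto simp: E_def)
 ultimately show ?thesis by simp
 qed
 define E' where "E' j = \<tau> -` E j \<inter> space S" for j
 have E': "E' j \<in> sets S" for j unfolding E'_def by (rule measurable_sets[OF \<tau> E])
 define G' where "G' = {s \<in> space N. fst s \<in> B & (\<exists>j. fst s \<in> E' j & fst (snd s) \<in> ball (c j) (r j) & snd (snd s) \<in> ball (d j) (r j))}"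
 note ol = open_liminf[where E=E', OF B E' e, where c=c and d=d and r=r, folded G'_def]
 let ?B = "{s \<in> space N. fst s \<in> B}" and ?F = "{s \<in> space N. fst s \<in> B & (\<tau> (fst s), snd s) \<in> F}"
 have FB: "?F = ?B \<inter> {s \<in> space N. (\<tau> (fst s), snd s) \<in> F}" by auto
 have Fs: "?F \<in> sets N" unfolding FB by (intro sets.Int base_sets[OF B] time_sets[OF F])
 define G where "G = ?B - ?F"
 have G: "G \<in> sets N" unfolding G_def by (intro sets.Diff base_sets[OF B] Fs)
 have sub: "G \<subseteq> G'"
 proof
 fix s assume "s \<in> G"
 hence s: "s \<in> space N" "fst s \<in> B" "(\<tau> (fst s), snd s) \<notin> F" by (auto simp: G_def)
 let ?t = "\<tau> (fst s)"
 have sS: "fst s \<in> space S" using s(1) by (auto simp: space_pair_measure)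
 hence t: "?t \<in> space L" using measurable_space[OF \<tau>] by blast
 have "open (- {v. (?t, v) \<in> F})" using cl[OF t] by (rule open_Compl)
 moreover have "snd s \<in> - {v. (?t, v) \<in> F}" using s(3) by simp
 ultimately obtain \<epsilon> where \<epsilon>: "\<epsilon> > 0" "ball (snd s) \<epsilon> \<subseteq> - {v. (?t, v) \<in> F}" by (rule openE)
 \<comment> \<open>The box centre is within \<open>\<rho>\<close> of the point in each factor, so
   points of the box are within \<open>2 * \<rho>\<close> in each factor and
   \<open>4 * \<rho>\<close> altogether.\<close>
 obtain n where n: "inverse (real (Suc n)) < \<epsilon> / 4" using reals_Archimedean[of "\<epsilon> / 4"] \<epsilon>(1) by auto
 define \<rho> where "\<rho> = inverse (real (Suc n))"
 have \<rho>: "\<rho> > 0" "4 * \<rho> < \<epsilon>" using n by (auto simp: \<rho>_def)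
 obtain x where x: "x \<in> Qx" "x \<in> ball (fst (snd s)) \<rho>" using Qx(2)[of "ball (fst (snd s)) \<rho>"] \<rho>(1) by auto
 obtain y where y: "y \<in> Qy" "y \<in> ball (snd (snd s)) \<rho>" using Qy(2)[of "ball (snd (snd s)) \<rho>"] \<rho>(1) by auto
 have "(x, y, \<rho>) \<in> ?I" using x y by (auto simp: \<rho>_def)
 from from_nat_into_surj[OF cI this] obtain j where j: "from_nat_into ?I j = (x, y, \<rho>)" by blast
 hence cdr: "c j = x" "d j = y" "r j = \<rho>" by (simp_all add: c_def d_def r_def)
 have "(?t, v) \<notin> D j" for v
 proof
 assume "(?t, v) \<in> D j"
 hence v: "(?t, v) \<in> F" "dist x (fst v) < \<rho>" "dist y (snd v) < \<rho>" by (auto simp: D_def cdr)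
 have "dist (fst (snd s)) (fst v) < 2 * \<rho>" using x(2) v(2) dist_triangle[of "fst (snd s)" "fst v" x] by simp
 moreover have "dist (snd (snd s)) (snd v) < 2 * \<rho>" using y(2) v(3) dist_triangle[of "snd (snd s)" "snd v" y] by simp
 moreover have "dist (snd s) v <= dist (fst (snd s)) (fst v) + dist (snd (snd s)) (snd v)"
 unfolding dist_prod_def by (rule sqrt_sum_squares_le_sum) auto
 ultimately have "v \<in> ball (snd s) \<epsilon>" using \<rho>(2) by simp
 thus False using \<epsilon>(2) v(1) by blast
 qed
 hence "?t \<in> E j" using t H_empty by (simp add: E_def)
 hence "fst s \<in> E' j" using sS by (simp add: E'_def)
 thus "s \<in> G'" using s x(2) y(2) unfolding G'_def by (auto simp: cdr dist_commute)
 qed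
 define Z where "Z j = {s \<in> space N. \<tau> (fst s) \<in> E j & (\<tau> (fst s), snd s) \<in> D j}" for j
 have Zs: "Z j \<in> sets N" for j
 proof -
 have "Z j = {s \<in> space N. fst s \<in> E' j} \<inter> {s \<in> space N. (\<tau> (fst s), snd s) \<in> D j}"
 by (auto simp: Z_def E'_def space_pair_measure)
 thus ?thesis using sets.Int[OF base_sets[OF E'] time_sets[OF D], of j j] by simp
 qed
 have ZN: "Z j \<in> null_sets (P k)" "Z j \<in> null_sets P0" for j k
 proof -
 have "(\<integral>\<^sup>+t. H k (D j) t * indicator (E j) t \<partial>L) = (\<integral>\<^sup>+t. 0 \<partial>L)"
 by (intro nn_integral_cong) (auto simp: E_def indicator_def)
 moreover have "(\<integral>\<^sup>+t. H0 (D j) t * indicator (E j) t \<partial>L) = (\<integral>\<^sup>+t. 0 \<partial>L)"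
 by (intro nn_integral_cong) (auto simp: E_def indicator_def)
 ultimately have "emeasure (P k) (Z j) = 0" "emeasure P0 (Z j) = 0"
 using P_H(1)[OF D E, of k j j] P_H(2)[OF D E, of j j] by (simp_all add: Z_def)
 thus "Z j \<in> null_sets (P k)" "Z j \<in> null_sets P0" using Zs P_sets P0_sets by auto
 qed
 have G'sub: "G' \<subseteq> G \<union> (\<Union>j. Z j)"
 proof
 fix s assume s: "s \<in> G'"
 hence s': "s \<in> space N" "fst s \<in> B" by (auto simp: G'_def)
 hence t: "\<tau> (fst s) \<in> space L" using measurable_space[OF \<tau>] by (auto simp: space_pair_measure)
 show "s \<in> G \<union> (\<Union>j. Z j)"
 proof (cases "(\<tau> (fst s), snd s) \<in> F")
 case False thus ?thesis using s' by (simp add: G_def)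
 next
 case True
 obtain j where "fst s \<in> E' j" "fst (snd s) \<in> ball (c j) (r j)" "snd (snd s) \<in> ball (d j) (r j)"
 using s by (auto simp: G'_def)
 hence "s \<in> Z j" using True t s' by (auto simp: Z_def D_def E'_def mem_Times_iff)
 thus ?thesis by blast
 qed
 qed
 have le: "measure R G' <= measure R G" if R: "finite_measure R" "sets R = sets N" "!!j. Z j \<in> null_sets R" for R
 proof -
 interpret R: finite_measure R by fact
 have "AE s in R. s \<notin> (\<Union>j. Z j)" by (rule AE_not_in) (use R(3) in blast)
 hence "AE s in R. s \<in> G' --> s \<in> G" by eventually_elim (use G'sub in blast)
 thus ?thesis using G R(2) by (intro R.finite_measure_mono_AE) auto
 qed
 have eqB: "measure R ?F = measure R ?B - measure R G" if R: "finite_measure R" "sets R = sets N" for R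
 proof -
 interpret R: finite_measure R by fact
 have "measure R G = measure R ?B - measure R ?F" unfolding G_def
 using base_sets[OF B] Fs R(2) by (intro R.finite_measure_Diff) auto
 thus ?thesis by simp
 qed
 have P0G: "measure P0 G <= measure P0 G'"
 proof -
 interpret P0: finite_measure P0 by (rule P0_finite)
 show ?thesis using sub ol(1) P0_sets by (intro P0.finite_measure_mono) auto
 qed
 from ol(2) show ?thesis
 proof eventually_elim
 case (elim k)
 have "measure (P k) G' <= measure (P k) G" by (rule le[OF P_finite P_sets ZN(1)])
 thus ?case
 unfolding eqB[OF P_finite P_sets] eqB[OF P0_finite P0_sets] P_base[OF B] using elim P0G by linarith
 qed
qed

text \<open>The sum is the integer part of \<open>y\<close>.\<close>

lemma sum_levels:
 fixes y :: real assumes "0 <= y" "y <= real n"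
 shows "(\<Sum>i\<in>{1..n}. if real i <= y then 1 else 0 :: real) <= y" "y <= (\<Sum>i\<in>{1..n}. if real i <= y then 1 else 0 :: real) + 1"
proof -
 have "(\<Sum>i\<in>{1..n}. if real i <= y then 1 else 0 :: real) = (\<Sum>i\<in>{1..n} \<inter> {i. real i <= y}. 1)"
 using sum.inter_restrict[of "{1..n}" "%_. 1::real" "{i. real i <= y}"] by simp
 also have "{1..n} \<inter> {i. real i <= y} = {1..nat \<lfloor>y\<rfloor>}" using assms by (auto simp: le_nat_floor nat_le_iff) linarith+
 also have "(\<Sum>i\<in>{1..nat \<lfloor>y\<rfloor>}. 1 :: real) = of_int \<lfloor>y\<rfloor>" using assms(1) by simp
 finally have eq: "(\<Sum>i\<in>{1..n}. if real i <= y then 1 else 0 :: real) = of_int \<lfloor>y\<rfloor>" .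
 show "(\<Sum>i\<in>{1..n}. if real i <= y then 1 else 0 :: real) <= y" "y <= (\<Sum>i\<in>{1..n}. if real i <= y then 1 else 0 :: real) + 1"
 unfolding eq by linarith+
qed

text \<open>\<open>\<alpha>\<close> is sliced into \<open>m\<close> levels of height
  \<open>w\<close>. Each superlevel set has closed sections, so \<open>closed_limsup\<close> applies
  level by level.\<close>

lemma usc_limsup:
 fixes M e :: real and \<alpha> :: "'t \<times> ('x \<times> 'y) => real"
 assumes B: "B \<in> sets S" and \<alpha>: "\<alpha> \<in> borel_measurable NL" and M: "M > 0" "!!v. \<bar>\<alpha> v\<bar> <= M"
 and usc: "!!t c. t \<in> space L ==> closed {v. c <= \<alpha> (t, v)}" and e: "e > 0"
 shows "\<forall>\<^sub>F k in sequentially. (\<integral>s. indicator B (fst s) * \<alpha> (\<tau> (fst s), snd s) \<partial>P k) \<le>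
 (\<integral>s. indicator B (fst s) * \<alpha> (\<tau> (fst s), snd s) \<partial>P0) + e"
proof -
 define b where "b = measure P0 {s \<in> space N. fst s \<in> B}"
 have b0: "0 <= b" by (simp add: b_def)
 \<comment> \<open>Slicing costs \<open>w * b\<close>, at most \<open>e / 2\<close>; the
   \<open>m\<close> levels, each with error \<open>e / (4 * M)\<close> and weight
   \<open>w = 2 * M / m\<close>, cost the other half. The \<open>+ 1\<close> keeps the divisor
   positive when \<open>b = 0\<close>.\<close>
 obtain n where n: "inverse (real (Suc n)) < e / (4 * M * (b + 1))"
 using reals_Archimedean[of "e / (4 * M * (b + 1))"] e M(1) b0 by auto
 define m where "m = Suc n"
 have m0: "real m > 0" by (simp add: m_def)
 define w where "w = 2 * M / real m"
 have w0: "w > 0" using M(1) m0 by (simp add: w_def)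
 have wb: "w * b <= e / 2"
 proof -
 have "inverse (real m) * (4 * M * (b + 1)) < e" using n M(1) b0 by (simp add: m_def pos_less_divide_eq)
 hence "2 * (w * (b + 1)) < e" by (simp add: w_def divide_inverse ac_simps)
 thus ?thesis using w0 by (simp add: distrib_left)
 qed
 define F where "F i = {v \<in> space NL. real i * w - M <= \<alpha> v}" for i :: nat
 have F: "F i \<in> sets NL" for i unfolding F_def using \<alpha> by measurable
 have Fcl: "closed {v. (t, v) \<in> F i}" if "t \<in> space L" for t i
 using usc[OF that, of "real i * w - M"] that by (simp add: F_def space_pair_measure)
 let ?A = "%i. {s \<in> space N. fst s \<in> B & (\<tau> (fst s), snd s) \<in> F i}"
 have As: "?A i \<in> sets N" for i
 proof -
 have "?A i = {s \<in> space N. fst s \<in> B} \<inter> {s \<in> space N. (\<tau> (fst s), snd s) \<in> F i}" by auto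
 thus ?thesis using sets.Int[OF base_sets[OF B] time_sets[OF F]] by simp
 qed
 let ?f = "%s. indicator B (fst s) * \<alpha> (\<tau> (fst s), snd s)"
 let ?g = "%s. w * (\<Sum>i\<in>{1..m}. indicator (?A i) s) - M * indicator {s \<in> space N. fst s \<in> B} s"
 have pt: "?g s <= ?f s" "?f s <= ?g s + w * indicator {s \<in> space N. fst s \<in> B} s" if s: "s \<in> space N" for s
 proof -
 have tv: "(\<tau> (fst s), snd s) \<in> space NL" using measurable_space[OF time_measurable s] .
 define y where "y = (\<alpha> (\<tau> (fst s), snd s) + M) / w"
 have wy: "w * y = \<alpha> (\<tau> (fst s), snd s) + M" using w0 by (simp add: y_def)
 have y: "0 <= y" "y <= real m"
 proof -
 show "0 <= y" unfolding y_def using M(2)[of "(\<tau> (fst s), snd s)"] w0 by (intro divide_nonneg_nonneg) linarith+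
 have "\<alpha> (\<tau> (fst s), snd s) + M <= real m * w" using M(2)[of "(\<tau> (fst s), snd s)"] m0 by (simp add: w_def)
 thus "y <= real m" unfolding y_def using w0 by (simp add: pos_divide_le_eq)
 qed
 have iff: "real i * w - M <= \<alpha> (\<tau> (fst s), snd s) \<longleftrightarrow> real i <= y" for i
 unfolding y_def using w0 by (simp add: pos_le_divide_eq algebra_simps)
 have sum: "(\<Sum>i\<in>{1..m}. indicator (?A i) s) = (if fst s \<in> B then (\<Sum>i\<in>{1..m}. if real i <= y then 1 else 0) else 0 :: real)"
 proof -
 have "indicator (?A i) s = (if fst s \<in> B & real i <= y then 1 else 0 :: real)" for i
 using s tv by (simp add: indicator_def F_def iff)
 thus ?thesis by (cases "fst s \<in> B") (simp_all only: simp_thms if_True if_False sum.neutral_const)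
 qed
 have "w * (\<Sum>i\<in>{1..m}. if real i <= y then 1 else 0 :: real) <= w * y" "w * y <= w * ((\<Sum>i\<in>{1..m}. if real i <= y then 1 else 0 :: real) + 1)"
 using sum_levels[OF y] w0 by (intro mult_left_mono; simp)+
 thus "?g s <= ?f s" "?f s <= ?g s + w * indicator {s \<in> space N. fst s \<in> B} s"
 unfolding sum wy using s by (auto simp: indicator_def algebra_simps)
 qed
 have int: "integrable R ?f" "integrable R ?g" "integrable R (%s. w * indicator {s \<in> space N. fst s \<in> B} s)"
 "(\<integral>s. ?g s \<partial>R) = w * (\<Sum>i\<in>{1..m}. measure R (?A i)) - M * measure R {s \<in> space N. fst s \<in> B}"
 "(\<integral>s. w * indicator {s \<in> space N. fst s \<in> B} s \<partial>R) = w * measure R {s \<in> space N. fst s \<in> B}"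
 if R: "finite_measure R" "sets R = sets N" for R
 proof -
 interpret R: finite_measure R by fact
 have i: "integrable R (indicator X :: _ => real)" if "X \<in> sets N" for X
 using that R(2) by (intro integrable_real_indicator) (auto simp: R.emeasure_finite less_top[symmetric])
 have iA: "integrable R (indicator (?A i) :: _ => real)" for i by (rule i[OF As])
 have iB: "integrable R (indicator {s \<in> space N. fst s \<in> B} :: _ => real)" by (rule i[OF base_sets[OF B]])
 have iS: "integrable R (%s. w * (\<Sum>i\<in>{1..m}. indicator (?A i) s))" by (intro integrable_mult_right Bochner_Integration.integrable_sum iA)
 show "integrable R ?g" by (intro Bochner_Integration.integrable_diff iS integrable_mult_right iB)
 show "integrable R (%s. w * indicator {s \<in> space N. fst s \<in> B} s)" by (intro integrable_mult_right iB)
 have XR: "X \<in> sets R" "X \<subseteq> space R" if "X \<in> sets N" for X using that R(2) sets.sets_into_space[of X R] by auto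
 show "(\<integral>s. w * indicator {s \<in> space N. fst s \<in> B} s \<partial>R) = w * measure R {s \<in> space N. fst s \<in> B}"
 using XR[OF base_sets[OF B]] by (simp add: Int_absorb2)
 have "(\<integral>s. ?g s \<partial>R) = (\<integral>s. w * (\<Sum>i\<in>{1..m}. indicator (?A i) s) \<partial>R) - (\<integral>s. M * indicator {s \<in> space N. fst s \<in> B} s \<partial>R)"
 by (intro Bochner_Integration.integral_diff iS integrable_mult_right iB)
 also have "(\<integral>s. w * (\<Sum>i\<in>{1..m}. indicator (?A i) s) \<partial>R) = w * (\<Sum>i\<in>{1..m}. \<integral>s. indicator (?A i) s \<partial>R)"
 using iA by (simp add: Bochner_Integration.integral_sum)
 also have "(\<Sum>i\<in>{1..m}. \<integral>s. indicator (?A i) s \<partial>R) = (\<Sum>i\<in>{1..m}. measure R (?A i))"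
 using XR[OF As] by (intro sum.cong) (simp_all add: Int_absorb2)
 also have "(\<integral>s. M * indicator {s \<in> space N. fst s \<in> B} s \<partial>R) = M * measure R {s \<in> space N. fst s \<in> B}"
 using XR[OF base_sets[OF B]] by (simp add: Int_absorb2)
 finally show "(\<integral>s. ?g s \<partial>R) = w * (\<Sum>i\<in>{1..m}. measure R (?A i)) - M * measure R {s \<in> space N. fst s \<in> B}" .
 have fm: "?f \<in> borel_measurable N"
 using B by (intro borel_measurable_times measurable_compose[OF measurable_fst] measurable_compose[OF time_measurable \<alpha>]) simp
 have "?f \<in> borel_measurable R" using fm measurable_cong_sets[OF R(2) refl] by blast
 thus "integrable R ?f" using M by (intro R.integrable_const_bound[of _ M]) (auto simp: indicator_def)
 qed
 have spR: "space R = space N" if "sets R = sets N" for R :: "('s \<times> 'x \<times> 'y) measure" by (rule sets_eq_imp_space_eq[OF that])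
 have ev: "\<forall>\<^sub>F k in sequentially. \<forall>i\<in>{1..m}. measure (P k) (?A i) <= measure P0 (?A i) + e / (4 * M)"
 by (rule eventually_ball_finite) (use closed_limsup[OF B F Fcl] e M(1) in auto)
 thus ?thesis
 proof eventually_elim
 case (elim k)
 have "(\<integral>s. ?f s \<partial>P k) <= (\<integral>s. ?g s + w * indicator {s \<in> space N. fst s \<in> B} s \<partial>P k)"
 proof (rule integral_mono)
 show "integrable (P k) (%s. ?g s + w * indicator {s \<in> space N. fst s \<in> B} s)"
 by (rule Bochner_Integration.integrable_add[OF int(2,3)[OF P_finite P_sets]])
 qed (use pt(2) int(1)[OF P_finite P_sets] spR[OF P_sets] in auto)
 also have "\<dots> = (\<integral>s. ?g s \<partial>P k) + (\<integral>s. w * indicator {s \<in> space N. fst s \<in> B} s \<partial>P k)"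
 by (rule Bochner_Integration.integral_add[OF int(2,3)[OF P_finite P_sets]])
 also have "\<dots> = w * (\<Sum>i\<in>{1..m}. measure (P k) (?A i)) - M * b + w * b"
 unfolding int(4,5)[OF P_finite P_sets] P_base[OF B] b_def ..
 also have "\<dots> <= w * (\<Sum>i\<in>{1..m}. measure P0 (?A i) + e / (4 * M)) - M * b + w * b"
 using elim w0 by (intro add_right_mono diff_right_mono mult_left_mono sum_mono) auto
 also have "\<dots> = w * (\<Sum>i\<in>{1..m}. measure P0 (?A i)) - M * b + w * (real m * (e / (4 * M))) + w * b"
 by (simp add: sum.distrib distrib_left)
 also have "w * (real m * (e / (4 * M))) = e / 2" using m0 M(1) by (simp add: w_def)
 also have "w * (\<Sum>i\<in>{1..m}. measure P0 (?A i)) - M * b = (\<integral>s. ?g s \<partial>P0)"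
 unfolding int(4)[OF P0_finite P0_sets] b_def ..
 also have "(\<integral>s. ?g s \<partial>P0) <= (\<integral>s. ?f s \<partial>P0)"
 by (rule integral_mono[OF int(2,1)[OF P0_finite P0_sets]]) (use pt(1) spR[OF P0_sets] in auto)
 finally show ?case using wb by linarith
 qed
qed

end

section \<open>Joint laws of base point, state and control\<close>

context control_kernel
begin

abbreviation "BT \<equiv> leb T \<Otimes>\<^sub>M (BH :: (('a::euclidean_space, 'b) hat) measure)"
abbreviation "BJ \<equiv> (BT :: (real \<times> (('a, 'b) hat)) measure) \<Otimes>\<^sub>M ((borel :: 'a::euclidean_space measure) \<Otimes>\<^sub>M (borel :: 'b measure))"

definition state_control :: "real \<times> (('a::euclidean_space, 'b) hat) => 'b => 'a \<times> 'b" where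
 "state_control y u = (fst (snd y) (fst y), u)"

definition time_kernel :: "real \<times> (('a::euclidean_space, 'b) hat) => 'b measure" where
 "time_kernel y = \<kappa> (snd (snd y)) (fst y)"

lemma measurable_time_kernel: "time_kernel \<in> BT \<rightarrow>\<^sub>M subprob_algebra BU"
 unfolding time_kernel_def[abs_def] by (rule measurable_kernel_BH)

lemma time_kernel_space:
 assumes "y \<in> space BT"
 shows "prob_space (time_kernel y)" "sets (time_kernel y) = sets BU" "space (time_kernel y) = U"
 unfolding time_kernel_def using assms by (intro kernel_space; auto simp: space_pair_measure)+

lemma measurable_state_control:
 assumes b: "b \<in> M \<rightarrow>\<^sub>M (BT :: (real \<times> ((real => 'a::euclidean_space) \<times> _)) measure)"
 shows "(%z. state_control (b (fst z)) (snd z)) \<in> M \<Otimes>\<^sub>M BU \<rightarrow>\<^sub>M borel \<Otimes>\<^sub>M borel"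
proof -
 have u: "(%u. u) \<in> BU \<rightarrow>\<^sub>M borel" by (rule measurable_BU) simp
 show ?thesis unfolding state_control_def
 by (intro measurable_Pair measurable_compose[OF measurable_compose[OF measurable_fst b] measurable_eval_BH] measurable_compose[OF measurable_snd u])
qed

text \<open>The base coordinate is read from \<open>a\<close>, the state and the kernel of the
  control from \<open>b\<close>. With \<open>a\<close> the limit point and \<open>b\<close> the
  approximating point, the base law stays fixed while state and control vary with the index.\<close>

definition joint :: "'c measure => ('c => real \<times> (('a::euclidean_space, 'b) hat)) =>
 ('c => real \<times> (('a, 'b) hat)) =>
 ((real \<times> (('a, 'b) hat)) \<times> ('a \<times> 'b)) measure" where
 "joint M a b = M \<bind> (%x. distr (time_kernel (b x)) BJ (%u. (a x, state_control (b x) u)))"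

context
 fixes M :: "'c measure" and a b :: "'c => real \<times> (('a::euclidean_space, 'b) hat)"
 assumes a: "a \<in> M \<rightarrow>\<^sub>M BT" and b: "b \<in> M \<rightarrow>\<^sub>M BT"
begin

lemma measurable_joint_map: "(%z. (a (fst z), state_control (b (fst z)) (snd z))) \<in> M \<Otimes>\<^sub>M BU \<rightarrow>\<^sub>M BJ"
 by (intro measurable_Pair measurable_compose[OF measurable_fst a] measurable_state_control[OF b])

lemma joint_kernel: "(%x. distr (time_kernel (b x)) BJ (%u. (a x, state_control (b x) u))) \<in> M \<rightarrow>\<^sub>M subprob_algebra BJ"
 by (rule measurable_distr2[OF _ measurable_compose[OF b measurable_time_kernel]])
 (use measurable_joint_map in \<open>simp add: case_prod_unfold\<close>)

lemma joint_map_section: "x \<in> space M ==> (%u. (a x, state_control (b x) u)) \<in> time_kernel (b x) \<rightarrow>\<^sub>M BJ"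
proof -
 assume x: "x \<in> space M"
 have "(%u. (a x, state_control (b x) u)) \<in> BU \<rightarrow>\<^sub>M BJ"
 using measurable_compose[OF measurable_Pair1'[OF x, of BU] measurable_joint_map] by (simp only: fst_conv snd_conv)
 thus "(%u. (a x, state_control (b x) u)) \<in> time_kernel (b x) \<rightarrow>\<^sub>M BJ"
 unfolding measurable_cong_sets[OF time_kernel_space(2)[OF measurable_space[OF b x]] refl] .
qed

lemma sets_joint: "space M ~= {} ==> sets (joint M a b) = sets BJ"
 unfolding joint_def by (rule sets_bind_measurable[OF joint_kernel])

lemma nn_integral_joint:
 assumes f: "f \<in> borel_measurable BJ"
 shows "(\<integral>\<^sup>+s. f s \<partial>joint M a b) = (\<integral>\<^sup>+x. \<integral>\<^sup>+u. f (a x, state_control (b x) u) \<partial>time_kernel (b x) \<partial>M)"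
 unfolding joint_def nn_integral_bind[OF f joint_kernel]
proof (rule nn_integral_cong)
 fix x assume x: "x \<in> space M"
 show "(\<integral>\<^sup>+s. f s \<partial>distr (time_kernel (b x)) BJ (%u. (a x, state_control (b x) u))) =
 (\<integral>\<^sup>+u. f (a x, state_control (b x) u) \<partial>time_kernel (b x))"
 by (rule nn_integral_distr[OF joint_map_section[OF x]]) (simp only: measurable_distr_eq1 f)
qed

text \<open>The kernels are probability measures, so the base marginal is the law of
  \<open>a\<close>.\<close>

lemma emeasure_joint_base:
 assumes B: "B \<in> sets BT" and M: "space M ~= {}"
 shows "emeasure (joint M a b) {s \<in> space BJ. fst s \<in> B} = (\<integral>\<^sup>+x. indicator B (a x) \<partial>M)"
proof -
 have s: "{s \<in> space BJ. fst s \<in> B} \<in> sets BJ"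
 using measurable_sets[of fst BJ BT B] B by (simp add: vimage_def Int_def conj_commute)
 have "emeasure (joint M a b) {s \<in> space BJ. fst s \<in> B} = (\<integral>\<^sup>+s. indicator {s \<in> space BJ. fst s \<in> B} s \<partial>joint M a b)"
 by (rule nn_integral_indicator[symmetric]) (simp add: sets_joint[OF M] s)
 also have "\<dots> = (\<integral>\<^sup>+x. \<integral>\<^sup>+u. indicator {s \<in> space BJ. fst s \<in> B} (a x, state_control (b x) u) \<partial>time_kernel (b x) \<partial>M)"
 by (rule nn_integral_joint[OF borel_measurable_indicator[OF s]])
 also have "\<dots> = (\<integral>\<^sup>+x. indicator B (a x) \<partial>M)"
 proof (rule nn_integral_cong)
 fix x assume x: "x \<in> space M"
 interpret prob_space "time_kernel (b x)" by (rule time_kernel_space(1)[OF measurable_space[OF b x]])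
 have "(\<integral>\<^sup>+u. indicator {s \<in> space BJ. fst s \<in> B} (a x, state_control (b x) u) \<partial>time_kernel (b x)) = (\<integral>\<^sup>+u. indicator B (a x) \<partial>time_kernel (b x))"
 using measurable_space[OF joint_map_section[OF x]] by (intro nn_integral_cong) (simp add: indicator_def)
 thus "(\<integral>\<^sup>+u. indicator {s \<in> space BJ. fst s \<in> B} (a x, state_control (b x) u) \<partial>time_kernel (b x)) = indicator B (a x)"
 by (simp add: emeasure_space_1)
 qed
 finally show ?thesis .
qed

lemma finite_measure_joint:
 assumes "finite_measure M" and M: "space M ~= {}"
 shows "finite_measure (joint M a b)"
proof
 interpret M: finite_measure M by fact
 have sp: "space (joint M a b) = space BJ" by (rule sets_eq_imp_space_eq[OF sets_joint[OF M]])
 hence "emeasure (joint M a b) (space (joint M a b)) = emeasure (joint M a b) {s \<in> space BJ. fst s \<in> space BT}"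
 by (intro arg_cong2[where f=emeasure] refl) (auto simp: space_pair_measure)
 also have "\<dots> = (\<integral>\<^sup>+x. indicator (space BT) (a x) \<partial>M)" by (rule emeasure_joint_base[OF sets.top M])
 also have "\<dots> <= (\<integral>\<^sup>+x. 1 \<partial>M)" by (intro nn_integral_mono) (simp add: indicator_def)
 finally show "emeasure (joint M a b) (space (joint M a b)) ~= \<infinity>"
 using M.emeasure_finite[of "space M"] by (auto simp: top_unique)
qed

text \<open>Given \<open>b x\<close> the state is deterministic and only the control is random, so a
  product test function integrates to the kernel mean of its last factor.\<close>

lemma joint_product:
 assumes C: "C \<in> sets BT" and f: "unit_lipschitz f" and g: "unit_lipschitz g" and M: "space M ~= {}"
 shows "(\<integral>s. indicator C (fst s) * f (fst (snd s)) * g (snd (snd s)) \<partial>joint M a b) =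
 (\<integral>x. indicator C (a x) * f (fst (snd (b x)) (fst (b x))) * kmean g (fst (b x)) (snd (snd (b x))) \<partial>M)"
proof -
 note f01 = unit_lipschitzD[OF f] and g01 = unit_lipschitzD[OF g]
 let ?F = "%s :: (real \<times> (('a, 'b) hat)) \<times> ('a \<times> 'b). indicator C (fst s) * f (fst (snd s)) * g (snd (snd s)) :: real"
 have F: "?F \<in> borel_measurable BJ"
 proof -
 have "(%s. indicator C (fst s) :: real) \<in> borel_measurable BJ" using C by (intro measurable_compose[OF measurable_fst]) simp
 moreover have "(%s. f (fst (snd s))) \<in> borel_measurable BJ"
 by (rule measurable_compose[OF measurable_compose[OF measurable_snd measurable_fst] unit_lipschitz_borel[OF f]])
 moreover have "(%s. g (snd (snd s))) \<in> borel_measurable BJ"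
 by (rule measurable_compose[OF measurable_compose[OF measurable_snd measurable_snd] unit_lipschitz_borel[OF g]])
 ultimately show ?thesis by (intro borel_measurable_times)
 qed
 have Fm: "?F \<in> borel_measurable (joint M a b)" unfolding measurable_cong_sets[OF sets_joint[OF M] refl] by (rule F)
 have Cm: "(%x. indicator C (a x) :: real) \<in> borel_measurable M" using C by (intro measurable_compose[OF a]) simp
 have fm: "(%x. f (fst (snd (b x)) (fst (b x)))) \<in> borel_measurable M"
 by (intro measurable_compose[OF measurable_compose[OF b measurable_eval_BH] unit_lipschitz_borel[OF f]])
 have gm: "(%x. kmean g (fst (b x)) (snd (snd (b x)))) \<in> borel_measurable M"
 by (rule measurable_compose[OF b measurable_kmean[OF unit_lipschitz_borel[OF g]]])
 have k0: "0 <= kmean g t q" for t q by (simp add: kmean_def)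
 have "(\<integral>s. ?F s \<partial>joint M a b) = enn2real (\<integral>\<^sup>+s. ennreal (?F s) \<partial>joint M a b)"
 by (rule integral_eq_nn_integral[OF Fm]) (simp add: f01 g01)
 also have "(\<integral>\<^sup>+s. ennreal (?F s) \<partial>joint M a b) = (\<integral>\<^sup>+x. \<integral>\<^sup>+u. ennreal (?F (a x, state_control (b x) u)) \<partial>time_kernel (b x) \<partial>M)"
 by (rule nn_integral_joint[OF measurable_compose[OF F measurable_ennreal]])
 also have "\<dots> = (\<integral>\<^sup>+x. ennreal (indicator C (a x) * f (fst (snd (b x)) (fst (b x))) * kmean g (fst (b x)) (snd (snd (b x)))) \<partial>M)"
 proof (rule nn_integral_cong)
 fix x assume x: "x \<in> space M"
 have bx: "snd (snd (b x)) \<in> controls T U p" "fst (b x) \<in> {0..T}"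
 using measurable_space[OF b x] by (auto simp: space_pair_measure)
 have gu: "(%u. ennreal (g u)) \<in> borel_measurable BU"
 by (rule measurable_compose[OF measurable_BU[OF unit_lipschitz_borel[OF g]] measurable_ennreal])
 have "(\<integral>\<^sup>+u. ennreal (?F (a x, state_control (b x) u)) \<partial>time_kernel (b x)) =
 (\<integral>\<^sup>+u. ennreal (indicator C (a x) * f (fst (snd (b x)) (fst (b x)))) * ennreal (g u) \<partial>\<kappa> (snd (snd (b x))) (fst (b x)))"
 unfolding time_kernel_def state_control_def by (simp add: ennreal_mult f01 g01)
 also have "\<dots> = ennreal (indicator C (a x) * f (fst (snd (b x)) (fst (b x)))) * ennreal (kmean g (fst (b x)) (snd (snd (b x))))"
 unfolding nn_integral_cmult[OF kernel_measurable_fun[OF bx gu]] kmean_bounds(1)[OF g01 bx] ..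
 also have "\<dots> = ennreal (indicator C (a x) * f (fst (snd (b x)) (fst (b x))) * kmean g (fst (b x)) (snd (snd (b x))))"
 by (rule ennreal_mult[symmetric]) (simp_all add: f01 k0)
 finally show "(\<integral>\<^sup>+u. ennreal (?F (a x, state_control (b x) u)) \<partial>time_kernel (b x)) = \<dots>" .
 qed
 also have "enn2real \<dots> = (\<integral>x. indicator C (a x) * f (fst (snd (b x)) (fst (b x))) * kmean g (fst (b x)) (snd (snd (b x))) \<partial>M)"
 by (rule integral_eq_nn_integral[symmetric]) (use Cm fm gm in \<open>auto simp: f01 k0\<close>)
 finally show ?thesis .
qed

end

abbreviation "NT \<equiv> leb T \<Otimes>\<^sub>M ((borel :: 'a::euclidean_space measure) \<Otimes>\<^sub>M (borel :: 'b measure))"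

lemma measurable_time_state_control:
 "(%z. (fst (fst z), state_control (fst z) (snd z))) \<in> BT \<Otimes>\<^sub>M BU \<rightarrow>\<^sub>M (NT :: (real \<times> ('a::euclidean_space \<times> 'b)) measure)"
 by (intro measurable_Pair measurable_compose[OF measurable_fst measurable_fst] measurable_state_control[OF measurable_ident_sets[OF refl]])

lemma measurable_time_section:
 assumes "y \<in> space (BT :: (real \<times> (('a::euclidean_space, 'b) hat)) measure)" "F \<in> NT \<rightarrow>\<^sub>M K"
 shows "(%u. F (fst y, state_control y u)) \<in> time_kernel y \<rightarrow>\<^sub>M K"
proof -
 have "(%u. F (fst y, state_control y u)) \<in> BU \<rightarrow>\<^sub>M K"
 using measurable_compose[OF measurable_Pair1'[OF assms(1), of BU] measurable_compose[OF measurable_time_state_control assms(2)]]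
 by (simp only: fst_conv snd_conv)
 thus ?thesis unfolding measurable_cong_sets[OF time_kernel_space(2)[OF assms(1)] refl] .
qed

lemma measurable_nn_integral_time_kernel:
 fixes F :: "real \<times> ('a::euclidean_space \<times> 'b) => ennreal"
 assumes F: "F \<in> borel_measurable NT"
 shows "(%y. \<integral>\<^sup>+u. F (fst y, state_control y u) \<partial>time_kernel y) \<in> borel_measurable BT"
proof (rule nn_integral_measurable_subprob_algebra2[OF _ measurable_time_kernel])
 show "(%(y, u). F (fst y, state_control y u)) \<in> borel_measurable (BT \<Otimes>\<^sub>M BU)"
 using measurable_compose[OF measurable_time_state_control F] by (simp add: case_prod_unfold)
qed

text \<open>The integrand depends on \<open>y\<close> too; pushing the kernels forward to
  \<open>NT\<close> moves the whole dependence into the measure.\<close>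

lemma measurable_integral_time_kernel:
 fixes F :: "real \<times> ('a::euclidean_space \<times> 'b) => real"
 assumes F: "F \<in> borel_measurable NT"
 shows "(%y. \<integral>u. F (fst y, state_control y u) \<partial>time_kernel y) \<in> borel_measurable BT"
proof -
 have "(%y. distr (time_kernel y) NT (%u. (fst y, state_control y u))) \<in> BT \<rightarrow>\<^sub>M subprob_algebra NT"
 by (rule measurable_distr2[OF _ measurable_time_kernel])
 (use measurable_time_state_control in \<open>simp add: case_prod_unfold\<close>)
 from measurable_compose[OF this integral_measurable_subprob_algebra[OF F]]
 have "(%y. \<integral>v. F v \<partial>distr (time_kernel y) NT (%u. (fst y, state_control y u))) \<in> borel_measurable BT" .
 moreover have "(\<integral>v. F v \<partial>distr (time_kernel y) NT (%u. (fst y, state_control y u))) = (\<integral>u. F (fst y, state_control y u) \<partial>time_kernel y)"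
 if "y \<in> space BT" for y
 by (rule integral_distr[OF measurable_time_section[OF that measurable_ident_sets[OF refl]] F])
 ultimately show ?thesis by (subst measurable_cong[symmetric]) auto
qed

text \<open>The integral at one fixed time under \<open>\<nu>\<close> and its control kernels. On
  indicators it plays the role of the kernels \<open>H\<close> and \<open>H0\<close> of
  \<open>stable_limit_kernel\<close>.\<close>

definition section_integral :: "(('a::euclidean_space, 'b) hat) measure => (real \<times> ('a \<times> 'b) => ennreal) => real => ennreal" where
 "section_integral \<nu> F t = (\<integral>\<^sup>+w. \<integral>\<^sup>+u. F (t, state_control (t, w) u) \<partial>time_kernel (t, w) \<partial>\<nu>)"

context
 fixes \<nu> :: "(('a::euclidean_space, 'b) hat) measure"
 assumes \<nu>: "\<nu> \<in> prob_measures OH dH"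
begin

lemma sets_pair_BT: "sets (leb T \<Otimes>\<^sub>M \<nu>) = sets BT"
 using prob_measuresD(2)[OF \<nu>] by (intro sets_pair_measure_cong) auto

lemma measurable_section_integral:
 assumes F: "F \<in> borel_measurable NT"
 shows "section_integral \<nu> F \<in> borel_measurable (leb T)"
proof -
 interpret \<nu>: prob_space \<nu> by (rule prob_measuresD(1)[OF \<nu>])
 have "(%(t, w). \<integral>\<^sup>+u. F (t, state_control (t, w) u) \<partial>time_kernel (t, w)) \<in> borel_measurable (leb T \<Otimes>\<^sub>M \<nu>)"
 unfolding measurable_cong_sets[OF sets_pair_BT refl]
 using measurable_nn_integral_time_kernel[OF F] by (simp add: case_prod_unfold)
 from \<nu>.borel_measurable_nn_integral[OF this] show ?thesis unfolding section_integral_def[abs_def] .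
qed

context
 fixes M :: "'c measure" and a b :: "'c => real \<times> (('a, 'b) hat)"
 assumes a: "a \<in> M \<rightarrow>\<^sub>M BT" and b: "b \<in> M \<rightarrow>\<^sub>M leb T \<Otimes>\<^sub>M \<nu>"
 and law: "distr M (leb T \<Otimes>\<^sub>M \<nu>) b = leb T \<Otimes>\<^sub>M \<nu>" and ab: "!!x. x \<in> space M ==> fst (a x) = fst (b x)"
begin

text \<open>\<open>a\<close> and \<open>b\<close> share the time coordinate, so a function of time,
  state and control does not see the rest of the base point, and its integral depends on the law of
  \<open>b\<close> alone.\<close>

lemma nn_integral_joint_time:
 assumes F: "F \<in> borel_measurable NT"
 shows "(\<integral>\<^sup>+s. F (fst (fst s), snd s) \<partial>joint M a b) = (\<integral>\<^sup>+t. section_integral \<nu> F t \<partial>leb T)"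
proof -
 interpret \<nu>: prob_space \<nu> by (rule prob_measuresD(1)[OF \<nu>])
 have b': "b \<in> M \<rightarrow>\<^sub>M BT" using b unfolding measurable_cong_sets[OF refl sets_pair_BT] .
 let ?G = "%y. \<integral>\<^sup>+u. F (fst y, state_control y u) \<partial>time_kernel y"
 have G: "?G \<in> borel_measurable (leb T \<Otimes>\<^sub>M \<nu>)"
 unfolding measurable_cong_sets[OF sets_pair_BT refl] by (rule measurable_nn_integral_time_kernel[OF F])
 have "(%s. (fst (fst s), snd s)) \<in> (BJ :: (_ \<times> ('a \<times> 'b)) measure) \<rightarrow>\<^sub>M NT"
 by (intro measurable_Pair measurable_compose[OF measurable_fst measurable_fst] measurable_snd)
 from nn_integral_joint[OF a b' measurable_compose[OF this F]]
 have "(\<integral>\<^sup>+s. F (fst (fst s), snd s) \<partial>joint M a b) = (\<integral>\<^sup>+x. \<integral>\<^sup>+u. F (fst (a x), state_control (b x) u) \<partial>time_kernel (b x) \<partial>M)"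
 by (simp only: fst_conv snd_conv)
 also have "\<dots> = (\<integral>\<^sup>+x. ?G (b x) \<partial>M)" by (intro nn_integral_cong) (simp only: ab)
 also have "\<dots> = (\<integral>\<^sup>+y. ?G y \<partial>(leb T \<Otimes>\<^sub>M \<nu>))" by (rule nn_integral_distr[OF b, unfolded law, OF G, symmetric])
 also have "\<dots> = (\<integral>\<^sup>+t. \<integral>\<^sup>+w. ?G (t, w) \<partial>\<nu> \<partial>leb T)" by (rule \<nu>.nn_integral_fst[OF G, symmetric])
 finally show ?thesis unfolding section_integral_def by (simp only: fst_conv)
qed

lemma emeasure_joint_time:
 assumes D: "D \<in> sets NT" and M: "space M ~= {}" and A: "A \<in> sets (leb T)"
 shows "emeasure (joint M a b) {s \<in> space BJ. fst (fst s) \<in> A & (fst (fst s), snd s) \<in> D} =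
 (\<integral>\<^sup>+t. section_integral \<nu> (indicator D) t * indicator A t \<partial>leb T)"
proof -
 have b': "b \<in> M \<rightarrow>\<^sub>M BT" using b unfolding measurable_cong_sets[OF refl sets_pair_BT] .
 note sets_joint = sets_joint[OF a b' M]
 define D' where "D' = D \<inter> fst -` A \<inter> space NT"
 have D': "D' \<in> sets NT" unfolding D'_def Int_assoc by (intro sets.Int D measurable_sets[OF measurable_fst A])
 let ?X = "{s \<in> space BJ. fst (fst s) \<in> A & (fst (fst s), snd s) \<in> D}"
 have tm: "(%s. (fst (fst s), snd s)) \<in> (BJ :: (_ \<times> ('a \<times> 'b)) measure) \<rightarrow>\<^sub>M NT"
 by (intro measurable_Pair measurable_compose[OF measurable_fst measurable_fst] measurable_snd)
 have X: "?X = (%s. (fst (fst s), snd s)) -` D' \<inter> space BJ"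
 using sets.sets_into_space[OF D] by (auto simp: D'_def)
 have "emeasure (joint M a b) ?X = (\<integral>\<^sup>+s. indicator ?X s \<partial>joint M a b)"
 unfolding X by (rule nn_integral_indicator[symmetric]) (simp only: sets_joint measurable_sets[OF tm D'])
 also have "\<dots> = (\<integral>\<^sup>+s. indicator D' (fst (fst s), snd s) \<partial>joint M a b)"
 unfolding X by (intro nn_integral_cong) (simp add: sets_eq_imp_space_eq[OF sets_joint] indicator_def)
 also have "\<dots> = (\<integral>\<^sup>+t. section_integral \<nu> (indicator D') t \<partial>leb T)"
 by (rule nn_integral_joint_time[OF borel_measurable_indicator[OF D']])
 also have "\<dots> = (\<integral>\<^sup>+t. section_integral \<nu> (indicator D) t * indicator A t \<partial>leb T)"
 proof (rule nn_integral_cong)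
 fix t
 have "indicator D' (t, v) = (indicator D (t, v) * indicator A t :: ennreal)" for v
 using sets.sets_into_space[OF D] by (auto simp: D'_def indicator_def)
 thus "section_integral \<nu> (indicator D') t = section_integral \<nu> (indicator D) t * indicator A t"
 unfolding section_integral_def by (cases "t \<in> A") simp_all
 qed
 finally show ?thesis .
qed

end

end

end

section \<open>Stable convergence of the joint laws along the coupled sequence\<close>

context coupled_sequence
begin

lemma space_M0_nonempty: "space M0 ~= {}"
proof -
 interpret prob_space \<mu> by (rule prob_measuresD(1)[OF \<mu>P])
 show ?thesis using T not_empty by (auto simp: space_pair_measure)
qed

lemma space_Mk_nonempty: "space (Mk k) ~= {}"
proof -
 interpret prob_space "\<pi> k" by (rule \<pi>_prob)
 show ?thesis using T not_empty by (auto simp: space_pair_measure)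
qed

lemma emeasure_Mk: "emeasure (Mk k) (space (Mk k)) = ennreal T"
proof -
 interpret P: prob_space "\<pi> k" by (rule \<pi>_prob)
 have "emeasure (Mk k) (space (leb T) \<times> space (\<pi> k)) = emeasure (leb T) (space (leb T)) * emeasure (\<pi> k) (space (\<pi> k))"
 by (rule P.emeasure_pair_measure_Times[OF sets.top sets.top])
 thus ?thesis using emeasure_leb[of T] T by (simp add: space_pair_measure P.emeasure_space_1)
qed

lemma integrable_Mk:
 fixes f :: "_ => real"
 assumes "f \<in> borel_measurable (Mk k)" "!!x. x \<in> space (Mk k) ==> \<bar>f x\<bar> <= K" shows "integrable (Mk k) f"
proof -
 interpret finite_measure "Mk k" by (rule Mk_finite)
 show ?thesis using assms by (intro integrable_const_bound[of _ K]) auto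
qed

definition ev :: "real \<times> (('a, 'b) hat) => 'a" where
 "ev y = fst (snd y) (fst y)"

lemma measurable_ev: "ev \<in> borel_measurable BT"
 unfolding ev_def[abs_def] by (rule measurable_eval_BH)

lemma eval_dist_tendsto:
 assumes f: "unit_lipschitz f"
 shows "(%k. \<integral>x. \<bar>f (ev (pw x)) - f (ev (pz x))\<bar> \<partial>Mk k) \<longlonglongrightarrow> 0"
proof -
 obtain L where L: "L > 0" "!!x y. \<bar>f x - f y\<bar> <= L * dist x y" using f by (auto simp: unit_lipschitz_def)
 \<comment> \<open>Balances the estimate \<open>d \<le> s + d\<^sup>2 / s\<close> for the distance
   \<open>d\<close> of the states: the first term integrates to \<open>s k * T\<close>, the second
   to at most \<open>(1 / 2) ^ k / s k\<close>, which is \<open>s k\<close>.\<close>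
 define s where "s k = sqrt ((1 / 2) ^ k)" for k :: nat
 have s: "s k > 0" "s k * s k = (1 / 2) ^ k" for k by (auto simp: s_def)
 have le: "(\<integral>x. \<bar>f (ev (pw x)) - f (ev (pz x))\<bar> \<partial>Mk k) <= L * (T + 1) * s k" for k
 proof (rule integral_real_bounded)
 show "0 <= L * (T + 1) * s k" using L(1) T s(1)[of k] by simp
 let ?d = "%x. dist (fst (fst (snd x)) (fst x)) (fst (snd (snd x)) (fst x))"
 have dm: "(%x. ennreal ((?d x)\<^sup>2)) \<in> borel_measurable (Mk k)"
 using eval_joint_fst eval_joint_snd by measurable
 have pt: "\<bar>f (ev (pw x)) - f (ev (pz x))\<bar> <= L * s k + L / s k * (?d x)\<^sup>2" for x
 proof -
 have "?d x <= s k + (?d x)\<^sup>2 / s k"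
 proof (cases "?d x <= s k")
 case True
 have "0 <= (?d x)\<^sup>2 / s k" using s(1)[of k] by simp
 thus ?thesis using True by linarith
 next
 case False
 hence "?d x * s k <= ?d x * ?d x" by (intro mult_left_mono) auto
 hence "?d x <= (?d x)\<^sup>2 / s k" using s(1)[of k] by (simp add: pos_le_divide_eq power2_eq_square)
 thus ?thesis using s(1)[of k] by linarith
 qed
 hence "L * ?d x <= L * (s k + (?d x)\<^sup>2 / s k)" using L(1) by (intro mult_left_mono) auto
 moreover have "\<bar>f (ev (pw x)) - f (ev (pz x))\<bar> <= L * ?d x"
 using L(2)[of "ev (pw x)" "ev (pz x)"] by (simp add: ev_def pw_def pz_def dist_commute)
 ultimately show ?thesis by (simp add: distrib_left)
 qed
 have "(\<integral>\<^sup>+x. ennreal \<bar>f (ev (pw x)) - f (ev (pz x))\<bar> \<partial>Mk k) <= (\<integral>\<^sup>+x. ennreal (L * s k) + ennreal (L / s k) * ennreal ((?d x)\<^sup>2) \<partial>Mk k)"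
 proof (rule nn_integral_mono)
 fix x
 have "ennreal \<bar>f (ev (pw x)) - f (ev (pz x))\<bar> <= ennreal (L * s k + L / s k * (?d x)\<^sup>2)" by (rule ennreal_leI[OF pt])
 also have "\<dots> = ennreal (L * s k) + ennreal (L / s k) * ennreal ((?d x)\<^sup>2)"
 proof -
 have e: "ennreal (L / s k * (?d x)\<^sup>2) = ennreal (L / s k) * ennreal ((?d x)\<^sup>2)"
 by (rule ennreal_mult) (use L(1) s(1)[of k] in simp_all)
 show ?thesis unfolding e[symmetric] by (rule ennreal_plus) (use L(1) s(1)[of k] in simp_all)
 qed
 finally show "ennreal \<bar>f (ev (pw x)) - f (ev (pz x))\<bar> <= \<dots>" .
 qed
 also have "\<dots> = (\<integral>\<^sup>+x. ennreal (L * s k) \<partial>Mk k) + (\<integral>\<^sup>+x. ennreal (L / s k) * ennreal ((?d x)\<^sup>2) \<partial>Mk k)"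
 by (rule nn_integral_add) (use dm in auto)
 also have "\<dots> = ennreal (L * s k) * ennreal T + ennreal (L / s k) * (\<integral>\<^sup>+x. ennreal ((?d x)\<^sup>2) \<partial>Mk k)"
 unfolding nn_integral_const emeasure_Mk nn_integral_cmult[OF dm] ..
 also have "\<dots> <= ennreal (L * s k) * ennreal T + ennreal (L / s k) * ennreal ((1 / 2) ^ k)"
 by (intro add_left_mono mult_left_mono nn_integral_path_sq) simp
 also have "\<dots> = ennreal (L * s k * T + L / s k * (s k * s k))"
 proof -
 have e: "ennreal (L * s k) * ennreal T = ennreal (L * s k * T)" "ennreal (L / s k) * ennreal ((1 / 2) ^ k) = ennreal (L / s k * (s k * s k))"
 unfolding s(2) by (rule ennreal_mult[symmetric]; use L(1) s(1)[of k] T in simp)+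
 show ?thesis unfolding e by (rule ennreal_plus[symmetric]) (use L(1) s(1)[of k] T in simp_all)
 qed
 also have "L * s k * T + L / s k * (s k * s k) = L * (T + 1) * s k" using s(1)[of k] by (simp add: algebra_simps)
 finally show "(\<integral>\<^sup>+x. ennreal \<bar>f (ev (pw x)) - f (ev (pz x))\<bar> \<partial>Mk k) <= ennreal (L * (T + 1) * s k)" .
 qed
 have "(%k. (1 / 2 :: real) ^ k) \<longlonglongrightarrow> 0" by (rule LIMSEQ_power_zero) simp
 from tendsto_real_sqrt[OF this] have "s \<longlonglongrightarrow> 0" by (simp add: s_def[abs_def])
 from tendsto_mult_left[OF this, of "L * (T + 1)"] have lim: "(%k. L * (T + 1) * s k) \<longlonglongrightarrow> 0" by simp
 show ?thesis by (rule tendsto_sandwich[OF _ _ tendsto_const lim]) (use le in auto)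
qed

text \<open>The error splits in two: \<open>?X\<close> replaces the approximating state by the limit
  state and vanishes by mean-square convergence; \<open>?Y\<close> then replaces the control and is
  a pairing, since its weight involves only time and the limit point.\<close>

lemma joint_limit:
 assumes C: "C \<in> sets BT" and f: "unit_lipschitz f" and g: "unit_lipschitz g"
 shows "(%k. \<integral>s. indicator C (fst s) * f (fst (snd s)) * g (snd (snd s)) \<partial>joint (Mk k) pz pw) \<longlonglongrightarrow>
 (\<integral>s. indicator C (fst s) * f (fst (snd s)) * g (snd (snd s)) \<partial>joint M0 (%y. y) (%y. y))"
proof -
 note f01 = unit_lipschitzD[OF f] and g01 = unit_lipschitzD[OF g]
 let ?\<rho> = "%y. indicator C y * f (ev y) :: real"
 have Cm: "(indicator C :: _ => real) \<in> borel_measurable BT" using C by simp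
 have fm: "(%y. f (ev y)) \<in> borel_measurable BT" by (rule measurable_compose[OF measurable_ev unit_lipschitz_borel[OF f]])
 note gm = \<gamma>_measurable[OF g]
 have idM: "(%y. y) \<in> M0 \<rightarrow>\<^sub>M BT" by (rule M0_measurable) simp
 have bnd: "\<bar>?\<rho> y\<bar> <= 1" for y using f01[of "ev y"] by (auto simp: indicator_def)
 interpret M0: finite_measure M0 by (rule M0_finite)
 have \<gamma>0: "\<bar>\<gamma> g y\<bar> <= 1" if "y \<in> space M0" for y
 proof -
 have "y \<in> {0..T} \<times> OH" using that by (simp only: space_pair_measure space_leb prob_measuresD(3)[OF \<mu>P])
 hence "snd (snd y) \<in> controls T U p" "fst y \<in> {0..T}" by auto
 from kmean_bounds(2,3)[of g, OF g01 this] show ?thesis by (simp add: \<gamma>_def)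
 qed
 have \<rho>i: "integrable M0 ?\<rho>"
 by (rule M0.integrable_const_bound[of _ 1]) (use bnd in \<open>auto intro!: M0_measurable borel_measurable_times Cm fm\<close>)
 have \<rho>\<gamma>i: "integrable M0 (%y. ?\<rho> y * \<gamma> g y)"
 proof (rule M0.integrable_const_bound[of _ 1])
 show "AE y in M0. norm (?\<rho> y * \<gamma> g y) <= 1"
 proof (rule AE_I2)
 fix y assume "y \<in> space M0"
 thus "norm (?\<rho> y * \<gamma> g y) <= 1"
 unfolding real_norm_def abs_mult[of "?\<rho> y"] by (intro mult_le_one bnd \<gamma>0 abs_ge_zero)
 qed
 show "(%y. ?\<rho> y * \<gamma> g y) \<in> borel_measurable M0"
 by (intro M0_measurable borel_measurable_times Cm fm gm)
 qed
 have R: "(\<integral>s. indicator C (fst s) * f (fst (snd s)) * g (snd (snd s)) \<partial>joint M0 (%y. y) (%y. y)) = (\<integral>y. ?\<rho> y * \<gamma> g y \<partial>M0)"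
 unfolding joint_product[OF idM idM C f g space_M0_nonempty] by (simp add: ev_def \<gamma>_def)
 have main: "\<bar>(\<integral>s. indicator C (fst s) * f (fst (snd s)) * g (snd (snd s)) \<partial>joint (Mk k) pz pw) - (\<integral>y. ?\<rho> y * \<gamma> g y \<partial>M0)\<bar>
 <= (\<integral>x. \<bar>f (ev (pw x)) - f (ev (pz x))\<bar> \<partial>Mk k) + \<bar>pairing g k ?\<rho>\<bar>" for k
 proof -
 let ?X = "%x. indicator C (pz x) * (f (ev (pw x)) - f (ev (pz x))) * \<gamma> g (pw x)"
 let ?Y = "%x. ?\<rho> (pz x) * (\<gamma> g (pw x) - \<gamma> g (pz x))"
 have m: "(%x. indicator C (pz x) :: real) \<in> borel_measurable (Mk k)" "(%x. f (ev (pw x))) \<in> borel_measurable (Mk k)"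
 "(%x. f (ev (pz x))) \<in> borel_measurable (Mk k)" "(%x. \<gamma> g (pw x)) \<in> borel_measurable (Mk k)"
 by (rule measurable_compose[OF measurable_pz_BH Cm] measurable_compose[OF measurable_pw fm]
 measurable_compose[OF measurable_pz_BH fm] measurable_compose[OF measurable_pw gm])+
 have df: "\<bar>f x - f y\<bar> <= 1" for x y using f01[of x] f01[of y] by linarith
 have Xle: "\<bar>?X x\<bar> <= \<bar>f (ev (pw x)) - f (ev (pz x))\<bar>" if "x \<in> space (Mk k)" for x
 proof -
 have "\<bar>?X x\<bar> = indicator C (pz x) * \<bar>f (ev (pw x)) - f (ev (pz x))\<bar> * \<bar>\<gamma> g (pw x)\<bar>" by (simp add: abs_mult)
 also have "\<dots> <= 1 * \<bar>f (ev (pw x)) - f (ev (pz x))\<bar> * 1"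
 using \<gamma>_bounds[OF g that] by (intro mult_mono) (auto simp: indicator_def)
 finally show ?thesis by simp
 qed
 have Xi: "integrable (Mk k) ?X"
 by (rule integrable_Mk[of _ _ 1]) (use m in measurable, use Xle df order_trans in blast)
 have di: "integrable (Mk k) (%x. \<bar>f (ev (pw x)) - f (ev (pz x))\<bar>)"
 by (rule integrable_Mk[of _ _ 1]) (use m in measurable, simp add: df)
 have Yi: "integrable (Mk k) ?Y" by (rule pairing_integrable(2)[OF g \<rho>i])
 have Zi: "integrable (Mk k) (%x. ?\<rho> (pz x) * \<gamma> g (pz x))" by (rule pairing_integrable(1)[OF g \<rho>\<gamma>i])
 have "(\<integral>s. indicator C (fst s) * f (fst (snd s)) * g (snd (snd s)) \<partial>joint (Mk k) pz pw) =
 (\<integral>x. (?X x + ?Y x) + ?\<rho> (pz x) * \<gamma> g (pz x) \<partial>Mk k)"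
 unfolding joint_product[OF measurable_pz_BH measurable_pw C f g space_Mk_nonempty]
 by (rule Bochner_Integration.integral_cong) (simp_all add: ev_def \<gamma>_def algebra_simps)
 also have "\<dots> = (\<integral>x. ?X x + ?Y x \<partial>Mk k) + (\<integral>x. ?\<rho> (pz x) * \<gamma> g (pz x) \<partial>Mk k)"
 by (rule Bochner_Integration.integral_add[OF Bochner_Integration.integrable_add[OF Xi Yi] Zi])
 also have "(\<integral>x. ?X x + ?Y x \<partial>Mk k) = (\<integral>x. ?X x \<partial>Mk k) + pairing g k ?\<rho>"
 unfolding pairing_def by (rule Bochner_Integration.integral_add[OF Xi Yi])
 also have "(\<integral>x. ?\<rho> (pz x) * \<gamma> g (pz x) \<partial>Mk k) = (\<integral>y. ?\<rho> y * \<gamma> g y \<partial>M0)" by (rule pairing_integrable(3)[OF g \<rho>\<gamma>i])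
 finally have eq: "(\<integral>s. indicator C (fst s) * f (fst (snd s)) * g (snd (snd s)) \<partial>joint (Mk k) pz pw) - (\<integral>y. ?\<rho> y * \<gamma> g y \<partial>M0) =
 (\<integral>x. ?X x \<partial>Mk k) + pairing g k ?\<rho>" by simp
 have "\<bar>\<integral>x. ?X x \<partial>Mk k\<bar> <= (\<integral>x. \<bar>?X x\<bar> \<partial>Mk k)" by (rule integral_abs_bound)
 also have "\<dots> <= (\<integral>x. \<bar>f (ev (pw x)) - f (ev (pz x))\<bar> \<partial>Mk k)"
 by (rule integral_mono[OF integrable_abs[OF Xi] di Xle])
 finally show ?thesis unfolding eq by linarith
 qed
 have lim: "(%k. (\<integral>x. \<bar>f (ev (pw x)) - f (ev (pz x))\<bar> \<partial>Mk k) + \<bar>pairing g k ?\<rho>\<bar>) \<longlonglongrightarrow> 0"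
 using tendsto_add[OF eval_dist_tendsto[OF f] tendsto_rabs[OF pairing_tendsto[OF g \<rho>i]]] by simp
 show ?thesis unfolding R
 by (rule LIM_zero_cancel, rule Lim_null_comparison[OF _ lim]) (use main in simp)
qed

text \<open>Equality of the base masses comes from \<open>distr_pz\<close>: the law of the limit
  point with time is the same for every \<open>k\<close>.\<close>

lemma limit_kernel:
 "stable_limit_kernel BT (%k. joint (Mk k) pz pw) (joint M0 (%y. y) (%y. y)) (leb T) fst
 (%k D. section_integral (\<nu> k) (indicator D)) (%D. section_integral \<mu> (indicator D))"
proof (intro stable_limit_kernel.intro stable_limit.intro stable_limit_kernel_axioms.intro)
 have idM: "(%y. y) \<in> M0 \<rightarrow>\<^sub>M BT" by (rule M0_measurable) simp
 have idM': "(%y. y) \<in> M0 \<rightarrow>\<^sub>M M0" by simp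
 show "sets (joint (Mk k) pz pw) = sets (BJ :: (_ \<times> ('a \<times> 'b)) measure)" for k
 by (rule sets_joint[OF measurable_pz_BH measurable_pw space_Mk_nonempty])
 show "sets (joint M0 (%y. y) (%y. y)) = sets (BJ :: (_ \<times> ('a \<times> 'b)) measure)"
 by (rule sets_joint[OF idM idM space_M0_nonempty])
 show "finite_measure (joint (Mk k) pz pw)" for k
 by (rule finite_measure_joint[OF measurable_pz_BH measurable_pw Mk_finite space_Mk_nonempty])
 show "finite_measure (joint M0 (%y. y) (%y. y))"
 by (rule finite_measure_joint[OF idM idM M0_finite space_M0_nonempty])
 show "(%k. \<integral>s. indicator C (fst s) * f (fst (snd s)) * g (snd (snd s)) \<partial>joint (Mk k) pz pw) \<longlonglongrightarrow>
 (\<integral>s. indicator C (fst s) * f (fst (snd s)) * g (snd (snd s)) \<partial>joint M0 (%y. y) (%y. y))"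
 if "C \<in> sets BT" "unit_lipschitz f" "unit_lipschitz g" for C and f :: "'a => real" and g :: "'b => real"
 by (rule joint_limit[OF that])
 show "fst \<in> BT \<rightarrow>\<^sub>M leb T" by (rule measurable_fst)
 show "section_integral (\<nu> k) (indicator D) \<in> borel_measurable (leb T)" if "D \<in> sets (leb T \<Otimes>\<^sub>M (borel \<Otimes>\<^sub>M borel))" for k D
 by (rule measurable_section_integral[OF \<nu>P borel_measurable_indicator[OF that]])
 show "section_integral \<mu> (indicator D) \<in> borel_measurable (leb T)" if "D \<in> sets (leb T \<Otimes>\<^sub>M (borel \<Otimes>\<^sub>M borel))" for D
 by (rule measurable_section_integral[OF \<mu>P borel_measurable_indicator[OF that]])
 show "section_integral (\<nu> k) (indicator D) t = 0" if "!!v. (t, v) \<notin> D" for k D t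
 using that by (simp add: section_integral_def)
 show "section_integral \<mu> (indicator D) t = 0" if "!!v. (t, v) \<notin> D" for D t
 using that by (simp add: section_integral_def)
 show "emeasure (joint (Mk k) pz pw) {s \<in> space BJ. fst (fst s) \<in> E & (fst (fst s), snd s) \<in> D} =
 (\<integral>\<^sup>+t. section_integral (\<nu> k) (indicator D) t * indicator E t \<partial>leb T)"
 if "D \<in> sets (leb T \<Otimes>\<^sub>M (borel \<Otimes>\<^sub>M borel))" "E \<in> sets (leb T)" for k D E
 by (rule emeasure_joint_time[OF \<nu>P measurable_pz_BH measurable_pw_nu distr_pw _ that(1) space_Mk_nonempty that(2)])
 (simp add: pz_def pw_def)
 show "emeasure (joint M0 (%y. y) (%y. y)) {s \<in> space BJ. fst (fst s) \<in> E & (fst (fst s), snd s) \<in> D} =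
 (\<integral>\<^sup>+t. section_integral \<mu> (indicator D) t * indicator E t \<partial>leb T)"
 if "D \<in> sets (leb T \<Otimes>\<^sub>M (borel \<Otimes>\<^sub>M borel))" "E \<in> sets (leb T)" for D E
 by (rule emeasure_joint_time[OF \<mu>P idM idM' _ _ that(1) space_M0_nonempty that(2)]) (simp_all add: distr_id)
 show "measure (joint (Mk k) pz pw) {s \<in> space BJ. fst s \<in> B} = measure (joint M0 (%y. y) (%y. y)) {s \<in> space BJ. fst s \<in> B}"
 if B: "B \<in> sets BT" for k B
 proof -
 have i: "indicator B \<in> borel_measurable M0" by (rule M0_measurable) (use B in simp)
 have "(\<integral>\<^sup>+x. indicator B (pz x) \<partial>Mk k) = (\<integral>\<^sup>+y. indicator B y \<partial>M0)"
 by (rule nn_integral_distr[OF measurable_pz, unfolded distr_pz, OF i, symmetric])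
 thus ?thesis
 unfolding measure_def emeasure_joint_base[OF measurable_pz_BH measurable_pw B space_Mk_nonempty]
 emeasure_joint_base[OF idM idM B space_M0_nonempty] by simp
 qed
qed

end

section \<open>The constraints in the limit\<close>

definition clip :: "real => real => real" where
 "clip N r = max (- N) (min N r)"

lemma clip_bounds: "0 <= N ==> \<bar>clip N r\<bar> <= N"
 by (auto simp: clip_def)

text \<open>The error is zero up to level \<open>N\<close> and at most \<open>\<bar>r\<bar>\<close>
  beyond it, where \<open>\<bar>r\<bar> \<le> r\<^sup>2 / N\<close>. This is how second moments pay
  for truncation.\<close>

lemma clip_diff:
 assumes "N > 0" shows "\<bar>r - clip N r\<bar> <= r\<^sup>2 / N"
proof (cases "\<bar>r\<bar> <= N")
 case True thus ?thesis using assms by (auto simp: clip_def)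
next
 case False
 hence "\<bar>r - clip N r\<bar> <= \<bar>r\<bar>" using assms by (auto simp: clip_def)
 also have "\<dots> <= r\<^sup>2 / N"
 proof -
 have "\<bar>r\<bar> * N <= \<bar>r\<bar> * \<bar>r\<bar>" using False by (intro mult_left_mono) auto
 thus ?thesis using assms by (simp add: pos_le_divide_eq power2_eq_square)
 qed
 finally show ?thesis .
qed

lemma measurable_clip: "clip N \<in> borel_measurable borel"
 unfolding clip_def[abs_def] by measurable

context prob_space
begin

text \<open>Both inequalities are trivial if \<open>r\<close> is not square integrable, so no integrability is assumed.\<close>

lemma clip_integral:
 fixes r :: "'a => real"
 assumes r: "r \<in> borel_measurable M" and N: "N > 0"
 shows "0 <= (\<integral>x. r x \<partial>M) ==> ennreal N <= (\<integral>\<^sup>+x. ennreal (clip N (r x) + N) \<partial>M) + ennreal (1 / N) * (\<integral>\<^sup>+x. ennreal ((r x)\<^sup>2) \<partial>M)"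
 and "(\<integral>x. r x \<partial>M) <= 0 ==> (\<integral>\<^sup>+x. ennreal (clip N (r x) + N) \<partial>M) + ennreal (- (\<integral>x. r x \<partial>M)) \<le>
 ennreal N + ennreal (1 / N) * (\<integral>\<^sup>+x. ennreal ((r x)\<^sup>2) \<partial>M)"
proof -
 let ?J = "\<integral>\<^sup>+x. ennreal ((r x)\<^sup>2) \<partial>M" and ?I = "\<integral>\<^sup>+x. ennreal (clip N (r x) + N) \<partial>M"
 have "(0 <= (\<integral>x. r x \<partial>M) --> ennreal N <= ?I + ennreal (1 / N) * ?J) \<and>
 ((\<integral>x. r x \<partial>M) <= 0 --> ?I + ennreal (- (\<integral>x. r x \<partial>M)) <= ennreal N + ennreal (1 / N) * ?J)"
 proof (cases "?J = \<infinity>")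
 case True
 thus ?thesis using N by (simp add: ennreal_mult_top)
 next
 case False
 have r2: "(%x. (r x)\<^sup>2) \<in> borel_measurable M" using r by measurable
 have sq: "integrable M (%x. (r x)\<^sup>2)"
 by (rule integrableI_nonneg[OF r2]) (use False in \<open>auto simp: less_top\<close>)
 have ir: "integrable M r" by (rule square_integrable_imp_integrable[OF r sq])
 have ic: "integrable M (%x. clip N (r x))"
 by (rule integrable_const_bound[of _ N])
 (use clip_bounds[of N] N measurable_compose[OF r measurable_clip] in auto)
 define J where "J = (\<integral>x. (r x)\<^sup>2 \<partial>M)"
 define c where "c = (\<integral>x. clip N (r x) \<partial>M)"
 have J: "?J = ennreal J" "0 <= J" unfolding J_def by (auto intro!: nn_integral_eq_integral sq)
 have cN: "- N <= clip N x" for x using N by (simp add: clip_def)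
 have "?I = ennreal (\<integral>x. clip N (r x) + N \<partial>M)"
 proof (rule nn_integral_eq_integral)
 show "integrable M (%x. clip N (r x) + N)" using ic by simp
 have "0 <= clip N (r x) + N" for x using cN[of "r x"] by linarith
 thus "AE x in M. 0 <= clip N (r x) + N" by simp
 qed
 also have "(\<integral>x. clip N (r x) + N \<partial>M) = c + N" unfolding c_def using ic by (simp add: prob_space)
 finally have I: "?I = ennreal (c + N)" .
 have "(\<integral>x. - N \<partial>M) <= c" unfolding c_def by (rule integral_mono) (use ic cN in auto)
 hence cN0: "0 <= c + N" by (simp add: prob_space)
 have "\<bar>(\<integral>x. r x - clip N (r x) \<partial>M)\<bar> <= (\<integral>x. \<bar>r x - clip N (r x)\<bar> \<partial>M)" by (rule integral_abs_bound)
 also have "\<dots> <= (\<integral>x. (r x)\<^sup>2 / N \<partial>M)"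
 by (rule integral_mono) (use ir ic sq clip_diff[OF N] in auto)
 also have "\<dots> = J / N" by (simp add: J_def)
 finally have d: "\<bar>(\<integral>x. r x \<partial>M) - c\<bar> <= J / N" using ir ic by (simp add: c_def)
 have e: "ennreal (1 / N) * ?J = ennreal (J / N)" unfolding J(1) by (subst ennreal_mult[symmetric]) (use N J(2) in auto)
 have J0: "0 <= J / N" using N J(2) by simp
 show ?thesis
 proof (intro conjI impI)
 assume "0 <= (\<integral>x. r x \<partial>M)"
 hence "N <= c + N + J / N" using d by linarith
 hence "ennreal N <= ennreal (c + N + J / N)" by (rule ennreal_leI)
 thus "ennreal N <= ?I + ennreal (1 / N) * ?J" unfolding e I ennreal_plus[OF cN0 J0] .
 next
 assume r0: "(\<integral>x. r x \<partial>M) <= 0"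
 hence m: "0 <= - (\<integral>x. r x \<partial>M)" by simp
 have N0: "0 <= N" using N by simp
 have "(c + N) + - (\<integral>x. r x \<partial>M) <= N + J / N" using d by linarith
 hence "ennreal ((c + N) + - (\<integral>x. r x \<partial>M)) <= ennreal (N + J / N)" by (rule ennreal_leI)
 thus "?I + ennreal (- (\<integral>x. r x \<partial>M)) <= ennreal N + ennreal (1 / N) * ?J"
 unfolding e I ennreal_plus[OF cN0 m] ennreal_plus[OF N0 J0] .
 qed
 qed
 thus "0 <= (\<integral>x. r x \<partial>M) ==> ennreal N <= ?I + ennreal (1 / N) * ?J"
 "(\<integral>x. r x \<partial>M) <= 0 ==> ?I + ennreal (- (\<integral>x. r x \<partial>M)) <= ennreal N + ennreal (1 / N) * ?J"
 by blast+
qed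

end

section \<open>Moment bounds for states and controls\<close>

context control_kernel
begin

lemma nn_integral_norm_control:
 assumes q: "q \<in> controls T U p"
 shows "(\<integral>\<^sup>+t. \<integral>\<^sup>+u. ennreal ((norm u)\<^sup>2) \<partial>\<kappa> q t \<partial>leb T) <= ennreal (T * control_moment T q)"
proof -
 have sm: "(%z. ennreal ((norm (snd z))\<^sup>2)) \<in> borel_measurable BE"
 by (intro measurable_restrict_space1 measurable_compose[OF _ measurable_ennreal] borel_measurable_continuous_onI continuous_intros)
 have nm: "(%z. ennreal ((norm z)\<^sup>2)) \<in> borel_measurable BE"
 by (intro measurable_restrict_space1 measurable_compose[OF _ measurable_ennreal] borel_measurable_continuous_onI continuous_intros)
 have "(\<integral>\<^sup>+t. \<integral>\<^sup>+u. ennreal ((norm (snd (t, u)))\<^sup>2) \<partial>\<kappa> q t \<partial>leb T) = (\<integral>\<^sup>+z. ennreal ((norm (snd z))\<^sup>2) \<partial>q)"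
 by (rule nn_integral_disintegration[OF q sm, symmetric])
 also have "\<dots> <= (\<integral>\<^sup>+z. ennreal ((norm z)\<^sup>2) \<partial>q)"
 proof (intro nn_integral_mono ennreal_leI power_mono norm_ge_zero)
 fix z :: "real \<times> 'b"
 show "norm (snd z) <= norm z" using norm_snd_le[of "snd z" "fst z"] by simp
 qed
 also have "\<dots> = ennreal T * (ennreal (1 / T) * (\<integral>\<^sup>+z. ennreal ((norm z)\<^sup>2) \<partial>q))"
 unfolding mult.assoc[symmetric] using T by (subst ennreal_mult[symmetric]) auto
 also have "\<dots> = ennreal (T * control_moment T q)"
 unfolding nn_integral_normalized[OF q nm, symmetric] control_moment[OF q]
 by (rule ennreal_mult[symmetric]) (use T control_moment_nonneg in auto)
 finally show ?thesis by simp
qed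

text \<open>Time is integrated first, for a fixed outcome: the state contributes at most
  \<open>T\<close> times the squared path norm and the control at most \<open>T\<close> times its
  moment, together \<open>T * hat_size\<close>.\<close>

lemma nn_integral_size_le:
 fixes \<nu> :: "(('a::euclidean_space, 'b) hat) measure"
 assumes \<nu>: "\<nu> \<in> prob_measures OH dH" and K: "(\<integral>\<^sup>+z. ennreal (hat_size z) \<partial>\<nu>) <= ennreal K" "0 <= K"
 shows "(\<integral>\<^sup>+y. \<integral>\<^sup>+u. ennreal ((norm (fst (snd y) (fst y)))\<^sup>2 + (norm u)\<^sup>2) \<partial>time_kernel y \<partial>(leb T \<Otimes>\<^sub>M \<nu>)) <= ennreal (T * K)"
proof -
 interpret \<nu>: prob_space \<nu> by (rule prob_measuresD(1)[OF \<nu>])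
 interpret L: finite_measure "leb T" by (rule finite_measure_leb)
 interpret pair_sigma_finite "leb T" \<nu> ..
 let ?F = "%y. \<integral>\<^sup>+u. ennreal ((norm (fst (snd y) (fst y)))\<^sup>2 + (norm u)\<^sup>2) \<partial>time_kernel y"
 have Fm: "(%v. ennreal ((norm (fst (snd v)))\<^sup>2 + (norm (snd (snd v)))\<^sup>2)) \<in> borel_measurable (NT :: (real \<times> ('a \<times> 'b)) measure)"
 by measurable
 have F: "?F \<in> borel_measurable (leb T \<Otimes>\<^sub>M \<nu>)"
 unfolding measurable_cong_sets[OF sets_pair_BT[OF \<nu>] refl]
 using measurable_nn_integral_time_kernel[OF Fm] by (simp add: state_control_def)
 have hm: "(%z. ennreal (hat_size z)) \<in> borel_measurable \<nu>"
 using hat_meas[OF \<nu> measurable_hat_size] by measurable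
 have "(\<integral>\<^sup>+y. ?F y \<partial>(leb T \<Otimes>\<^sub>M \<nu>)) = (\<integral>\<^sup>+w. \<integral>\<^sup>+t. ?F (t, w) \<partial>leb T \<partial>\<nu>)"
 by (rule nn_integral_snd[symmetric]) (use F in \<open>simp add: case_prod_unfold\<close>)
 also have "\<dots> <= (\<integral>\<^sup>+w. ennreal T * ennreal (hat_size w) \<partial>\<nu>)"
 proof (rule nn_integral_mono)
 fix w assume "w \<in> space \<nu>"
 hence "w \<in> OH" by (simp only: prob_measuresD(3)[OF \<nu>])
 hence w: "fst w \<in> skorokhod T" "snd w \<in> controls T U p" by auto
 have um: "(%u. ennreal ((norm u)\<^sup>2)) \<in> borel_measurable BU" by (rule measurable_BU) measurable
 have kt: "(%t. \<integral>\<^sup>+u. ennreal ((norm u)\<^sup>2) \<partial>\<kappa> (snd w) t) \<in> borel_measurable (leb T)"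
 proof -
 have "(%z. ennreal ((norm (snd z))\<^sup>2)) \<in> borel_measurable BE"
 by (intro measurable_restrict_space1 measurable_compose[OF _ measurable_ennreal] borel_measurable_continuous_onI continuous_intros)
 from kernel_nn_integral_measurable_time[OF this w(2)] show ?thesis by (simp only: snd_conv)
 qed
 have "(\<integral>\<^sup>+t. ?F (t, w) \<partial>leb T) <= (\<integral>\<^sup>+t. ennreal ((path_norm T (fst w))\<^sup>2) + (\<integral>\<^sup>+u. ennreal ((norm u)\<^sup>2) \<partial>\<kappa> (snd w) t) \<partial>leb T)"
 proof (rule nn_integral_mono)
 fix t assume "t \<in> space (leb T)"
 hence t: "t \<in> {0..T}" by simp
 interpret k: prob_space "\<kappa> (snd w) t" by (rule kernel_space(1)[OF w(2) t])
 have "?F (t, w) = (\<integral>\<^sup>+u. ennreal ((norm (fst w t))\<^sup>2) + ennreal ((norm u)\<^sup>2) \<partial>\<kappa> (snd w) t)"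
 by (simp add: time_kernel_def)
 also have "\<dots> = (\<integral>\<^sup>+u. ennreal ((norm (fst w t))\<^sup>2) \<partial>\<kappa> (snd w) t) + (\<integral>\<^sup>+u. ennreal ((norm u)\<^sup>2) \<partial>\<kappa> (snd w) t)"
 by (rule nn_integral_add[OF _ kernel_measurable_fun[OF w(2) t um]]) simp
 also have "\<dots> <= ennreal ((path_norm T (fst w))\<^sup>2) + (\<integral>\<^sup>+u. ennreal ((norm u)\<^sup>2) \<partial>\<kappa> (snd w) t)"
 unfolding nn_integral_const k.emeasure_space_1 mult_1_right
 by (intro add_right_mono ennreal_leI power_mono norm_le_path_norm[OF w(1) t] norm_ge_zero)
 finally show "?F (t, w) <= \<dots>" .
 qed
 also have "\<dots> = (\<integral>\<^sup>+t. ennreal ((path_norm T (fst w))\<^sup>2) \<partial>leb T) + (\<integral>\<^sup>+t. \<integral>\<^sup>+u. ennreal ((norm u)\<^sup>2) \<partial>\<kappa> (snd w) t \<partial>leb T)"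
 by (rule nn_integral_add[OF _ kt]) simp
 also have "\<dots> <= ennreal ((path_norm T (fst w))\<^sup>2) * ennreal T + ennreal (T * control_moment T (snd w))"
 unfolding nn_integral_const space_leb emeasure_leb[OF less_imp_le[OF T]]
 by (intro add_left_mono nn_integral_norm_control[OF w(2)])
 also have "\<dots> = ennreal ((path_norm T (fst w))\<^sup>2 * T + T * control_moment T (snd w))"
 proof -
 have e: "ennreal ((path_norm T (fst w))\<^sup>2) * ennreal T = ennreal ((path_norm T (fst w))\<^sup>2 * T)"
 by (rule ennreal_mult[symmetric]) (use T in auto)
 show ?thesis unfolding e by (rule ennreal_plus[symmetric]) (use T control_moment_nonneg in \<open>auto intro!: mult_nonneg_nonneg\<close>)
 qed
 also have "(path_norm T (fst w))\<^sup>2 * T + T * control_moment T (snd w) = T * hat_size w"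
 by (simp add: hat_size_def algebra_simps)
 also have "ennreal (T * hat_size w) = ennreal T * ennreal (hat_size w)"
 by (rule ennreal_mult[OF less_imp_le[OF T] hat_size_nonneg])
 finally show "(\<integral>\<^sup>+t. ?F (t, w) \<partial>leb T) <= ennreal T * ennreal (hat_size w)" .
 qed
 also have "\<dots> = ennreal T * (\<integral>\<^sup>+w. ennreal (hat_size w) \<partial>\<nu>)" by (rule nn_integral_cmult[OF hm])
 also have "\<dots> <= ennreal T * ennreal K" by (intro mult_left_mono K(1)) simp
 also have "\<dots> = ennreal (T * K)" by (rule ennreal_mult[symmetric]) (use T K(2) in auto)
 finally show ?thesis .
qed

lemma nn_integral_joint_base:
 fixes M :: "'c measure" and a b :: "'c => real \<times> (('a::euclidean_space, 'b) hat)"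
 and F :: "real \<times> ('a \<times> 'b) => ennreal"
 assumes a: "a \<in> M \<rightarrow>\<^sub>M BT" and b: "b \<in> M \<rightarrow>\<^sub>M BT" and ab: "!!x. x \<in> space M ==> fst (a x) = fst (b x)"
 and B: "B \<in> sets BT" and F: "F \<in> borel_measurable NT"
 shows "(\<integral>\<^sup>+s. indicator B (fst s) * F (fst (fst s), snd s) \<partial>joint M a b) =
 (\<integral>\<^sup>+x. indicator B (a x) * (\<integral>\<^sup>+u. F (fst (b x), state_control (b x) u) \<partial>time_kernel (b x)) \<partial>M)"
proof -
 have "(%s. (fst (fst s), snd s)) \<in> (BJ :: (_ \<times> ('a \<times> 'b)) measure) \<rightarrow>\<^sub>M NT"
 by (intro measurable_Pair measurable_compose[OF measurable_fst measurable_fst] measurable_snd)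
 note Fm = measurable_compose[OF this F]
 have Bm: "(%s. indicator B (fst s)) \<in> borel_measurable (BJ :: (_ \<times> ('a \<times> 'b)) measure)"
 using B by (intro measurable_compose[OF measurable_fst]) simp
 have "(\<integral>\<^sup>+s. indicator B (fst s) * F (fst (fst s), snd s) \<partial>joint M a b) =
 (\<integral>\<^sup>+x. \<integral>\<^sup>+u. indicator B (a x) * F (fst (a x), state_control (b x) u) \<partial>time_kernel (b x) \<partial>M)"
 using nn_integral_joint[OF a b borel_measurable_times_ennreal[OF Bm Fm]] by (simp only: fst_conv snd_conv)
 also have "\<dots> = (\<integral>\<^sup>+x. indicator B (a x) * (\<integral>\<^sup>+u. F (fst (b x), state_control (b x) u) \<partial>time_kernel (b x)) \<partial>M)"
 proof (rule nn_integral_cong)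
 fix x assume x: "x \<in> space M"
 show "(\<integral>\<^sup>+u. indicator B (a x) * F (fst (a x), state_control (b x) u) \<partial>time_kernel (b x)) =
 indicator B (a x) * (\<integral>\<^sup>+u. F (fst (b x), state_control (b x) u) \<partial>time_kernel (b x))"
 unfolding ab[OF x] by (cases "a x \<in> B") simp_all
 qed
 finally show ?thesis .
qed

lemma section_integral_le:
 fixes \<nu> :: "(('a::euclidean_space, 'b) hat) measure"
 assumes \<nu>: "\<nu> \<in> prob_measures OH dH" and t: "t \<in> {0..T}" and le: "!!v. F (t, v) <= e"
 shows "section_integral \<nu> F t <= e"
proof -
 interpret \<nu>: prob_space \<nu> by (rule prob_measuresD(1)[OF \<nu>])
 have "section_integral \<nu> F t <= (\<integral>\<^sup>+w. e \<partial>\<nu>)"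
 unfolding section_integral_def
 proof (rule nn_integral_mono)
 fix w assume "w \<in> space \<nu>"
 hence "w \<in> OH" by (simp only: prob_measuresD(3)[OF \<nu>])
 hence w: "snd w \<in> controls T U p" by auto
 interpret k: prob_space "time_kernel (t, w)" unfolding time_kernel_def using kernel_space(1)[OF w t] by simp
 have "(\<integral>\<^sup>+u. F (t, state_control (t, w) u) \<partial>time_kernel (t, w)) <= (\<integral>\<^sup>+u. e \<partial>time_kernel (t, w))"
 by (intro nn_integral_mono le)
 thus "(\<integral>\<^sup>+u. F (t, state_control (t, w) u) \<partial>time_kernel (t, w)) <= e" by (simp add: k.emeasure_space_1)
 qed
 thus ?thesis by (simp add: \<nu>.emeasure_space_1)
qed

end

lemma (in control_kernel) measurable_time:
 "fst \<in> (NT :: (real \<times> ('a::euclidean_space \<times> 'b)) measure) \<rightarrow>\<^sub>M restrict_space borel {0..T}"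
proof -
 have "fst \<in> (NT :: (real \<times> ('a \<times> 'b)) measure) \<rightarrow>\<^sub>M leb T" by (rule measurable_fst)
 thus ?thesis using measurable_cong_sets[OF refl sets_leb] by blast
qed

locale constraint_sequence = coupled_sequence T p U \<kappa> \<mu> \<nu> \<pi> c
 for T p :: real and U :: "'b::euclidean_space set" and \<kappa>
 and \<mu> :: "(('a::euclidean_space, 'b) hat) measure" and \<nu> \<pi> c +
 fixes \<phi> :: "real => 'a => 'a measure => 'b => real" and C :: real
 assumes meas: "(%(t, x, \<mu>, u). \<phi> t x \<mu> u)
 \<in> borel_measurable (restrict_space borel {0..T} \<Otimes>\<^sub>M borel \<Otimes>\<^sub>M borel_on P2 W2 \<Otimes>\<^sub>M borel)"
 and usc: "!!t. t \<in> {0..T} ==>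
 usc_on (UNIV \<times> P2 \<times> UNIV) (sum_dist dist (sum_dist W2 dist)) (%(x, \<mu>, u). \<phi> t x \<mu> u)"
 and C: "C > 0"
 and growth: "!!t x \<mu> u. t \<in> {0..T} ==> \<mu> \<in> P2 ==>
 \<bar>\<phi> t x \<mu> u\<bar> <= C * (1 + norm x + sqrt (second_moment \<mu>) + norm u)"
 and unif_usc: "!!\<mu> \<epsilon>. \<mu> \<in> P2 ==> \<epsilon> > 0 ==>
 \<exists>\<delta>>0. \<forall>\<nu>\<in>P2. W2 \<mu> \<nu> < \<delta> --> (\<forall>t\<in>{0..T}. \<forall>x u. \<phi> t x \<nu> u < \<phi> t x \<mu> u + \<epsilon>)"
begin

text \<open>The constraint with its measure argument frozen at the time marginal of
  \<open>\<eta>\<close>; what remains is a function of time, state and control, to which the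
  portmanteau theorem applies.\<close>

definition \<alpha> :: "(('a, 'b) hat) measure => real \<times> ('a \<times> 'b) => real" where
 "\<alpha> \<eta> v = \<phi> (fst v) (fst (snd v)) (hat_law \<eta> (fst v)) (snd (snd v))"

lemma measurable_\<alpha>:
 assumes \<eta>: "\<eta> \<in> prob_moment 2 OH dH" shows "\<alpha> \<eta> \<in> borel_measurable NT"
proof -
 have "(%v. (fst v, (fst (snd v), (hat_law \<eta> (fst v), snd (snd v))))) \<in>
 NT \<rightarrow>\<^sub>M restrict_space borel {0..T} \<Otimes>\<^sub>M borel \<Otimes>\<^sub>M borel_on P2 W2 \<Otimes>\<^sub>M borel"
 by (intro measurable_Pair measurable_time measurable_compose[OF measurable_fst measurable_hat_law[OF \<eta>]]
 measurable_compose[OF measurable_snd measurable_fst] measurable_compose[OF measurable_snd measurable_snd])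
 from measurable_compose[OF this meas] show ?thesis by (simp add: \<alpha>_def[abs_def] case_prod_unfold)
qed

text \<open>Linear growth and \<open>(1 + x + y + z)\<^sup>2 \<le> 4 * (1 + x\<^sup>2 + y\<^sup>2 +
  z\<^sup>2)\<close>, where \<open>y\<^sup>2\<close> is the second moment of the marginal, at most
  \<open>K\<close>. The bound depends on the law only through \<open>K\<close>, hence is uniform
  along the sequence.\<close>

lemma \<alpha>_square:
 assumes \<eta>: "\<eta> \<in> prob_moment 2 OH dH" and K: "(\<integral>\<^sup>+z. ennreal (hat_size z) \<partial>\<eta>) <= ennreal K" "0 <= K"
 shows "(\<integral>\<^sup>+y. \<integral>\<^sup>+u. ennreal ((\<alpha> \<eta> (fst y, state_control y u))\<^sup>2) \<partial>time_kernel y \<partial>(leb T \<Otimes>\<^sub>M \<eta>))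
 <= ennreal (4 * C\<^sup>2 * (1 + K) * T + 4 * C\<^sup>2 * (T * K))"
proof -
 note \<eta>P = prob_moment_prob[OF \<eta>]
 interpret \<eta>: prob_space \<eta> by (rule prob_measuresD(1)[OF \<eta>P])
 let ?S = "%v :: real \<times> ('a \<times> 'b). ennreal ((norm (fst (snd v)))\<^sup>2 + (norm (snd (snd v)))\<^sup>2)"
 have Sm: "?S \<in> borel_measurable NT" by measurable
 let ?F = "%y. \<integral>\<^sup>+u. ?S (fst y, state_control y u) \<partial>time_kernel y"
 have F: "?F \<in> borel_measurable (leb T \<Otimes>\<^sub>M \<eta>)"
 unfolding measurable_cong_sets[OF sets_pair_BT[OF \<eta>P] refl] by (rule measurable_nn_integral_time_kernel[OF Sm])
 have sp: "space (leb T \<Otimes>\<^sub>M \<eta>) = space BT" by (rule sets_eq_imp_space_eq[OF sets_pair_BT[OF \<eta>P]])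
 have sq: "(\<alpha> \<eta> (t, v))\<^sup>2 <= 4 * C\<^sup>2 * (1 + K) + 4 * C\<^sup>2 * ((norm (fst v))\<^sup>2 + (norm (snd v))\<^sup>2)" if t: "t \<in> {0..T}" for t v
 proof -
 define x y z where "x = norm (fst v)" and "y = sqrt (second_moment (hat_law \<eta> t))" and "z = norm (snd v)"
 have "second_moment (hat_law \<eta> t) \<ge> 0" by (simp add: second_moment_def)
 hence y2: "y\<^sup>2 <= K" using second_moment_hat_law[OF \<eta> t K] by (simp add: y_def)
 have "\<bar>\<alpha> \<eta> (t, v)\<bar> <= C * (1 + x + y + z)"
 unfolding \<alpha>_def x_def y_def z_def using growth[OF t hat_law_moment(4)[OF \<eta> t]] by simp
 hence "\<bar>\<alpha> \<eta> (t, v)\<bar>\<^sup>2 <= (C * (1 + x + y + z))\<^sup>2" by (rule power_mono) simp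
 hence 1: "(\<alpha> \<eta> (t, v))\<^sup>2 <= C\<^sup>2 * (1 + x + y + z)\<^sup>2" by (simp add: power_mult_distrib)
 have "(1 + x + y + z)\<^sup>2 <= 4 * (1 + x\<^sup>2 + y\<^sup>2 + z\<^sup>2)"
 proof -
 have "0 <= (1 - x)\<^sup>2 + (1 - y)\<^sup>2 + (1 - z)\<^sup>2 + (x - y)\<^sup>2 + (x - z)\<^sup>2 + (y - z)\<^sup>2" by (intro add_nonneg_nonneg) auto
 thus ?thesis by (simp add: power2_eq_square algebra_simps)
 qed
 also have "\<dots> <= 4 * (1 + K) + 4 * (x\<^sup>2 + z\<^sup>2)" using y2 by simp
 finally have "C\<^sup>2 * (1 + x + y + z)\<^sup>2 <= C\<^sup>2 * (4 * (1 + K) + 4 * (x\<^sup>2 + z\<^sup>2))" by (intro mult_left_mono) auto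
 also have "\<dots> = 4 * C\<^sup>2 * (1 + K) + 4 * C\<^sup>2 * (x\<^sup>2 + z\<^sup>2)" by (simp add: algebra_simps)
 finally show ?thesis using 1 unfolding x_def z_def by linarith
 qed
 let ?c = "4 * C\<^sup>2 * (1 + K)"
 have c0: "0 <= ?c" "0 <= 4 * C\<^sup>2" using K(2) by auto
 have "(\<integral>\<^sup>+y. \<integral>\<^sup>+u. ennreal ((\<alpha> \<eta> (fst y, state_control y u))\<^sup>2) \<partial>time_kernel y \<partial>(leb T \<Otimes>\<^sub>M \<eta>)) \<le>
 (\<integral>\<^sup>+y. ennreal ?c + ennreal (4 * C\<^sup>2) * ?F y \<partial>(leb T \<Otimes>\<^sub>M \<eta>))"
 proof (rule nn_integral_mono)
 fix y assume "y \<in> space (leb T \<Otimes>\<^sub>M \<eta>)"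
 hence y: "y \<in> space BT" unfolding sp .
 hence t: "fst y \<in> {0..T}" by (auto simp: space_pair_measure)
 interpret k: prob_space "time_kernel y" by (rule time_kernel_space(1)[OF y])
 have S: "(%u. ?S (fst y, state_control y u)) \<in> borel_measurable (time_kernel y)" by (rule measurable_time_section[OF y Sm])
 have "(\<integral>\<^sup>+u. ennreal ((\<alpha> \<eta> (fst y, state_control y u))\<^sup>2) \<partial>time_kernel y) \<le>
 (\<integral>\<^sup>+u. ennreal ?c + ennreal (4 * C\<^sup>2) * ?S (fst y, state_control y u) \<partial>time_kernel y)"
 proof (rule nn_integral_mono)
 fix u
 let ?n = "(norm (fst (state_control y u)))\<^sup>2 + (norm (snd (state_control y u)))\<^sup>2"
 have "ennreal ((\<alpha> \<eta> (fst y, state_control y u))\<^sup>2) <= ennreal (?c + 4 * C\<^sup>2 * ?n)" by (rule ennreal_leI[OF sq[OF t]])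
 also have "\<dots> = ennreal ?c + ennreal (4 * C\<^sup>2 * ?n)" by (rule ennreal_plus) (use c0 in auto)
 also have "ennreal (4 * C\<^sup>2 * ?n) = ennreal (4 * C\<^sup>2) * ennreal ?n" by (rule ennreal_mult) (use c0 in auto)
 finally show "ennreal ((\<alpha> \<eta> (fst y, state_control y u))\<^sup>2) <= ennreal ?c + ennreal (4 * C\<^sup>2) * ?S (fst y, state_control y u)"
 by (simp only: snd_conv)
 qed
 also have "\<dots> = (\<integral>\<^sup>+u. ennreal ?c \<partial>time_kernel y) + (\<integral>\<^sup>+u. ennreal (4 * C\<^sup>2) * ?S (fst y, state_control y u) \<partial>time_kernel y)"
 by (rule nn_integral_add) (use S in auto)
 also have "\<dots> = ennreal ?c + ennreal (4 * C\<^sup>2) * ?F y"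
 unfolding nn_integral_cmult[OF S] by (simp add: k.emeasure_space_1)
 finally show "(\<integral>\<^sup>+u. ennreal ((\<alpha> \<eta> (fst y, state_control y u))\<^sup>2) \<partial>time_kernel y) <= \<dots>" .
 qed
 also have "\<dots> = (\<integral>\<^sup>+y. ennreal ?c \<partial>(leb T \<Otimes>\<^sub>M \<eta>)) + (\<integral>\<^sup>+y. ennreal (4 * C\<^sup>2) * ?F y \<partial>(leb T \<Otimes>\<^sub>M \<eta>))"
 by (rule nn_integral_add) (use F in auto)
 also have "\<dots> = ennreal ?c * ennreal T + ennreal (4 * C\<^sup>2) * (\<integral>\<^sup>+y. ?F y \<partial>(leb T \<Otimes>\<^sub>M \<eta>))"
 proof -
 have "emeasure (leb T \<Otimes>\<^sub>M \<eta>) (space (leb T) \<times> space \<eta>) = emeasure (leb T) (space (leb T)) * emeasure \<eta> (space \<eta>)"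
 by (rule \<eta>.emeasure_pair_measure_Times[OF sets.top sets.top])
 hence "emeasure (leb T \<Otimes>\<^sub>M \<eta>) (space (leb T \<Otimes>\<^sub>M \<eta>)) = ennreal T"
 using emeasure_leb[of T] T by (simp add: space_pair_measure \<eta>.emeasure_space_1)
 thus ?thesis unfolding nn_integral_cmult[OF F] nn_integral_const by simp
 qed
 also have "\<dots> <= ennreal ?c * ennreal T + ennreal (4 * C\<^sup>2) * ennreal (T * K)"
 using nn_integral_size_le[OF \<eta>P K] by (intro add_left_mono mult_left_mono) (simp_all add: state_control_def)
 also have "\<dots> = ennreal (?c * T + 4 * C\<^sup>2 * (T * K))"
 proof -
 have e: "ennreal ?c * ennreal T = ennreal (?c * T)" "ennreal (4 * C\<^sup>2) * ennreal (T * K) = ennreal (4 * C\<^sup>2 * (T * K))"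
 by (rule ennreal_mult[symmetric]; use c0 T K(2) in auto)+
 show ?thesis unfolding e by (rule ennreal_plus[symmetric]) (use c0 T K(2) in auto)
 qed
 finally show ?thesis .
qed

text \<open>The error of replacing the marginal of \<open>\<nu> k\<close> by that of
  \<open>\<mu>\<close>. Only the positive part is kept, as upper semicontinuity is one-sided.
  Clipped functions differ by at most \<open>2 * N\<close>, so the cap loses nothing and provides a
  dominating constant.\<close>

definition gap :: "real => nat => real \<times> ('a \<times> 'b) => real" where
 "gap N k v = min (2 * N) (max 0 (\<alpha> (\<nu> k) v - \<alpha> \<mu> v))"

lemma measurable_gap: "gap N k \<in> borel_measurable NT"
 using measurable_\<alpha>[OF \<mu>] measurable_\<alpha>[OF \<nu>, of k] unfolding gap_def[abs_def] by measurable

text \<open>At almost every time the marginals converge, and upper semicontinuity in the measure,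
  uniform in state and control, makes the gap small at all states and controls of that time at once.
  So its integral is small under the moving law \<open>\<nu> k\<close>, and dominated convergence in
  time finishes.\<close>

lemma gap_tendsto:
 assumes N: "N > 0"
 shows "(%k. \<integral>\<^sup>+s. ennreal (gap N k (fst (fst s), snd s)) \<partial>joint (Mk k) pz pw) \<longlonglongrightarrow> 0"
proof -
 have gm: "(%v. ennreal (gap N k v)) \<in> borel_measurable NT" for k
 by (rule measurable_compose[OF measurable_gap measurable_ennreal])
 have eq: "(\<integral>\<^sup>+s. ennreal (gap N k (fst (fst s), snd s)) \<partial>joint (Mk k) pz pw) =
 (\<integral>\<^sup>+t. section_integral (\<nu> k) (%v. ennreal (gap N k v)) t \<partial>leb T)" for k
 by (rule nn_integral_joint_time[OF \<nu>P measurable_pz_BH measurable_pw_nu distr_pw _ gm]) (simp add: pz_def pw_def)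
 have "(%k. \<integral>\<^sup>+t. section_integral (\<nu> k) (%v. ennreal (gap N k v)) t \<partial>leb T) \<longlonglongrightarrow> (\<integral>\<^sup>+t. 0 \<partial>leb T)"
 proof (rule nn_integral_dominated_convergence[where w="%_. ennreal (2 * N)"])
 show "section_integral (\<nu> k) (%v. ennreal (gap N k v)) \<in> borel_measurable (leb T)" for k
 by (rule measurable_section_integral[OF \<nu>P gm])
 show "AE t in leb T. section_integral (\<nu> k) (%v. ennreal (gap N k v)) t <= ennreal (2 * N)" for k
 proof (rule AE_I2)
 fix t assume "t \<in> space (leb T)"
 hence t: "t \<in> {0..T}" by simp
 show "section_integral (\<nu> k) (%v. ennreal (gap N k v)) t <= ennreal (2 * N)"
 by (rule section_integral_le[OF \<nu>P t]) (simp add: gap_def ennreal_leI)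
 qed
 show "(\<integral>\<^sup>+t. ennreal (2 * N) \<partial>leb T) < \<infinity>"
 using emeasure_leb[of T] T by (simp add: ennreal_mult_less_top)
 show "AE t in leb T. (%k. section_integral (\<nu> k) (%v. ennreal (gap N k v)) t) \<longlonglongrightarrow> 0"
 using hat_law_tendsto AE_space
 proof eventually_elim
 case (elim t)
 hence t: "t \<in> {0..T}" by simp
 show ?case
 proof (rule order_tendstoI)
 fix a :: ennreal assume "0 < a"
 then obtain r where r: "0 < r" "r < a" using dense by blast
 define e where "e = enn2real r"
 have rt: "r < top" using r(2) top_greatest by (rule less_le_trans)
 have er: "ennreal e = r" unfolding e_def by (rule ennreal_enn2real[OF rt])
 have e: "e > 0" unfolding e_def enn2real_positive_iff using r(1) rt by blast
 obtain \<delta> where \<delta>: "\<delta> > 0" "!!\<eta> s x u. \<eta> \<in> P2 ==> W2 (hat_law \<mu> t) \<eta> < \<delta> ==> s \<in> {0..T} ==> \<phi> s x \<eta> u < \<phi> s x (hat_law \<mu> t) u + e"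
 using unif_usc[OF hat_law_moment(4)[OF \<mu> t] e] by blast
 have "\<forall>\<^sub>F k in sequentially. W2 (hat_law \<mu> t) (hat_law (\<nu> k) t) < \<delta>"
 using order_tendstoD(2)[OF elim(1) \<delta>(1)] .
 thus "\<forall>\<^sub>F k in sequentially. section_integral (\<nu> k) (%v. ennreal (gap N k v)) t < a"
 proof eventually_elim
 case (elim k)
 have "gap N k (t, v) <= e" for v
 using \<delta>(2)[OF hat_law_moment(4)[OF \<nu> t] elim t, of "fst v" "snd v"] e by (simp add: gap_def \<alpha>_def)
 hence "section_integral (\<nu> k) (%v. ennreal (gap N k v)) t <= ennreal e"
 by (intro section_integral_le[OF \<nu>P t] ennreal_leI)
 thus ?case using r(2) unfolding er by (rule le_less_trans)
 qed
 qed simp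
 qed
 qed simp_all
 thus ?thesis unfolding eq by simp
qed

text \<open>For a level inside the range of the clipped function the set is a superlevel set of
  \<open>\<alpha> \<mu>\<close>; outside it is everything or nothing. Closedness uses semicontinuity
  in state and control with the law held fixed, at distance 0 by \<open>W2_self\<close>.\<close>

lemma closed_clip:
 assumes t: "t \<in> {0..T}" and N: "0 <= N"
 shows "closed {v. l <= clip N (\<alpha> \<mu> (t, v)) + N}"
proof -
 have cl: "closed {v. r <= \<alpha> \<mu> (t, v)}" for r
 proof -
 have "open (- {v. r <= \<alpha> \<mu> (t, v)})"
 proof (rule openI)
 fix v assume "v \<in> - {v. r <= \<alpha> \<mu> (t, v)}"
 hence e: "0 < r - \<alpha> \<mu> (t, v)" by simp
 note P = hat_law_moment[OF \<mu> t]
 have v: "(fst v, hat_law \<mu> t, snd v) \<in> UNIV \<times> P2 \<times> UNIV" using P(4) by simp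
 obtain \<delta> where \<delta>: "\<delta> > 0" "\<forall>y\<in>UNIV \<times> P2 \<times> UNIV. sum_dist dist (sum_dist W2 dist) (fst v, hat_law \<mu> t, snd v) y < \<delta> \<longrightarrow>
 (%(x, \<mu>, u). \<phi> t x \<mu> u) y < (%(x, \<mu>, u). \<phi> t x \<mu> u) (fst v, hat_law \<mu> t, snd v) + (r - \<alpha> \<mu> (t, v))"
 using usc[OF t, unfolded usc_on_def, THEN bspec, OF v, THEN spec, THEN mp, OF e] by (elim exE conjE) (rule that)
 have "v' \<in> - {v. r <= \<alpha> \<mu> (t, v)}" if "v' \<in> ball v (\<delta> / 2)" for v'
 proof -
 have "dist (fst v) (fst v') <= dist v v'" "dist (snd v) (snd v') <= dist v v'" by (rule dist_fst_le dist_snd_le)+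
 hence ds: "sum_dist dist (sum_dist W2 dist) (fst v, hat_law \<mu> t, snd v) (fst v', hat_law \<mu> t, snd v') < \<delta>"
 using that unfolding sum_dist_def by (simp add: W2_self[OF P(1,2)])
 have v': "(fst v', hat_law \<mu> t, snd v') \<in> UNIV \<times> P2 \<times> UNIV" using P(4) by simp
 have "\<phi> t (fst v') (hat_law \<mu> t) (snd v') < \<phi> t (fst v) (hat_law \<mu> t) (snd v) + (r - \<alpha> \<mu> (t, v))"
 using \<delta>(2)[THEN bspec, OF v', THEN mp, OF ds] by (simp only: prod.case)
 thus ?thesis by (simp add: \<alpha>_def)
 qed
 thus "\<exists>e>0. ball v e \<subseteq> - {v. r <= \<alpha> \<mu> (t, v)}" using \<delta>(1) by (intro exI[of _ "\<delta> / 2"]) auto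
 qed
 thus ?thesis by (simp add: closed_def)
 qed
 consider "l <= 0" | "0 < l" "N < l - N" | "0 < l" "l - N <= N" by linarith
 thus ?thesis
 proof cases
 case 1
 have "l <= clip N x + N" for x using 1 by (simp add: clip_def le_max_iff_disj)
 thus ?thesis by simp
 next
 case 2
 have "\<not> l <= clip N x + N" for x using 2 N by (auto simp: clip_def)
 thus ?thesis by simp
 next
 case 3
 have "l <= clip N x + N \<longleftrightarrow> l - N <= x" for x using 3 by (auto simp: clip_def)
 thus ?thesis using cl[of "l - N"] by simp
 qed
qed

end

section \<open>Passing to the limit in one constraint\<close>

context constraint_sequence
begin

definition constraint where
 "constraint \<eta> y = (\<integral>u. \<alpha> \<eta> (fst y, state_control y u) \<partial>time_kernel y)"

lemma measurable_constraint: "\<eta> \<in> prob_moment 2 OH dH ==> constraint \<eta> \<in> borel_measurable BT"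
 unfolding constraint_def[abs_def] by (intro measurable_integral_time_kernel measurable_\<alpha>)

text \<open>The shift by \<open>N\<close> makes the truncated constraint nonnegative, so that it can
  be integrated in \<open>ennreal\<close>.\<close>

definition clipped :: "real => (('a, 'b) hat) measure => real \<times> ('a \<times> 'b) => real" where
 "clipped N \<eta> v = clip N (\<alpha> \<eta> v) + N"

lemma measurable_clipped: "\<eta> \<in> prob_moment 2 OH dH ==> clipped N \<eta> \<in> borel_measurable NT"
 unfolding clipped_def[abs_def]
 by (intro borel_measurable_add borel_measurable_const measurable_compose[OF measurable_\<alpha> measurable_clip])

lemma measurable_clipped_ennreal: "\<eta> \<in> prob_moment 2 OH dH ==> (%v. ennreal (clipped N \<eta> v)) \<in> borel_measurable NT"
 by (rule measurable_compose[OF measurable_clipped measurable_ennreal])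

lemma clipped_bounds: "0 <= N ==> 0 <= clipped N \<eta> v" "0 <= N ==> clipped N \<eta> v <= 2 * N"
 using clip_bounds[of N "\<alpha> \<eta> v"] unfolding clipped_def by linarith+

lemma clipped_gap: "0 <= N ==> clipped N (\<nu> k) v <= clipped N \<mu> v + gap N k v"
 unfolding clipped_def gap_def clip_def by linarith

lemma space_BT_M0: "y \<in> space M0 ==> y \<in> space BT"
 by (simp only: sets_eq_imp_space_eq[OF sets_pair_BT[OF \<mu>P]])

text \<open>Let \<open>b\<close> be the mass of the bad set \<open>B\<close>. Over \<open>B\<close>
  the clipped constraints of \<open>\<nu> k\<close> integrate to at least \<open>N * b\<close>, up
  to \<open>K4 / N\<close>, and semicontinuity carries this lower bound to \<open>\<mu>\<close>. But
  for \<open>\<mu>\<close> the integral falls short of \<open>N * b\<close> by \<open>Q\<close>,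
  again up to \<open>K4 / N\<close>. Hence \<open>Q\<close> is at most a constant over
  \<open>N\<close> for every \<open>N\<close>, so it is 0.\<close>

lemma constraint_limit:
 assumes nonneg: "!!k. AE y in leb T \<Otimes>\<^sub>M \<nu> k. 0 <= constraint (\<nu> k) y"
 shows "AE y in M0. 0 <= constraint \<mu> y"
proof -
 interpret SL: stable_limit_kernel BT "%k. joint (Mk k) pz pw" "joint M0 (%y. y) (%y. y)" "leb T" fst
 "%k D. section_integral (\<nu> k) (indicator D)" "%D. section_integral \<mu> (indicator D)"
 by (rule limit_kernel)
 interpret M0: finite_measure M0 by (rule M0_finite)
 have idM: "(%y. y) \<in> M0 \<rightarrow>\<^sub>M BT" by (rule M0_measurable) simp
 define B where "B = {y \<in> space BT. constraint \<mu> y < 0}"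
 have B: "B \<in> sets BT" unfolding B_def using measurable_constraint[OF \<mu>] by measurable
 have BM0: "B \<in> sets M0" using B sets_pair_BT[OF \<mu>P] by simp
 obtain K where K: "K > 0" "(\<integral>\<^sup>+z. ennreal (hat_size z) \<partial>\<mu>) <= ennreal K" "!!k. (\<integral>\<^sup>+z. ennreal (hat_size z) \<partial>\<nu> k) <= ennreal K"
 using hat_size_bound by blast
 have K0: "0 <= K" using K(1) by simp
 define K4 where "K4 = 4 * C\<^sup>2 * (1 + K) * T + 4 * C\<^sup>2 * (T * K)"
 have K40: "0 <= K4" unfolding K4_def using K0 T by (intro add_nonneg_nonneg mult_nonneg_nonneg) auto
 define sq where "sq \<eta> y = (\<integral>\<^sup>+u. ennreal ((\<alpha> \<eta> (fst y, state_control y u))\<^sup>2) \<partial>time_kernel y)" for \<eta> y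
 have sqm: "sq \<eta> \<in> borel_measurable BT" if "\<eta> \<in> prob_moment 2 OH dH" for \<eta>
 unfolding sq_def[abs_def]
 by (rule measurable_nn_integral_time_kernel[of "%v. ennreal ((\<alpha> \<eta> v)\<^sup>2)"]) (use measurable_\<alpha>[OF that] in measurable)
 have sq\<mu>: "(\<integral>\<^sup>+y. sq \<mu> y \<partial>M0) <= ennreal K4" unfolding sq_def K4_def by (rule \<alpha>_square[OF \<mu> K(2) K0])
 have sq\<nu>: "(\<integral>\<^sup>+y. sq (\<nu> k) y \<partial>(leb T \<Otimes>\<^sub>M \<nu> k)) <= ennreal K4" for k
 unfolding sq_def K4_def by (rule \<alpha>_square[OF \<nu> K(3) K0])
 define cl where "cl N \<eta> y = (\<integral>\<^sup>+u. ennreal (clipped N \<eta> (fst y, state_control y u)) \<partial>time_kernel y)" for N \<eta> y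
 have clm: "cl N \<eta> \<in> borel_measurable BT" if "\<eta> \<in> prob_moment 2 OH dH" for N \<eta>
 unfolding cl_def[abs_def] by (rule measurable_nn_integral_time_kernel[OF measurable_clipped_ennreal[OF that]])
 have pt: "0 <= constraint \<eta> y ==> ennreal N <= cl N \<eta> y + ennreal (1 / N) * sq \<eta> y"
 "constraint \<eta> y <= 0 ==> cl N \<eta> y + ennreal (- constraint \<eta> y) <= ennreal N + ennreal (1 / N) * sq \<eta> y"
 if y: "y \<in> space BT" and \<eta>: "\<eta> \<in> prob_moment 2 OH dH" and N: "N > 0" for \<eta> y N
 proof -
 interpret k: prob_space "time_kernel y" by (rule time_kernel_space(1)[OF y])
 note r = measurable_time_section[OF y measurable_\<alpha>[OF \<eta>]]
 show "0 <= constraint \<eta> y ==> ennreal N <= cl N \<eta> y + ennreal (1 / N) * sq \<eta> y"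
 unfolding constraint_def cl_def sq_def clipped_def by (rule k.clip_integral(1)[OF r N])
 show "constraint \<eta> y <= 0 ==> cl N \<eta> y + ennreal (- constraint \<eta> y) <= ennreal N + ennreal (1 / N) * sq \<eta> y"
 unfolding constraint_def cl_def sq_def clipped_def by (rule k.clip_integral(2)[OF r N])
 qed
 define Q where "Q = (\<integral>\<^sup>+y. indicator B y * ennreal (- constraint \<mu> y) \<partial>M0)"
 have key: "Q <= ennreal ((2 + 2 * K4) / N)" if N: "N > 0" for N
 proof -
 have N0: "0 <= N" using N by simp
 define b where "b = emeasure M0 B"
 define Y0 where "Y0 = (\<integral>\<^sup>+s. indicator B (fst s) * ennreal (clipped N \<mu> (fst (fst s), snd s)) \<partial>joint M0 (%y. y) (%y. y))"
 define Y where "Y k = (\<integral>\<^sup>+s. indicator B (fst s) * ennreal (clipped N \<mu> (fst (fst s), snd s)) \<partial>joint (Mk k) pz pw)" for k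
 define d where "d k = (\<integral>\<^sup>+s. ennreal (gap N k (fst (fst s), snd s)) \<partial>joint (Mk k) pz pw)" for k
 have ab: "fst (pz x) = fst (pw x)" for x by (simp add: pz_def pw_def)
 have Y0eq: "Y0 = (\<integral>\<^sup>+y. indicator B y * cl N \<mu> y \<partial>M0)"
 unfolding Y0_def cl_def by (rule nn_integral_joint_base[OF idM idM refl B measurable_clipped_ennreal[OF \<mu>]])
 have iB: "indicator B \<in> borel_measurable M0" using BM0 by simp
 have clM0: "cl N \<mu> \<in> borel_measurable M0" by (rule M0_measurable[OF clm[OF \<mu>]])
 \<comment> \<open>Nonnegativity holds at the approximating point, while membership in
   \<open>B\<close> is asked of the limit point; the coupling brings both under one
   integral.\<close>
 have 1: "ennreal N * b <= (\<integral>\<^sup>+s. indicator B (fst s) * ennreal (clipped N (\<nu> k) (fst (fst s), snd s)) \<partial>joint (Mk k) pz pw) + ennreal (K4 / N)" for k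
 proof -
 have Bpz: "(%x. indicator B (pz x)) \<in> borel_measurable (Mk k)" by (rule measurable_compose[OF measurable_pz iB])
 have clpw: "(%x. cl N (\<nu> k) (pw x)) \<in> borel_measurable (Mk k)" by (rule measurable_compose[OF measurable_pw clm[OF \<nu>]])
 have sqpw: "(%x. sq (\<nu> k) (pw x)) \<in> borel_measurable (Mk k)" by (rule measurable_compose[OF measurable_pw sqm[OF \<nu>]])
 have "AE y in distr (Mk k) (leb T \<Otimes>\<^sub>M \<nu> k) pw. 0 <= constraint (\<nu> k) y" unfolding distr_pw by (rule nonneg)
 from AE_distrD[OF measurable_pw_nu this] have ae: "AE x in Mk k. 0 <= constraint (\<nu> k) (pw x)" .
 have "ennreal N * b = (\<integral>\<^sup>+y. ennreal N * indicator B y \<partial>M0)"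
 unfolding b_def by (rule nn_integral_cmult_indicator[OF BM0, symmetric])
 also have "\<dots> = (\<integral>\<^sup>+x. ennreal N * indicator B (pz x) \<partial>Mk k)"
 by (rule nn_integral_distr[OF measurable_pz, unfolded distr_pz]) (use iB in measurable)
 also have "\<dots> <= (\<integral>\<^sup>+x. indicator B (pz x) * cl N (\<nu> k) (pw x) + ennreal (1 / N) * sq (\<nu> k) (pw x) \<partial>Mk k)"
 proof (rule nn_integral_mono_AE)
 show "AE x in Mk k. ennreal N * indicator B (pz x) <= indicator B (pz x) * cl N (\<nu> k) (pw x) + ennreal (1 / N) * sq (\<nu> k) (pw x)"
 using ae AE_space
 proof eventually_elim
 case (elim x)
 show ?case using pt(1)[OF measurable_space[OF measurable_pw elim(2)] \<nu> N elim(1)] by (cases "pz x \<in> B") simp_all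
 qed
 qed
 also have "\<dots> = (\<integral>\<^sup>+x. indicator B (pz x) * cl N (\<nu> k) (pw x) \<partial>Mk k) + (\<integral>\<^sup>+x. ennreal (1 / N) * sq (\<nu> k) (pw x) \<partial>Mk k)"
 by (rule nn_integral_add) (intro borel_measurable_times_ennreal Bpz clpw sqpw borel_measurable_const)+
 also have "(\<integral>\<^sup>+x. indicator B (pz x) * cl N (\<nu> k) (pw x) \<partial>Mk k) =
 (\<integral>\<^sup>+s. indicator B (fst s) * ennreal (clipped N (\<nu> k) (fst (fst s), snd s)) \<partial>joint (Mk k) pz pw)"
 unfolding cl_def
 by (rule nn_integral_joint_base[OF measurable_pz_BH measurable_pw ab B measurable_clipped_ennreal[OF \<nu>], symmetric])
 also have "(\<integral>\<^sup>+x. ennreal (1 / N) * sq (\<nu> k) (pw x) \<partial>Mk k) = ennreal (1 / N) * (\<integral>\<^sup>+x. sq (\<nu> k) (pw x) \<partial>Mk k)"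
 by (rule nn_integral_cmult[OF sqpw])
 also have "(\<integral>\<^sup>+x. sq (\<nu> k) (pw x) \<partial>Mk k) = (\<integral>\<^sup>+y. sq (\<nu> k) y \<partial>(leb T \<Otimes>\<^sub>M \<nu> k))"
 by (rule nn_integral_distr[OF measurable_pw_nu, unfolded distr_pw, symmetric])
 (simp only: measurable_cong_sets[OF sets_pair_BT[OF \<nu>P] refl] sqm[OF \<nu>])
 also have "ennreal (1 / N) * (\<integral>\<^sup>+y. sq (\<nu> k) y \<partial>(leb T \<Otimes>\<^sub>M \<nu> k)) <= ennreal (1 / N) * ennreal K4"
 by (intro mult_left_mono sq\<nu>) simp
 also have "ennreal (1 / N) * ennreal K4 = ennreal (K4 / N)" by (subst ennreal_mult[symmetric]) (use N K40 in auto)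
 finally show ?thesis by (simp add: add_left_mono)
 qed
 have jm: "(%s. (fst (fst s), snd s)) \<in> (BJ :: (_ \<times> ('a \<times> 'b)) measure) \<rightarrow>\<^sub>M NT" by (rule SL.time_measurable)
 have Bs: "(%s. indicator B (fst s)) \<in> borel_measurable (BJ :: (_ \<times> ('a \<times> 'b)) measure)"
 using B by (intro measurable_compose[OF measurable_fst]) simp
 have 2: "(\<integral>\<^sup>+s. indicator B (fst s) * ennreal (clipped N (\<nu> k) (fst (fst s), snd s)) \<partial>joint (Mk k) pz pw) <= Y k + d k" for k
 proof -
 have "(\<integral>\<^sup>+s. indicator B (fst s) * ennreal (clipped N (\<nu> k) (fst (fst s), snd s)) \<partial>joint (Mk k) pz pw) \<le>
 (\<integral>\<^sup>+s. indicator B (fst s) * ennreal (clipped N \<mu> (fst (fst s), snd s)) + ennreal (gap N k (fst (fst s), snd s)) \<partial>joint (Mk k) pz pw)"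
 proof (rule nn_integral_mono)
 fix s :: "(real \<times> (('a, 'b) hat)) \<times> ('a \<times> 'b)"
 let ?v = "(fst (fst s), snd s)"
 have g0: "0 <= gap N k ?v" using N by (simp add: gap_def)
 have "ennreal (clipped N (\<nu> k) ?v) <= ennreal (clipped N \<mu> ?v + gap N k ?v)" by (rule ennreal_leI[OF clipped_gap[OF N0]])
 also have "\<dots> = ennreal (clipped N \<mu> ?v) + ennreal (gap N k ?v)" by (rule ennreal_plus[OF clipped_bounds(1)[OF N0] g0])
 finally show "indicator B (fst s) * ennreal (clipped N (\<nu> k) ?v) <= indicator B (fst s) * ennreal (clipped N \<mu> ?v) + ennreal (gap N k ?v)"
 by (cases "fst s \<in> B") simp_all
 qed
 also have "\<dots> = Y k + d k" unfolding Y_def d_def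
 by (intro nn_integral_add borel_measurable_times_ennreal SL.P_meas(1) Bs measurable_compose[OF jm measurable_clipped_ennreal[OF \<mu>]]
 measurable_compose[OF jm measurable_compose[OF measurable_gap measurable_ennreal]])
 finally show ?thesis .
 qed
 let ?f = "%s. indicator B (fst s) * clipped N \<mu> (fst (fst s), snd s) :: real"
 have real: "(\<integral>\<^sup>+s. indicator B (fst s) * ennreal (clipped N \<mu> (fst (fst s), snd s)) \<partial>R) = ennreal (\<integral>s. ?f s \<partial>R)" "0 <= (\<integral>s. ?f s \<partial>R)"
 if R: "finite_measure R" "sets R = sets (BJ :: (_ \<times> ('a \<times> 'b)) measure)" for R
 proof -
 interpret R: finite_measure R by fact
 have "(%s. indicator B (fst s) :: real) \<in> borel_measurable (BJ :: (_ \<times> ('a \<times> 'b)) measure)"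
 using B by (intro measurable_compose[OF measurable_fst]) simp
 from borel_measurable_times[OF this measurable_compose[OF jm measurable_clipped[OF \<mu>]]]
 have m: "?f \<in> borel_measurable R" unfolding measurable_cong_sets[OF R(2) refl] .
 have f0: "0 <= ?f s" "\<bar>?f s\<bar> <= 2 * N" for s
 using clipped_bounds[OF N0, of \<mu> "(fst (fst s), snd s)"] N by (auto simp: indicator_def)
 have "(\<integral>\<^sup>+s. ennreal (?f s) \<partial>R) = ennreal (\<integral>s. ?f s \<partial>R)"
 proof (rule nn_integral_eq_integral)
 show "integrable R ?f" using m f0(2) by (intro R.integrable_const_bound[of _ "2 * N"]) auto
 qed (use f0(1) in simp)
 moreover have "indicator B (fst s) * ennreal (clipped N \<mu> (fst (fst s), snd s)) = ennreal (?f s)" for s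
 by (simp add: indicator_def)
 ultimately show "(\<integral>\<^sup>+s. indicator B (fst s) * ennreal (clipped N \<mu> (fst (fst s), snd s)) \<partial>R) = ennreal (\<integral>s. ?f s \<partial>R)" by simp
 show "0 <= (\<integral>s. ?f s \<partial>R)" using f0(1) by (rule Bochner_Integration.integral_nonneg)
 qed
 \<comment> \<open>Semicontinuity and gap errors are taken of the same order as the truncation
   error.\<close>
 define e where "e = 1 / N"
 have e: "e > 0" using N by (simp add: e_def)
 have bnd: "\<bar>clipped N \<mu> v\<bar> <= 2 * N" for v using clipped_bounds[OF N0, of \<mu> v] by simp
 have N2: "2 * N > 0" using N by simp
 have closed: "closed {v. l <= clipped N \<mu> (t, v)}" if "t \<in> space (leb T)" for t l
 unfolding clipped_def by (rule closed_clip[OF _ N0]) (use that in simp)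
 have "\<forall>\<^sub>F k in sequentially. (\<integral>s. ?f s \<partial>joint (Mk k) pz pw) <= (\<integral>s. ?f s \<partial>joint M0 (%y. y) (%y. y)) + e"
 by (rule SL.usc_limsup[OF B measurable_clipped[OF \<mu>] N2 bnd closed e])
 hence 3: "\<forall>\<^sub>F k in sequentially. Y k <= Y0 + ennreal e"
 proof eventually_elim
 case (elim k)
 thus ?case
 unfolding Y_def Y0_def real(1)[OF SL.P_finite SL.P_sets] real(1)[OF SL.P0_finite SL.P0_sets]
 using ennreal_leI[OF elim] ennreal_plus[OF real(2)[OF SL.P0_finite SL.P0_sets] less_imp_le[OF e]] by simp
 qed
 have "\<forall>\<^sub>F k in sequentially. d k < ennreal e"
 using order_tendstoD(2)[OF gap_tendsto[OF N], of "ennreal e"] e by (simp add: d_def)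
 with 3 have "\<forall>\<^sub>F k in sequentially. Y k <= Y0 + ennreal e & d k < ennreal e" by (rule eventually_conj)
 then obtain k where k: "Y k <= Y0 + ennreal e" "d k <= ennreal e"
 using eventually_happens[of _ sequentially] by (fastforce intro: less_imp_le)
 have "ennreal N * b <= Y k + d k + ennreal (K4 / N)" using 1[of k] add_right_mono[OF 2[of k]] by (rule order_trans)
 also have "\<dots> <= (Y0 + ennreal e) + ennreal e + ennreal (K4 / N)" by (intro add_right_mono add_mono k)
 finally have low: "ennreal N * b <= Y0 + (ennreal e + ennreal e + ennreal (K4 / N))" by (simp only: add.assoc)
 have 4: "Y0 + Q <= ennreal N * b + ennreal (K4 / N)"
 proof -
 have cm: "(%y. indicator B y * ennreal (- constraint \<mu> y)) \<in> borel_measurable M0"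
 using iB M0_measurable[OF measurable_constraint[OF \<mu>]] by measurable
 have "Y0 + Q = (\<integral>\<^sup>+y. indicator B y * cl N \<mu> y + indicator B y * ennreal (- constraint \<mu> y) \<partial>M0)"
 unfolding Y0eq Q_def by (rule nn_integral_add[OF borel_measurable_times_ennreal[OF iB clM0] cm, symmetric])
 also have "\<dots> <= (\<integral>\<^sup>+y. ennreal N * indicator B y + ennreal (1 / N) * sq \<mu> y \<partial>M0)"
 proof (rule nn_integral_mono)
 fix y assume "y \<in> space M0"
 hence y: "y \<in> space BT" by (rule space_BT_M0)
 show "indicator B y * cl N \<mu> y + indicator B y * ennreal (- constraint \<mu> y) <= ennreal N * indicator B y + ennreal (1 / N) * sq \<mu> y"
 using pt(2)[OF y \<mu> N] by (cases "y \<in> B") (simp_all add: B_def)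
 qed
 also have "\<dots> = (\<integral>\<^sup>+y. ennreal N * indicator B y \<partial>M0) + (\<integral>\<^sup>+y. ennreal (1 / N) * sq \<mu> y \<partial>M0)"
 by (rule nn_integral_add) (intro borel_measurable_times_ennreal iB borel_measurable_const M0_measurable[OF sqm[OF \<mu>]])+
 also have "(\<integral>\<^sup>+y. ennreal N * indicator B y \<partial>M0) = ennreal N * b" unfolding b_def by (rule nn_integral_cmult_indicator[OF BM0])
 also have "(\<integral>\<^sup>+y. ennreal (1 / N) * sq \<mu> y \<partial>M0) = ennreal (1 / N) * (\<integral>\<^sup>+y. sq \<mu> y \<partial>M0)"
 by (rule nn_integral_cmult[OF M0_measurable[OF sqm[OF \<mu>]]])
 also have "ennreal N * b + ennreal (1 / N) * (\<integral>\<^sup>+y. sq \<mu> y \<partial>M0) <= ennreal N * b + ennreal (1 / N) * ennreal K4"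
 by (intro add_left_mono mult_left_mono sq\<mu>) simp
 also have "ennreal (1 / N) * ennreal K4 = ennreal (K4 / N)" by (subst ennreal_mult[symmetric]) (use N K40 in auto)
 finally show ?thesis .
 qed
 have K4N: "0 <= K4 / N" using K40 N by simp
 have "Y0 + Q <= Y0 + (ennreal e + ennreal e + ennreal (K4 / N)) + ennreal (K4 / N)"
 by (rule order_trans[OF 4 add_right_mono[OF low]])
 also have "\<dots> = Y0 + ((ennreal e + ennreal e + ennreal (K4 / N)) + ennreal (K4 / N))" by (simp only: add.assoc)
 also have "ennreal e + ennreal e + ennreal (K4 / N) + ennreal (K4 / N) = ennreal (e + e + K4 / N + K4 / N)"
 using e K4N by (simp only: ennreal_plus add_nonneg_nonneg less_imp_le)
 also have "e + e + K4 / N + K4 / N = (2 + 2 * K4) / N" by (simp add: e_def add_divide_distrib)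
 finally have "Y0 + Q <= Y0 + ennreal ((2 + 2 * K4) / N)" .
 \<comment> \<open>\<open>Y0\<close> can be cancelled only if it is finite, which truncation
   guarantees.\<close>
 moreover have "Y0 ~= top" unfolding Y0_def real(1)[OF SL.P0_finite SL.P0_sets] by simp
 ultimately show ?thesis by (simp add: ennreal_add_left_cancel_le)
 qed
 have "Q <= 0"
 proof (rule ennreal_le_epsilon)
 fix e :: real assume e: "e > 0"
 have n: "(2 + 2 * K4) / e > 0" using e K40 by (intro divide_pos_pos) auto
 have "(2 + 2 * K4) / ((2 + 2 * K4) / e) = e" using K40 by simp
 thus "Q <= 0 + ennreal e" using key[OF n] by simp
 qed
 hence "(\<integral>\<^sup>+y. indicator B y * ennreal (- constraint \<mu> y) \<partial>M0) = 0" by (simp add: Q_def)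
 moreover have "(%y. indicator B y * ennreal (- constraint \<mu> y)) \<in> borel_measurable M0"
 using BM0 M0_measurable[OF measurable_constraint[OF \<mu>]] by measurable
 ultimately have "AE y in M0. indicator B y * ennreal (- constraint \<mu> y) = 0" using nn_integral_0_iff_AE by blast
 thus ?thesis using AE_space
 proof eventually_elim
 case (elim y)
 show ?case
 proof (rule ccontr)
 assume "\<not> 0 <= constraint \<mu> y"
 hence "y \<in> B" "0 < - constraint \<mu> y" using space_BT_M0[OF elim(2)] by (auto simp: B_def)
 thus False using elim(1) by (simp add: ennreal_eq_0_iff)
 qed
 qed
qed

end

section \<open>Closedness\<close>

text \<open>Openness asks for a ball around the point, so a point outside \<open>S\<close> without
  such a ball has members of \<open>S\<close> at every positive distance.\<close>

lemma closedin_metric_topologyI: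
 assumes "S \<subseteq> M" and cl: "!!x. x \<in> M ==> (!!r. r > 0 ==> \<exists>y\<in>S. d x y < r) ==> x \<in> S"
 shows "closedin (metric_topology M d) S"
proof -
 have "openin (metric_topology M d) M" unfolding openin_metric_topology by (auto intro: exI[of _ 1])
 moreover have "topspace (metric_topology M d) \<subseteq> M"
 using openin_topspace[of "metric_topology M d"] unfolding openin_metric_topology by blast
 ultimately have top: "topspace (metric_topology M d) = M" using openin_subset by blast
 have "openin (metric_topology M d) (M - S)"
 unfolding openin_metric_topology
 proof (intro conjI ballI)
 fix x assume x: "x \<in> M - S"
 show "\<exists>r>0. \<forall>y\<in>M. d x y < r --> y \<in> M - S"
 proof (rule ccontr)
 assume "\<not> ?thesis"
 hence "\<exists>y\<in>S. d x y < r" if "r > 0" for r using that by blast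
 thus False using cl[of x] x by blast
 qed
 qed blast
 thus ?thesis unfolding closedin_def top using assms(1) by blast
qed

lemma mono_paths_dist_nonneg: "0 <= mono_paths_dist T a b"
 unfolding mono_paths_dist_def fortet_mourier_def by (intro sum_nonneg) simp

lemma marginal_hat_moment:
 assumes "R \<in> laws T U p"
 shows "marginal_hat T U p R \<in> prob_moment 2 (skorokhod T \<times> controls T U p) (sum_dist (skorokhod_dist T) (controls_dist T U))"
 using assms by (simp add: laws_def Omega_hat_def Omega_hat_dist_def)

lemma wasserstein_le_laws_dist:
 "wasserstein 2 (skorokhod T \<times> controls T U p) (sum_dist (skorokhod_dist T) (controls_dist T U))
 (marginal_hat T U p R) (marginal_hat T U p R') <= laws_dist T U p R R'"
 unfolding laws_dist_def Omega_hat_def Omega_hat_dist_def fortet_mourier_def by simp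

text \<open>The event depends on the outcome through path and control only, and on \<open>R\<close>
  through the same marginal, so it can be tested under \<open>\<mu>\<close>. Measurability of
  \<open>\<Phi>\<close> matters because \<open>emeasure\<close> is 0 outside the
  sigma-algebra.\<close>

lemma emeasure_constraint_set:
 fixes R :: "('n::finite, 'l::finite, 'k::finite) Omega measure" and U :: "(real ^ 'l) set"
 and f :: "real => real ^ 'n => (real ^ 'n) measure => real ^ 'l => real"
 assumes "control_kernel T p U \<kappa>" and R: "R \<in> laws T U p"
 defines "\<mu> \<equiv> marginal_hat T U p R"
 defines "\<Phi> \<equiv> %y. \<integral>u. f (fst y) (fst (snd y) (fst y)) (hat_law \<mu> (fst y)) u \<partial>\<kappa> (snd (snd y)) (fst y)"
 assumes \<Phi>: "\<Phi> \<in> borel_measurable (leb T \<Otimes>\<^sub>M \<mu>)"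
 shows "emeasure (leb T \<Otimes>\<^sub>M R) (constraint_set T U p \<kappa> f R) = ennreal T \<longleftrightarrow> (AE y in leb T \<Otimes>\<^sub>M \<mu>. 0 <= \<Phi> y)"
proof -
 interpret control_kernel T p U \<kappa> by fact
 have RP: "R \<in> prob_measures (Omega T U p) (Omega_dist T U)" using R by (simp add: laws_def)
 interpret R: prob_space R by (rule prob_measuresD(1)[OF RP])
 interpret L: finite_measure "leb T" by (rule finite_measure_leb)
 have \<mu>P: "\<mu> \<in> prob_measures (Omega_hat T U p) (Omega_hat_dist T U)" using R by (simp add: laws_def prob_moment_def \<mu>_def)
 interpret \<mu>: prob_space \<mu> by (rule prob_measuresD(1)[OF \<mu>P])
 have nn: "0 <= Omega_hat_dist T U z w" for z w :: "('n, 'l) Omega_hat" unfolding Omega_hat_dist_def by (rule dH_nonneg)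
 have "fst \<in> borel_on (Omega T U p) (Omega_dist T U) \<rightarrow>\<^sub>M
 borel_on (Omega_hat T U p) (Omega_hat_dist T U :: ('n, 'l) Omega_hat => _)"
 unfolding Omega_def Omega_dist_def by (rule measurable_fst_sum_dist[OF nn mono_paths_dist_nonneg])
 hence fR: "fst \<in> R \<rightarrow>\<^sub>M borel_on (Omega_hat T U p) (Omega_hat_dist T U)"
 unfolding measurable_cong_sets[OF prob_measuresD(2)[OF RP] refl] .
 have f\<mu>: "fst \<in> R \<rightarrow>\<^sub>M \<mu>" unfolding measurable_cong_sets[OF refl prob_measuresD(2)[OF \<mu>P]] by (rule fR)
 have d\<mu>: "distr R \<mu> fst = \<mu>"
 unfolding \<mu>_def marginal_hat_def by (intro distr_cong) auto
 let ?h = "%x. (fst x, fst (snd x))"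
 have h: "?h \<in> leb T \<Otimes>\<^sub>M R \<rightarrow>\<^sub>M leb T \<Otimes>\<^sub>M \<mu>"
 by (intro measurable_Pair measurable_fst measurable_compose[OF measurable_snd f\<mu>])
 have dh: "distr (leb T \<Otimes>\<^sub>M R) (leb T \<Otimes>\<^sub>M \<mu>) ?h = leb T \<Otimes>\<^sub>M \<mu>"
 proof -
 have id: "distr (leb T) (leb T) (%t. t) = leb T" by (rule distr_id2) simp
 have "distr (leb T) (leb T) (%t. t) \<Otimes>\<^sub>M distr R \<mu> fst = distr (leb T \<Otimes>\<^sub>M R) (leb T \<Otimes>\<^sub>M \<mu>) (%(x, y). (x, fst y))"
 by (rule pair_measure_distr[OF measurable_ident f\<mu>, unfolded id_def])
 (unfold d\<mu>, rule \<mu>.sigma_finite_measure_axioms)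
 thus ?thesis unfolding id d\<mu> by (simp add: case_prod_unfold)
 qed
 have law: "law_X R t = hat_law \<mu> t" if t: "t \<in> {0..T}" for t
 proof -
 have "(%z :: ('n, 'l) Omega_hat. fst z t) \<in> borel_measurable (borel_on (Omega_hat T U p) (Omega_hat_dist T U))"
 unfolding Omega_hat_def Omega_hat_dist_def by (rule measurable_eval_BH_time[OF t])
 from distr_distr[OF this fR] show ?thesis
 unfolding law_X_def hat_law_def \<mu>_def marginal_hat_def coord_X_def by (simp add: comp_def)
 qed
 define Z where "Z = {x \<in> space (leb T \<Otimes>\<^sub>M R). 0 <= \<Phi> (?h x)}"
 have cs: "constraint_set T U p \<kappa> f R = Z"
 proof (rule set_eqI)
 fix x :: "real \<times> ('n, 'l, 'k) Omega"
 obtain t \<omega> where x: "x = (t, \<omega>)" by (cases x)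
 show "x \<in> constraint_set T U p \<kappa> f R \<longleftrightarrow> x \<in> Z"
 proof (cases "t \<in> {0..T}")
 case True
 thus ?thesis
 by (simp add: x Z_def constraint_set_def space_pair_measure prob_measuresD(3)[OF RP] \<Phi>_def law coord_X_def coord_q_def)
 next
 case False
 thus ?thesis by (auto simp: x Z_def constraint_set_def space_pair_measure)
 qed
 qed
 have Z: "Z \<in> sets (leb T \<Otimes>\<^sub>M R)"
 unfolding Z_def using measurable_compose[OF h \<Phi>] by measurable
 have "emeasure (leb T \<Otimes>\<^sub>M R) (space (leb T) \<times> space R) = emeasure (leb T) (space (leb T)) * emeasure R (space R)"
 by (rule R.emeasure_pair_measure_Times[OF sets.top sets.top])
 hence tot: "emeasure (leb T \<Otimes>\<^sub>M R) (space (leb T \<Otimes>\<^sub>M R)) = ennreal T"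
 using emeasure_leb[of T] T by (simp add: space_pair_measure R.emeasure_space_1)
 have "emeasure (leb T \<Otimes>\<^sub>M R) Z = ennreal T \<longleftrightarrow> (AE x in leb T \<Otimes>\<^sub>M R. 0 <= \<Phi> (?h x))"
 proof
 assume eq: "emeasure (leb T \<Otimes>\<^sub>M R) Z = ennreal T"
 have "emeasure (leb T \<Otimes>\<^sub>M R) (space (leb T \<Otimes>\<^sub>M R) - Z) = emeasure (leb T \<Otimes>\<^sub>M R) (space (leb T \<Otimes>\<^sub>M R)) - emeasure (leb T \<Otimes>\<^sub>M R) Z"
 by (rule emeasure_compl[OF Z]) (simp add: eq)
 hence "emeasure (leb T \<Otimes>\<^sub>M R) (space (leb T \<Otimes>\<^sub>M R) - Z) = 0" unfolding eq tot by simp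
 hence "space (leb T \<Otimes>\<^sub>M R) - Z \<in> null_sets (leb T \<Otimes>\<^sub>M R)" using Z by (intro null_setsI) auto
 thus "AE x in leb T \<Otimes>\<^sub>M R. 0 <= \<Phi> (?h x)" by (rule AE_I') (auto simp: Z_def)
 next
 assume "AE x in leb T \<Otimes>\<^sub>M R. 0 <= \<Phi> (?h x)"
 hence "AE x in leb T \<Otimes>\<^sub>M R. x \<in> Z \<longleftrightarrow> x \<in> space (leb T \<Otimes>\<^sub>M R)"
 using AE_space by eventually_elim (simp add: Z_def)
 from emeasure_eq_AE[OF this Z sets.top] show "emeasure (leb T \<Otimes>\<^sub>M R) Z = ennreal T" unfolding tot .
 qed
 also have "\<dots> \<longleftrightarrow> (AE y in distr (leb T \<Otimes>\<^sub>M R) (leb T \<Otimes>\<^sub>M \<mu>) ?h. 0 <= \<Phi> y)"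
 by (rule AE_distr_iff[OF h, symmetric]) (use \<Phi> in measurable)
 finally show ?thesis unfolding cs dh .
qed

theorem lemma3p8:
  fixes T p C :: real
    and d :: nat
    and U :: "(real ^ 'l) set"
    and \<phi> :: "nat \<Rightarrow> real \<Rightarrow> real ^ 'n \<Rightarrow> (real ^ 'n) measure \<Rightarrow> real ^ 'l \<Rightarrow> real"
    and \<kappa> :: "(real \<times> (real ^ 'l)) measure \<Rightarrow> real \<Rightarrow> (real ^ 'l) measure"
  assumes "T > 0" and "p > 2"
    and "closed U" and "convex U"
    and meas: "\<And>i. i \<in> {1..d} \<Longrightarrow>
      (\<lambda>(t, x, \<mu>, u). \<phi> i t x \<mu> u)
        \<in> borel_measurable (restrict_space borel {0..T} \<Otimes>\<^sub>M borel \<Otimes>\<^sub>M borel_on P2 W2 \<Otimes>\<^sub>M borel)"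
    and usc: "\<And>i t. i \<in> {1..d} \<Longrightarrow> t \<in> {0..T} \<Longrightarrow>
      usc_on (UNIV \<times> P2 \<times> UNIV) (sum_dist dist (sum_dist W2 dist)) (\<lambda>(x, \<mu>, u). \<phi> i t x \<mu> u)"
    and "C > 0"
    and growth: "\<And>i t x \<mu> u. i \<in> {1..d} \<Longrightarrow> t \<in> {0..T} \<Longrightarrow> \<mu> \<in> P2 \<Longrightarrow>
      \<bar>\<phi> i t x \<mu> u\<bar> \<le> C * (1 + norm x + sqrt (second_moment \<mu>) + norm u)"
    and unif_usc: "\<And>i \<mu> \<epsilon>. i \<in> {1..d} \<Longrightarrow> \<mu> \<in> P2 \<Longrightarrow> \<epsilon> > 0 \<Longrightarrow>
      \<exists>\<delta>>0. \<forall>\<nu>\<in>P2. W2 \<mu> \<nu> < \<delta> \<longrightarrow>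
        (\<forall>t\<in>{0..T}. \<forall>x u. \<phi> i t x \<nu> u < \<phi> i t x \<mu> u + \<epsilon>)"
    and "disintegration T U p \<kappa>"
  shows "closedin (metric_topology (laws T U p) (laws_dist T U p))
    {R \<in> (laws T U p :: ('n::finite, 'l::finite, 'k::finite) Omega measure set).
       \<forall>i\<in>{1..d}. emeasure (leb T \<Otimes>\<^sub>M R) (constraint_set T U p \<kappa> (\<phi> i) R) = ennreal T}"
    (is "closedin _ ?S")
proof (rule closedin_metric_topologyI)
 have ck: "control_kernel T p U \<kappa>" by unfold_locales fact+
 interpret control_kernel T p U \<kappa> by (rule ck)
 fix R :: "('n, 'l, 'k) Omega measure"
 assume R: "R \<in> laws T U p" and near: "!!r. r > 0 ==> \<exists>R'\<in>?S. laws_dist T U p R R' < r"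
 let ?\<mu> = "marginal_hat T U p R"
 note \<mu> = marginal_hat_moment[OF R]
 \<comment> \<open>Law, coupling and cost bound are chosen together for each \<open>k\<close>, as a
   triple.\<close>
 define G where "G k R' \<pi> c \<longleftrightarrow> R' \<in> ?S & \<pi> \<in> couplings (skorokhod T \<times> controls T U p) (sum_dist (skorokhod_dist T) (controls_dist T U)) ?\<mu> (marginal_hat T U p R') \<and>
 (\<integral>\<^sup>+z. ennreal (sum_dist (skorokhod_dist T) (controls_dist T U) (fst z) (snd z) powr 2) \<partial>\<pi>) <= ennreal c \<and>
 0 <= c & c <= inverse (real (Suc k)) & (\<integral>\<^sup>+z. path_sq T (fst (fst z)) (fst (snd z)) \<partial>\<pi>) <= ennreal ((1 / 2) ^ k)" for k R' \<pi> c
 have "\<exists>x. G k (fst x) (fst (snd x)) (snd (snd x))" for k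
 proof -
 obtain c' where c': "c' > 0" "\<forall>\<nu>\<in>prob_measures (skorokhod T \<times> controls T U p) (sum_dist (skorokhod_dist T) (controls_dist T U)).
 \<forall>\<pi>\<in>couplings (skorokhod T \<times> controls T U p) (sum_dist (skorokhod_dist T) (controls_dist T U)) ?\<mu> \<nu>.
 (\<integral>\<^sup>+z. ennreal (sum_dist (skorokhod_dist T) (controls_dist T U) (fst z) (snd z) powr 2) \<partial>\<pi>) <= ennreal c' \<longrightarrow>
 (\<integral>\<^sup>+z. path_sq T (fst (fst z)) (fst (snd z)) \<partial>\<pi>) <= ennreal ((1 / 2) ^ k)"
 using path_sq_coupling[OF \<mu>, of "(1 / 2) ^ k"] by auto
 \<comment> \<open>\<open>c'\<close> buys the rate \<open>(1 / 2) ^ k\<close> for the paths, and the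
   second bound makes the costs tend to 0. A law within \<open>sqrt c\<close> of \<open>R\<close>
   admits a coupling of cost below \<open>c\<close>.\<close>
 define c where "c = min c' (inverse (real (Suc k)))"
 have c: "c > 0" "c <= c'" "c <= inverse (real (Suc k))" using c'(1) by (auto simp: c_def)
 obtain R' where R': "R' \<in> ?S" "laws_dist T U p R R' < sqrt c" using near[of "sqrt c"] c(1) by auto
 hence \<nu>: "marginal_hat T U p R' \<in> prob_moment 2 (skorokhod T \<times> controls T U p) (sum_dist (skorokhod_dist T) (controls_dist T U))"
 by (intro marginal_hat_moment) simp
 obtain \<pi> where \<pi>: "\<pi> \<in> couplings (skorokhod T \<times> controls T U p) (sum_dist (skorokhod_dist T) (controls_dist T U)) ?\<mu> (marginal_hat T U p R')"
 "(\<integral>\<^sup>+z. ennreal (sum_dist (skorokhod_dist T) (controls_dist T U) (fst z) (snd z) powr 2) \<partial>\<pi>) < ennreal ((sqrt c)\<^sup>2)"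
 using ex_hat_coupling[OF \<mu> \<nu> le_less_trans[OF wasserstein_le_laws_dist R'(2)]] by blast
 have le: "(\<integral>\<^sup>+z. ennreal (sum_dist (skorokhod_dist T) (controls_dist T U) (fst z) (snd z) powr 2) \<partial>\<pi>) <= ennreal c"
 using \<pi>(2) c(1) by simp
 hence "(\<integral>\<^sup>+z. ennreal (sum_dist (skorokhod_dist T) (controls_dist T U) (fst z) (snd z) powr 2) \<partial>\<pi>) <= ennreal c'"
 using ennreal_leI[OF c(2)] by (rule order_trans)
 hence "(\<integral>\<^sup>+z. path_sq T (fst (fst z)) (fst (snd z)) \<partial>\<pi>) <= ennreal ((1 / 2) ^ k)"
 using c'(2)[THEN bspec, OF prob_moment_prob[OF \<nu>], THEN bspec, OF \<pi>(1)] by blast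
 with R'(1) \<pi>(1) le less_imp_le[OF c(1)] c(3) have "G k R' \<pi> c" unfolding G_def by (intro conjI)
 thus ?thesis by (intro exI[of _ "(R', \<pi>, c)"]) (simp only: fst_conv snd_conv)
 qed
 from choice[OF allI[OF this]] obtain x where x: "\<forall>k. G k (fst (x k)) (fst (snd (x k))) (snd (snd (x k)))" ..
 define R' \<pi> c where "R' k = fst (x k)" and "\<pi> k = fst (snd (x k))" and "c k = snd (snd (x k))" for k
 have G: "G k (R' k) (\<pi> k) (c k)" for k using x unfolding R'_def \<pi>_def c_def by (rule spec)
 note seq = G[unfolded G_def, THEN conjunct1]
 G[unfolded G_def, THEN conjunct2, THEN conjunct1]
 G[unfolded G_def, THEN conjunct2, THEN conjunct2, THEN conjunct1]
 G[unfolded G_def, THEN conjunct2, THEN conjunct2, THEN conjunct2, THEN conjunct1]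
 G[unfolded G_def, THEN conjunct2, THEN conjunct2, THEN conjunct2, THEN conjunct2, THEN conjunct1]
 G[unfolded G_def, THEN conjunct2, THEN conjunct2, THEN conjunct2, THEN conjunct2, THEN conjunct2]
 have Rk: "R' k \<in> laws T U p" for k using seq(1) by blast
 have c0: "c \<longlonglongrightarrow> 0"
 by (rule tendsto_sandwich[OF _ _ tendsto_const LIMSEQ_inverse_real_of_nat]) (use seq(4,5) in auto)
 have "emeasure (leb T \<Otimes>\<^sub>M R) (constraint_set T U p \<kappa> (\<phi> i) R) = ennreal T" if i: "i \<in> {1..d}" for i
 proof -
 interpret constraint_sequence T p U \<kappa> ?\<mu> "%k. marginal_hat T U p (R' k)" \<pi> c "\<phi> i" C
 by (intro constraint_sequence.intro coupled_sequence.intro coupled_sequence_axioms.intro constraint_sequence_axioms.intro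
 ck \<mu> marginal_hat_moment[OF Rk] seq(2-4,6) c0 meas[OF i] usc[OF i] \<open>C > 0\<close> growth[OF i] unif_usc[OF i])
 have eq: "constraint \<eta> = (%y. \<integral>u. \<phi> i (fst y) (fst (snd y) (fst y)) (hat_law \<eta> (fst y)) u \<partial>\<kappa> (snd (snd y)) (fst y))" for \<eta>
 by (simp add: fun_eq_iff constraint_def \<alpha>_def state_control_def time_kernel_def)
 have m: "constraint \<eta> \<in> borel_measurable (leb T \<Otimes>\<^sub>M \<eta>)"
 if "\<eta> \<in> prob_moment 2 (skorokhod T \<times> controls T U p) (sum_dist (skorokhod_dist T) (controls_dist T U))" for \<eta>
 unfolding measurable_cong_sets[OF sets_pair_BT[OF prob_moment_prob[OF that]] refl] by (rule measurable_constraint[OF that])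
 have "AE y in leb T \<Otimes>\<^sub>M marginal_hat T U p (R' k). 0 <= constraint (marginal_hat T U p (R' k)) y" for k
 using emeasure_constraint_set[OF ck Rk, of "\<phi> i" k] m[OF marginal_hat_moment[OF Rk], of k] seq(1)[of k] i unfolding eq by blast
 hence "AE y in leb T \<Otimes>\<^sub>M ?\<mu>. 0 <= constraint ?\<mu> y" by (rule constraint_limit)
 thus ?thesis using emeasure_constraint_set[OF ck R, of "\<phi> i"] m[OF \<mu>] unfolding eq by blast
 qed
 thus "R \<in> ?S" using R by blast
qed blast

end
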